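(* Let $p\in(0,1)$ and let $\check S$ be the negatively step-reinforced random walk with reinforcement parameter $p$ built from i.i.d. variables $X_1,X_2,\dots$ with $\mathbb{E}(X_1^2)<\infty$. Write $m_i=\mathbb{E}(X_1^i)$ for $i=1,2$ and $$\check\mu=\frac{(1-p)m_1}{1+p},\qquad \check\sigma^2=m_2-\left(\frac{(1-p)m_1}{1+p}\right)^2,$$ and assume $\check\sigma>0$. Then there exists a richer probability space with a standard Brownian motion $\{W(t),t\ge0\}$ such that, as $n\to\infty$, $$\frac{1}{\sqrt{n^{2p+1}\log\log n}}\left|\frac{\sqrt{2p+1}}{\check\sigma}\,\frac{\check S(n)-\check\mu n}{n^{-p}}-W(n^{2p+1})\right|\to0\quad\text{a.s.}$$ and $$\max_{0\le t\le1}\left|\frac{\sqrt{2p+1}}{\check\sigma}\,\frac{\check S([nt])-\check\mu[nt]}{\sqrt n}-\frac{t^{-p}\,W((nt)^{2p+1})}{\sqrt{n^{2p+1}}}\right|\to0\quad\text{in probability.}$$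
   Context: Let $\{X_n,n\ge1\}$ be i.i.d. real random variables, $\{\varepsilon_n,n\ge2\}$ i.i.d. Bernoulli variables with parameter $p$ (so $\mathbb{P}(\varepsilon_n=1)=p$), and for $n\ge2$ let $U_n$ be uniformly distributed on $\{1,\dots,n-1\}$; all the variables $X_1,X_2,\varepsilon_2,U_2,X_3,\varepsilon_3,U_3,\dots$ are independent. Negatively step-reinforced walk: $\check X_1=X_1$ and for $n\ge2$, $\check X_n=X_n$ if $\varepsilon_n=0$, $\check X_n=-\check X_{U_n}$ if $\varepsilon_n=1$; $\check S(n)=\check X_1+\dots+\check X_n$, $\check S(0)=0$. $[x]$ is the integer part of $x$; "max" over an interval of $t$ means supremum; the expression $t^{-p}W((nt)^{2p+1})$ is read as $0$ at $t=0$ (its a.s. limit). "There exists a richer probability space with a standard Brownian motion" means: there is a probability space carrying a copy of the process (with the same law) together with a standard Brownian motion $W$ such that the stated convergences hold for them jointly. *)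

theory Defs
  imports "HOL-Probability.Probability"
begin

text \<open>
  The negatively step-reinforced sequence for fixed values of the innovations \<open>x\<close>, the
  reinforcement indicators \<open>e\<close> (\<open>True\<close> stands for the value 1) and the memory indices \<open>u\<close>.
  The guard \<open>u n \<in> {1..<n}\<close> is only there for termination: \<open>U\<^sub>n\<close> is uniform on \<open>{1,\<dots>,n-1}\<close>, so
  it holds almost surely.
\<close>
fun nsr_step :: "(nat \<Rightarrow> real) \<Rightarrow> (nat \<Rightarrow> bool) \<Rightarrow> (nat \<Rightarrow> nat) \<Rightarrow> nat \<Rightarrow> real" where
  "nsr_step x e u n =
     (if 2 \<le> n \<and> e n \<and> u n \<in> {1..<n} then - nsr_step x e u (u n) else x n)"

declare nsr_step.simps [simp del]

definition nsr_walk :: "(nat \<Rightarrow> real) \<Rightarrow> (nat \<Rightarrow> bool) \<Rightarrow> (nat \<Rightarrow> nat) \<Rightarrow> nat \<Rightarrow> real" where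
  "nsr_walk x e u n = (\<Sum>i = 1..n. nsr_step x e u i)"

datatype nsr_index = Innovation nat | Indicator nat | Memory nat

text \<open>
  The input variables take values in three different types, so their joint independence is
  independence of the generated sigma-algebras. The variables \<open>X 0\<close>, \<open>\<epsilon> 0\<close>, \<open>\<epsilon> 1\<close>, \<open>U 0\<close>, \<open>U 1\<close>
  are unconstrained and unused.
\<close>
locale nsr_input = prob_space M
  for M :: "'a measure" and p :: real
    and X :: "nat \<Rightarrow> 'a \<Rightarrow> real" and \<epsilon> :: "nat \<Rightarrow> 'a \<Rightarrow> bool" and U :: "nat \<Rightarrow> 'a \<Rightarrow> nat" +
  assumes X_measurable: "\<And>n. 1 \<le> n \<Longrightarrow> X n \<in> borel_measurable M"
    and X_identical: "\<And>n. 1 \<le> n \<Longrightarrow> distr M borel (X n) = distr M borel (X 1)"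
    and \<epsilon>_measurable: "\<And>n. 2 \<le> n \<Longrightarrow> \<epsilon> n \<in> measurable M (count_space UNIV)"
    and \<epsilon>_bernoulli: "\<And>n. 2 \<le> n \<Longrightarrow>
      distr M (count_space UNIV) (\<epsilon> n) = measure_pmf (bernoulli_pmf p)"
    and U_measurable: "\<And>n. 2 \<le> n \<Longrightarrow> U n \<in> measurable M (count_space UNIV)"
    and U_uniform: "\<And>n. 2 \<le> n \<Longrightarrow>
      distr M (count_space UNIV) (U n) = measure_pmf (pmf_of_set {1..<n})"
    and independent:
      "indep_sets
        (\<lambda>i. case i of
            Innovation n \<Rightarrow> sets (vimage_algebra (space M) (X n) borel)
          | Indicator n \<Rightarrow> sets (vimage_algebra (space M) (\<epsilon> n) (count_space UNIV))
          | Memory n \<Rightarrow> sets (vimage_algebra (space M) (U n) (count_space UNIV)))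
        (Innovation ` {1..} \<union> Indicator ` {2..} \<union> Memory ` {2..})"

text \<open>Only the values of \<open>W\<close> at times \<open>t \<ge> 0\<close> are constrained.\<close>
locale std_brownian_motion = prob_space N
  for N :: "'b measure" and W :: "real \<Rightarrow> 'b \<Rightarrow> real" +
  assumes W_measurable: "\<And>t. 0 \<le> t \<Longrightarrow> W t \<in> borel_measurable N"
    and starts_at_zero: "AE \<omega> in N. W 0 \<omega> = 0"
    and continuous_paths: "AE \<omega> in N. continuous_on {0..} (\<lambda>t. W t \<omega>)"
    and gaussian_increments: "\<And>s t. 0 \<le> s \<Longrightarrow> s < t \<Longrightarrow>
      distributed N lborel (\<lambda>\<omega>. W t \<omega> - W s \<omega>) (normal_density 0 (sqrt (t - s)))"
    and independent_increments: "\<And>(k::nat) (\<tau>::nat \<Rightarrow> real).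
      0 \<le> \<tau> 0 \<Longrightarrow> (\<And>i. i < k \<Longrightarrow> \<tau> i \<le> \<tau> (Suc i)) \<Longrightarrow>
      indep_vars (\<lambda>_. borel) (\<lambda>i \<omega>. W (\<tau> (Suc i)) \<omega> - W (\<tau> i) \<omega>) {..<k}"

text \<open>
  The values are extended nonnegative reals so that suprema over \<open>t\<close> need no boundedness side
  condition. Measurability is part of the notion, since \<open>measure\<close> is 0 on non-measurable sets.
\<close>
definition tendsto_zero_in_prob :: "'b measure \<Rightarrow> (nat \<Rightarrow> 'b \<Rightarrow> ennreal) \<Rightarrow> bool" where
  "tendsto_zero_in_prob N Y \<longleftrightarrow>
     (\<forall>n. Y n \<in> borel_measurable N) \<and>
     (\<forall>\<delta>>0. (\<lambda>n. measure N {\<omega> \<in> space N. Y n \<omega> > ennreal \<delta>}) \<longlonglongrightarrow> 0)"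

text \<open>Equality in law of real sequences, as equality of distributions on the product space.\<close>
definition same_law ::
  "'a measure \<Rightarrow> (nat \<Rightarrow> 'a \<Rightarrow> real) \<Rightarrow> 'b measure \<Rightarrow> (nat \<Rightarrow> 'b \<Rightarrow> real) \<Rightarrow> bool" where
  "same_law M S N S' \<longleftrightarrow>
     (\<forall>n. S n \<in> borel_measurable M) \<and> (\<forall>n. S' n \<in> borel_measurable N) \<and>
     distr M (\<Pi>\<^sub>M n\<in>UNIV. borel) (\<lambda>\<omega> n. S n \<omega>) = distr N (\<Pi>\<^sub>M n\<in>UNIV. borel) (\<lambda>\<omega> n. S' n \<omega>)"

text \<open>
  HOL cannot quantify existentially over types, so the richer probability space has to live on a
  fixed type. Pairs of a sequence and a function of real time lose no generality: the joint law
  of a walk and a Brownian motion on any probability space can be realised there.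
\<close>
type_synonym path_pair = "(nat \<Rightarrow> real) \<times> (real \<Rightarrow> real)"

end

theory Submission
  imports Defs "HOL-Real_Asymp.Real_Asymp"
begin

text \<open>
  Given the first \<open>i\<close> steps, step \<open>i + 1\<close> is a fresh \<open>X\<close> with probability \<open>1 - p\<close> and otherwise the negative of a
  uniformly chosen past step, so its conditional mean is \<open>(1 - p) m1 - p S i / i\<close> and
  \<open>n powr p * (S n - \<mu> n)\<close> is, up to lower-order corrections, a martingale with steps of size \<open>n powr p\<close>.
  The steps are truncated and centred at their conditional means, and each is realised as the position
  of one Brownian path at the exit from an interval drawn given the past; after every exit the path starts afresh,
  so the steps can be sampled one after the other (Ionescu-Tulcea), with the reinforced conditional laws.
  Laws of large numbers for the first two moments of the steps, hence for the conditional means of the exit times,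
  show that the embedding times grow like \<open>n powr (2 * p + 1)\<close>. Estimates for the oscillation
  of the Brownian path then replace the random embedding times by these deterministic ones.
\<close>

section \<open>Brownian motion on path space\<close>

text \<open>Only second moments are assumed, while a law of large numbers for exit times needs their
  second moments, that is, fourth moments of the steps. Truncating step \<open>i\<close> at
  \<open>sqrt (i + 1)\<close> supplies them, and the sums still converge under a second moment. They
  can be computed because a sign flip is invisible to even functions:
  \<open>\<bar>xi i\<bar>\<close> has the law of the innovations' absolute value for every
  \<open>i\<close>, whatever the reinforcement did. The untruncated step is kept beside the embedded
  one, so the new walk has exactly the required law; since no input variables exist on the new
  space, this is checked by comparing one-step kernels. Step \<open>i\<close> moves the path by
  about \<open>(i + 1) powr p\<close>, so the clock is a sum of \<open>(i + 1) powr (2 * p)\<close>,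
  which \<open>lam\<close> normalises to \<open>n powr (2 * p + 1)\<close>. In the second statement
  \<open>t powr (- p)\<close> explodes at 0. In Brownian time this is a weight of exponent
  \<open>p / (2 * p + 1) < 1/2\<close>, which is what a summable bound over dyadic blocks needs. For
  a fixed relative error \<open>d\<close> of the clock that bound is small with \<open>d\<close> but
  does not decrease in \<open>n\<close>; this yields convergence in probability.\<close>

definition gauss :: "real => real measure" where
 "gauss v = density lborel (\<lambda>x. ennreal (normal_density 0 (sqrt v) x))"

lemma sets_gauss[measurable_cong, simp]: "sets (gauss v) = sets borel"
 by (simp add: gauss_def)

lemma space_gauss[simp]: "space (gauss v) = UNIV"
 by (simp add: gauss_def)

lemma prob_space_gauss: "0 < v ==> prob_space (gauss v)"
 unfolding gauss_def by (rule prob_space_normal_density) simp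

lemma distributed_gauss_iff:
 "distributed M lborel X (normal_density 0 (sqrt v)) \<longleftrightarrow>
   X \<in> borel_measurable M \<and> distr M borel X = gauss v"
proof -
 have "distr M lborel X = distr M borel X" by (rule distr_cong) auto
 then show ?thesis
  by (auto simp: distributed_def gauss_def)
qed

lemma prob_PiM_empty_eqI:
 assumes "prob_space M" "prob_space N" "sets M = sets (PiM {} A)" "sets N = sets (PiM {} A)"
 shows "M = N"
proof (rule measure_eqI)
 fix X assume "X \<in> sets M"
 then have "X = {} \<or> X = {\<lambda>_. undefined}" using assms(3) by (auto simp: sets_PiM_empty)
 moreover have "space M = {\<lambda>_. undefined}" "space N = {\<lambda>_. undefined}"
  using assms(3,4)[THEN sets_eq_imp_space_eq] by (auto simp: space_PiM)
 ultimately show "emeasure M X = emeasure N X"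
  using assms(1,2)[THEN prob_space.emeasure_space_1] by auto
qed (use assms in simp)

text \<open>Finite sets of positive times replace ordered tuples: an increment is indexed by its
  right end, and its left end is the preceding time of \<open>J\<close>, or 0 for the first
  one.\<close>

definition prev_time :: "real set => real => real" where
 "prev_time J t = Max (insert 0 {s \<in> J. s < t})"

lemma prev_time_props:
 assumes "finite J" "J \<subseteq> {0<..}" "0 < t"
 shows "0 \<le> prev_time J t" "prev_time J t < t" "prev_time J t \<in> insert 0 J"
  "\<And>s. s \<in> J ==> s < t ==> s \<le> prev_time J t"
proof -
 have fin: "finite (insert 0 {s \<in> J. s < t})" using assms by auto
 have mem: "prev_time J t \<in> insert 0 {s \<in> J. s < t}"
  unfolding prev_time_def using fin by (intro Max_in) auto
 then show "prev_time J t < t" "prev_time J t \<in> insert 0 J" using assms by auto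
 show "0 \<le> prev_time J t"
  unfolding prev_time_def using fin by (intro Max_ge) auto
 show "s \<le> prev_time J t" if "s \<in> J" "s < t" for s
  unfolding prev_time_def using fin that by (intro Max_ge) auto
qed

text \<open>Induction on the number of times in the block, peeling off the last one. It is applied
  to the values of a path and, with \<open>F\<close> the identity, to the variances.\<close>

lemma telescope_prev_time:
 fixes F :: "real => real"
 assumes J: "finite J" "J \<subseteq> {0<..}" and a: "a \<in> insert 0 J" and b: "b \<in> insert 0 J" and "a \<le> b"
 shows "(\<Sum>s\<in>{s\<in>J. a < s \<and> s \<le> b}. F s - F (prev_time J s)) = F b - F a"
 using b \<open>a \<le> b\<close>
proof (induction "card {s\<in>J. a < s \<and> s \<le> b}" arbitrary: b rule: less_induct)
 case less
 show ?case
 proof (cases "a = b")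
  case True
  then have e: "{s\<in>J. a < s \<and> s \<le> b} = {}" by auto
  show ?thesis unfolding e using True by simp
 next
  case False
  with less.prems have ab: "a < b" by simp
  have "0 \<le> a" using a J by auto
  with ab less.prems have bJ: "b \<in> J" "0 < b" by auto
  let ?c = "prev_time J b"
  have c: "?c \<in> insert 0 J" "?c < b" "\<And>s. s \<in> J ==> s < b ==> s \<le> ?c" "0 \<le> ?c"
   using prev_time_props[OF J bJ(2)] by auto
  have "a \<le> ?c" using a ab c by auto
  have eq: "{s\<in>J. a < s \<and> s \<le> b} = insert b {s\<in>J. a < s \<and> s \<le> ?c}"
   using bJ ab c by force
  have nb: "b \<notin> {s\<in>J. a < s \<and> s \<le> ?c}" using c by auto
  have fin: "finite {s\<in>J. a < s \<and> s \<le> ?c}" using J by auto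
  have "(\<Sum>s\<in>{s\<in>J. a < s \<and> s \<le> ?c}. F s - F (prev_time J s)) = F ?c - F a"
   using eq nb fin c \<open>a \<le> ?c\<close> by (intro less.hyps) auto
  then show ?thesis unfolding eq using nb fin by simp
 qed
qed

text \<open>The finite-dimensional law of Brownian motion, built by cumulating independent centred
  Gaussians. No covariance matrix enters, and consistency becomes a statement about
  increments.\<close>

definition bm_fdd :: "real set => (real => real) measure" where
 "bm_fdd J = distr (PiM J (\<lambda>t. gauss (t - prev_time J t))) (PiM J (\<lambda>_. borel))
   (\<lambda>z. \<lambda>t\<in>J. \<Sum>s\<in>{s\<in>J. s \<le> t}. z s)"

lemma bm_increments_prob_space:
 assumes "finite J" "J \<subseteq> {0<..}"
 shows "prob_space (PiM J (\<lambda>t. gauss (t - prev_time J t)))"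
proof (rule prob_space_PiM)
 fix t assume "t \<in> J"
 then have "0 < t" using assms by auto
 then show "prob_space (gauss (t - prev_time J t))"
  using prev_time_props(2)[OF assms] by (intro prob_space_gauss) auto
qed

lemma bm_fdd_measurable[measurable]:
 "(\<lambda>z. \<lambda>t\<in>J. \<Sum>s\<in>{s\<in>J. s \<le> t}. z s) \<in> measurable (PiM J (\<lambda>_. borel)) (PiM J (\<lambda>_. borel :: real measure))"
 by (intro measurable_restrict borel_measurable_sum measurable_component_singleton) auto

lemma sets_PiM_gauss[measurable_cong]:
 "sets (PiM J (\<lambda>t. gauss (v t))) = sets (PiM J (\<lambda>_. borel))"
 by (intro sets_PiM_cong) auto

lemma prob_space_bm_fdd:
 assumes "finite J" "J \<subseteq> {0<..}"
 shows "prob_space (bm_fdd J)"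
 unfolding bm_fdd_def
 by (rule prob_space.prob_space_distr[OF bm_increments_prob_space[OF assms]])
  (simp add: measurable_cong_sets[OF sets_PiM_gauss refl])

abbreviation increment :: "(real => 'a => real) => real set => real => 'a => real" where
 "increment X J t x \<equiv> X t x - X (prev_time J t) x"

text \<open>One equation between laws packs the independence of the increments together with their
  Gaussian marginals; \<open>gauss_increments_onD\<close> and \<open>gauss_increments_onI\<close>
  translate from and to the separate statements.\<close>

definition gauss_increments_on :: "'a measure => (real => 'a => real) => real set => bool" where
 "gauss_increments_on M X J \<longleftrightarrow> distr M (PiM J (\<lambda>_. borel)) (\<lambda>x. \<lambda>t\<in>J. increment X J t x) = PiM J (\<lambda>t. gauss (t - prev_time J t))"

definition gauss_increments :: "'a measure => (real => 'a => real) => bool" where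
 "gauss_increments M X \<longleftrightarrow>
   (\<forall>t. X t \<in> borel_measurable M) \<and> (\<forall>x\<in>space M. X 0 x = 0) \<and>
   (\<forall>J. finite J --> J \<subseteq> {0<..} --> gauss_increments_on M X J)"

lemma distr_component_gauss:
 assumes J: "finite J" "J \<subseteq> {0<..}" and t: "t \<in> J"
 shows "distr (PiM J (\<lambda>t. gauss (t - prev_time J t))) borel (\<lambda>z. z t) = gauss (t - prev_time J t)"
proof -
 \<comment> \<open>\<open>product_prob_space\<close> asks every factor to be a probability measure,
   hence the variance 1 outside \<open>J\<close>.\<close>
 define v where "v = (\<lambda>s. if s \<in> J then s - prev_time J s else 1)"
 have eq: "PiM J (\<lambda>t. gauss (t - prev_time J t)) = PiM J (\<lambda>s. gauss (v s))"
  by (rule PiM_cong) (auto simp: v_def)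
 have vpos: "0 < v s" for s
  using prev_time_props(2)[OF J, of s] J by (auto simp: v_def)
 interpret product_prob_space "\<lambda>s. gauss (v s)" J
  by (intro product_prob_spaceI prob_space_gauss vpos)
 have "distr (PiM J (\<lambda>s. gauss (v s))) borel (\<lambda>z. z t) = distr (PiM J (\<lambda>s. gauss (v s))) (gauss (v t)) (\<lambda>z. z t)"
  by (rule distr_cong) auto
 also have "... = gauss (v t)" by (rule PiM_component) (use t in auto)
 finally show ?thesis using t by (simp add: eq v_def)
qed

lemma gauss_increments_onD:
 assumes "prob_space M" and [measurable]: "\<And>t. X t \<in> borel_measurable M" and J: "finite J" "J \<subseteq> {0<..}"
  and X: "gauss_increments_on M X J"
 shows "prob_space.indep_vars M (\<lambda>_. borel) (increment X J) J"
  and "\<And>t. t \<in> J ==> distr M borel (increment X J t) = gauss (t - prev_time J t)"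
proof -
 interpret prob_space M by fact
 note eq = X[unfolded gauss_increments_on_def]
 show marg: "distr M borel (increment X J t) = gauss (t - prev_time J t)" if t: "t \<in> J" for t
 proof -
  have "distr M borel (increment X J t) = distr (distr M (PiM J (\<lambda>_. borel)) (\<lambda>x. \<lambda>t\<in>J. increment X J t x)) borel (\<lambda>z. z t)"
   using t by (subst distr_distr) (auto intro!: distr_cong)
  then show ?thesis unfolding eq distr_component_gauss[OF J t] .
 qed
 show "indep_vars (\<lambda>_. borel) (increment X J) J"
 proof (cases "J = {}")
  case False
  have "(\<Pi>\<^sub>M i\<in>J. distr M borel (increment X J i)) = PiM J (\<lambda>t. gauss (t - prev_time J t))"
   by (rule PiM_cong) (auto simp: marg)
  then show ?thesis using False eq by (subst indep_vars_iff_distr_eq_PiM') auto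
 qed (simp add: indep_vars_def indep_sets_def)
qed

lemma gauss_increments_onI:
 assumes "prob_space M" and [measurable]: "\<And>t. X t \<in> borel_measurable M"
  and ind: "prob_space.indep_vars M (\<lambda>_. borel) (increment X J) J"
  and marg: "\<And>t. t \<in> J ==> distr M borel (increment X J t) = gauss (t - prev_time J t)"
 shows "gauss_increments_on M X J"
 unfolding gauss_increments_on_def
proof -
 interpret prob_space M by fact
 show "distr M (PiM J (\<lambda>_. borel)) (\<lambda>x. \<lambda>t\<in>J. increment X J t x) = PiM J (\<lambda>t. gauss (t - prev_time J t))"
 proof (cases "J = {}")
  case True
  show ?thesis
   by (rule prob_PiM_empty_eqI[where A="\<lambda>_. borel"])
    (use True in \<open>auto intro!: prob_space_distr prob_space_PiM simp: sets_PiM_gauss\<close>)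
 next
  case False
  have "distr M (PiM J (\<lambda>_. borel)) (\<lambda>x. \<lambda>t\<in>J. increment X J t x) = (\<Pi>\<^sub>M i\<in>J. distr M borel (increment X J i))"
   using ind False by (subst (asm) indep_vars_iff_distr_eq_PiM') auto
  also have "... = PiM J (\<lambda>t. gauss (t - prev_time J t))" by (intro PiM_cong marg) auto
  finally show ?thesis .
 qed
qed

lemma gauss_increments_indep:
 assumes "gauss_increments M X" "prob_space M" and J: "finite J" "J \<subseteq> {0<..}"
 shows "prob_space.indep_vars M (\<lambda>_. borel) (increment X J) J"
  and "\<And>t. t \<in> J ==> distr M borel (increment X J t) = gauss (t - prev_time J t)"
 using gauss_increments_onD[of M X J] assms by (auto simp: gauss_increments_def)

lemma cumsum_increments:
 fixes X :: "real => 'a => real"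
 assumes J: "finite J" "J \<subseteq> {0<..}" and t: "t \<in> J" and "X 0 x = 0"
 shows "(\<Sum>s\<in>{s\<in>J. s \<le> t}. X s x - X (prev_time J s) x) = X t x"
proof -
 have "{s\<in>J. s \<le> t} = {s\<in>J. 0 < s \<and> s \<le> t}" using J by auto
 then show ?thesis
  using telescope_prev_time[OF J, of 0 t "\<lambda>s. X s x"] t assms(4) J(2)
  by (auto simp: subset_iff less_imp_le)
qed

text \<open>The values on \<open>J\<close> are cumulative sums of the increments because the process
  starts at 0, so the law of the increments determines the law of the values.\<close>

lemma gauss_increments_fdd:
 assumes [measurable]: "\<And>t. X t \<in> borel_measurable M" and X0: "\<And>x. x \<in> space M ==> X 0 x = 0"
  and J: "finite J" "J \<subseteq> {0<..}" and X: "gauss_increments_on M X J"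
 shows "distr M (PiM J (\<lambda>_. borel)) (\<lambda>x. \<lambda>t\<in>J. X t x) = bm_fdd J"
proof -
 let ?D = "\<lambda>x. \<lambda>t\<in>J. increment X J t x" and ?S = "\<lambda>z. \<lambda>t\<in>J. \<Sum>s\<in>{s\<in>J. s \<le> t}. z s :: real"
 have "?D \<in> measurable M (PiM J (\<lambda>_. borel))" by (intro measurable_restrict) auto
 then have "bm_fdd J = distr M (PiM J (\<lambda>_. borel)) (?S \<circ> ?D)"
  unfolding bm_fdd_def X[unfolded gauss_increments_on_def, symmetric] by (rule distr_distr[rotated]) simp
 also have "... = distr M (PiM J (\<lambda>_. borel)) (\<lambda>x. \<lambda>t\<in>J. X t x)"
  using cumsum_increments[where X=X, OF J _ X0] by (intro distr_cong) (auto simp: restrict_def fun_eq_iff)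
 finally show ?thesis by simp
qed

text \<open>Increments over a coarser set of times are sums over disjoint blocks of finer increments.\<close>
lemma coarser_increments:
 fixes X :: "real => 'a => real"
 assumes "prob_space M" and X: "\<And>t. X t \<in> borel_measurable M"
  and H: "finite H" "H \<subseteq> {0<..}" and JH: "J \<subseteq> H" and GH: "gauss_increments_on M X H"
 shows "gauss_increments_on M X J"
proof -
 interpret prob_space M by fact
 note [measurable] = X
 note ind = gauss_increments_onD(1)[OF assms(1) X H GH] and marg = gauss_increments_onD(2)[OF assms(1) X H GH]
 have J: "finite J" "J \<subseteq> {0<..}" using JH H finite_subset by auto
 let ?B = "\<lambda>t. {s\<in>H. prev_time J t < s \<and> s \<le> t}"
 let ?Z = "\<lambda>t x. X t x - X (prev_time H t) x"
 have prevJ: "prev_time J t \<in> insert 0 H" "prev_time J t < t" if "t \<in> J" for t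
  using prev_time_props[OF J, of t] that J JH by auto
 note prevJ' = prevJ(2)[THEN less_imp_le]
 have tele: "(\<Sum>s\<in>?B t. ?Z s x) = X t x - X (prev_time J t) x" if "t \<in> J" for t x
  using that prevJ prevJ' JH by (intro telescope_prev_time[OF H]) auto
 have vars: "(\<Sum>s\<in>?B t. s - prev_time H s) = t - prev_time J t" if "t \<in> J" for t
  using that prevJ prevJ' JH telescope_prev_time[OF H, of "prev_time J t" t "\<lambda>s. s"] by auto
 have disj: "disjoint_family_on ?B J"
 proof (auto simp: disjoint_family_on_def)
  fix s t u assume st: "s \<in> J" "t \<in> J" "s \<noteq> t" and u: "prev_time J s < u" "u \<le> s" "prev_time J t < u" "u \<le> t"
  have "s < t \<or> t < s" using st by auto
  then show False
   using prev_time_props(4)[OF J, of t s] prev_time_props(4)[OF J, of s t] st u J by force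
 qed
 have ind1: "indep_vars (\<lambda>t. PiM (?B t) (\<lambda>_. borel)) (\<lambda>t x. restrict (\<lambda>i. ?Z i x) (?B t)) J"
  by (rule indep_vars_restrict[OF ind]) (use disj in auto)
 have "indep_vars (\<lambda>_. borel) (\<lambda>t x. \<Sum>s\<in>?B t. restrict (\<lambda>i. ?Z i x) (?B t) s) J"
  by (rule indep_vars_compose2[OF ind1]) (auto intro!: borel_measurable_sum measurable_component_singleton)
 moreover have "(\<Sum>s\<in>?B t. restrict (\<lambda>i. ?Z i x) (?B t) s) = X t x - X (prev_time J t) x" if "t \<in> J" for t x
 proof -
  have "(\<Sum>s\<in>?B t. restrict (\<lambda>i. ?Z i x) (?B t) s) = (\<Sum>s\<in>?B t. ?Z s x)"
   by (rule sum.cong) auto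
  then show ?thesis using tele[OF that] by simp
 qed
 ultimately have "indep_vars (\<lambda>_. borel) (increment X J) J"
  by (subst indep_vars_cong[OF refl, where Y="\<lambda>t x. \<Sum>s\<in>?B t. restrict (\<lambda>i. ?Z i x) (?B t) s" and N'="\<lambda>_. borel"])
    (auto simp: fun_eq_iff)
 moreover have "distr M borel (increment X J t) = gauss (t - prev_time J t)" if t: "t \<in> J" for t
 proof -
  have posH: "0 < s - prev_time H s" if "s \<in> H" for s
   using prev_time_props(2)[OF H, of s] that H by auto
  have "t \<in> ?B t" using t prevJ JH by auto
  then have ne: "?B t \<noteq> {}" by blast
  have "distributed M lborel (\<lambda>x. \<Sum>s\<in>?B t. ?Z s x)
    (normal_density (\<Sum>s\<in>?B t. 0) (sqrt (\<Sum>s\<in>?B t. (sqrt (s - prev_time H s))^2)))"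
  proof (rule sum_indep_normal)
   show "indep_vars (\<lambda>i. borel) ?Z (?B t)" by (rule indep_vars_subset[OF ind]) auto
   show "distributed M lborel (?Z i) (normal_density 0 (sqrt (i - prev_time H i)))" if "i \<in> ?B t" for i
    using that marg[of i] by (subst distributed_gauss_iff) auto
  qed (use H ne posH in auto)
  moreover have "(\<Sum>s\<in>?B t. (sqrt (s - prev_time H s))^2) = t - prev_time J t"
   unfolding vars[OF t, symmetric] using posH by (intro sum.cong) (auto simp: less_imp_le)
  ultimately have "distributed M lborel (\<lambda>x. X t x - X (prev_time J t) x) (normal_density 0 (sqrt (t - prev_time J t)))"
   using tele[OF t] by simp
  then show ?thesis by (simp add: distributed_gauss_iff)
 qed
 ultimately show ?thesis by (rule gauss_increments_onI[OF assms(1) X])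
qed

text \<open>Inverts the cumulation in \<open>bm_fdd\<close>: differences of partial sums return the
  coordinates. The case distinction stands in for the missing coordinate at time 0.\<close>

lemma prev_time_cumsum:
 assumes H: "finite H" "H \<subseteq> {0<..}" and t: "t \<in> H"
 shows "(\<Sum>s\<in>{s\<in>H. s \<le> t}. z s) - (if prev_time H t = 0 then 0 else \<Sum>s\<in>{s\<in>H. s \<le> prev_time H t}. z s) = (z t :: real)"
proof -
 have tp: "0 < t" using H t by auto
 note p = prev_time_props[OF H tp]
 have "{s\<in>H. s \<le> t} = insert t {s\<in>H. s \<le> prev_time H t}"
  using p t by force
 moreover have "t \<notin> {s\<in>H. s \<le> prev_time H t}" using p by auto
 ultimately have S: "(\<Sum>s\<in>{s\<in>H. s \<le> t}. z s) = z t + (\<Sum>s\<in>{s\<in>H. s \<le> prev_time H t}. z s)"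
  using H by simp
 show ?thesis
 proof (cases "prev_time H t = 0")
  case True
  then have e: "{s\<in>H. s \<le> prev_time H t} = {}" using H by auto
  show ?thesis using S unfolding e using True by simp
 qed (use S in simp)
qed

text \<open>The partial sums over \<open>H\<close> form a process with Gaussian increments on
  \<open>H\<close>, hence on \<open>J\<close> by \<open>coarser_increments\<close>; its values on
  \<open>J\<close> therefore have law \<open>bm_fdd J\<close>.\<close>

lemma bm_fdd_projective:
 assumes JH: "J \<subseteq> H" and H: "finite H" "H \<subseteq> {0<..}"
 shows "bm_fdd J = distr (bm_fdd H) (PiM J (\<lambda>_. borel)) (\<lambda>f. restrict f J)"
proof -
 have J: "finite J" "J \<subseteq> {0<..}" using JH H finite_subset by auto
 let ?P = "PiM H (\<lambda>t. gauss (t - prev_time H t))"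
 interpret P: prob_space ?P by (rule bm_increments_prob_space[OF H])
 define X where "X = (\<lambda>t z. if t = 0 then 0 else \<Sum>s\<in>{s\<in>H. s \<le> t}. z s :: real)"
 have Xm[measurable]: "X t \<in> borel_measurable ?P" for t
  unfolding X_def by (cases "t = 0")
   (auto intro!: borel_measurable_sum simp: measurable_cong_sets[OF sets_PiM_gauss refl] measurable_component_singleton)
 have Z: "X t z - X (prev_time H t) z = z t" if "t \<in> H" for t z
  using prev_time_cumsum[OF H that, of z] H that by (auto simp: X_def)
 have "distr ?P (PiM H (\<lambda>_. borel)) (\<lambda>y. \<lambda>t\<in>H. increment X H t y) = distr ?P ?P (\<lambda>x. x)"
  using Z by (intro distr_cong) (auto simp: sets_PiM_gauss space_PiM fun_eq_iff PiE_iff extensional_def)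
 then have "gauss_increments_on ?P X H" by (simp add: gauss_increments_on_def)
 from gauss_increments_fdd[OF Xm _ J coarser_increments[OF P.prob_space_axioms Xm H JH this]]
 have GI: "distr ?P (PiM J (\<lambda>_. borel)) (\<lambda>y. \<lambda>t\<in>J. X t y) = bm_fdd J" by (simp add: X_def)
 have "distr (bm_fdd H) (PiM J (\<lambda>_. borel)) (\<lambda>f. restrict f J)
   = distr ?P (PiM J (\<lambda>_. borel)) ((\<lambda>f. restrict f J) \<circ> (\<lambda>z. \<lambda>t\<in>H. \<Sum>s\<in>{s\<in>H. s \<le> t}. z s))"
  unfolding bm_fdd_def using JH
  by (subst distr_distr) (auto intro!: measurable_restrict_subset)
 also have "... = distr ?P (PiM J (\<lambda>_. borel)) (\<lambda>y. \<lambda>t\<in>J. X t y)"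
  using J JH by (intro distr_cong) (auto simp: fun_eq_iff X_def restrict_def)
 finally show ?thesis using GI by simp
qed

text \<open>Kolmogorov's extension theorem. Time 0 is left out because \<open>gauss 0\<close> is the
  null measure; \<open>bm_pre\<close> restores the value 0 there.\<close>

interpretation bm_fdd: polish_projective "{0<..} :: real set" bm_fdd
proof (rule polish_projective.intro, rule projective_family.intro)
 show "bm_fdd J = distr (bm_fdd H) (PiM J (\<lambda>_. borel)) (\<lambda>f. restrict f J)"
  if "J \<subseteq> H" "finite H" "H \<subseteq> {0<..}" for J H
  using that by (rule bm_fdd_projective)
 show "prob_space (bm_fdd J)" if "finite J" "J \<subseteq> {0<..}" for J
  using that by (rule prob_space_bm_fdd)
qed

definition bm_pre :: "real => (real => real) => real" where
 "bm_pre t x = (if t \<le> 0 then 0 else x t)"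

text \<open>The marginals of the projective limit are the \<open>bm_fdd J\<close> by construction,
  and taking differences undoes the cumulation, which leaves the product of Gaussians.\<close>

lemma gauss_increments_bm_pre: "gauss_increments bm_fdd.lim bm_pre"
proof -
 have [measurable]: "bm_pre t \<in> borel_measurable bm_fdd.lim" for t
  by (cases "t \<le> 0") (auto simp: bm_pre_def[abs_def] measurable_cong_sets[OF bm_fdd.sets_lim refl])
 show ?thesis
  unfolding gauss_increments_def gauss_increments_on_def
 proof (intro conjI allI impI ballI)
  fix J :: "real set" assume J: "finite J" "J \<subseteq> {0<..}"
  have rm: "(\<lambda>y. restrict y J) \<in> measurable bm_fdd.lim (PiM J (\<lambda>_. borel))"
   using J by (auto simp: measurable_cong_sets[OF bm_fdd.sets_lim refl] intro!: measurable_restrict_subset)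
  have fdd: "distr bm_fdd.lim (PiM J (\<lambda>_. borel)) (\<lambda>y. restrict y J) = bm_fdd J"
   by (rule measure_eqI) (use J bm_fdd.emeasure_lim_emb[OF J(2,1)] in
    \<open>simp_all add: emeasure_distr[OF rm] prod_emb_def space_PiM bm_fdd.sets_P\<close>)
  let ?P = "PiM J (\<lambda>t. gauss (t - prev_time J t))"
  let ?D = "\<lambda>f. \<lambda>t\<in>J. f t - (if prev_time J t = 0 then 0 else f (prev_time J t)) :: real"
  have pj: "t \<in> J ==> prev_time J t \<noteq> 0 ==> prev_time J t \<in> J" for t
   using prev_time_props(3)[OF J, of t] J by auto
  have Dm[measurable]: "?D \<in> measurable (PiM J (\<lambda>_. borel)) (PiM J (\<lambda>_. borel))"
  proof (intro measurable_restrict)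
   fix t assume "t \<in> J"
   then show "(\<lambda>f. f t - (if prev_time J t = 0 then 0 else f (prev_time J t)) :: real) \<in> borel_measurable (PiM J (\<lambda>_. borel))"
    using pj[of t] by (cases "prev_time J t = 0") auto
  qed
  have "distr bm_fdd.lim (PiM J (\<lambda>_. borel)) (\<lambda>y. \<lambda>t\<in>J. bm_pre t y - bm_pre (prev_time J t) y)
   = distr bm_fdd.lim (PiM J (\<lambda>_. borel)) (?D \<circ> (\<lambda>y. restrict y J))"
  proof (rule distr_cong)
   fix y
   have "t \<in> J ==> bm_pre t y - bm_pre (prev_time J t) y = y t - (if prev_time J t = 0 then 0 else y (prev_time J t))" for t
    using J prev_time_props(1)[OF J, of t] by (auto simp: bm_pre_def)
   then show "(\<lambda>t\<in>J. bm_pre t y - bm_pre (prev_time J t) y) = (?D \<circ> (\<lambda>y. restrict y J)) y"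
    using pj by (auto simp: fun_eq_iff)
  qed auto
  also have "... = distr (bm_fdd J) (PiM J (\<lambda>_. borel)) ?D"
   unfolding fdd[symmetric] by (rule distr_distr[symmetric, OF Dm rm])
  also have "... = distr ?P (PiM J (\<lambda>_. borel)) (?D \<circ> (\<lambda>z. \<lambda>t\<in>J. \<Sum>s\<in>{s\<in>J. s \<le> t}. z s))"
   unfolding bm_fdd_def by (subst distr_distr) auto
  also have "... = distr ?P ?P (\<lambda>x. x)"
  proof (rule distr_cong)
   fix z assume "z \<in> space ?P"
   then have ze: "z \<in> extensional J" by (auto simp: space_PiM PiE_iff)
   show "(?D \<circ> (\<lambda>z. \<lambda>t\<in>J. \<Sum>s\<in>{s\<in>J. s \<le> t}. z s)) z = z"
   proof
    fix t show "(?D \<circ> (\<lambda>z. \<lambda>t\<in>J. \<Sum>s\<in>{s\<in>J. s \<le> t}. z s)) z t = z t"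
     using prev_time_cumsum[OF J, of t z] pj[of t] ze
     by (cases "t \<in> J") (auto simp: extensional_def)
   qed
  qed (auto simp: sets_PiM_gauss)
  finally show "distr bm_fdd.lim (PiM J (\<lambda>_. borel)) (\<lambda>y. \<lambda>t\<in>J. bm_pre t y - bm_pre (prev_time J t) y) = ?P"
   by simp
 qed (auto simp: bm_pre_def)
qed

section \<open>Moments and tails of centred Gaussians\<close>

lemma integrable_gauss_iff:
 fixes f :: "real => real"
 assumes [measurable]: "f \<in> borel_measurable borel"
 shows "integrable (gauss v) f \<longleftrightarrow> integrable lborel (\<lambda>x. normal_density 0 (sqrt v) x * f x)"
 unfolding gauss_def by (subst integrable_density) auto

lemma integral_gauss_eq:
 fixes f :: "real => real"
 assumes [measurable]: "f \<in> borel_measurable borel"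
 shows "integral\<^sup>L (gauss v) f = (LINT x|lborel. normal_density 0 (sqrt v) x * f x)"
 unfolding gauss_def by (subst integral_density) auto

lemma gauss_moments:
 assumes "0 < v"
 shows "integrable (gauss v) (\<lambda>x. x)" "(LINT x|gauss v. x) = 0"
  "integrable (gauss v) (\<lambda>x. x^2)" "(LINT x|gauss v. x^2) = v"
  "integrable (gauss v) (\<lambda>x. x ^ 3)" "(LINT x|gauss v. x ^ 3) = 0"
  "integrable (gauss v) (\<lambda>x. x ^ 4)" "(LINT x|gauss v. x ^ 4) = 3 * v^2"
proof -
 have s: "0 < sqrt v" using assms by simp
 note e = normal_moment_even[OF s, of 0] and o = normal_moment_odd[OF s, of 0]
 have "(\<lambda>x. x ^ 3) \<in> borel_measurable (borel::real measure)" "(\<lambda>x. x ^ 4) \<in> borel_measurable (borel::real measure)" by auto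
 show "integrable (gauss v) (\<lambda>x. x)" "(LINT x|gauss v. x) = 0"
  using integrable_normal_moment_nz_1[OF s, of 0] integral_normal_moment_nz_1[OF s, of 0]
  by (auto simp: integrable_gauss_iff integral_gauss_eq)
 show "integrable (gauss v) (\<lambda>x. x^2)" "(LINT x|gauss v. x^2) = v"
  using e[of 1] assms by (auto simp: integrable_gauss_iff integral_gauss_eq has_bochner_integral_iff)
 show "integrable (gauss v) (\<lambda>x. x ^ 3)" "(LINT x|gauss v. x ^ 3) = 0"
  using o[of 1] by (auto simp: integrable_gauss_iff integral_gauss_eq has_bochner_integral_iff numeral_3_eq_3)
 have "fact 4 / (4 / v^2 * 2) = 3 * v^2" using assms by (simp add: fact_numeral field_simps)
 then show "integrable (gauss v) (\<lambda>x. x ^ 4)" "(LINT x|gauss v. x ^ 4) = 3 * v^2"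
  using e[of 2] assms by (auto simp: integrable_gauss_iff integral_gauss_eq has_bochner_integral_iff power_divide)
qed

text \<open>Markov's inequality for the fourth power. A power bound of this order is enough for
  continuity of the paths; the oscillation estimates use the exponential bound
  \<open>prob_gauss_tail\<close>.\<close>

lemma prob_gauss_fourth_moment_bound:
 assumes "0 < v" "0 < a"
 shows "measure (gauss v) {x. a < \<bar>x\<bar>} \<le> 3 * v^2 / a ^ 4"
proof -
 interpret prob_space "gauss v" by (rule prob_space_gauss) fact
 have "measure (gauss v) {x \<in> space (gauss v). a ^ 4 \<le> x ^ 4} \<le> (LINT x|gauss v. x ^ 4) / a ^ 4"
  using assms by (intro integral_Markov_inequality_measure[where A="space (gauss v)" and c="a^4", simplified]) (auto simp: gauss_moments)
 moreover have "measure (gauss v) {x. a < \<bar>x\<bar>} \<le> measure (gauss v) {x \<in> space (gauss v). a ^ 4 \<le> x ^ 4}"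
 proof (rule finite_measure_mono)
  show "{x. a < \<bar>x\<bar>} \<subseteq> {x \<in> space (gauss v). a ^ 4 \<le> x ^ 4}"
   using power_mono[of a "\<bar>x\<bar>" 4 for x :: real] assms by (auto simp: power_abs)
 qed measurable
 ultimately show ?thesis using gauss_moments(8)[OF assms(1)] by simp
qed

text \<open>\<open>exp (x^2 / (4 v))\<close> times the density of variance \<open>v\<close> is \<open>sqrt 2\<close> times the density of variance \<open>2 v\<close>.\<close>
lemma prob_gauss_tail:
 assumes "0 < v" "0 \<le> a"
 shows "measure (gauss v) {x. a < \<bar>x\<bar>} \<le> 2 * exp (- a\<^sup>2 / (4 * v))"
proof -
 interpret prob_space "gauss v" by (rule prob_space_gauss) fact
 have eq: "normal_density 0 (sqrt v) x * exp (x^2 / (4 * v)) = sqrt 2 * normal_density 0 (sqrt (2 * v)) x" for x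
 proof -
  have "- x\<^sup>2 / (2 * v) + x^2 / (4 * v) = - x\<^sup>2 / (4 * v)" using assms by (simp add: field_simps)
  then have "exp (- x\<^sup>2 / (2 * v)) * exp (x^2 / (4 * v)) = exp (- x\<^sup>2 / (4 * v))"
   by (simp only: exp_add[symmetric])
  moreover have "sqrt 2 / sqrt (2 * pi * (2 * v)) = 1 / sqrt (2 * pi * v)"
   using assms by (simp add: real_sqrt_mult field_simps)
  ultimately show ?thesis using assms
   by (simp add: normal_density_def real_sqrt_mult field_simps)
 qed
 have int: "integrable (gauss v) (\<lambda>x. exp (x^2 / (4 * v)))"
  using assms by (subst integrable_gauss_iff) (auto simp: eq)
 have val: "(LINT x|gauss v. exp (x^2 / (4 * v))) = sqrt 2"
  using assms by (subst integral_gauss_eq) (auto simp: eq)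
 have "measure (gauss v) {x \<in> space (gauss v). exp (a^2 / (4 * v)) \<le> exp (x^2 / (4 * v))}
   \<le> (LINT x|gauss v. exp (x^2 / (4 * v))) / exp (a^2 / (4 * v))"
  using int by (intro integral_Markov_inequality_measure[where A="space (gauss v)", simplified]) auto
 also have "... = sqrt 2 * exp (- a\<^sup>2 / (4 * v))" unfolding val by (simp add: exp_minus field_simps)
 also have "... \<le> 2 * exp (- a\<^sup>2 / (4 * v))"
  using sqrt2_less_2 by (intro mult_right_mono) auto
 finally have *: "measure (gauss v) {x \<in> space (gauss v). exp (a^2 / (4 * v)) \<le> exp (x^2 / (4 * v))} \<le> 2 * exp (- a\<^sup>2 / (4 * v))" .
 have "measure (gauss v) {x. a < \<bar>x\<bar>} \<le> measure (gauss v) {x \<in> space (gauss v). exp (a^2 / (4 * v)) \<le> exp (x^2 / (4 * v))}"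
 proof (rule finite_measure_mono)
  show "{x. a < \<bar>x\<bar>} \<subseteq> {x \<in> space (gauss v). exp (a^2 / (4 * v)) \<le> exp (x^2 / (4 * v))}"
   using power_mono[of a "\<bar>x\<bar>" 2 for x :: real] assms by (auto intro!: divide_right_mono)
 qed measurable
 with * show ?thesis by simp
qed

lemma gauss_increments_diff:
 assumes X: "gauss_increments M X" "prob_space M" and st: "0 \<le> s" "s < t"
 shows "distr M borel (\<lambda>x. X t x - X s x) = gauss (t - s)"
proof -
 \<comment> \<open>For \<open>s = 0\<close> the intersection drops \<open>s\<close>, and
   \<open>prev_time\<close> falls back to 0.\<close>
 define J where "J = {s, t} \<inter> {0<..}"
 have J: "finite J" "J \<subseteq> {0<..}" by (auto simp: J_def)
 have "insert 0 {r \<in> J. r < t} = {0, s}" using st by (auto simp: J_def)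
 then have "prev_time J t = s" using st by (simp add: prev_time_def)
 moreover have "t \<in> J" using st by (auto simp: J_def)
 ultimately show ?thesis using gauss_increments_indep(2)[OF X J, of t] by simp
qed

lemma prob_distr_gauss:
 assumes "distr M borel Y = gauss v" "Y \<in> borel_measurable M" "A \<in> sets borel"
 shows "measure M {x\<in>space M. Y x \<in> A} = measure (gauss v) A"
 using assms by (subst assms(1)[symmetric], subst measure_distr) (auto intro!: arg_cong[where f="measure M"])

section \<open>Dyadic chaining\<close>

definition dyadic_floor :: "nat => real => real" where
 "dyadic_floor m t = real_of_int \<lfloor>2 ^ m * t\<rfloor> / 2 ^ m"

lemma dyadic_floor_bounds:
 fixes t :: real
 shows "dyadic_floor m t \<le> t" "t < dyadic_floor m t + 1 / 2 ^ m"
proof -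
 have "real_of_int \<lfloor>2 ^ m * t\<rfloor> \<le> 2 ^ m * t" "2 ^ m * t < real_of_int \<lfloor>2 ^ m * t\<rfloor> + 1" by linarith+
 then show "dyadic_floor m t \<le> t" "t < dyadic_floor m t + 1 / 2 ^ m"
  by (auto simp: dyadic_floor_def field_simps)
qed

lemma dyadic_floor_nonneg: "0 \<le> t ==> 0 \<le> dyadic_floor m t"
 by (auto simp: dyadic_floor_def)

lemma tendsto_inverse_two_power: "(\<lambda>m. 1 / 2 ^ m :: real) \<longlonglongrightarrow> 0"
 using LIMSEQ_realpow_zero[of "1/2::real"] by (simp add: power_divide)

lemma dyadic_floor_tendsto: "(\<lambda>m. dyadic_floor m t) \<longlonglongrightarrow> t"
proof (rule LIMSEQ_I)
 fix e :: real assume "0 < e"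
 then obtain m0 where m0: "\<And>m. m \<ge> m0 ==> norm (1 / 2 ^ m - 0 :: real) < e"
  using LIMSEQ_D[OF tendsto_inverse_two_power] by blast
 show "\<exists>no. \<forall>n\<ge>no. norm (dyadic_floor n t - t) < e"
 proof (intro exI[of _ m0] allI impI)
  fix m assume "m0 \<le> m"
  then show "norm (dyadic_floor m t - t) < e"
   using m0[of m] dyadic_floor_bounds[where m=m and t=t] by auto
 qed
qed

lemma dyadic_floor_nat:
 assumes "0 \<le> t"
 obtains k :: nat where "dyadic_floor m t = k / 2 ^ m" "\<And>N. t < real N ==> k < N * 2 ^ m"
proof
 define k where "k = nat \<lfloor>2 ^ m * t\<rfloor>"
 have k: "real k = real_of_int \<lfloor>2 ^ m * t\<rfloor>" using assms by (simp add: k_def)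
 then show "dyadic_floor m t = real k / 2 ^ m" by (simp add: dyadic_floor_def)
 show "k < N * 2 ^ m" if "t < real N" for N
 proof -
  have "2 ^ m * t < 2 ^ m * real N" using that by simp
  then have "real k < 2 ^ m * real N" using k by linarith
  then have "real k < real (N * 2 ^ m)" by (simp add: mult.commute)
  then show ?thesis by (simp only: of_nat_less_iff)
 qed
qed

lemma dyadic_floor_Suc:
 assumes "dyadic_floor m t = real k / 2 ^ m"
 shows "dyadic_floor (Suc m) t = real (2 * k) / 2 ^ Suc m \<or> dyadic_floor (Suc m) t = real (Suc (2 * k)) / 2 ^ Suc m"
proof -
 have k: "\<lfloor>2 ^ m * t\<rfloor> = int k" using assms by (simp add: dyadic_floor_def)
 then have "int k \<le> 2 ^ m * t" "2 ^ m * t < int k + 1" by linarith+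
 then have "\<lfloor>2 ^ Suc m * t\<rfloor> = int (2 * k) \<or> \<lfloor>2 ^ Suc m * t\<rfloor> = int (Suc (2 * k))"
  by (auto simp: floor_eq_iff)
 then show ?thesis unfolding dyadic_floor_def by (metis of_int_of_nat_eq)
qed

lemma floor_next:
 fixes a b :: real
 assumes "\<lfloor>a\<rfloor> = int k" "a \<le> b" "b < a + 1"
 shows "\<lfloor>b\<rfloor> = int k \<or> \<lfloor>b\<rfloor> = int (Suc k)"
 using assms by (simp add: floor_eq_iff) linarith

text \<open>Refining the grid once keeps the left neighbour of \<open>t\<close> or moves it to the
  next point of the finer grid, so at most one finer increment is involved.\<close>

lemma chaining_step:
 fixes f :: "real => real"
 assumes t: "0 \<le> t" "t < real N"
  and f: "\<And>k. k < N * 2 ^ Suc m ==> \<bar>f (real (Suc k) / 2 ^ Suc m) - f (real k / 2 ^ Suc m)\<bar> \<le> e"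
  and "0 \<le> e"
 shows "\<bar>f (dyadic_floor (Suc m) t) - f (dyadic_floor m t)\<bar> \<le> e"
proof -
 obtain k where k: "dyadic_floor m t = real k / 2 ^ m" "k < N * 2 ^ m"
  using dyadic_floor_nat[OF t(1)] t(2) by metis
 then have kb: "2 * k < N * 2 ^ Suc m" by simp
 have k': "dyadic_floor m t = real (2 * k) / 2 ^ Suc m" using k by simp
 from dyadic_floor_Suc[OF k(1)] show ?thesis
  using f[OF kb] \<open>0 \<le> e\<close> unfolding k' by auto
qed

text \<open>The successive approximations telescope over the levels. The error sequence is kept
  general: it is a plain geometric series for continuity and is rescaled by the size of the
  deviation in \<open>wiener_dev_bound\<close>.\<close>

lemma chaining_limit:
 fixes f :: "real => real" and e :: "nat => real"
 assumes t: "0 \<le> t" "t < real N" and "summable e" and e0: "\<And>m. 0 \<le> e m"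
  and f: "\<And>m k. m \<ge> m0 ==> k < N * 2 ^ m ==> \<bar>f (real (Suc k) / 2 ^ m) - f (real k / 2 ^ m)\<bar> \<le> e m"
 shows "convergent (\<lambda>m. f (dyadic_floor m t))"
  and "m \<ge> m0 ==> \<bar>lim (\<lambda>m. f (dyadic_floor m t)) - f (dyadic_floor m t)\<bar> \<le> (\<Sum>l. e (l + Suc m))"
proof -
 let ?g = "\<lambda>m. f (dyadic_floor m t)"
 have step: "\<bar>?g (Suc m) - ?g m\<bar> \<le> e (Suc m)" if "m \<ge> m0" for m
  using that f[of "Suc m"] by (intro chaining_step[OF t]) (auto intro!: e0)
 have sum: "summable (\<lambda>l. e (l + Suc m))" for m
  using assms(3) by (rule summable_ignore_initial_segment)
 have conv: "(\<lambda>n. \<Sum>i<n. ?g (Suc (i + m)) - ?g (i + m)) \<longlonglongrightarrow> (\<Sum>l. ?g (Suc (l + m)) - ?g (l + m))"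
  "\<bar>\<Sum>l. ?g (Suc (l + m)) - ?g (l + m)\<bar> \<le> (\<Sum>l. e (l + Suc m))" if "m \<ge> m0" for m
 proof -
  have abs: "summable (\<lambda>l. \<bar>?g (Suc (l + m)) - ?g (l + m)\<bar>)"
   by (rule summable_comparison_test'[OF sum[of m], of 0]) (use step that in auto)
  then show "(\<lambda>n. \<Sum>i<n. ?g (Suc (i + m)) - ?g (i + m)) \<longlonglongrightarrow> (\<Sum>l. ?g (Suc (l + m)) - ?g (l + m))"
   by (rule summable_LIMSEQ[OF summable_rabs_cancel])
  have "\<bar>\<Sum>l. ?g (Suc (l + m)) - ?g (l + m)\<bar> \<le> (\<Sum>l. \<bar>?g (Suc (l + m)) - ?g (l + m)\<bar>)"
   by (rule summable_rabs[OF abs])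
  also have "... \<le> (\<Sum>l. e (l + Suc m))"
   using step that by (intro suminf_le abs sum) auto
  finally show "\<bar>\<Sum>l. ?g (Suc (l + m)) - ?g (l + m)\<bar> \<le> (\<Sum>l. e (l + Suc m))" .
 qed
 have tele: "(\<Sum>i<n. ?g (Suc (i + m)) - ?g (i + m)) = ?g (n + m) - ?g m" for n m
  using sum_lessThan_telescope[of "\<lambda>i. ?g (i + m)" n] by simp
 have L: "?g \<longlonglongrightarrow> ?g m + (\<Sum>l. ?g (Suc (l + m)) - ?g (l + m))" if "m \<ge> m0" for m
 proof -
  have "(\<lambda>n. ?g m + (?g (n + m) - ?g m)) \<longlonglongrightarrow> ?g m + (\<Sum>l. ?g (Suc (l + m)) - ?g (l + m))"
   using conv(1)[OF that] unfolding tele by (intro tendsto_intros)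
  then show ?thesis by (intro LIMSEQ_offset[of ?g m]) simp
 qed
 then show "convergent ?g" by (auto simp: convergent_def)
 show "m \<ge> m0 ==> \<bar>lim ?g - ?g m\<bar> \<le> (\<Sum>l. e (l + Suc m))"
  using limI[OF L] conv(2) by auto
qed

text \<open>Only increments between neighbouring dyadic points are controlled, for each horizon
  \<open>N\<close> from some level on. Two nearby times are compared at a level where their dyadic
  floors coincide or are adjacent.\<close>

lemma chaining_continuous:
 fixes f :: "real => real"
 assumes f: "\<And>N. \<exists>m0. \<forall>m\<ge>m0. \<forall>k<N * 2 ^ m. \<bar>f (real (Suc k) / 2 ^ m) - f (real k / 2 ^ m)\<bar> \<le> (9/10) ^ m"
 shows "\<And>t. 0 \<le> t ==> (\<lambda>m. f (dyadic_floor m t)) \<longlonglongrightarrow> lim (\<lambda>m. f (dyadic_floor m t))"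
  and "continuous_on {0..} (\<lambda>t. lim (\<lambda>m. f (dyadic_floor m t)))"
proof -
 let ?e = "\<lambda>m. (9/10::real) ^ m"
 let ?V = "\<lambda>t. lim (\<lambda>m. f (dyadic_floor m t))"
 have sume: "summable ?e" by (rule summable_geometric) simp
 have tail: "(\<Sum>l. ?e (l + Suc m)) \<le> 10 * ?e m" for m
 proof -
  have "(\<Sum>l. ?e (l + Suc m)) = ?e (Suc m) * (\<Sum>l. ?e l)"
   unfolding power_add by (subst mult.commute, rule suminf_mult[OF sume])
  also have "(\<Sum>l. ?e l) = 10" by (subst suminf_geometric) auto
  finally show ?thesis by simp
 qed
 show "(\<lambda>m. f (dyadic_floor m t)) \<longlonglongrightarrow> lim (\<lambda>m. f (dyadic_floor m t))" if t: "0 \<le> t" for t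
 proof -
  obtain N :: nat where N: "t < real N" using reals_Archimedean2 by blast
  obtain m0 where "\<forall>m\<ge>m0. \<forall>k<N * 2 ^ m. \<bar>f (real (Suc k) / 2 ^ m) - f (real k / 2 ^ m)\<bar> \<le> (9/10) ^ m"
   using f by blast
  then show ?thesis
   using chaining_limit(1)[OF t N sume, of m0 f] by (simp add: convergent_LIMSEQ_iff)
 qed
 show "continuous_on {0..} ?V"
  unfolding continuous_on_iff
 proof (intro ballI allI impI)
  fix x e :: real assume x: "x \<in> {0..}" and "0 < e"
  obtain N :: nat where N: "x + 1 < real N" using reals_Archimedean2 by blast
  obtain m0 where m0: "\<And>m k. m\<ge>m0 ==> k<N * 2 ^ m ==> \<bar>f (real (Suc k) / 2 ^ m) - f (real k / 2 ^ m)\<bar> \<le> (9/10) ^ m"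
   using f by blast
  \<comment> \<open>21 = 10 + 1 + 10: a chaining tail at each of the two times and one grid
    increment between their dyadic floors.\<close>
  have "(\<lambda>m. 21 * ?e m) \<longlonglongrightarrow> 21 * 0"
   by (intro tendsto_intros LIMSEQ_realpow_zero) auto
  then obtain m1 where m1: "\<And>m. m \<ge> m1 ==> norm (21 * ?e m - 0) < e"
   using \<open>0 < e\<close> LIMSEQ_D[of _ "21 * 0"] by (metis mult_zero_right)
  define m where "m = max m0 m1"
  have m: "m \<ge> m0" "21 * ?e m < e" using m1[of m] by (auto simp: m_def)
  have key: "\<bar>?V t - ?V s\<bar> < e" if st: "0 \<le> s" "s \<le> t" "t < real N" "t - s < 1 / 2 ^ m" for s t
  proof -
   have b: "\<bar>?V r - f (dyadic_floor m r)\<bar> \<le> 10 * ?e m" if "0 \<le> r" "r < real N" for r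
    using chaining_limit(2)[OF that sume, of m0 f m] m0 m tail[of m] by force
   obtain k where k: "dyadic_floor m s = real k / 2 ^ m" and kN: "k < N * 2 ^ m"
    using dyadic_floor_nat[OF st(1)] st by (metis le_less_trans)
   have fl: "\<lfloor>2 ^ m * s\<rfloor> = int k" using k by (simp add: dyadic_floor_def)
   have tb: "2 ^ m * t < 2 ^ m * s + 1" "2 ^ m * s \<le> 2 ^ m * t" using st by (auto simp: field_simps)
   have "\<lfloor>2 ^ m * t\<rfloor> = int k \<or> \<lfloor>2 ^ m * t\<rfloor> = int (Suc k)"
    by (rule floor_next[OF fl tb(2,1)])
   then have cases: "dyadic_floor m t = real k / 2 ^ m \<or> dyadic_floor m t = real (Suc k) / 2 ^ m"
    unfolding dyadic_floor_def by (metis of_int_of_nat_eq)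
   have "\<bar>f (dyadic_floor m t) - f (dyadic_floor m s)\<bar> \<le> ?e m"
    using cases m0[OF m(1) kN] k by auto
   then show ?thesis using b[of s] b[of t] st m(2) by auto
  qed
  show "\<exists>d>0. \<forall>x'\<in>{0..}. dist x' x < d --> dist (?V x') (?V x) < e"
  proof (intro exI[of _ "min 1 (1 / 2 ^ m)"] conjI ballI impI)
   fix y :: real assume y: "y \<in> {0..}" "dist y x < min 1 (1 / 2 ^ m)"
   show "dist (?V y) (?V x) < e"
   proof (cases "y \<le> x")
    case True then show ?thesis using key[of y x] x y N by (auto simp: dist_real_def)
   next
    case False
    have "dist y x < 1" using y(2) by (rule less_le_trans) simp
    then have "y < real N" using N by (auto simp: dist_real_def)
    then show ?thesis using False key[of x y] x y by (auto simp: dist_real_def)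
   qed
  qed simp
 qed
qed

section \<open>Path space and Wiener measure\<close>

definition path_set :: "(real => real) set" where
 "path_set = {w. continuous_on UNIV w \<and> (\<forall>t\<le>0. w t = 0)}"

text \<open>The trace sigma-algebra is used because \<open>path_set\<close> is not a measurable
  subset of the product over all real times. Freezing paths at 0 for negative times keeps them total
  functions without adding randomness.\<close>

definition path_space :: "(real => real) measure" where
 "path_space = restrict_space (PiM UNIV (\<lambda>_. borel)) path_set"

lemma space_path_space[simp]: "space path_space = path_set"
 by (simp add: path_space_def space_restrict_space space_PiM)

lemma path_coordinate_measurable[measurable]: "(\<lambda>w. w t) \<in> borel_measurable path_space"
 unfolding path_space_def by (intro measurable_restrict_space1) auto

lemma measurable_path_spaceI:
 assumes "\<And>x. x \<in> space M ==> f x \<in> path_set" "\<And>t. (\<lambda>x. f x t) \<in> borel_measurable M"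
 shows "f \<in> measurable M path_space"
 unfolding path_space_def
 by (intro measurable_restrict_space2 measurable_PiM_single') (use assms in \<open>auto simp: space_PiM\<close>)

lemma path_setD: "w \<in> path_set ==> isCont w t" "w \<in> path_set ==> t \<le> 0 ==> w t = 0"
 by (auto simp: path_set_def continuous_on_eq_continuous_at)

lemma path_tendsto: "w \<in> path_set ==> (f \<longlongrightarrow> t) F ==> ((\<lambda>x. w (f x)) \<longlongrightarrow> w t) F"
 by (rule isCont_tendsto_compose[OF path_setD(1)])

text \<open>Evaluation at a random time is the limit of evaluations at its dyadic floors, which take
  countably many values; continuity of the path justifies the limit.\<close>

lemma path_eval_measurable:
 assumes "f \<in> measurable M path_space" "g \<in> borel_measurable M"
 shows "(\<lambda>x. f x (g x)) \<in> borel_measurable M"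
proof (rule borel_measurable_LIMSEQ_real)
 fix x assume "x \<in> space M"
 then have "f x \<in> path_set" using measurable_space[OF assms(1)] by auto
 then show "(\<lambda>m. f x (dyadic_floor m (g x))) \<longlonglongrightarrow> f x (g x)"
  by (rule path_tendsto) (rule dyadic_floor_tendsto)
next
 fix m
 show "(\<lambda>x. f x (dyadic_floor m (g x))) \<in> borel_measurable M"
  unfolding dyadic_floor_def
 proof (rule measurable_compose_countable[where f="\<lambda>i x. f x (real_of_int i / 2 ^ m)"])
  show "(\<lambda>x. f x (real_of_int i / 2 ^ m)) \<in> borel_measurable M" for i
   by (rule measurable_compose[OF assms(1) path_coordinate_measurable])
  show "(\<lambda>x. \<lfloor>2 ^ m * g x\<rfloor>) \<in> measurable M (count_space UNIV)"
   using assms(2) by measurable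
 qed
qed

text \<open>Strict inequalities make the condition open, so its indicator is a limit of continuous
  functions of finitely many coordinates; \<open>regeneration_event\<close> relies on this.\<close>

definition path_cylinder :: "real set => (real => real) => (real => real) set" where
 "path_cylinder J a = {w \<in> path_set. \<forall>r\<in>J. w r < a r}"

definition path_cylinders :: "(real => real) set set" where
 "path_cylinders = {path_cylinder J a | J a. finite J}"

lemma Int_stable_path_cylinders: "Int_stable path_cylinders"
proof (rule Int_stableI)
 fix A B assume "A \<in> path_cylinders" "B \<in> path_cylinders"
 then obtain J a K b where A: "A = path_cylinder J a" "finite J" and B: "B = path_cylinder K b" "finite K"
  by (auto simp: path_cylinders_def)
 have "A \<inter> B = path_cylinder (J \<union> K) (\<lambda>r. if r \<in> J then if r \<in> K then min (a r) (b r) else a r else b r)"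
  unfolding A B path_cylinder_def by (auto split: if_splits)
 then show "A \<inter> B \<in> path_cylinders" using A B by (auto simp: path_cylinders_def)
qed

lemma path_cylinders_Pow: "path_cylinders \<subseteq> Pow path_set"
 by (auto simp: path_cylinders_def path_cylinder_def)

lemma path_set_in_cylinders: "path_set \<in> path_cylinders"
 unfolding path_cylinders_def by (intro CollectI exI[of _ "{}"]) (auto simp: path_cylinder_def)

lemma sets_path_space_cylinders: "sets path_space = sigma_sets path_set path_cylinders"
proof
 have "(\<lambda>w. w) \<in> measurable (sigma path_set path_cylinders) path_space"
 proof (rule measurable_path_spaceI)
  fix t
  show "(\<lambda>w. w t) \<in> borel_measurable (sigma path_set path_cylinders)"
   unfolding borel_measurable_iff_less
  proof
   fix a
   have "path_cylinder {t} (\<lambda>_. a) \<in> path_cylinders" by (auto simp: path_cylinders_def)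
   then have "path_cylinder {t} (\<lambda>_. a) \<in> sets (sigma path_set path_cylinders)"
    using path_cylinders_Pow by (simp add: sigma_sets.Basic)
   also have "path_cylinder {t} (\<lambda>_. a) = {w \<in> space (sigma path_set path_cylinders). w t < a}"
    using path_cylinders_Pow by (auto simp: path_cylinder_def space_measure_of_conv)
   finally show "{w \<in> space (sigma path_set path_cylinders). w t < a} \<in> sets (sigma path_set path_cylinders)" .
  qed
 qed (use path_cylinders_Pow in \<open>simp add: space_measure_of_conv\<close>)
 then show "sets path_space \<subseteq> sigma_sets path_set path_cylinders"
  using path_cylinders_Pow sets.sets_into_space[of _ path_space]
  by (auto simp: measurable_def space_measure_of_conv Int_absorb2)
 show "sigma_sets path_set path_cylinders \<subseteq> sets path_space"
 proof (rule sets.sigma_sets_subset'[of _ path_space, simplified])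
  show "path_cylinders \<subseteq> sets path_space"
  proof
   fix A assume "A \<in> path_cylinders"
   then obtain J a where A: "finite J" "A = path_cylinder J a" by (auto simp: path_cylinders_def)
   have "A = {w \<in> space path_space. \<forall>r\<in>J. w r < a r}" unfolding A by (auto simp: path_cylinder_def)
   also have "... \<in> sets path_space" using A(1) by measurable
   finally show "A \<in> sets path_space" .
  qed
 qed (use sets.top[of path_space] in simp)
qed

lemma (in prob_space) borel_cantelli_geometric:
 assumes "\<And>m. A m \<in> events" and A: "\<And>m. prob (A m) \<le> c * q ^ m" and q: "0 \<le> q" "q < 1"
 shows "AE x in M. eventually (\<lambda>m. x \<in> space M - A m) sequentially"
proof -
 have "summable (\<lambda>m. c * q ^ m)" using q by (intro summable_mult summable_geometric) simp
 then have "summable (\<lambda>m. prob (A m))" by (rule summable_comparison_test'[of _ 0]) (use A in auto)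
 then show ?thesis using assms(1) by (intro borel_cantelli_AE1) (auto simp: emeasure_eq_measure)
qed

text \<open>Kolmogorov's continuity criterion with fourth moments. Outside the event
  \<open>G\<close>, on which chaining works, the path is set to 0, so that every sample point yields
  a member of \<open>path_set\<close>.\<close>

theorem brownian_path_exists:
 assumes "prob_space M" and X: "gauss_increments M X"
 shows "\<exists>W \<in> measurable M path_space. \<forall>t\<ge>0. AE z in M. W z t = X t z"
proof -
 interpret prob_space M by fact
 have [measurable]: "X t \<in> borel_measurable M" for t
  using X by (auto simp: gauss_increments_def)
 have X0: "z \<in> space M ==> X 0 z = 0" for z
  using X by (auto simp: gauss_increments_def)
 have tailb: "prob {z\<in>space M. a < \<bar>X t z - X s z\<bar>} \<le> 3 * (t - s)^2 / a ^ 4" if "0 \<le> s" "s \<le> t" "0 < a" for s t a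
 proof (cases "s = t")
  case True then show ?thesis using that by simp
 next
  case False
  then have st: "s < t" using that by simp
  have "prob {z\<in>space M. X t z - X s z \<in> {x. a < \<bar>x\<bar>}} = measure (gauss (t - s)) {x. a < \<bar>x\<bar>}"
   using gauss_increments_diff[OF X assms(1) that(1) st] by (rule prob_distr_gauss) auto
  also have "... \<le> 3 * (t - s)^2 / a ^ 4"
   using st that by (intro prob_gauss_fourth_moment_bound) auto
  finally show ?thesis by simp
 qed
 \<comment> \<open>The ratio is close enough to 1 that
   \<open>2 * (1/2)^2 / ?r ^ 4 = 5000/6561\<close> is below 1: the factor 2 is the growth of the
   number of increments per level, \<open>(1/2)^2\<close> that of the squared variance.\<close>
 let ?r = "9/10 :: real"
 let ?good = "\<lambda>N m z. \<forall>k<N * 2 ^ m. \<bar>X (real (Suc k) / 2 ^ m) z - X (real k / 2 ^ m) z\<bar> \<le> ?r ^ m"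
 have AE_good: "AE z in M. \<forall>N. \<exists>m0. \<forall>m\<ge>m0. ?good N m z"
  unfolding AE_all_countable
 proof
  fix N :: nat
  let ?A = "\<lambda>m. {z\<in>space M. \<not> ?good N m z}"
  have bound: "prob (?A m) \<le> 3 * real N * (5000/6561) ^ m" for m
  proof -
   let ?B = "\<lambda>k. {z\<in>space M. ?r ^ m < \<bar>X (real (Suc k) / 2 ^ m) z - X (real k / 2 ^ m) z\<bar>}"
   have "prob (?A m) \<le> prob (\<Union>k\<in>{..<N * 2 ^ m}. ?B k)"
    by (intro finite_measure_mono) (auto simp: not_le)
   also have "... \<le> (\<Sum>k\<in>{..<N * 2 ^ m}. prob (?B k))"
    by (rule finite_measure_subadditive_finite) auto
   also have "... \<le> (\<Sum>k\<in>{..<N * 2 ^ m}. 3 * (1 / 2 ^ m)^2 / (?r ^ m) ^ 4)"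
   proof (rule sum_mono)
    fix k
    have "real (Suc k) / 2 ^ m - real k / 2 ^ m = 1 / 2 ^ m" by (simp add: field_simps)
    then show "prob (?B k) \<le> 3 * (1 / 2 ^ m)^2 / (?r ^ m) ^ 4"
     using tailb[of "real k / 2 ^ m" "real (Suc k) / 2 ^ m" "?r ^ m"] by (simp add: divide_right_mono)
   qed
   also have "... = 3 * real N * (2 * (1/2)^2 / ?r ^ 4) ^ m"
   proof -
    have "(2::real) ^ m * (3 * (1 / 2 ^ m)^2 / (?r ^ m) ^ 4) = 3 * (2 * (1/2)^2 / ?r ^ 4) ^ m"
     by (simp only: power_mult_distrib power_divide power_mult[symmetric] mult.commute[of m] power_one) simp
    then have "real N * ((2::real) ^ m * (3 * (1 / 2 ^ m)^2 / (?r ^ m) ^ 4)) = real N * (3 * (2 * (1/2)^2 / ?r ^ 4) ^ m)"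
     by (rule arg_cong)
    then show ?thesis by (simp only: sum_constant card_lessThan of_nat_mult of_nat_power of_nat_numeral ac_simps)
   qed
   also have "2 * (1/2)^2 / ?r ^ 4 = (5000/6561 :: real)" by (simp add: power_divide)
   finally show ?thesis .
  qed
  from borel_cantelli_geometric[OF _ bound] have "AE z in M. eventually (\<lambda>m. z \<in> space M - ?A m) sequentially" by simp
  then show "AE z in M. \<exists>m0. \<forall>m\<ge>m0. ?good N m z"
   by eventually_elim (auto simp: eventually_sequentially)
 qed
 define G where "G = {z\<in>space M. \<forall>N. \<exists>m0. \<forall>m\<ge>m0. ?good N m z}"
 have [measurable]: "G \<in> sets M" unfolding G_def by measurable
 define W where "W = (\<lambda>z t. if z \<in> G then lim (\<lambda>m. X (dyadic_floor m (max 0 t)) z) else 0)"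
 have Wlim: "(\<lambda>m. X (dyadic_floor m t) z) \<longlonglongrightarrow> W z t" if "z \<in> G" "0 \<le> t" for z t
  using chaining_continuous(1)[of "\<lambda>t. X t z" t] that by (auto simp: W_def G_def)
 have "W \<in> measurable M path_space"
 proof (rule measurable_path_spaceI)
  fix z assume z: "z \<in> space M"
  show "W z \<in> path_set"
  proof (cases "z \<in> G")
   case True
   then have "continuous_on {0..} (\<lambda>t. lim (\<lambda>m. X (dyadic_floor m t) z))"
    by (intro chaining_continuous(2)) (auto simp: G_def)
   then have "continuous_on UNIV (\<lambda>t. lim (\<lambda>m. X (dyadic_floor m (max 0 t)) z))"
    by (rule continuous_on_compose2[where f="max 0"]) (auto intro!: continuous_intros)
   moreover have "lim (\<lambda>m. X (dyadic_floor m 0) z) = 0"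
    using X0[OF z] by (simp add: dyadic_floor_def limI)
   ultimately show ?thesis using True by (simp add: W_def path_set_def max_absorb1 max_def)
  qed (auto simp: W_def path_set_def)
 next
  fix t show "(\<lambda>z. W z t) \<in> borel_measurable M"
   unfolding W_def by measurable
 qed
 moreover have "AE z in M. W z t = X t z" if t: "0 \<le> t" for t
 proof -
  \<comment> \<open>One increment per level instead of \<open>N * 2 ^ m\<close>, so the factor 2
    disappears from the ratio. It shows that the limit along the dyadic floors is a modification of
    \<open>X\<close>.\<close>
  let ?A = "\<lambda>m. {z\<in>space M. ?r ^ m < \<bar>X t z - X (dyadic_floor m t) z\<bar>}"
  have bound: "prob (?A m) \<le> 3 * (2500/6561) ^ m" for m
  proof -
   have d: "0 \<le> dyadic_floor m t" "dyadic_floor m t \<le> t" "t - dyadic_floor m t \<le> 1 / 2 ^ m"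
    using dyadic_floor_bounds[where m=m and t=t] dyadic_floor_nonneg[OF t, of m] by auto
   have "prob (?A m) \<le> 3 * (t - dyadic_floor m t)^2 / (?r ^ m) ^ 4"
    using d by (intro tailb) auto
   also have "... \<le> 3 * (1 / 2 ^ m)^2 / (?r ^ m) ^ 4"
    using d by (intro divide_right_mono mult_left_mono power_mono) auto
   also have "... = 3 * ((1/2)^2 / ?r ^ 4) ^ m"
    by (simp only: power_mult_distrib power_divide power_mult[symmetric] mult.commute[of m] power_one)
   also have "(1/2)^2 / ?r ^ 4 = (2500/6561 :: real)" by (simp add: power_divide)
   finally show ?thesis .
  qed
  from borel_cantelli_geometric[OF _ bound] have "AE z in M. eventually (\<lambda>m. z \<in> space M - ?A m) sequentially" by simp
  then show ?thesis using AE_good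
  proof eventually_elim
   case (elim z)
   then have z: "z \<in> G" by (auto simp: G_def eventually_sequentially)
   have "(\<lambda>m. X (dyadic_floor m t) z - X t z) \<longlonglongrightarrow> 0"
   proof (rule Lim_null_comparison)
    show "\<forall>\<^sub>F m in sequentially. norm (X (dyadic_floor m t) z - X t z) \<le> ?r ^ m"
     using elim(1) by eventually_elim auto
   qed (rule LIMSEQ_realpow_zero, auto)
   then have "(\<lambda>m. X (dyadic_floor m t) z) \<longlonglongrightarrow> X t z" by (rule LIM_zero_cancel)
   then show ?case using Wlim[OF z t] LIMSEQ_unique by blast
  qed
 qed
 ultimately show ?thesis by blast
qed

definition is_wiener :: "(real => real) measure => bool" where
 "is_wiener P \<longleftrightarrow> prob_space P \<and> sets P = sets path_space \<and> gauss_increments P (\<lambda>t w. w t)"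

lemma gauss_increments_distr:
 assumes W[measurable]: "W \<in> measurable M path_space"
 shows "gauss_increments_on (distr M path_space W) (\<lambda>t w. w t) J \<longleftrightarrow> gauss_increments_on M (\<lambda>t x. W x t) J"
  and "gauss_increments (distr M path_space W) (\<lambda>t w. w t) \<longleftrightarrow> gauss_increments M (\<lambda>t x. W x t)"
proof -
 have m: "(\<lambda>w. \<lambda>t\<in>J. w t - w (prev_time J t)) \<in> measurable path_space (PiM J (\<lambda>_. borel :: real measure))" for J
  by (intro measurable_restrict) auto
 show on: "gauss_increments_on (distr M path_space W) (\<lambda>t w. w t) J \<longleftrightarrow> gauss_increments_on M (\<lambda>t x. W x t) J" for J
  unfolding gauss_increments_on_def distr_distr[OF m W] comp_def ..
 have "(\<lambda>x. W x t) \<in> borel_measurable M" for t by (rule measurable_compose[OF W path_coordinate_measurable])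
 moreover have "W x 0 = 0" if "x \<in> space M" for x using measurable_space[OF W that] by (simp add: path_set_def)
 ultimately show "gauss_increments (distr M path_space W) (\<lambda>t w. w t) \<longleftrightarrow> gauss_increments M (\<lambda>t x. W x t)"
  by (auto simp: gauss_increments_def on path_set_def)
qed

text \<open>Passing to a continuous modification alters any finite family of coordinates on a null
  set only, so the joint laws of increments survive.\<close>

lemma is_wiener_exists: "\<exists>P. is_wiener P"
proof -
 let ?L = bm_fdd.lim
 have prob: "prob_space ?L" by unfold_locales
 interpret prob_space ?L by (fact prob)
 obtain W where W[measurable]: "W \<in> measurable ?L path_space"
  and AEW: "\<And>t. 0 \<le> t ==> AE x in ?L. W x t = bm_pre t x"
  using brownian_path_exists[OF prob gauss_increments_bm_pre] by blast
 have [measurable]: "bm_pre t \<in> borel_measurable ?L" "(\<lambda>x. W x t) \<in> borel_measurable ?L" for t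
  using gauss_increments_bm_pre measurable_compose[OF W path_coordinate_measurable] by (auto simp: gauss_increments_def)
 have "gauss_increments ?L (\<lambda>t x. W x t)"
  unfolding gauss_increments_def
 proof (intro conjI allI impI ballI)
  show "W x 0 = 0" if "x \<in> space ?L" for x using measurable_space[OF W that] by (simp add: path_set_def)
  fix J :: "real set" assume J: "finite J" "J \<subseteq> {0<..}"
  have "AE x in ?L. \<forall>t\<in>J. W x t = bm_pre t x \<and> W x (prev_time J t) = bm_pre (prev_time J t) x"
  proof (rule AE_finite_allI[OF J(1)])
   fix t assume t: "t \<in> J"
   then have "0 \<le> t" "0 \<le> prev_time J t" using J prev_time_props(1)[OF J, of t] by auto
   then show "AE x in ?L. W x t = bm_pre t x \<and> W x (prev_time J t) = bm_pre (prev_time J t) x"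
    using AEW[of t] AEW[of "prev_time J t"] by auto
  qed
  then have "AE x in ?L. (\<lambda>t\<in>J. W x t - W x (prev_time J t)) = (\<lambda>t\<in>J. increment bm_pre J t x)"
   by eventually_elim (auto simp: fun_eq_iff)
  then have "distr ?L (PiM J (\<lambda>_. borel)) (\<lambda>x. \<lambda>t\<in>J. W x t - W x (prev_time J t)) = distr ?L (PiM J (\<lambda>_. borel)) (\<lambda>x. \<lambda>t\<in>J. increment bm_pre J t x)"
   by (rule distr_cong_AE[OF refl refl]) (auto intro!: measurable_restrict)
  then show "gauss_increments_on ?L (\<lambda>t x. W x t) J"
   using gauss_increments_bm_pre J by (simp add: gauss_increments_def gauss_increments_on_def)
 qed simp
 then show ?thesis
  unfolding is_wiener_def using prob_space.prob_space_distr[OF prob W] gauss_increments_distr(2)[OF W]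
  by (intro exI[of _ "distr ?L path_space W"]) simp
qed

text \<open>The choice is harmless: by \<open>wiener_unique\<close> there is only one such
  measure.\<close>

definition wiener :: "(real => real) measure" where
 "wiener = (SOME P. is_wiener P)"

lemma is_wiener: "is_wiener wiener"
 unfolding wiener_def using is_wiener_exists by (rule someI_ex)

lemma prob_space_wiener: "prob_space wiener"
 and sets_wiener[measurable_cong, simp]: "sets wiener = sets path_space"
 and wiener_increments: "gauss_increments wiener (\<lambda>t w. w t)"
 using is_wiener by (auto simp: is_wiener_def)

lemma space_wiener[simp]: "space wiener = path_set"
 using sets_eq_imp_space_eq[OF sets_wiener] by simp

interpretation wiener: prob_space wiener by (rule prob_space_wiener)

lemma path_measure_eqI:
 assumes "prob_space M" "prob_space N" and sets: "sets M = sets path_space" "sets N = sets path_space"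
  and eq: "\<And>J a. finite J ==> emeasure M (path_cylinder J a) = emeasure N (path_cylinder J a)"
 shows "M = N"
proof (rule measure_eqI_generator_eq[OF Int_stable_path_cylinders path_cylinders_Pow])
 show "sets M = sigma_sets path_set path_cylinders" "sets N = sigma_sets path_set path_cylinders"
  using sets sets_path_space_cylinders by auto
 show "range (\<lambda>i::nat. path_set) \<subseteq> path_cylinders" using path_set_in_cylinders by auto
 show "emeasure M path_set \<noteq> \<infinity>" for i :: nat
  using prob_space.emeasure_space_1[OF assms(1)] sets_eq_imp_space_eq[OF sets(1)] by simp
qed (use eq in \<open>auto simp: path_cylinders_def\<close>)

lemma path_cylinder_sets[measurable]: "finite J ==> path_cylinder J a \<in> sets path_space"
 unfolding sets_path_space_cylinders by (rule sigma_sets.Basic) (auto simp: path_cylinders_def)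

text \<open>A cylinder splits into times at most 0, where all paths vanish and the condition is the
  constant \<open>c\<close>, and positive times, whose joint law is forced to be
  \<open>bm_fdd\<close>.\<close>

lemma wiener_unique:
 assumes "prob_space M" and W[measurable]: "W \<in> measurable M path_space"
  and GI: "gauss_increments M (\<lambda>t x. W x t)"
 shows "distr M path_space W = wiener"
proof (rule path_measure_eqI)
 show "prob_space (distr M path_space W)" by (rule prob_space.prob_space_distr[OF assms(1) W])
 show "prob_space wiener" by (rule prob_space_wiener)
 fix J :: "real set" and a :: "real => real" assume J: "finite J"
 define J' where "J' = J \<inter> {0<..}"
 have J': "finite J'" "J' \<subseteq> {0<..}" using J by (auto simp: J'_def)
 let ?C = "{f \<in> space (PiM J' (\<lambda>_. borel)). \<forall>r\<in>J'. f r < a r}"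
 have C[measurable]: "?C \<in> sets (PiM J' (\<lambda>_. borel))" using J' by measurable
 define c where "c \<longleftrightarrow> (\<forall>r\<in>J - J'. 0 < a r)"
 have val: "emeasure Q (path_cylinder J a) = (if c then emeasure (bm_fdd J') ?C else 0)"
  if Q: "prob_space Q" "sets Q = sets path_space" "gauss_increments Q (\<lambda>t w. w t)" for Q
 proof -
  have sp: "space Q = path_set" using sets_eq_imp_space_eq[OF Q(2)] by simp
  have m: "(\<lambda>w. \<lambda>t\<in>J'. w t) \<in> measurable Q (PiM J' (\<lambda>_. borel))"
   by (intro measurable_restrict) (auto simp: measurable_cong_sets[OF Q(2) refl])
  have eq: "path_cylinder J a = (if c then (\<lambda>w. \<lambda>t\<in>J'. w t) -` ?C \<inter> space Q else {})"
  proof (intro set_eqI)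
   fix w
   have split: "(\<forall>r\<in>J. w r < a r) \<longleftrightarrow> (\<forall>r\<in>J'. w r < a r) \<and> (\<forall>r\<in>J - J'. w r < a r)"
    by (auto simp: J'_def)
   have "(\<forall>r\<in>J - J'. w r < a r) \<longleftrightarrow> c" if "w \<in> path_set"
   proof -
    have "w r = 0" if "r \<in> J - J'" for r
     using that path_setD(2)[OF \<open>w \<in> path_set\<close>, of r] by (auto simp: J'_def not_less)
    then show ?thesis unfolding c_def by (metis (no_types, lifting))
   qed
   then show "w \<in> path_cylinder J a \<longleftrightarrow> w \<in> (if c then (\<lambda>w. \<lambda>t\<in>J'. w t) -` ?C \<inter> space Q else {})"
    by (auto simp: path_cylinder_def split sp space_PiM)
  qed
  show ?thesis
   unfolding eq using gauss_increments_fdd[of "\<lambda>t w. w t" Q, OF _ _ J'] Q(3) J' emeasure_distr[OF m C]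
   by (simp add: gauss_increments_def)
 qed
 have GI': "gauss_increments (distr M path_space W) (\<lambda>t w. w t)" using GI gauss_increments_distr(2)[OF W] by simp
 show "emeasure (distr M path_space W) (path_cylinder J a) = emeasure wiener (path_cylinder J a)"
  using val[OF _ _ GI'] val[OF _ _ wiener_increments] prob_space.prob_space_distr[OF assms(1) W] prob_space_wiener
  by simp
qed auto

section \<open>Shifted and stopped paths; the simple Markov property\<close>

definition path_shift :: "real => (real => real) => real => real" where
 "path_shift t w = (\<lambda>s. if s \<le> 0 then 0 else w (t + s) - w t)"

text \<open>Information up to time \<open>t\<close> is encoded by a map instead of a filtration: an
  event belongs to the past of \<open>t\<close> when it can be read off the stopped path.\<close>

definition path_stop :: "real => (real => real) => real => real" where
 "path_stop t w = (\<lambda>s. w (min s t))"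

lemma path_shift_eq: "path_shift t w s = w (t + max 0 s) - w t"
 by (auto simp: path_shift_def max_def)

lemma path_shift_in: "w \<in> path_set ==> path_shift t w \<in> path_set"
proof -
 assume w: "w \<in> path_set"
 then have c: "continuous_on UNIV w" by (simp add: path_set_def)
 have "continuous_on UNIV (\<lambda>s. w (t + max 0 s) - w t)"
  by (intro continuous_intros continuous_on_compose2[OF c]) auto
 then show ?thesis by (auto simp: path_set_def path_shift_eq[abs_def])
qed

lemma path_stop_in: "0 \<le> t ==> w \<in> path_set ==> path_stop t w \<in> path_set"
proof -
 assume w: "w \<in> path_set" and t: "0 \<le> t"
 then have c: "continuous_on UNIV w" by (simp add: path_set_def)
 have "continuous_on UNIV (\<lambda>s. w (min s t))"
  by (intro continuous_intros continuous_on_compose2[OF c]) auto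
 then show ?thesis using w t by (auto simp: path_set_def path_stop_def)
qed

lemma path_shift_measurable2:
 assumes [measurable]: "f \<in> measurable M path_space" "g \<in> borel_measurable M"
 shows "(\<lambda>x. path_shift (g x) (f x)) \<in> measurable M path_space"
proof (rule measurable_path_spaceI)
 fix x assume "x \<in> space M"
 then show "path_shift (g x) (f x) \<in> path_set"
  using measurable_space[OF assms(1)] by (intro path_shift_in) auto
next
 fix t
 show "(\<lambda>x. path_shift (g x) (f x) t) \<in> borel_measurable M"
  unfolding path_shift_eq
  by (intro borel_measurable_diff path_eval_measurable[OF assms(1)]) measurable
qed

lemma path_shift_measurable[measurable]: "path_shift t \<in> measurable path_space path_space"
 using path_shift_measurable2[of "\<lambda>w. w" path_space "\<lambda>_. t"] by simp

lemma path_stop_measurable: "0 \<le> t ==> path_stop t \<in> measurable path_space path_space"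
 by (rule measurable_path_spaceI) (auto simp: path_stop_in, simp add: path_stop_def)

text \<open>As \<open>t\<close> is itself a time of \<open>H\<close>, or is 0, the predecessor of a
  shifted time never lies strictly before \<open>t\<close>, and predecessors commute with the
  shift.\<close>

lemma prev_time_shift:
 assumes J: "finite J" "J \<subseteq> {0<..}" and t: "0 \<le> t" and s: "s \<in> J"
  and H: "H = H1 \<union> (\<lambda>s. t + s) ` J" "finite H1" "H1 \<subseteq> {0<..t}" "0 < t ==> t \<in> H1"
 shows "prev_time H (t + s) = t + prev_time J s"
proof -
 have sp: "0 < s" using s J by auto
 note p = prev_time_props[OF J sp]
 have fin: "finite (insert 0 {r \<in> H. r < t + s})" using H J by auto
 show ?thesis
  unfolding prev_time_def[of H]
 proof (rule Max_eqI[OF fin])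
  fix y assume "y \<in> insert 0 {r \<in> H. r < t + s}"
  then show "y \<le> t + prev_time J s" using p t H by (auto simp: algebra_simps)
 next
  show "t + prev_time J s \<in> insert 0 {r \<in> H. r < t + s}"
   using p t H sp by (cases "0 < t") auto
 qed
qed

lemma path_increment_sum:
 fixes w :: "real => real"
 assumes H: "finite H" "H \<subseteq> {0<..}" and ab: "a \<in> insert 0 H" "b \<in> insert 0 H" "a \<le> b"
 shows "w b - w a = (\<Sum>s\<in>{s\<in>H. a < s \<and> s \<le> b}. w s - w (prev_time H s))"
 using telescope_prev_time[OF H ab, of w] by simp

lemma shift_wiener:
 assumes t: "0 \<le> t"
 shows "distr wiener path_space (path_shift t) = wiener"
proof (rule wiener_unique[OF prob_space_wiener])
 show "path_shift t \<in> measurable wiener path_space" by simp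
 have m[measurable]: "(\<lambda>w. path_shift t w s) \<in> borel_measurable wiener" for s
  by (rule measurable_compose[OF _ path_coordinate_measurable]) simp
 have "gauss_increments_on wiener (\<lambda>s w. path_shift t w s) J" if J: "finite J" "J \<subseteq> {0<..}" for J
 proof (rule gauss_increments_onI[OF prob_space_wiener m])
  define H1 where "H1 = {t} \<inter> {0<..}"
  define H where "H = H1 \<union> (\<lambda>s. t + s) ` J"
  have H1: "finite H1" "H1 \<subseteq> {0<..t}" "0 < t ==> t \<in> H1" by (auto simp: H1_def)
  have H: "finite H" "H \<subseteq> {0<..}" using J H1 t by (auto simp: H_def)
  have inc: "path_shift t w s - path_shift t w (prev_time J s) = w (t + s) - w (prev_time H (t + s))" if "s \<in> J" for s w
  proof -
   have "0 < s" using that J by auto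
   then show ?thesis
    using prev_time_shift[OF J t that H_def H1] prev_time_props(1)[OF J, of s]
    by (auto simp: path_shift_eq)
  qed
  note G = gauss_increments_indep[OF wiener_increments prob_space_wiener H]
  show "distr wiener borel (\<lambda>w. path_shift t w s - path_shift t w (prev_time J s)) = gauss (s - prev_time J s)"
   if s: "s \<in> J" for s
   using G(2)[of "t + s"] prev_time_shift[OF J t s H_def H1] s inc[OF s] by (auto simp: H_def)
  let ?Z = "\<lambda>s w. w s - w (prev_time H s)"
  have "wiener.indep_vars (\<lambda>s. PiM {t + s} (\<lambda>_. borel)) (\<lambda>s w. restrict (\<lambda>i. ?Z i w) {t + s}) J"
   by (rule wiener.indep_vars_restrict[OF G(1)]) (auto simp: H_def disjoint_family_on_def)
  then have "wiener.indep_vars (\<lambda>_. borel) (\<lambda>s w. restrict (\<lambda>i. ?Z i w) {t + s} (t + s)) J"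
   by (rule wiener.indep_vars_compose2) auto
  then show "wiener.indep_vars (\<lambda>_. borel) (\<lambda>s w. path_shift t w s - path_shift t w (prev_time J s)) J"
   by (rule wiener.indep_vars_cong[THEN iffD1, rotated -1]) (auto simp: inc)
 qed
 then show "gauss_increments wiener (\<lambda>s w. path_shift t w s)" by (simp add: gauss_increments_def path_shift_def m)
qed

text \<open>Both events are functions of increments over one common time set: the past uses those
  ending by \<open>t\<close>, the future those ending after \<open>t\<close>, and these are disjoint
  blocks of independent variables.\<close>

lemma markov_cylinders:
 assumes t: "0 \<le> t" and J: "finite J" and K: "finite K"
 shows "wiener.prob {w\<in>path_set. path_stop t w \<in> path_cylinder J a \<and> path_shift t w \<in> path_cylinder K b}
  = wiener.prob {w\<in>path_set. path_stop t w \<in> path_cylinder J a} * wiener.prob {w\<in>path_set. path_shift t w \<in> path_cylinder K b}"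
proof -
 define K' where "K' = K \<inter> {0<..}"
 \<comment> \<open>\<open>t\<close> is inserted as a grid time, so that no increment straddles
   it.\<close>
 define H1 where "H1 = ((\<lambda>r. min r t) ` J \<union> {t}) \<inter> {0<..}"
 define H2 where "H2 = (\<lambda>s. t + s) ` K'"
 define H where "H = H1 \<union> H2"
 have K': "finite K'" "K' \<subseteq> {0<..}" using K by (auto simp: K'_def)
 have H1: "finite H1" "H1 \<subseteq> {0<..t}" using J t by (auto simp: H1_def)
 have H2: "finite H2" "H2 \<subseteq> {t<..}" using K' by (auto simp: H2_def)
 have H: "finite H" "H \<subseteq> {0<..}" using H1 H2 t by (auto simp: H_def)
 have disj: "H1 \<inter> H2 = {}" using H1(2) H2(2) by force
 let ?Z = "\<lambda>s w. w s - w (prev_time H s)"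
 note G = gauss_increments_indep(1)[OF wiener_increments prob_space_wiener H]
 have ind: "wiener.indep_var (PiM H1 (\<lambda>_. borel)) (\<lambda>w. restrict (\<lambda>i. ?Z i w) H1) (PiM H2 (\<lambda>_. borel)) (\<lambda>w. restrict (\<lambda>i. ?Z i w) H2)"
  by (rule wiener.indep_var_restrict[OF G]) (use disj in \<open>auto simp: H_def\<close>)
 define A where "A = {z\<in>space (PiM H1 (\<lambda>_. borel :: real measure)). \<forall>r\<in>J. (\<Sum>s\<in>{s\<in>H1. s \<le> min r t}. z s) < a r}"
 define B where "B = {z\<in>space (PiM H2 (\<lambda>_. borel :: real measure)). \<forall>r\<in>K. (\<Sum>s\<in>{s\<in>H2. s \<le> t + r}. z s) < b r}"
 have sumA: "(\<lambda>z. \<Sum>s\<in>{s\<in>H1. s \<le> c}. z s) \<in> borel_measurable (PiM H1 (\<lambda>_. borel :: real measure))" for c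
  by (intro borel_measurable_sum measurable_component_singleton) auto
 have sumB: "(\<lambda>z. \<Sum>s\<in>{s\<in>H2. s \<le> c}. z s) \<in> borel_measurable (PiM H2 (\<lambda>_. borel :: real measure))" for c
  by (intro borel_measurable_sum measurable_component_singleton) auto
 note [measurable] = sumA sumB
 have A: "A \<in> sets (PiM H1 (\<lambda>_. borel))" unfolding A_def using J by measurable
 have B: "B \<in> sets (PiM H2 (\<lambda>_. borel))" unfolding B_def using K by measurable
 have eA: "path_stop t w \<in> path_cylinder J a \<longleftrightarrow> restrict (\<lambda>i. ?Z i w) H1 \<in> A" if w: "w \<in> path_set" for w
 proof -
  have "(\<Sum>s\<in>{s\<in>H1. s \<le> min r t}. restrict (\<lambda>i. ?Z i w) H1 s) = w (min r t)" if r: "r \<in> J" for r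
  proof (cases "min r t \<le> 0")
   case True
   then have e: "{s\<in>H1. s \<le> min r t} = {}" using H1 by force
   show ?thesis unfolding e using path_setD(2)[OF w True] by simp
  next
   case False
   then have m: "min r t \<in> insert 0 H" "0 \<le> min r t" using r by (auto simp: H_def H1_def)
   have e: "{s\<in>H1. s \<le> min r t} = {s\<in>H. 0 < s \<and> s \<le> min r t}" using H1 H2 by (auto simp: H_def)
   have "(\<Sum>s\<in>{s\<in>H1. s \<le> min r t}. restrict (\<lambda>i. ?Z i w) H1 s) = (\<Sum>s\<in>{s\<in>H1. s \<le> min r t}. ?Z s w)"
    by (rule sum.cong) auto
   also have "... = w (min r t) - w 0"
    unfolding e using path_increment_sum[OF H _ m, of w] by simp
   finally show ?thesis using path_setD(2)[OF w] by simp
  qed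
  then show ?thesis
   using path_stop_in[OF t w] by (auto simp: path_cylinder_def A_def space_PiM path_stop_def)
 qed
 have eB: "path_shift t w \<in> path_cylinder K b \<longleftrightarrow> restrict (\<lambda>i. ?Z i w) H2 \<in> B" if w: "w \<in> path_set" for w
 proof -
  have "(\<Sum>s\<in>{s\<in>H2. s \<le> t + r}. restrict (\<lambda>i. ?Z i w) H2 s) = path_shift t w r" if r: "r \<in> K" for r
  proof (cases "r \<le> 0")
   case True
   then have e: "{s\<in>H2. s \<le> t + r} = {}" using H2 by force
   show ?thesis unfolding e using True by (simp add: path_shift_def)
  next
   case False
   then have m: "t + r \<in> insert 0 H" "t \<le> t + r" "t \<in> insert 0 H"
    using r t by (auto simp: H_def H2_def K'_def H1_def)
   have e: "{s\<in>H2. s \<le> t + r} = {s\<in>H. t < s \<and> s \<le> t + r}" using H1 H2 by (auto simp: H_def)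
   have "(\<Sum>s\<in>{s\<in>H2. s \<le> t + r}. restrict (\<lambda>i. ?Z i w) H2 s) = (\<Sum>s\<in>{s\<in>H2. s \<le> t + r}. ?Z s w)"
    by (rule sum.cong) auto
   also have "... = w (t + r) - w t"
    unfolding e using path_increment_sum[OF H m(3,1,2), of w] by simp
   finally show ?thesis using False by (simp add: path_shift_def)
  qed
  then show ?thesis
   using path_shift_in[OF w] by (auto simp: path_cylinder_def B_def space_PiM)
 qed
 have "{w\<in>path_set. path_stop t w \<in> path_cylinder J a \<and> path_shift t w \<in> path_cylinder K b}
   = (\<lambda>w. (restrict (\<lambda>i. ?Z i w) H1, restrict (\<lambda>i. ?Z i w) H2)) -` (A \<times> B) \<inter> space wiener"
  using eA eB by auto
 moreover have "{w\<in>path_set. path_stop t w \<in> path_cylinder J a} = (\<lambda>w. restrict (\<lambda>i. ?Z i w) H1) -` A \<inter> space wiener"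
  using eA by auto
 moreover have "{w\<in>path_set. path_shift t w \<in> path_cylinder K b} = (\<lambda>w. restrict (\<lambda>i. ?Z i w) H2) -` B \<inter> space wiener"
  using eB by auto
 ultimately show ?thesis
  using wiener.indep_varD[OF ind A B] by simp
qed

lemma vimage_cylinder_sigma:
 assumes "f \<in> path_set \<rightarrow> path_set"
 shows "{f -` A \<inter> path_set | A. A \<in> sets path_space} = sigma_sets path_set {f -` A \<inter> path_set | A. A \<in> path_cylinders}"
 unfolding sets_path_space_cylinders by (rule sigma_sets_vimage_commute[OF assms])

lemma Int_stable_vimage:
 assumes "Int_stable \<C>" shows "Int_stable {f -` A \<inter> S | A. A \<in> \<C>}"
proof (rule Int_stableI)
 fix a b assume "a \<in> {f -` A \<inter> S | A. A \<in> \<C>}" "b \<in> {f -` A \<inter> S | A. A \<in> \<C>}"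
 then obtain A B where "a = f -` A \<inter> S" "b = f -` B \<inter> S" "A \<in> \<C>" "B \<in> \<C>" by auto
 moreover have "A \<inter> B \<in> \<C>" using \<open>A \<in> \<C>\<close> \<open>B \<in> \<C>\<close> assms by (auto simp: Int_stable_def)
 ultimately show "a \<inter> b \<in> {f -` A \<inter> S | A. A \<in> \<C>}"
  by (intro CollectI exI[of _ "A \<inter> B"]) auto
qed

text \<open>Cylinders form an intersection-stable generator, so their independence extends to the
  generated sigma-algebras. Stating it as a product law makes it directly usable under
  Fubini.\<close>

theorem wiener_markov:
 assumes t: "0 \<le> t"
 shows "distr wiener (path_space \<Otimes>\<^sub>M path_space) (\<lambda>w. (path_stop t w, path_shift t w))
   = distr wiener path_space (path_stop t) \<Otimes>\<^sub>M wiener"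
proof -
 note [measurable] = path_stop_measurable[OF t]
 let ?A = "{path_stop t -` A \<inter> path_set | A. A \<in> path_cylinders}"
 let ?B = "{path_shift t -` A \<inter> path_set | A. A \<in> path_cylinders}"
 have ps: "path_stop t \<in> path_set \<rightarrow> path_set" "path_shift t \<in> path_set \<rightarrow> path_set"
  using path_stop_in[OF t] path_shift_in by auto
 have cyls: "path_cylinders \<subseteq> sets path_space" by (auto simp: path_cylinders_def)
 have "wiener.indep_set ?A ?B"
 proof (rule wiener.indep_setI)
  have "f -` A \<inter> path_set \<in> sets path_space" if "f \<in> measurable path_space path_space" "A \<in> path_cylinders" for f A
   using measurable_sets[OF that(1), of A] that(2) cyls by auto
  then show "?A \<subseteq> wiener.events" "?B \<subseteq> wiener.events" by auto
  fix a b assume "a \<in> ?A" "b \<in> ?B"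
  then obtain J x K y where J: "finite J" "a = path_stop t -` path_cylinder J x \<inter> path_set"
   and K: "finite K" "b = path_shift t -` path_cylinder K y \<inter> path_set"
   by (auto simp: path_cylinders_def)
  have "a \<inter> b = {w\<in>path_set. path_stop t w \<in> path_cylinder J x \<and> path_shift t w \<in> path_cylinder K y}"
   "a = {w\<in>path_set. path_stop t w \<in> path_cylinder J x}" "b = {w\<in>path_set. path_shift t w \<in> path_cylinder K y}"
   unfolding J K by auto
  then show "wiener.prob (a \<inter> b) = wiener.prob a * wiener.prob b"
   using markov_cylinders[OF t J(1) K(1), of x y] by simp
 qed
 from wiener.indep_set_sigma_sets[OF this Int_stable_vimage Int_stable_vimage] Int_stable_path_cylinders
 have "wiener.indep_set (sigma_sets path_set ?A) (sigma_sets path_set ?B)" by simp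
 then have "wiener.indep_var path_space (path_stop t) path_space (path_shift t)"
  unfolding wiener.indep_var_eq space_wiener vimage_cylinder_sigma[OF ps(1)] vimage_cylinder_sigma[OF ps(2)]
  by (subst (1 2) sigma_sets_sigma_sets_eq) auto
 then show ?thesis unfolding wiener.indep_var_distribution_eq by (simp add: shift_wiener[OF t])
qed

section \<open>Exit times and the strong Markov property\<close>

abbreviation plane :: "(real \<times> real) measure" where
 "plane \<equiv> borel \<Otimes>\<^sub>M borel"

definition exit_set :: "real => real => (real => real) => real set" where
 "exit_set l u w = {t. 0 \<le> t \<and> (w t \<le> l \<or> u \<le> w t)}"

text \<open>The value \<open>-1\<close> marks the (null) event that the path never leaves the interval.\<close>
definition exit_time :: "real => real => (real => real) => real" where
 "exit_time l u w = (if exit_set l u w = {} then -1 else Inf (exit_set l u w))"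

lemma exit_set_closed: assumes "w \<in> path_set" shows "closed (exit_set l u w)"
proof -
 have c: "continuous_on UNIV w" using assms by (simp add: path_set_def)
 have "exit_set l u w = {t. 0 \<le> t} \<inter> ({t. w t \<le> l} \<union> {t. u \<le> w t})" by (auto simp: exit_set_def)
 also have "closed ..." by (intro closed_Int closed_Un closed_Collect_le c continuous_intros)
 finally show ?thesis .
qed

lemma exit_time_first:
 assumes w: "w \<in> path_set" and "0 \<le> exit_time l u w"
 shows "exit_time l u w \<in> exit_set l u w" "\<And>r. r \<in> exit_set l u w ==> exit_time l u w \<le> r"
proof -
 have ne: "exit_set l u w \<noteq> {}" using assms by (auto simp: exit_time_def)
 have bb: "bdd_below (exit_set l u w)" by (auto simp: exit_set_def bdd_below_def)
 show "exit_time l u w \<in> exit_set l u w"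
  using closed_contains_Inf[OF ne bb exit_set_closed[OF w]] ne by (simp add: exit_time_def)
 show "exit_time l u w \<le> r" if "r \<in> exit_set l u w" for r
  using that bb ne by (simp add: exit_time_def cInf_lower)
qed

lemma exit_time_eqI:
 assumes "s \<in> exit_set l u w" "\<And>r. r \<in> exit_set l u w ==> s \<le> r"
 shows "exit_time l u w = s"
 using assms cInf_eq_minimum[of s "exit_set l u w"] by (auto simp: exit_time_def)

lemma exit_time_nonneg: "exit_set l u w \<noteq> {} ==> 0 \<le> exit_time l u w"
 by (auto simp: exit_time_def intro!: cInf_greatest) (auto simp: exit_set_def)

lemma exit_time_ge: "exit_time l u w = -1 \<or> 0 \<le> exit_time l u w"
 using exit_time_nonneg by (auto simp: exit_time_def)

text \<open>Were the path beyond an end point at the exit, the intermediate value theorem would give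
  an earlier visit to that end point. The sign conditions place the start inside the closed
  interval.\<close>

lemma exit_position:
 assumes w: "w \<in> path_set" and lu: "l \<le> 0" "0 \<le> u" and T: "0 \<le> exit_time l u w"
 shows "w (exit_time l u w) = l \<or> w (exit_time l u w) = u"
proof (rule ccontr)
 assume neg: "\<not> ?thesis"
 let ?T = "exit_time l u w"
 note first = exit_time_first[OF w T]
 have w0: "w 0 = 0" using path_setD(2)[OF w] by simp
 have cont: "\<forall>x. 0 \<le> x \<and> x \<le> ?T --> isCont w x" using path_setD(1)[OF w] by blast
 obtain r where r: "0 \<le> r" "r \<le> ?T" "w r = l \<or> w r = u"
  using neg first(1) IVT2[of w ?T l 0] IVT[of w 0 u ?T] w0 lu T cont by (force simp: exit_set_def)
 then have "?T \<le> r" by (intro first(2)) (auto simp: exit_set_def)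
 then show False using r neg by auto
qed

lemma exit_inside:
 assumes w: "w \<in> path_set" and r: "0 \<le> r" "exit_time l u w < 0 \<or> r < exit_time l u w"
 shows "l < w r" "w r < u"
proof -
 have "r \<notin> exit_set l u w" using exit_time_first(2)[OF w exit_time_nonneg, of l u r] exit_time_nonneg[of l u w] r by force
 then show "l < w r" "w r < u" using r by (auto simp: exit_set_def)
qed

lemma exit_time_cong:
 assumes w: "w \<in> path_set" "w' \<in> path_set" and eq: "\<And>r. r \<le> t ==> w r = w' r"
  and T: "0 \<le> exit_time l u w" "exit_time l u w \<le> t"
 shows "exit_time l u w' = exit_time l u w"
proof (rule exit_time_eqI)
 note f = exit_time_first[OF w(1) T(1)]
 show "exit_time l u w \<in> exit_set l u w'" using f(1) eq[OF T(2)] by (auto simp: exit_set_def)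
 show "exit_time l u w \<le> r" if r: "r \<in> exit_set l u w'" for r
 proof (rule ccontr)
  assume n: "\<not> exit_time l u w \<le> r"
  then have "r \<in> exit_set l u w" using r eq[of r] T by (auto simp: exit_set_def)
  then show False using f(2) n by auto
 qed
qed

text \<open>The stopping time property without a filtration: whether the exit occurs by time
  \<open>t\<close>, and anything (\<open>Q\<close>) about its date then, is the same for the path
  and for the path stopped at \<open>t\<close>.\<close>

lemma exit_time_stop_iff:
 assumes w: "w \<in> path_set" and t: "0 \<le> t"
 shows "(0 \<le> exit_time l u (path_stop t w) \<and> exit_time l u (path_stop t w) \<le> t \<and> Q (exit_time l u (path_stop t w)))
  \<longleftrightarrow> (0 \<le> exit_time l u w \<and> exit_time l u w \<le> t \<and> Q (exit_time l u w))"
proof -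
 note w' = path_stop_in[OF t w]
 have eq: "r \<le> t ==> w r = path_stop t w r" for r by (simp add: path_stop_def)
 show ?thesis
  using exit_time_cong[OF w w' eq, of t l u] exit_time_cong[OF w' w eq[symmetric], of t l u] by metis
qed

text \<open>A countable description, for measurability. The slack \<open>1 / real (Suc n)\<close>
  lets rational times approach the exit; conversely the distance to the boundary attains its infimum
  over \<open>{0..c}\<close>, and slack for every \<open>n\<close> forces that infimum to be at most
  0.\<close>

lemma exit_before_iff:
 assumes w: "w \<in> path_set" and c: "0 \<le> c"
 shows "0 \<le> exit_time l u w \<and> exit_time l u w \<le> c \<longleftrightarrow>
   (\<forall>n::nat. \<exists>q::rat. 0 \<le> real_of_rat q \<and> real_of_rat q \<le> c \<and>
    (w (real_of_rat q) < l + 1 / real (Suc n) \<or> u - 1 / real (Suc n) < w (real_of_rat q)))" (is "?L \<longleftrightarrow> ?R")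
proof
 assume L: ?L
 define T where "T = exit_time l u w"
 have T: "0 \<le> T" "T \<le> c" "w T \<le> l \<or> u \<le> w T"
  using L exit_time_first(1)[OF w, of l u] by (auto simp: T_def exit_set_def)
 show ?R
 proof
  fix n :: nat
  let ?e = "1 / real (Suc n)"
  have "0 < ?e" by simp
  then obtain d where d: "0 < d" "\<And>r. \<bar>r - T\<bar> < d ==> \<bar>w r - w T\<bar> < ?e"
   using path_setD(1)[OF w, of T] unfolding continuous_at_eps_delta dist_real_def by blast
  obtain q where q: "0 \<le> real_of_rat q" "real_of_rat q \<le> c" "\<bar>real_of_rat q - T\<bar> < d"
  proof (cases "c = 0")
   case True
   then show ?thesis using that[of 0] T d by auto
  next
   case False
   then have "max 0 (T - d) < min c (T + d)" using T c d by auto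
   then obtain q where "max 0 (T - d) < real_of_rat q" "real_of_rat q < min c (T + d)"
    using of_rat_dense by blast
   then show ?thesis using that[of q] by auto
  qed
  then have "\<bar>w (real_of_rat q) - w T\<bar> < ?e" using d by auto
  then have "w (real_of_rat q) < l + ?e \<or> u - ?e < w (real_of_rat q)" using T(3) by linarith
  then show "\<exists>q. 0 \<le> real_of_rat q \<and> real_of_rat q \<le> c \<and>
    (w (real_of_rat q) < l + ?e \<or> u - ?e < w (real_of_rat q))" using q by blast
 qed
next
 assume R: ?R
 let ?h = "\<lambda>t. min (w t - l) (u - w t)"
 have cw: "continuous_on {0..c} w" using w continuous_on_subset by (auto simp: path_set_def)
 have "continuous_on {0..c} ?h" by (intro continuous_intros cw)
 then obtain s where s: "s \<in> {0..c}" "\<And>t. t \<in> {0..c} ==> ?h s \<le> ?h t"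
  using continuous_attains_inf[of "{0..c}" ?h] c by auto
 have "?h s \<le> 0"
 proof (rule field_le_epsilon)
  fix e :: real assume "0 < e"
  then obtain n where n: "1 / real (Suc n) < e" using nat_approx_posE by blast
  obtain q where q: "0 \<le> real_of_rat q" "real_of_rat q \<le> c"
   "w (real_of_rat q) < l + 1 / real (Suc n) \<or> u - 1 / real (Suc n) < w (real_of_rat q)"
   using R by blast
  have "?h (real_of_rat q) \<le> 1 / real (Suc n)" using q(3) by linarith
  then show "?h s \<le> 0 + e" using s(2)[of "real_of_rat q"] q n by auto
 qed
 then have "s \<in> exit_set l u w" using s(1) by (auto simp: exit_set_def)
 moreover from this have "0 \<le> exit_time l u w" by (intro exit_time_nonneg) auto
 ultimately show ?L using exit_time_first(2)[OF w, of l u s] s(1) by auto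
qed

text \<open>The end points vary with the sample point because the embedding draws the interval at
  random.\<close>

lemma exit_time_measurable:
 assumes f: "f \<in> measurable M path_space" and [measurable]: "l \<in> borel_measurable M" "u \<in> borel_measurable M"
 shows "(\<lambda>x. exit_time (l x) (u x) (f x)) \<in> borel_measurable M"
proof -
 have [measurable]: "(\<lambda>x. f x t) \<in> borel_measurable M" for t
  by (rule measurable_compose[OF f path_coordinate_measurable])
 have fp: "x \<in> space M ==> f x \<in> path_set" for x using measurable_space[OF f] by auto
 let ?T = "\<lambda>x. exit_time (l x) (u x) (f x)"
 have H: "{x\<in>space M. 0 \<le> ?T x \<and> ?T x \<le> c} \<in> sets M" if "0 \<le> c" for c
 proof -
  have "{x\<in>space M. 0 \<le> ?T x \<and> ?T x \<le> c} = {x\<in>space M. (\<forall>n::nat. \<exists>q::rat. 0 \<le> real_of_rat q \<and> real_of_rat q \<le> c \<and>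
    (f x (real_of_rat q) < l x + 1 / real (Suc n) \<or> u x - 1 / real (Suc n) < f x (real_of_rat q)))}"
   using exit_before_iff[OF fp that] by blast
  also have "... \<in> sets M" by measurable
  finally show ?thesis .
 qed
 have pos: "{x\<in>space M. 0 \<le> ?T x} \<in> sets M"
 proof -
  have "{x\<in>space M. 0 \<le> ?T x} = (\<Union>n::nat. {x\<in>space M. 0 \<le> ?T x \<and> ?T x \<le> real n})"
   using real_arch_simple by auto
  also have "... \<in> sets M" using H by auto
  finally show ?thesis .
 qed
 show ?thesis
  unfolding borel_measurable_iff_le
 proof
  fix c :: real
  \<comment> \<open>The cases reflect the default value -1: nothing lies below it, and levels
    between -1 and 0 see exactly the paths that never exit.\<close>
  have "{x\<in>space M. ?T x \<le> c} = (if c < -1 then {} else if c < 0 then space M - {x\<in>space M. 0 \<le> ?T x}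
   else {x\<in>space M. 0 \<le> ?T x \<and> ?T x \<le> c} \<union> (space M - {x\<in>space M. 0 \<le> ?T x}))"
   using exit_time_ge by (auto simp: not_le) (smt (verit, best))+
  also have "... \<in> sets M" using pos H[of c] by auto
  finally show "{x\<in>space M. ?T x \<le> c} \<in> sets M" .
 qed
qed

lemma measure_gauss_interval:
 assumes "0 < v" "l \<le> u"
 shows "measure (gauss v) {l<..<u} \<le> (u - l) / sqrt (2 * pi * v)"
proof -
 interpret prob_space "gauss v" by (rule prob_space_gauss) fact
 have b: "normal_density 0 (sqrt v) x \<le> 1 / sqrt (2 * pi * v)" for x
 proof -
  have "exp (- x\<^sup>2 / (2 * v)) \<le> 1" using assms by simp
  then have "1 / sqrt (2 * pi * v) * exp (- x\<^sup>2 / (2 * v)) \<le> 1 / sqrt (2 * pi * v) * 1"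
   using assms by (intro mult_left_mono) auto
  then show ?thesis using assms by (simp add: normal_density_def)
 qed
 have "emeasure (gauss v) {l<..<u} = (\<integral>\<^sup>+x. ennreal (normal_density 0 (sqrt v) x) * indicator {l<..<u} x \<partial>lborel)"
  unfolding gauss_def by (subst emeasure_density) auto
 also have "... \<le> (\<integral>\<^sup>+x. ennreal (1 / sqrt (2 * pi * v)) * indicator {l<..<u} x \<partial>lborel)"
  using b by (intro nn_integral_mono mult_right_mono ennreal_leI) auto
 also have "... = ennreal (1 / sqrt (2 * pi * v)) * ennreal (u - l)"
  using assms by (subst nn_integral_cmult_indicator) auto
 also have "... = ennreal ((u - l) / sqrt (2 * pi * v))"
  using assms by (subst ennreal_mult[symmetric]) auto
 finally show ?thesis using assms by (simp add: emeasure_eq_measure)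
qed

lemma wiener_marginal:
 assumes "0 < t" shows "distr wiener borel (\<lambda>w. w t) = gauss t"
proof -
 have "distr wiener borel (\<lambda>w. w t) = distr wiener borel (\<lambda>w. w t - w 0)"
  by (rule distr_cong) (auto simp: path_set_def)
 then show ?thesis using gauss_increments_diff[OF wiener_increments prob_space_wiener, of 0 t] assms by simp
qed

text \<open>A path that never exits is still in the interval at time \<open>n + 1\<close>, and this
  has probability of order \<open>1 / sqrt (n + 1)\<close> because the Gaussian density
  flattens.\<close>

lemma AE_exit:
 assumes "l \<le> u" shows "AE w in wiener. 0 \<le> exit_time l u w"
proof -
 have [measurable]: "(\<lambda>w. exit_time l u w) \<in> borel_measurable wiener"
  using exit_time_measurable[of "\<lambda>w. w" wiener "\<lambda>_. l" "\<lambda>_. u"] by simp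
 let ?N = "{w\<in>space wiener. \<not> 0 \<le> exit_time l u w}"
 have b: "wiener.prob ?N \<le> (u - l) / sqrt (2 * pi) / sqrt (real (Suc n))" for n
 proof -
  have "{w\<in>space wiener. w (real (Suc n)) \<in> {l<..<u}} \<in> sets wiener" by measurable
  then have "wiener.prob ?N \<le> wiener.prob {w\<in>space wiener. w (real (Suc n)) \<in> {l<..<u}}"
   using exit_inside[where r="real (Suc n)" and l=l and u=u]
   by (intro wiener.finite_measure_mono) auto
  also have "... = measure (gauss (real (Suc n))) {l<..<u}"
   by (rule prob_distr_gauss) (auto intro: wiener_marginal)
  also have "... \<le> (u - l) / sqrt (2 * pi * real (Suc n))"
   using assms by (intro measure_gauss_interval) auto
  finally show ?thesis by (simp add: real_sqrt_mult)
 qed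
 have "(\<lambda>n. (u - l) / sqrt (2 * pi) / sqrt (real (Suc n))) \<longlonglongrightarrow> 0"
  by real_asymp
 then have "wiener.prob ?N \<le> 0" by (rule LIMSEQ_le_const) (use b in auto)
 then have "wiener.prob ?N = 0" by (simp add: measure_le_0_iff)
 then have "emeasure wiener ?N = 0" by (simp add: wiener.emeasure_eq_measure)
 moreover have "?N \<in> sets wiener" by measurable
 ultimately show ?thesis by (intro AE_I[of _ _ ?N]) simp_all
qed

section \<open>The strong Markov property at exit times\<close>

lemma shift_tendsto:
 assumes w: "w \<in> path_set" and s: "sm \<longlonglongrightarrow> s"
 shows "(\<lambda>m. path_shift (sm m) w r) \<longlonglongrightarrow> path_shift s w r"
 unfolding path_shift_eq by (intro tendsto_intros path_tendsto[OF w] s)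

lemma clamp_tendsto: "(\<lambda>k::nat. min 1 (max 0 (real k * d))) \<longlonglongrightarrow> (if 0 < d then 1 else 0)"
proof (cases "0 < d")
 case True
 obtain n :: nat where n: "1 / d < real n" using reals_Archimedean2 by blast
 have "1 \<le> real k * d" if "k \<ge> n" for k
 proof -
  have "1 < real n * d" using n True by (simp add: field_simps)
  also have "... \<le> real k * d" using that True by (intro mult_right_mono) auto
  finally show ?thesis by simp
 qed
 then have "eventually (\<lambda>k. 1 \<le> real k * d) sequentially" by (auto simp: eventually_sequentially)
 then have "eventually (\<lambda>k. min 1 (max 0 (real k * d)) = 1) sequentially"
  by eventually_elim (auto simp: min_absorb1 max_absorb2)
 then show ?thesis using True by (simp add: tendsto_eventually)
qed (simp add: mult_nonneg_nonpos max_absorb1)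

context
 fixes l u :: real and A :: "(real \<times> real) set" and E :: "(real => real) set"
 assumes lu: "l \<le> u" and A[measurable]: "A \<in> sets plane"
 defines "E \<equiv> {w\<in>path_set. 0 \<le> exit_time l u w \<and> (exit_time l u w, w (exit_time l u w)) \<in> A}"
begin

lemma exit_time_meas[measurable]: "exit_time l u \<in> borel_measurable path_space"
 using exit_time_measurable[of "\<lambda>w. w" path_space "\<lambda>_. l" "\<lambda>_. u"] by simp

lemma exit_pos_meas: "(\<lambda>w. w (exit_time l u w)) \<in> borel_measurable path_space"
 using path_eval_measurable[of "\<lambda>w. w" path_space "exit_time l u"] by simp

lemma exit_shift_meas[measurable]: "(\<lambda>w. path_shift (exit_time l u w) w) \<in> measurable path_space path_space"
 by (rule path_shift_measurable2) simp_all

lemma E_meas[measurable]: "E \<in> sets path_space"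
proof -
 have "(\<lambda>w. (exit_time l u w, w (exit_time l u w))) \<in> measurable path_space plane"
  by (intro measurable_Pair exit_time_meas exit_pos_meas)
 from measurable_sets[OF this A]
 have [measurable]: "(\<lambda>w. (exit_time l u w, w (exit_time l u w))) -` A \<inter> space path_space \<in> sets path_space" .
 have "E = {w\<in>space path_space. 0 \<le> exit_time l u w} \<inter> ((\<lambda>w. (exit_time l u w, w (exit_time l u w))) -` A \<inter> space path_space)"
  by (auto simp: E_def)
 also have "... \<in> sets path_space" by measurable
 finally show ?thesis .
qed

text \<open>The exit time is replaced by a dyadic upper approximation with countably many values;
  the simple Markov property applies at each of them, and continuity of \<open>F\<close> along
  shifts allows the limit.\<close>

lemma regeneration_test:
 fixes F :: "(real => real) => ennreal"
 assumes F[measurable]: "F \<in> borel_measurable path_space" and le: "\<And>w. F w \<le> 1"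
  and cont: "\<And>w s sm. w \<in> path_set ==> sm \<longlonglongrightarrow> s ==> (\<lambda>m::nat. F (path_shift (sm m) w)) \<longlonglongrightarrow> F (path_shift s w)"
 shows "(\<integral>\<^sup>+w. indicator E w * F (path_shift (exit_time l u w) w) \<partial>wiener) = emeasure wiener E * (\<integral>\<^sup>+w. F w \<partial>wiener)"
proof -
 let ?T = "exit_time l u"
 \<comment> \<open>The right end of the dyadic interval and not its floor: at that time the exit has
   already happened.\<close>
 let ?Tm = "\<lambda>m w. dyadic_floor m (?T w) + 1 / 2 ^ m"
 have sh: "(\<lambda>w. path_shift (?Tm m w) w) \<in> measurable path_space path_space" for m
 proof (rule path_shift_measurable2)
  note path_coordinate_measurable[measurable del]
  show "(\<lambda>w. ?Tm m w) \<in> borel_measurable path_space"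
   unfolding dyadic_floor_def by measurable
 qed simp
 note [measurable] = sh
 have step: "(\<integral>\<^sup>+w. indicator E w * F (path_shift (?Tm m w) w) \<partial>wiener) = emeasure wiener E * (\<integral>\<^sup>+w. F w \<partial>wiener)" for m
 proof -
  define Ek where "Ek = (\<lambda>k::nat. {w\<in>E. \<lfloor>2 ^ m * ?T w\<rfloor> = int k})"
  define t where "t = (\<lambda>k::nat. real (Suc k) / 2 ^ m)"
  have t0: "0 \<le> t k" for k by (simp add: t_def)
  have [measurable]: "Ek k \<in> sets path_space" for k
  proof -
   have "Ek k = {w\<in>space path_space. w \<in> E \<and> \<lfloor>2 ^ m * ?T w\<rfloor> = int k}" using sets.sets_into_space[OF E_meas] by (auto simp: Ek_def)
   also have "... \<in> sets path_space" by measurable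
   finally show ?thesis .
  qed
  have Tlt: "?T w \<le> t k" if "\<lfloor>2 ^ m * ?T w\<rfloor> = int k" for w k
  proof -
   have "2 ^ m * ?T w \<le> real (Suc k)" using that by linarith
   then show ?thesis by (simp add: t_def field_simps)
  qed
  \<comment> \<open>On each piece the exit time is at most \<open>t k\<close>, so membership,
    including the exit position, can be read off the path stopped at \<open>t k\<close>.\<close>
  have stop_iff: "path_stop (t k) w \<in> Ek k \<longleftrightarrow> w \<in> Ek k" if w: "w \<in> path_set" for w k
  proof -
   let ?Q = "\<lambda>s. (s, w s) \<in> A \<and> \<lfloor>2 ^ m * s\<rfloor> = int k"
   have "w \<in> Ek k \<longleftrightarrow> 0 \<le> ?T w \<and> ?T w \<le> t k \<and> ?Q (?T w)"
    using w Tlt[of w k] by (auto simp: Ek_def E_def)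
   also have "... \<longleftrightarrow> 0 \<le> ?T (path_stop (t k) w) \<and> ?T (path_stop (t k) w) \<le> t k \<and> ?Q (?T (path_stop (t k) w))"
    using exit_time_stop_iff[OF w t0, where Q="?Q"] by simp
   also have "... \<longleftrightarrow> path_stop (t k) w \<in> Ek k"
    using path_stop_in[OF t0 w] Tlt[of "path_stop (t k) w" k]
    by (auto simp: Ek_def E_def path_stop_def min_absorb1)
   finally show ?thesis by simp
  qed
  have piece: "(\<integral>\<^sup>+w. indicator (Ek k) w * F (path_shift (t k) w) \<partial>wiener) = emeasure wiener (Ek k) * (\<integral>\<^sup>+w. F w \<partial>wiener)" for k
  proof -
   note [measurable] = path_stop_measurable[OF t0[of k]]
   let ?D = "distr wiener path_space (path_stop (t k))"
   have "(\<integral>\<^sup>+w. indicator (Ek k) w * F (path_shift (t k) w) \<partial>wiener)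
    = (\<integral>\<^sup>+w. indicator (Ek k) (path_stop (t k) w) * F (path_shift (t k) w) \<partial>wiener)"
    using stop_iff by (intro nn_integral_cong) (auto simp: indicator_def)
   also have "... = (\<integral>\<^sup>+x. indicator (Ek k) (fst x) * F (snd x) \<partial>distr wiener (path_space \<Otimes>\<^sub>M path_space) (\<lambda>w. (path_stop (t k) w, path_shift (t k) w)))"
    by (subst nn_integral_distr) auto
   also have "... = (\<integral>\<^sup>+x. indicator (Ek k) (fst x) * F (snd x) \<partial>(?D \<Otimes>\<^sub>M wiener))"
    unfolding wiener_markov[OF t0] ..
   also have "... = (\<integral>\<^sup>+a. (\<integral>\<^sup>+b. indicator (Ek k) a * F b \<partial>wiener) \<partial>?D)"
    by (subst wiener.nn_integral_fst[symmetric]) auto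
   also have "... = (\<integral>\<^sup>+a. indicator (Ek k) a * (\<integral>\<^sup>+b. F b \<partial>wiener) \<partial>?D)"
    by (intro nn_integral_cong nn_integral_cmult) auto
   also have "... = emeasure ?D (Ek k) * (\<integral>\<^sup>+b. F b \<partial>wiener)"
    by (subst nn_integral_multc) auto
   also have "emeasure ?D (Ek k) = emeasure wiener (Ek k)"
    using stop_iff sets.sets_into_space[of "Ek k" path_space]
    by (subst emeasure_distr) (auto intro!: arg_cong[where f="emeasure wiener"])
   finally show ?thesis .
  qed
  have disj: "disjoint_family Ek" by (auto simp: disjoint_family_on_def Ek_def)
  have UE: "(\<Union>k. Ek k) = E"
  proof -
   have "\<exists>k. w \<in> Ek k" if "w \<in> E" for w
   proof -
    have "0 \<le> \<lfloor>2 ^ m * ?T w\<rfloor>" using that by (auto simp: E_def)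
    then show ?thesis using that by (intro exI[of _ "nat \<lfloor>2 ^ m * ?T w\<rfloor>"]) (auto simp: Ek_def)
   qed
   then show ?thesis by (auto simp: Ek_def)
  qed
  have pt: "indicator E w * F (path_shift (?Tm m w) w) = (\<Sum>k. indicator (Ek k) w * F (path_shift (t k) w))" for w
  proof (cases "w \<in> E")
   case True
   then obtain k0 where k0: "w \<in> Ek k0" using UE by auto
   have "(\<Sum>k. indicator (Ek k) w * F (path_shift (t k) w)) = (\<Sum>k\<in>{k0}. indicator (Ek k) w * F (path_shift (t k) w))"
    using k0 by (intro suminf_finite) (auto simp: Ek_def)
   moreover have "?Tm m w = t k0" using k0 by (simp add: Ek_def t_def dyadic_floor_def add_divide_distrib)
   ultimately show ?thesis using True k0 by simp
  next
   case False
   then have "indicator (Ek k) w = (0::ennreal)" for k using UE by (auto simp: indicator_def)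
   then show ?thesis using False by simp
  qed
  have "(\<integral>\<^sup>+w. indicator E w * F (path_shift (?Tm m w) w) \<partial>wiener) = (\<Sum>k. emeasure wiener (Ek k) * (\<integral>\<^sup>+w. F w \<partial>wiener))"
   unfolding pt piece[symmetric] by (rule nn_integral_suminf) simp
  also have "... = (\<Sum>k. emeasure wiener (Ek k)) * (\<integral>\<^sup>+w. F w \<partial>wiener)" by (rule ennreal_suminf_multc)
  also have "(\<Sum>k. emeasure wiener (Ek k)) = emeasure wiener E"
   unfolding UE[symmetric] by (rule suminf_emeasure) (use disj in auto)
  finally show ?thesis .
 qed
 have "(\<lambda>m. \<integral>\<^sup>+w. indicator E w * F (path_shift (?Tm m w) w) \<partial>wiener) \<longlonglongrightarrow> (\<integral>\<^sup>+w. indicator E w * F (path_shift (?T w) w) \<partial>wiener)"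
 proof (rule nn_integral_dominated_convergence[where w="\<lambda>_. 1"])
  show "AE w in wiener. indicator E w * F (path_shift (?Tm m w) w) \<le> 1" for m
   using le by (intro AE_I2) (auto simp: indicator_def)
  show "AE w in wiener. (\<lambda>m. indicator E w * F (path_shift (?Tm m w) w)) \<longlonglongrightarrow> indicator E w * F (path_shift (?T w) w)"
  proof (rule AE_I2)
   fix w assume "w \<in> space wiener"
   then have w: "w \<in> path_set" by simp
   have "(\<lambda>m. ?Tm m w) \<longlonglongrightarrow> ?T w + 0"
    by (intro tendsto_intros dyadic_floor_tendsto tendsto_inverse_two_power)
   then have "(\<lambda>m. F (path_shift (?Tm m w) w)) \<longlonglongrightarrow> F (path_shift (?T w) w)"
    using cont[OF w] by simp
   then show "(\<lambda>m. indicator E w * F (path_shift (?Tm m w) w)) \<longlonglongrightarrow> indicator E w * F (path_shift (?T w) w)"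
    by (cases "w \<in> E") auto
  qed
 qed (auto simp: wiener.emeasure_space_1[simplified])
 then show ?thesis unfolding step by (rule LIMSEQ_unique[OF _ tendsto_const])
qed

text \<open>Two finite measures on path space are compared on cylinders, whose indicators are limits
  of test functions covered by \<open>regeneration_test\<close>; the generator argument does the
  rest.\<close>

lemma regeneration_event:
 assumes B: "B \<in> sets path_space"
 shows "(\<integral>\<^sup>+w. indicator E w * indicator B (path_shift (exit_time l u w) w) \<partial>wiener) = emeasure wiener E * emeasure wiener B"
proof -
 let ?s = "\<lambda>w. path_shift (exit_time l u w) w"
 let ?M = "distr (density wiener (indicator E)) path_space ?s"
 let ?N = "density wiener (\<lambda>_. emeasure wiener E)"
 have M: "emeasure ?M B = (\<integral>\<^sup>+w. indicator E w * indicator B (?s w) \<partial>wiener)"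
  if [measurable]: "B \<in> sets path_space" for B
 proof -
  have "emeasure ?M B = (\<integral>\<^sup>+w. indicator E w * indicator (?s -` B \<inter> path_set) w \<partial>wiener)"
   using measurable_sets[OF exit_shift_meas that]
   by (subst emeasure_distr) (auto simp: emeasure_density)
  also have "... = (\<integral>\<^sup>+w. indicator E w * indicator B (?s w) \<partial>wiener)"
   by (intro nn_integral_cong) (auto simp: indicator_def)
  finally show ?thesis .
 qed
 have N: "emeasure ?N B = emeasure wiener E * emeasure wiener B" if "B \<in> sets path_space" for B
  using that by (simp add: emeasure_density nn_integral_cmult_indicator)
 have "?M = ?N"
 proof (rule measure_eqI_generator_eq[OF Int_stable_path_cylinders path_cylinders_Pow])
  fix C assume "C \<in> path_cylinders"
  then obtain K b where K: "finite K" and C: "C = path_cylinder K b" by (auto simp: path_cylinders_def)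
  note [measurable] = path_cylinder_sets[OF K, of b]
  \<comment> \<open>Clamped linear functions of finitely many coordinates: continuous in the shift,
    bounded by 1, and converging pointwise to the indicator of the open condition.\<close>
  define f where "f = (\<lambda>k::nat. \<lambda>w. ennreal (\<Prod>r\<in>K. min 1 (max 0 (real k * (b r - w r)))))"
  have \<phi>m[measurable]: "f k \<in> borel_measurable path_space" for k
   unfolding f_def by measurable
  have \<phi>le: "f k w \<le> 1" for k w
   unfolding f_def using prod_le_1[of K "\<lambda>r. min 1 (max 0 (real k * (b r - w r)))"] by (simp add: ennreal_le_1)
  have \<phi>c: "(\<lambda>m. f k (path_shift (sm m) w)) \<longlonglongrightarrow> f k (path_shift s w)" if "w \<in> path_set" "sm \<longlonglongrightarrow> s" for k w s sm
   unfolding f_def by (intro tendsto_intros shift_tendsto that tendsto_ennrealI)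
  have \<phi>lim: "(\<lambda>k. f k w) \<longlonglongrightarrow> indicator C w" if w: "w \<in> path_set" for w
  proof -
   have "(\<lambda>k. f k w) \<longlonglongrightarrow> ennreal (\<Prod>r\<in>K. if 0 < b r - w r then 1 else 0)"
    unfolding f_def by (intro tendsto_ennrealI tendsto_prod clamp_tendsto)
   moreover have "(\<Prod>r\<in>K. if 0 < b r - w r then 1 else 0 :: real) = indicator C w"
    using K w by (auto simp: C path_cylinder_def indicator_def intro: prod_zero intro!: prod.neutral)
   ultimately show ?thesis by (cases "w \<in> C") simp_all
  qed
  have "(\<lambda>k. \<integral>\<^sup>+w. indicator E w * f k (?s w) \<partial>wiener) \<longlonglongrightarrow> (\<integral>\<^sup>+w. indicator E w * indicator C (?s w) \<partial>wiener)"
  proof (rule nn_integral_dominated_convergence[where w="\<lambda>_. 1"])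
   show "AE w in wiener. indicator E w * f k (?s w) \<le> 1" for k
    using \<phi>le by (intro AE_I2) (auto simp: indicator_def)
   show "AE w in wiener. (\<lambda>k. indicator E w * f k (?s w)) \<longlonglongrightarrow> indicator E w * indicator C (?s w)"
   proof (rule AE_I2)
    fix w assume "w \<in> space wiener"
    then have "(\<lambda>k. f k (?s w)) \<longlonglongrightarrow> indicator C (?s w)" by (intro \<phi>lim path_shift_in) simp
    then show "(\<lambda>k. indicator E w * f k (?s w)) \<longlonglongrightarrow> indicator E w * indicator C (?s w)" by (cases "w \<in> E") auto
   qed
  qed (auto simp: C wiener.emeasure_space_1[simplified])
  moreover have "(\<integral>\<^sup>+w. indicator E w * f k (?s w) \<partial>wiener) = emeasure wiener E * (\<integral>\<^sup>+w. f k w \<partial>wiener)" for k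
   by (rule regeneration_test[OF \<phi>m \<phi>le \<phi>c])
  moreover have "(\<lambda>k. \<integral>\<^sup>+w. f k w \<partial>wiener) \<longlonglongrightarrow> (\<integral>\<^sup>+w. indicator C w \<partial>wiener)"
   by (rule nn_integral_dominated_convergence[where w="\<lambda>_. 1"])
    (auto simp: C[symmetric] wiener.emeasure_space_1[simplified] \<phi>le intro!: AE_I2 \<phi>lim, auto simp: C)
  then have "(\<lambda>k. emeasure wiener E * (\<integral>\<^sup>+w. f k w \<partial>wiener)) \<longlonglongrightarrow> emeasure wiener E * (\<integral>\<^sup>+w. indicator C w \<partial>wiener)"
   by (intro tendsto_mult_ennreal tendsto_const) (auto simp: wiener.emeasure_eq_measure C)
  ultimately have "(\<integral>\<^sup>+w. indicator E w * indicator C (?s w) \<partial>wiener) = emeasure wiener E * (\<integral>\<^sup>+w. indicator C w \<partial>wiener)"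
   using LIMSEQ_unique by simp
  then show "emeasure ?M C = emeasure ?N C"
   using M[of C] N[of C] by (simp add: C)
 next
  show "emeasure ?M path_set \<noteq> \<infinity>" for i :: nat
  proof -
   have "emeasure ?M path_set \<le> (\<integral>\<^sup>+w. 1 \<partial>wiener)"
    unfolding M[OF sets.top[of path_space], simplified] by (intro nn_integral_mono) (auto simp: indicator_def)
   then show ?thesis using wiener.emeasure_space_1 by (auto simp: top_unique)
  qed
  show "range (\<lambda>i::nat. path_set) \<subseteq> path_cylinders" using path_set_in_cylinders by auto
 qed (auto simp: sets_path_space_cylinders)
 then show ?thesis using M[OF B] N[OF B] by simp
qed

end

text \<open>Time and place of the exit are independent of the path that starts afresh there. Paths
  that never exit carry the default time -1, but they form a null set by
  \<open>AE_exit\<close>.\<close>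

theorem wiener_regeneration:
 assumes lu: "l \<le> u"
 shows "distr wiener (plane \<Otimes>\<^sub>M path_space)
   (\<lambda>w. ((exit_time l u w, w (exit_time l u w)), path_shift (exit_time l u w) w))
  = distr wiener plane (\<lambda>w. (exit_time l u w, w (exit_time l u w))) \<Otimes>\<^sub>M wiener"
proof -
 let ?T = "exit_time l u"
 note em = exit_time_meas[OF lu sets.empty_sets] and ep = exit_pos_meas[OF lu sets.empty_sets] and es = exit_shift_meas[OF lu sets.empty_sets]
 have pm: "(\<lambda>w. (?T w, w (?T w))) \<in> measurable wiener plane"
  using em ep by (intro measurable_Pair) auto
 have pm2: "(\<lambda>w. ((?T w, w (?T w)), path_shift (?T w) w)) \<in> measurable wiener (plane \<Otimes>\<^sub>M path_space)"
  using es by (intro measurable_Pair pm) auto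
 interpret S: prob_space "distr wiener plane (\<lambda>w. (?T w, w (?T w)))"
  by (rule wiener.prob_space_distr[OF pm])
 show ?thesis
 proof (rule pair_measure_eqI[symmetric])
  fix A B assume "A \<in> sets (distr wiener plane (\<lambda>w. (?T w, w (?T w))))" "B \<in> sets wiener"
  then have [measurable]: "A \<in> sets plane" "B \<in> sets path_space" by auto
  let ?E = "{w\<in>path_set. 0 \<le> ?T w \<and> (?T w, w (?T w)) \<in> A}"
  have mE: "?E \<in> sets path_space" by (rule E_meas[OF lu]) simp
  have e1: "emeasure (distr wiener plane (\<lambda>w. (?T w, w (?T w)))) A = emeasure wiener ?E"
  proof (subst emeasure_distr[OF pm])
   show "emeasure wiener ((\<lambda>w. (?T w, w (?T w))) -` A \<inter> space wiener) = emeasure wiener ?E"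
    using AE_exit[OF lu] mE measurable_sets[OF pm, of A] by (intro emeasure_eq_AE) auto
  qed auto
  let ?g = "\<lambda>w. ((?T w, w (?T w)), path_shift (?T w) w)"
  have "emeasure (distr wiener (plane \<Otimes>\<^sub>M path_space) ?g) (A \<times> B) = (\<integral>\<^sup>+w. indicator (A \<times> B) (?g w) \<partial>wiener)"
   by (subst nn_integral_distr[OF pm2, symmetric]) auto
  also have "... = (\<integral>\<^sup>+w. indicator ?E w * indicator B (path_shift (?T w) w) \<partial>wiener)"
  proof (rule nn_integral_cong_AE)
   show "AE w in wiener. indicator (A \<times> B) (?g w) = (indicator ?E w * indicator B (path_shift (?T w) w) :: ennreal)"
    using AE_exit[OF lu] AE_space[of wiener] by eventually_elim (auto simp: indicator_def)
  qed
  finally show "emeasure (distr wiener plane (\<lambda>w. (?T w, w (?T w)))) A * emeasure wiener B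
    = emeasure (distr wiener (plane \<Otimes>\<^sub>M path_space) ?g) (A \<times> B)"
   unfolding e1 using regeneration_event[OF lu, of A B] by simp
 qed (auto intro: S.sigma_finite_measure_axioms wiener.sigma_finite_measure_axioms)
qed

section \<open>Moments of exit times and exit positions\<close>

lemma wiener_moments:
 assumes "0 \<le> h"
 shows "integrable wiener (\<lambda>w. w h)" "(LINT w|wiener. w h) = 0"
  "integrable wiener (\<lambda>w. (w h)^2)" "(LINT w|wiener. (w h)^2) = h"
  "integrable wiener (\<lambda>w. (w h) ^ 3)" "(LINT w|wiener. (w h) ^ 3) = 0"
  "integrable wiener (\<lambda>w. (w h) ^ 4)" "(LINT w|wiener. (w h) ^ 4) = 3 * h^2"
proof -
 have gen: "integrable wiener (\<lambda>w. (w h) ^ n) \<and> (LINT w|wiener. (w h) ^ n) = c"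
  if n: "0 < n" and g: "0 < h ==> integrable (gauss h) (\<lambda>x. x ^ n)" "0 < h ==> (LINT x|gauss h. x ^ n) = c" and c: "h = 0 ==> c = 0" for n c
 proof (cases "h = 0")
  case True
  have e: "(w h) ^ n = 0" if "w \<in> space wiener" for w using that True n path_setD(2)[of w 0] by simp
  show ?thesis
   by (subst Bochner_Integration.integrable_cong[OF refl e], assumption,
    subst Bochner_Integration.integral_cong[OF refl e], assumption) (simp add: c[OF True])
 next
  case False
  then have h: "0 < h" using assms by simp
  have "(\<lambda>x. x ^ n) \<in> borel_measurable (borel :: real measure)" by measurable
  then show ?thesis using g[OF h] by (simp add: wiener_marginal[OF h, symmetric] integrable_distr_eq integral_distr)
 qed
 show "integrable wiener (\<lambda>w. w h)" "(LINT w|wiener. w h) = 0"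
  using gen[of 1 0] gauss_moments(1,2)[of h] by simp_all
 show "integrable wiener (\<lambda>w. (w h)^2)" "(LINT w|wiener. (w h)^2) = h"
  using gen[of 2 h] gauss_moments(3,4)[of h] by simp_all
 show "integrable wiener (\<lambda>w. (w h) ^ 3)" "(LINT w|wiener. (w h) ^ 3) = 0"
  using gen[of 3 0] gauss_moments(5,6)[of h] by simp_all
 show "integrable wiener (\<lambda>w. (w h) ^ 4)" "(LINT w|wiener. (w h) ^ 4) = 3 * h^2"
  using gen[of 4 "3 * h^2"] gauss_moments(7,8)[of h] by simp_all
qed

lemma power4_sum: "(y + x) ^ 4 = y ^ 4 + 4 * y ^ 3 * x + 6 * y^2 * x^2 + 4 * y * x ^ 3 + (x::real) ^ 4"
 by (simp add: power2_eq_square power3_eq_cube power4_eq_xxxx algebra_simps)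

text \<open>These are the heat polynomials for the powers 1, 2 and 4; they serve as the function
  \<open>q\<close> of \<open>exit_stopped\<close>.\<close>

lemma wiener_shifted_moments:
 assumes "0 \<le> h"
 shows "(LINT w|wiener. y + w h) = y"
  "(LINT w|wiener. (y + w h)^2) = y^2 + h"
  "(LINT w|wiener. (y + w h) ^ 4) = y ^ 4 + 6 * y^2 * h + 3 * h^2"
proof -
 note m = wiener_moments[OF assms]
 note [simp] = m wiener.prob_space[simplified]
 show "(LINT w|wiener. y + w h) = y" by simp
 have "(y + x)^2 = y^2 + 2 * y * x + x^2" for x by (simp add: power2_sum)
 then show "(LINT w|wiener. (y + w h)^2) = y^2 + h" by simp
 show "(LINT w|wiener. (y + w h) ^ 4) = y ^ 4 + 6 * y^2 * h + 3 * h^2"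
  unfolding power4_sum by simp
qed

context
 fixes l u :: real
 assumes lu: "l \<le> 0" "0 \<le> u"
begin

private abbreviation "T \<equiv> exit_time l u"
private abbreviation "S N w \<equiv> min (T w) N"
private abbreviation "Z N w \<equiv> w (S N w)"

lemma lu': "l \<le> u" using lu by simp

lemma T_meas: "T \<in> borel_measurable path_space"
 by (rule exit_time_meas[OF lu' sets.empty_sets])

lemma Y_meas: "(\<lambda>w. w (T w)) \<in> borel_measurable path_space"
 by (rule exit_pos_meas[OF lu' sets.empty_sets])

lemma TY_meas: "(\<lambda>w. (T w, w (T w))) \<in> measurable wiener plane"
 using T_meas Y_meas by (intro measurable_Pair) auto

text \<open>Optional stopping without martingale theory. If the exit comes by time \<open>N\<close>,
  regeneration averages \<open>f (w N)\<close> over the remaining time \<open>N - T\<close> and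
  gives \<open>q (w T) (N - T)\<close>; otherwise no time remains and \<open>q\<close> is
  \<open>f\<close> itself. The two parts add up to the mean of \<open>f (w N)\<close>.\<close>

lemma exit_stopped:
 fixes f :: "real => real" and q :: "real => real => real"
 assumes f[measurable]: "f \<in> borel_measurable borel" and int: "integrable wiener (\<lambda>w. f (w N))" and N: "0 \<le> N"
  and q: "\<And>y h. 0 \<le> h ==> (LINT w'|wiener. f (y + w' h)) = q y h" and q0: "\<And>y. q y 0 = f y"
 shows "(LINT w|wiener. q (Z N w) (N - S N w)) = q 0 N"
proof -
 let ?B = "plane" and ?g = "\<lambda>w. ((T w, w (T w)), path_shift (T w) w)"
 let ?D = "distr wiener ?B (\<lambda>w. (T w, w (T w)))"
 interpret D: prob_space ?D by (rule wiener.prob_space_distr[OF TY_meas])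
 interpret DW: pair_prob_space ?D wiener ..
 define F :: "(real \<times> real) \<times> (real => real) => real" where
  "F = (\<lambda>x. indicator {..N} (fst (fst x)) * f (snd (fst x) + snd x (N - fst (fst x))))"
 have [measurable]: "(\<lambda>x. snd x (N - fst (fst x))) \<in> borel_measurable (?B \<Otimes>\<^sub>M path_space)"
  by (rule path_eval_measurable) auto
 have Fm: "F \<in> borel_measurable (?B \<Otimes>\<^sub>M path_space)" unfolding F_def by measurable
 have gm: "?g \<in> measurable wiener (?B \<Otimes>\<^sub>M path_space)"
  using exit_shift_meas[OF lu' sets.empty_sets]
  by (intro measurable_Pair[OF TY_meas]) (simp add: measurable_cong_sets[OF sets_wiener refl])
 note reg = wiener_regeneration[OF lu']
 have [measurable]: "T \<in> borel_measurable wiener" using T_meas by simp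
 have i: "integrable wiener (\<lambda>w. indicator A (T w) * f (w N))" if [measurable]: "A \<in> sets borel" for A
  by (rule Bochner_Integration.integrable_bound[OF int]) (use int in \<open>auto simp: indicator_def\<close>)
 have ae: "AE w in wiener. F (?g w) = indicator {..N} (T w) * f (w N)"
  using AE_exit[OF lu'] by eventually_elim (auto simp: F_def path_shift_eq max_def indicator_def)
 have Fg: "(\<lambda>w. F (?g w)) \<in> borel_measurable wiener" using measurable_compose[OF gm Fm] .
 have "integrable wiener (\<lambda>w. F (?g w))"
  by (rule integrable_cong_AE_imp[OF i[of "{..N}"] Fg]) (use ae in auto)
 then have int3: "integrable (?D \<Otimes>\<^sub>M wiener) F"
  unfolding reg[symmetric] by (subst integrable_distr_eq[OF gm Fm])
 have F: "(LINT w'|wiener. F ((T w, w (T w)), w')) = indicator {..N} (T w) * q (w (T w)) (N - T w)" for w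
  using q[of "N - T w" "w (T w)"] by (cases "T w \<le> N") (auto simp: F_def)
 have iq: "integrable wiener (\<lambda>w. indicator {..N} (T w) * q (w (T w)) (N - T w))"
  using integrable_distr[OF TY_meas DW.integrable_fst'[OF int3]] by (simp add: F)
 have "(LINT w|wiener. indicator {..N} (T w) * f (w N)) = (LINT w|wiener. F (?g w))"
  by (rule integral_cong_AE[symmetric]) (use ae i[of "{..N}"] Fg in auto)
 also have "... = integral\<^sup>L (?D \<Otimes>\<^sub>M wiener) F"
  unfolding reg[symmetric] by (rule integral_distr[symmetric, OF gm Fm])
 also have "... = (LINT p|?D. (LINT w'|wiener. F (p, w')))"
  by (rule DW.integral_fst'[symmetric, OF int3])
 also have "... = (LINT w|wiener. indicator {..N} (T w) * q (w (T w)) (N - T w))"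
  using integral_distr[OF TY_meas, of "\<lambda>p. \<integral>w'. F (p, w') \<partial>wiener"] DW.integrable_fst'[OF int3]
  by (simp add: F measurable_distr_eq1[symmetric] borel_measurable_integrable del: measurable_distr_eq1)
 finally have sp: "(LINT w|wiener. indicator {..N} (T w) * q (w (T w)) (N - T w)) = (LINT w|wiener. indicator {..N} (T w) * f (w N))" ..
 \<comment> \<open>On \<open>T > N\<close> the remaining time is 0, and \<open>q0\<close> turns
   \<open>q\<close> back into \<open>f\<close>.\<close>
 have "q (Z N w) (N - S N w) = indicator {..N} (T w) * q (w (T w)) (N - T w) + indicator {N<..} (T w) * f (w N)" for w
  by (cases "T w \<le> N") (auto simp: min_def q0)
 then have "(LINT w|wiener. q (Z N w) (N - S N w)) = (LINT w|wiener. indicator {..N} (T w) * f (w N) + indicator {N<..} (T w) * f (w N))"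
  using iq i by (simp add: sp)
 also have "... = (LINT w|wiener. f (w N))"
  by (rule Bochner_Integration.integral_cong) (auto split: split_indicator)
 also have "... = q 0 N" using q[OF N, of 0] by simp
 finally show ?thesis .
qed

lemma stopped_bound:
 assumes w: "w \<in> path_set" and N: "0 \<le> N" and T0: "0 \<le> T w"
 shows "\<bar>Z N w\<bar> \<le> u - l" "\<bar>w (T w)\<bar> \<le> u - l"
proof -
 show *: "\<bar>w (T w)\<bar> \<le> u - l" using exit_position[OF w lu T0] lu by auto
 show "\<bar>Z N w\<bar> \<le> u - l"
  using * exit_inside[OF w N, of l u] lu by (cases "T w \<le> N") (auto simp: min_def)
qed

lemma AE_stopped_bound: "0 \<le> N ==> AE w in wiener. \<bar>Z N w\<bar> \<le> u - l \<and> \<bar>w (T w)\<bar> \<le> u - l"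
 using AE_space[of wiener] AE_exit[OF lu'] by eventually_elim (use stopped_bound in auto)

lemma stopped_meas:
 "Z N \<in> borel_measurable wiener" "S N \<in> borel_measurable wiener"
proof -
 show m: "S N \<in> borel_measurable wiener"
  using T_meas by (intro borel_measurable_min) auto
 show "Z N \<in> borel_measurable wiener" by (rule path_eval_measurable[OF _ m]) auto
qed

text \<open>\<open>exit_stopped\<close> for the powers 1, 2 and 4. The identity of degree 2 cancels
  every term containing \<open>N\<close> in the identity of degree 4, so the resulting bounds are
  uniform in \<open>N\<close>.\<close>

lemma stopped_moments:
 assumes N: "0 \<le> N"
 shows "(LINT w|wiener. Z N w) = 0" "(LINT w|wiener. S N w) = (LINT w|wiener. (Z N w)^2)"
  "(LINT w|wiener. (S N w)^2) \<le> 4 * (LINT w|wiener. (Z N w) ^ 4)"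
  "integrable wiener (S N)" "integrable wiener (\<lambda>w. (S N w)^2)"
proof -
 note [measurable] = stopped_meas
 define Z' S' where "Z' = Z N" and "S' = S N"
 have int: "integrable wiener (\<lambda>w. (Z' w) ^ m * (S' w) ^ n)" for m n
 proof (rule wiener.integrable_const_bound[where B="(u - l) ^ m * N ^ n"])
  show "AE w in wiener. norm ((Z' w) ^ m * (S' w) ^ n) \<le> (u - l) ^ m * N ^ n"
   using AE_stopped_bound[OF N] AE_exit[OF lu']
   by eventually_elim (use N lu in \<open>auto simp: Z'_def S'_def abs_mult power_abs intro!: mult_mono power_mono\<close>)
 qed (simp add: Z'_def S'_def)
 note i = int[of 0 1] int[of 0 2] int[of 2 0] int[of 4 0] int[of 2 1]
 note [simp] = i[simplified] wiener.prob_space[simplified]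
 show "integrable wiener (S N)" "integrable wiener (\<lambda>w. (S N w)^2)"
  using i(1,2) by (auto simp: S'_def)
 have ZS: "S N w = S' w" "w (S' w) = Z' w" for w by (simp_all add: Z'_def S'_def)
 note stop = exit_stopped[OF _ _ N, unfolded ZS] and m = wiener_moments[OF N] and sm = wiener_shifted_moments
 show "(LINT w|wiener. Z N w) = 0"
  using stop[of "\<lambda>x. x", OF _ m(1) sm(1)] by (simp add: Z'_def)
 have eq2: "(LINT w|wiener. S' w) = (LINT w|wiener. (Z' w)^2)"
  using stop[of "\<lambda>x. x^2", OF _ m(3) sm(2)] by simp
 then show "(LINT w|wiener. S N w) = (LINT w|wiener. (Z N w)^2)" by (simp add: Z'_def S'_def)
 have eq: "(Z' w) ^ 4 + 6 * (Z' w)^2 * (N - S' w) + 3 * (N - S' w)^2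
   = (Z' w) ^ 4 + 6 * N * (Z' w)^2 - 6 * ((Z' w)^2 * S' w) + 3 * N^2 - 6 * N * S' w + 3 * (S' w)^2" for w
  by (simp add: power2_eq_square algebra_simps)
 have eq4: "(LINT w|wiener. (Z' w) ^ 4) - 6 * (LINT w|wiener. (Z' w)^2 * S' w) + 3 * (LINT w|wiener. (S' w)^2) = 0"
  using stop[of "\<lambda>x. x ^ 4", OF _ m(7) sm(3), unfolded eq] eq2 by simp
 \<comment> \<open>This is \<open>3/2\<close> times the square of \<open>S' - 2 * Z'^2\<close>.
   Inserted in \<open>eq4\<close> it bounds the second moment of \<open>S'\<close> by
   \<open>10/3\<close> times the fourth moment of \<open>Z'\<close>, which is rounded up to
   4.\<close>
 have "(LINT w|wiener. 6 * ((Z' w)^2 * S' w)) \<le> (LINT w|wiener. 3/2 * (S' w)^2 + 6 * (Z' w) ^ 4)"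
 proof (rule integral_mono)
  show "6 * ((Z' w)^2 * S' w) \<le> 3/2 * (S' w)^2 + 6 * (Z' w) ^ 4" for w
   using zero_le_power2[of "S' w - 2 * (Z' w)^2"] by (simp add: power2_eq_square power4_eq_xxxx algebra_simps)
 qed auto
 then have "6 * (LINT w|wiener. (Z' w)^2 * S' w) \<le> 3/2 * (LINT w|wiener. (S' w)^2) + 6 * (LINT w|wiener. (Z' w) ^ 4)" by simp
 moreover have "0 \<le> (LINT w|wiener. (Z' w) ^ 4)" by (rule Bochner_Integration.integral_nonneg) simp
 ultimately show "(LINT w|wiener. (S N w)^2) \<le> 4 * (LINT w|wiener. (Z N w) ^ 4)"
  unfolding ZS using eq4 by linarith
qed

text \<open>The limit \<open>N\<close> to infinity: bounded convergence for the stopped position,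
  monotone convergence for the stopped time, and Fatou's lemma for its square, where only an
  inequality survives.\<close>

lemma exit_moments:
 shows "(LINT w|wiener. w (T w)) = 0"
  "integrable wiener T" "(LINT w|wiener. T w) = (LINT w|wiener. (w (T w))^2)"
  "integrable wiener (\<lambda>w. (T w)^2)" "(LINT w|wiener. (T w)^2) \<le> 4 * (LINT w|wiener. (w (T w)) ^ 4)"
  "integrable wiener (\<lambda>w. (w (T w)) ^ n)"
proof -
 have [measurable]: "T \<in> borel_measurable wiener" "(\<lambda>w. w (T w)) \<in> borel_measurable wiener" using T_meas Y_meas by auto
 note [measurable] = stopped_meas
 have bound: "AE w in wiener. norm ((Z (real N) w) ^ n) \<le> (u - l) ^ n" "AE w in wiener. norm ((w (T w)) ^ n) \<le> (u - l) ^ n" for n N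
  by (rule AE_mp[OF AE_stopped_bound[OF of_nat_0_le_iff[of N]] AE_I2]; auto simp: power_abs intro!: power_mono)+
 show "integrable wiener (\<lambda>w. (w (T w)) ^ n)" for n by (rule wiener.integrable_const_bound[OF bound(2)]) simp
 have S: "(\<lambda>N. f (S (real N) w)) \<longlonglongrightarrow> f (T w)" for w and f :: "real => real"
 proof -
  obtain N0 :: nat where "T w \<le> real N0" using real_arch_simple by blast
  then show ?thesis by (intro tendsto_eventually) (auto simp: eventually_sequentially min_def intro!: exI[of _ N0])
 qed
 have lim: "(\<lambda>N. \<integral>w. (Z (real N) w) ^ n \<partial>wiener) \<longlonglongrightarrow> (LINT w|wiener. (w (T w)) ^ n)" for n
  by (rule integral_dominated_convergence[where w="\<lambda>_. (u - l) ^ n"]) (use bound(1) S[of "\<lambda>t. w t ^ n" w for w] in auto)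
 have "(\<lambda>N. 0) \<longlonglongrightarrow> (LINT w|wiener. w (T w))" using lim[of 1] stopped_moments(1) by simp
 then show "(LINT w|wiener. w (T w)) = 0" by (simp add: LIMSEQ_const_iff)
 have "has_bochner_integral wiener T (LINT w|wiener. (w (T w))^2)"
 proof (rule has_bochner_integral_monotone_convergence)
  show "integrable wiener (S (real N))" for N by (rule stopped_moments(4)) simp
  show "AE w in wiener. mono (\<lambda>N. S (real N) w)" by (auto simp: mono_def)
  show "(\<lambda>N. \<integral>w. S (real N) w \<partial>wiener) \<longlonglongrightarrow> (LINT w|wiener. (w (T w))^2)"
   using lim[of 2] by (simp add: stopped_moments(2))
 qed (use S[of "\<lambda>t. t"] in auto)
 then show "integrable wiener T" "(LINT w|wiener. T w) = (LINT w|wiener. (w (T w))^2)"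
  by (auto simp: has_bochner_integral_iff)
 have "(\<integral>\<^sup>+w. ennreal ((T w)^2) \<partial>wiener) = (\<integral>\<^sup>+w. liminf (\<lambda>N. ennreal ((S (real N) w)^2)) \<partial>wiener)"
  by (intro nn_integral_cong lim_imp_Liminf[symmetric] tendsto_ennrealI S) simp
 also have "... \<le> liminf (\<lambda>N. \<integral>\<^sup>+w. ennreal ((S (real N) w)^2) \<partial>wiener)" by (rule nn_integral_liminf) simp
 also have "... \<le> liminf (\<lambda>N. ennreal (4 * (LINT w|wiener. (Z (real N) w) ^ 4)))"
  using stopped_moments(3,5) by (intro Liminf_mono always_eventually allI) (simp add: nn_integral_eq_integral ennreal_leI)
 also have "... = ennreal (4 * (LINT w|wiener. (w (T w)) ^ 4))"
  by (intro lim_imp_Liminf tendsto_ennrealI tendsto_intros lim) simp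
 finally have le: "(\<integral>\<^sup>+w. ennreal ((T w)^2) \<partial>wiener) \<le> ennreal (4 * (LINT w|wiener. (w (T w)) ^ 4))" .
 then show i: "integrable wiener (\<lambda>w. (T w)^2)"
  using le_less_trans[OF _ ennreal_less_top] by (auto simp: integrable_iff_bounded)
 show "(LINT w|wiener. (T w)^2) \<le> 4 * (LINT w|wiener. (w (T w)) ^ 4)"
  using le nn_integral_eq_integral[OF i] by (simp add: ennreal_le_iff)
qed

end

text \<open>Gambler's ruin: the exit position takes only two values and has mean 0. The event is
  written \<open>w (exit_time l u w) \<le> l\<close> because this is the test made by
  \<open>emb_val\<close>.\<close>

lemma exit_probability:
 assumes lu: "l < 0" "0 < u"
 shows "emeasure wiener {w\<in>path_set. w (exit_time l u w) \<le> l} = ennreal (u / (u - l))"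
  "emeasure wiener {w\<in>path_set. \<not> w (exit_time l u w) \<le> l} = ennreal (- l / (u - l))"
proof -
 have lu': "l \<le> 0" "0 \<le> u" using lu by auto
 let ?Y = "\<lambda>w. w (exit_time l u w)"
 have Ym: "?Y \<in> borel_measurable wiener" using Y_meas[OF lu'] by simp
 define L where "L = {w\<in>path_set. ?Y w \<le> l}"
 have L[measurable]: "L \<in> sets wiener"
  using borel_measurable_le[OF Ym, of "\<lambda>_. l"] by (simp add: L_def)
 have LP: "L \<inter> path_set = L" by (auto simp: L_def)
 have int: "integrable wiener (indicator L :: _ => real)"
  using L by (subst integrable_indicator_iff) (simp_all add: LP wiener.emeasure_eq_measure)
 have "0 = (LINT w|wiener. ?Y w)" using exit_moments(1)[OF lu'] by simp
 also have "... = (LINT w|wiener. u + (l - u) * indicator L w)"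
 proof (rule integral_cong_AE[OF Ym])
  show "AE w in wiener. ?Y w = u + (l - u) * indicator L w"
   using AE_space[of wiener] AE_exit[OF less_imp_le[OF less_trans[OF lu]]]
   by eventually_elim (use exit_position[OF _ lu'] lu in \<open>force simp: L_def indicator_def\<close>)
 qed simp
 also have "... = u + (l - u) * wiener.prob L" using int wiener.prob_space LP by simp
 finally have p: "wiener.prob L = u / (u - l)" using lu by (simp add: field_simps)
 then show "emeasure wiener {w\<in>path_set. ?Y w \<le> l} = ennreal (u / (u - l))"
  by (simp add: L_def[symmetric] wiener.emeasure_eq_measure)
 have "{w\<in>path_set. \<not> ?Y w \<le> l} = space wiener - L" by (auto simp: L_def)
 moreover have "1 - u / (u - l) = - l / (u - l)" using lu by (simp add: field_simps)
 ultimately show "emeasure wiener {w\<in>path_set. \<not> ?Y w \<le> l} = ennreal (- l / (u - l))"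
  using wiener.prob_compl[OF L] p by (simp add: wiener.emeasure_eq_measure)
qed

section \<open>Oscillation of Brownian paths\<close>

lemma exp_minus_le_inverse_square: "0 < (y::real) ==> exp (- y) \<le> 2 / y^2"
proof -
 assume y: "0 < y"
 have "y^2 / 2 \<le> exp y" using exp_lower_Taylor_quadratic[of y] y by simp
 then have "exp (- y) \<le> inverse (y^2 / 2)"
  unfolding exp_minus using y by (intro le_imp_inverse_le) auto
 then show ?thesis using y by (simp add: field_simps)
qed

text \<open>The thresholds \<open>x / 10 * (9/10) ^ m\<close> add up to \<open>x\<close> over all
  levels, so a path that avoids all these events moves by at most \<open>x\<close> on the
  window.\<close>

definition wiener_dev_step :: "real => real => real => nat => nat => (real => real) set" where
 "wiener_dev_step s h x m k = {w\<in>path_set. x / 10 * (9/10) ^ m < \<bar>w (s + h * (real (Suc k) / 2 ^ m)) - w (s + h * (real k / 2 ^ m))\<bar>}"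

definition wiener_dev :: "real => real => real => (real => real) set" where
 "wiener_dev s h x = (\<Union>m. \<Union>k<2 ^ m. wiener_dev_step s h x m k)"

lemma wiener_dev_step_sets[measurable]: "wiener_dev_step s h x m k \<in> sets wiener"
proof -
 have "{w\<in>space wiener. x / 10 * (9/10) ^ m < \<bar>w (s + h * (real (Suc k) / 2 ^ m)) - w (s + h * (real k / 2 ^ m))\<bar>} \<in> sets wiener"
  by measurable
 then show ?thesis by (simp add: wiener_dev_step_def)
qed

lemma wiener_dev_sets[measurable]: "wiener_dev s h x \<in> sets wiener"
 unfolding wiener_dev_def by measurable

lemma wiener_dev_bound:
 assumes w: "w \<in> path_set" "w \<notin> wiener_dev s h x" and h: "0 < h" and x: "0 \<le> x" and r: "r \<in> {s..s + h}"
 shows "\<bar>w r - w s\<bar> \<le> x"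
proof -
 define e where "e = (\<lambda>m. x / 10 * (9/10) ^ m)"
 let ?f = "\<lambda>t. w (s + h * t)"
 have e: "e sums x" unfolding e_def using sums_mult[OF geometric_sums[of "9/10::real"], of "x / 10"] by simp
 have e0: "0 \<le> e m" for m using x by (simp add: e_def)
 have esum: "(\<Sum>l. e (l + Suc 0)) \<le> x"
  using suminf_split_initial_segment[OF sums_summable[OF e], of "Suc 0"] e0[of 0] sums_unique[OF e, symmetric] by simp
 have inc: "\<bar>?f (real (Suc k) / 2 ^ m) - ?f (real k / 2 ^ m)\<bar> \<le> e m" if "k < 1 * 2 ^ m" for m k
 proof (rule ccontr)
  assume "\<not> ?thesis"
  then have "w \<in> wiener_dev_step s h x m k" using w(1) by (simp add: wiener_dev_step_def e_def)
  then show False using w(2) that by (auto simp: wiener_dev_def)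
 qed
 define t where "t = (r - s) / h"
 have t: "0 \<le> t" "t \<le> 1" and rt: "r = s + h * t" using r h by (auto simp: t_def field_simps)
 show ?thesis
 proof (cases "t = 1")
  case True
  then show ?thesis using inc[of 0 0] x rt by (simp add: e_def)
 next
  case False
  then have t1: "t < real (1::nat)" using t by simp
  have "\<bar>lim (\<lambda>m. ?f (dyadic_floor m t)) - ?f (dyadic_floor 0 t)\<bar> \<le> (\<Sum>l. e (l + Suc 0))"
   by (rule chaining_limit(2)[OF t(1) t1 sums_summable[OF e] e0, of 0]) (use inc in auto)
  moreover have "(\<lambda>m. ?f (dyadic_floor m t)) \<longlonglongrightarrow> ?f t"
   by (rule path_tendsto[OF w(1)]) (intro tendsto_intros dyadic_floor_tendsto)
  moreover have "dyadic_floor 0 t = 0" using t t1 by (simp add: dyadic_floor_def floor_eq_iff)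
  ultimately show ?thesis using esum rt by (simp add: limI)
 qed
qed

text \<open>A union bound over all levels and increments replaces the reflection principle; the
  order \<open>x^2 / h\<close> of the exponent survives, at the price of the constants 400 and 64.
  The 400 is 4 from \<open>prob_gauss_tail\<close> times \<open>10^2\<close> from the
  thresholds.\<close>

lemma prob_wiener_dev:
 assumes s: "0 \<le> s" and h: "0 < h" and x: "0 \<le> x"
 shows "wiener.prob (wiener_dev s h x) \<le> 64 * exp (- (x^2 / (400 * h)))"
proof (cases "x^2 / (400 * h) < 1")
 \<comment> \<open>In this range the right-hand side exceeds 1; the other case has
   \<open>y >= 1\<close> at its disposal.\<close>
 case True
 have "1 \<le> exp 1 * exp (- (x^2 / (400 * h)))" using True unfolding exp_add[symmetric] by simp
 also have "... \<le> 64 * exp (- (x^2 / (400 * h)))" using exp_le by (intro mult_right_mono) auto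
 finally show ?thesis using wiener.prob_le_1 order_trans by blast
next
 case False
 define y where "y = x^2 / (400 * h)"
 have y1: "1 \<le> y" using False by (simp add: y_def)
 have step: "wiener.prob (wiener_dev_step s h x m k) \<le> 4 * exp 1 * exp (- y) / ((81/50)^2) ^ m" for m k
 proof -
  let ?t = "\<lambda>k. s + h * (real k / 2 ^ m)" and ?e = "x / 10 * (9/10) ^ m" and ?g = "(81/50 :: real) ^ m"
  have tp: "0 \<le> ?t k" "?t k < ?t (Suc k)" "?t (Suc k) - ?t k = h / 2 ^ m"
   using s h by (auto intro!: divide_strict_right_mono simp: field_simps)
  have "wiener.prob (wiener_dev_step s h x m k) = measure (gauss (h / 2 ^ m)) {z. ?e < \<bar>z\<bar>}"
   using prob_distr_gauss[OF gauss_increments_diff[OF wiener_increments prob_space_wiener tp(1,2)], of "{z. ?e < \<bar>z\<bar>}"]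
   unfolding tp(3) by (simp add: wiener_dev_step_def)
  also have "... \<le> 2 * exp (- ?e\<^sup>2 / (4 * (h / 2 ^ m)))" using h x by (intro prob_gauss_tail) auto
  also have "?g = 2 ^ m * ((9/10) ^ m)^2"
   by (simp add: power_mult_distrib[symmetric] power_mult[symmetric] mult.commute[of m] power_divide power_mult)
    (simp add: power_mult_distrib[symmetric] power_divide[symmetric])
  then have "- ?e\<^sup>2 / (4 * (h / 2 ^ m)) = - (y * ?g)"
   using h by (simp add: y_def power_mult_distrib power_divide field_simps)
  \<comment> \<open>Both factors are at least 1, hence \<open>(y - 1) * (?g - 1) >= 0\<close>. The
    product turns into a sum, which separates the dependence on \<open>x\<close> from that on the
    level.\<close>
  also have "- (y * ?g) \<le> - y + 1 + - ?g"
   using mult_right_mono[OF y1, of "?g - 1"] by (simp add: algebra_simps)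
  also have "exp (- y + 1 + - ?g) = exp (- y) * exp 1 * exp (- ?g)" by (simp only: exp_add)
  also have "... \<le> exp (- y) * exp 1 * (2 / ?g^2)"
   using exp_minus_le_inverse_square[of ?g] by (intro mult_left_mono) auto
  also have "?g^2 = ((81/50)^2) ^ m" by (simp only: power_mult[symmetric] mult.commute)
  finally show ?thesis by (simp add: ac_simps)
 qed
 \<comment> \<open>\<open>2 ^ m\<close> increments against a decay of \<open>(81/50)^2\<close> per
   level; the ratio is \<open>5000/6561\<close>, and \<open>4 * 3 / (1 - a)\<close> stays below
   64.\<close>
 define a :: real where "a = 2 / (81/50)^2"
 have a: "(\<lambda>m. 4 * exp 1 * exp (- y) * a ^ m) sums (4 * exp 1 * exp (- y) * (1 / (1 - a)))"
  by (intro sums_mult geometric_sums) (simp add: a_def power2_eq_square)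
 let ?B = "\<lambda>m. \<Union>k<2 ^ m. wiener_dev_step s h x m k"
 have Bm: "?B m \<in> sets wiener" for m by measurable
 have pm: "wiener.prob (?B m) \<le> 4 * exp 1 * exp (- y) * a ^ m" for m
 proof -
  have "wiener.prob (?B m) \<le> (\<Sum>k<2 ^ m. wiener.prob (wiener_dev_step s h x m k))"
   by (rule wiener.finite_measure_subadditive_finite) (use wiener_dev_step_sets in auto)
  also have "... \<le> (\<Sum>k<(2::nat) ^ m. 4 * exp 1 * exp (- y) / ((81/50)^2) ^ m)" by (intro sum_mono step)
  also have "... = 4 * exp 1 * exp (- y) * a ^ m" by (simp add: a_def power_divide power_mult_distrib[symmetric])
  finally show ?thesis .
 qed
 have sum: "summable (\<lambda>m. wiener.prob (?B m))"
  by (rule summable_comparison_test'[OF sums_summable[OF a], of 0]) (use pm in auto)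
 have "wiener.prob (wiener_dev s h x) \<le> (\<Sum>m. wiener.prob (?B m))"
  unfolding wiener_dev_def by (rule wiener.finite_measure_subadditive_countably[OF _ sum]) (use Bm in blast)
 also have "... \<le> 4 * exp 1 * exp (- y) * (1 / (1 - a))"
  using suminf_le[OF pm sum sums_summable[OF a]] sums_unique[OF a] by simp
 also have "... = 4 * (1 / (1 - a)) * exp 1 * exp (- y)" by simp
 also have "... \<le> 4 * (1 / (1 - a)) * 3 * exp (- y)"
  by (intro mult_right_mono mult_left_mono exp_le) (auto simp: a_def power2_eq_square)
 also have "... \<le> 64 * exp (- y)" by (intro mult_right_mono) (auto simp: a_def power2_eq_square)
 finally show ?thesis by (simp add: y_def)
qed

lemma power_bracket:
 fixes r a :: real
 assumes "1 < r" "1 \<le> a"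
 obtains k :: nat where "r ^ k \<le> a" "a < r ^ Suc k"
proof -
 obtain n where n: "a < r ^ n" using real_arch_pow[OF assms(1)] by blast
 define m where "m = (LEAST n. a < r ^ n)"
 have m: "a < r ^ m" unfolding m_def using n by (rule LeastI)
 then have "m \<noteq> 0" using assms by (intro notI) simp
 then obtain k where k: "m = Suc k" by (cases m) auto
 have "\<not> a < r ^ k" using not_less_Least[of k "\<lambda>n. a < r ^ n"] k m_def by auto
 then show thesis using that[of k] m k by auto
qed

text \<open>Borel-Cantelli over a geometric grid \<open>r ^ k\<close> with \<open>r\<close> close to
  1. On the window that starts at \<open>r ^ k\<close> the path moves by a small multiple of the
  iterated logarithm scale, once the window is short compared with \<open>e^2\<close>.\<close>

lemma wiener_modulus_fixed:
 assumes e: "0 < e"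
 shows "AE w in wiener. \<exists>d>0. \<exists>t0. \<forall>t\<ge>t0. \<forall>s. \<bar>s - t\<bar> \<le> d * t --> \<bar>w s - w t\<bar> \<le> e * sqrt (t * ln (ln t))"
proof -
 \<comment> \<open>The window length is at most \<open>5 * d * r ^ k\<close>;
   \<open>64000 = 16 * 800 * 5\<close> makes the exponent of \<open>prob_wiener_dev\<close> at least
   \<open>2 * L k\<close>.\<close>
 define d where "d = min (1/2) (e^2 / 64000)"
 have d: "0 < d" "d \<le> 1/2" "64000 * d \<le> e^2" using e by (auto simp: d_def min_def)
 define r where "r = 1 + d"
 have r: "1 < r" using d by (simp add: r_def)
 have ln\<rho>: "0 < ln r" using r by simp
 define L where "L = (\<lambda>k::nat. ln (ln (r ^ k)))"
 have lnpow: "ln (r ^ k) = real k * ln r" for k using r by (simp add: ln_realpow)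
 obtain K0 :: nat where K0: "exp 1 / ln r < real K0" using reals_Archimedean2 by blast
 have big: "exp 1 \<le> ln (r ^ k)" if "k \<ge> K0" for k
 proof -
  have "exp 1 / ln r \<le> real k" using K0 that by linarith
  then show ?thesis using ln\<rho> by (simp add: lnpow field_simps)
 qed
 have lnp: "0 < ln (r ^ k)" if "k \<ge> K0" for k using less_le_trans[OF exp_gt_zero big[OF that]] .
 have L1: "1 \<le> L k" if "k \<ge> K0" for k unfolding L_def using big[OF that] lnp[OF that] by (simp add: ln_ge_iff)
 define x where "x = (\<lambda>k. e / 4 * sqrt (r ^ k * L k))"
 \<comment> \<open>A time \<open>t\<close> in \<open>[r ^ (k + 1), r ^ (k + 2))\<close> and all
   \<open>s\<close> with \<open>\<bar>s - t\<bar> \<le> d / 2 * t\<close> lie in the window from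
   \<open>r ^ k\<close> to \<open>r ^ (k + 3)\<close>; both are compared with the path at
   \<open>r ^ k\<close>.\<close>
 define h where "h = (\<lambda>k. r ^ (k + 3) - r ^ k)"
 have hk: "h k = r ^ k * (d * (3 + 3 * d + d^2))" for k
  by (simp add: h_def r_def power_add power2_eq_square power3_eq_cube algebra_simps)
 have hpos: "0 < h k" for k unfolding hk using r d by (auto intro!: mult_pos_pos add_pos_nonneg)
 \<comment> \<open>\<open>exp (- 2 * L k)\<close> is \<open>(k * ln r)\<close> to the power -2,
   which is summable in \<open>k\<close>.\<close>
 have expo: "exp (- ((x k)^2 / (400 * h k))) \<le> 1 / (ln r)^2 * (1 / real k ^ 2)" if k: "k \<ge> K0" for k
 proof -
  have Lk: "1 \<le> L k" by (rule L1[OF k])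
  have x2: "(x k)^2 = e^2 / 16 * (r ^ k * L k)" using Lk r by (simp add: x_def power_mult_distrib power_divide)
  have "d^2 \<le> d * (1/2)" unfolding power2_eq_square using d by (intro mult_left_mono) auto
  then have "d * (3 + 3 * d + d^2) \<le> d * 5" using d by (intro mult_left_mono) auto
  then have "800 * (d * (3 + 3 * d + d^2)) \<le> e^2 / 16" using d by linarith
  then have "(r ^ k * L k) * (800 * (d * (3 + 3 * d + d^2))) \<le> (r ^ k * L k) * (e^2 / 16)"
   using Lk r by (intro mult_left_mono) auto
  then have "2 * L k * (400 * h k) \<le> (x k)^2" unfolding x2 hk by (simp add: algebra_simps)
  then have "2 * L k \<le> (x k)^2 / (400 * h k)" using hpos[of k] by (simp add: pos_le_divide_eq)
  then have "exp (- ((x k)^2 / (400 * h k))) \<le> exp (- (2 * L k))" by simp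
  also have "... = (exp (- L k))^2" by (simp add: exp_double[symmetric])
  also have "exp (- L k) = 1 / (real k * ln r)"
   using lnp[OF k] unfolding L_def lnpow by (simp add: exp_minus inverse_eq_divide)
  finally show ?thesis by (simp add: power_mult_distrib power_divide mult.commute)
 qed
 define A where "A = (\<lambda>k. wiener_dev (r ^ k) (h k) (x k))"
 have xk: "0 \<le> x k" if "k \<ge> K0" for k using L1[OF that] e r by (simp add: x_def)
 have "summable (\<lambda>k. wiener.prob (A k))"
 proof (rule summable_comparison_test')
  show "summable (\<lambda>k. 64 * (1 / (ln r)^2 * (1 / real k ^ 2)))"
   using inverse_power_summable[of 2, where 'a=real] by (intro summable_mult) (simp add: inverse_eq_divide)
  show "norm (wiener.prob (A k)) \<le> 64 * (1 / (ln r)^2 * (1 / real k ^ 2))" if "k \<ge> K0" for k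
   using prob_wiener_dev[OF _ hpos xk[OF that], of "r ^ k" k] expo[OF that] r by (simp add: A_def)
 qed
 then have "AE w in wiener. eventually (\<lambda>k. w \<in> space wiener - A k) sequentially"
  by (intro borel_cantelli_AE1) (use wiener_dev_sets in \<open>auto simp: wiener.emeasure_eq_measure A_def\<close>)
 then show ?thesis
 proof eventually_elim
  case (elim w)
  then obtain K1 where "\<And>k. k \<ge> K1 ==> w \<in> path_set - A k" by (auto simp: eventually_sequentially)
  then obtain K where K: "K \<ge> K0" "\<And>k. k \<ge> K ==> w \<in> path_set - A k"
   by (metis max.bounded_iff max.cobounded1 max.cobounded2)
  have "\<bar>w s - w t\<bar> \<le> e * sqrt (t * ln (ln t))" if t: "r ^ Suc K \<le> t" and st: "\<bar>s - t\<bar> \<le> d / 2 * t" for t s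
  proof -
   have "1 \<le> r ^ Suc K" using r by (intro one_le_power) simp
   then have t0: "1 \<le> t" using t by linarith
   obtain j where j: "r ^ j \<le> t" "t < r ^ Suc j" using power_bracket[OF r t0] by blast
   have "r ^ Suc K < r ^ Suc j" using j t by linarith
   then have "K < j" using r by (simp only: power_strict_increasing_iff Suc_less_eq)
   then obtain k where k: "j = Suc k" "k \<ge> K" by (cases j) auto
   have kK0: "k \<ge> K0" using k K by simp
   have "1 \<le> r * (1 - d / 2)" using d by (simp add: r_def algebra_simps mult_left_le)
   then have "r ^ k * 1 \<le> r ^ k * (r * (1 - d / 2))" using r by (intro mult_left_mono) auto
   also have "... = r ^ j * (1 - d / 2)" by (simp add: k)
   also have "... \<le> t * (1 - d / 2)" using j d by (intro mult_right_mono) auto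
   finally have s1: "r ^ k \<le> s" using abs_ge_minus_self[of "s - t"] st by (simp add: algebra_simps)
   have "s \<le> r * t" using abs_ge_self[of "s - t"] st mult_nonneg_nonneg[of d t] d t0 unfolding r_def distrib_right by linarith
   also have "... \<le> r * r ^ Suc j" using j r by (intro mult_left_mono) auto
   finally have s2: "s \<le> r ^ (k + 3)" by (simp add: k eval_nat_numeral)
   have kt: "r ^ k \<le> t" using j r power_increasing[of k j r] k by linarith
   have "r ^ Suc j \<le> r ^ (k + 3)" using r by (intro power_increasing) (auto simp: k)
   then have "\<bar>w s - w (r ^ k)\<bar> \<le> x k" "\<bar>w t - w (r ^ k)\<bar> \<le> x k"
    using wiener_dev_bound[OF _ _ hpos xk[OF kK0], of w "r ^ k" k] K(2)[OF k(2)] s1 s2 kt j by (auto simp: A_def h_def)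
   then have "\<bar>w s - w t\<bar> \<le> 2 * x k" by linarith
   also have "2 * x k = e / 2 * sqrt (r ^ k * L k)" by (simp add: x_def)
   also have "... \<le> e * sqrt (t * ln (ln t))"
   proof (rule mult_mono)
    have pk: "0 < r ^ k" using r by simp
    then have "ln (r ^ k) \<le> ln t" using kt t0 by simp
    then have "L k \<le> ln (ln t)" unfolding L_def using lnp[OF kK0] by (subst ln_le_cancel_iff) auto
    then show "sqrt (r ^ k * L k) \<le> sqrt (t * ln (ln t))"
     using kt L1[OF kK0] pk t0 by (intro real_sqrt_le_mono mult_mono) auto
   qed (use e L1[OF kK0] r in auto)
   finally show ?thesis .
  qed
  then show ?case using d by (intro exI[of _ "d / 2"]) auto
 qed
qed

text \<open>A countable family of tolerances, so that one null set serves all of them, while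
  \<open>d\<close> and \<open>t0\<close> may depend on the path.\<close>

theorem wiener_modulus:
 "AE w in wiener. \<forall>n::nat. \<exists>d>0. \<exists>t0. \<forall>t\<ge>t0. \<forall>s. \<bar>s - t\<bar> \<le> d * t --> \<bar>w s - w t\<bar> \<le> 1 / real (Suc n) * sqrt (t * ln (ln t))"
 unfolding AE_all_countable by (intro allI wiener_modulus_fixed) simp

lemma dyadic_block:
 fixes t N :: real
 assumes "0 < t" "t \<le> N"
 obtains j :: nat where "N / 2 ^ Suc j < t" "t \<le> N / 2 ^ j"
proof -
 have "1 \<le> N / t" using assms by simp
 then obtain j where j: "2 ^ j \<le> N / t" "N / t < 2 ^ Suc j" using power_bracket[of 2] by auto
 have "N < 2 ^ Suc j * t" using j(2) assms(1) by (simp add: pos_divide_less_eq)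
 then have "N / 2 ^ Suc j < t" by (subst pos_divide_less_eq) (auto simp: mult.commute)
 moreover have "2 ^ j * t \<le> N" using j(1) assms(1) by (simp add: pos_le_divide_eq)
 then have "t \<le> N / 2 ^ j" by (subst pos_le_divide_eq) (auto simp: mult.commute)
 ultimately show thesis by (rule that)
qed

text \<open>
 A union bound over dyadic blocks and, inside the block of scale \<open>N / 2 ^ j\<close>, over windows of length
 \<open>d N / 2 ^ j\<close>; as \<open>q < 1/2\<close> the failure probabilities form a geometric series.
\<close>
theorem wiener_weighted_oscillation:
 assumes q: "0 \<le> q" "q < 1/2"
 shows "\<exists>C. \<forall>d e N. 0 < d --> d \<le> 1 --> 0 < e --> 0 < N -->
  (\<exists>A\<in>sets wiener. wiener.prob A \<le> C * d / e ^ 4 \<and>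
   (\<forall>w\<in>path_set - A. \<forall>t\<in>{0<..N}. \<forall>v\<ge>0. \<bar>v - t\<bar> \<le> d * t --> \<bar>w v - w t\<bar> \<le> e * N powr (1/2 - q) * t powr q))"
proof -
 \<comment> \<open>The ratio between the bounds of successive blocks; it is below 1 exactly because
   \<open>2 - 4 * q\<close> is positive.\<close>
 define b where "b = (1/2) powr (2 - 4 * q)"
 have b: "0 < b" "b < 1" using q powr01_less_one[of "1/2" "2 - 4 * q"] by (auto simp: b_def)
 \<comment> \<open>64 is the factor of \<open>prob_wiener_dev\<close>. The rest comes from
   \<open>2 / y^2\<close> with \<open>y = (x j)^2 / (800 * h j)\<close>:
   \<open>81920000 = 2 * 800^2 * 2^2 * 16\<close>.\<close>
 define C1 :: real where "C1 = 64 * 81920000"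
 have C1: "0 < C1" by (simp add: C1_def)
 show ?thesis
 proof (intro exI[of _ "2 * C1 / (1 - b)"] allI impI)
  fix d e N :: real assume d: "0 < d" "d \<le> 1" and e: "0 < e" and N: "0 < N"
  define h where "h = (\<lambda>j::nat. d * (N / 2 ^ j))"
  define x where "x = (\<lambda>j::nat. 1/2 * (e * N powr (1/2 - q) * (N / 2 ^ Suc j) powr q))"
  have h: "0 < h j" for j using d N by (simp add: h_def)
  have x: "0 < x j" for j using e N by (simp add: x_def)
  define I where "I = nat \<lfloor>1 / d\<rfloor>"
  have "1 \<le> 1 / d" "real I \<le> 1 / d" using d by (simp_all add: I_def)
  then have I: "real (Suc I) \<le> 2 / d" by (simp add: add_divide_distrib[symmetric])
  \<comment> \<open>The windows are twice as long as their spacing, so that any two points of the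
    block at distance at most \<open>h j\<close> lie in a common window.\<close>
  define A where "A = (\<lambda>j i. wiener_dev (real i * h j) (2 * h j) (x j))"
  have A: "wiener.prob (A j i) \<le> C1 * d^2 / e ^ 4 * b ^ j" for j i
  proof -
   define y where "y = (x j)^2 / (800 * h j)"
   define a where "a = N / 2 ^ Suc j"
   have y: "0 < y" using x[of j] h[of j] by (simp add: y_def)
   have a: "0 < a" using N by (simp add: a_def)
   have "wiener.prob (A j i) \<le> 64 * exp (- y)"
    using prob_wiener_dev[of "real i * h j" "2 * h j" "x j"] h[of j] x[of j] by (simp add: A_def y_def)
   also have "... \<le> 64 * (2 / y^2)" using exp_minus_le_inverse_square[OF y] by (intro mult_left_mono) auto
   also have "2 / y^2 = 1280000 * (2 * d * a)^2 / (x j) ^ 4"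
    using h[of j] x[of j] by (simp add: y_def a_def h_def power_divide power_mult_distrib field_simps)
   also have "(x j) ^ 4 = e ^ 4 / 16 * (N powr (2 - 4 * q) * a powr (4 * q))"
    unfolding x_def a_def[symmetric] using N a by (simp add: power_mult_distrib power_divide powr_power algebra_simps)
   also have "1280000 * (2 * d * a)^2 / (e ^ 4 / 16 * (N powr (2 - 4 * q) * a powr (4 * q)))
    = 81920000 * d^2 / e ^ 4 * (a^2 / a powr (4 * q) / N powr (2 - 4 * q))"
    by (simp add: power_mult_distrib ac_simps)
   also have "a^2 / a powr (4 * q) / N powr (2 - 4 * q) = (a / N) powr (2 - 4 * q)"
    using a N by (simp add: powr_divide powr_diff)
   also have "a / N = (1/2) powr real (Suc j)" using N by (simp only: a_def powr_realpow) (simp add: power_divide)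
   also have "((1/2) powr real (Suc j)) powr (2 - 4 * q) = b ^ Suc j"
    unfolding b_def powr_powr by (subst powr_realpow[symmetric]) (simp_all add: powr_powr mult.commute)
   also have "81920000 * d^2 / e ^ 4 * b ^ Suc j \<le> 81920000 * d^2 / e ^ 4 * b ^ j"
    using b by (intro mult_left_mono power_decreasing) auto
   finally show ?thesis by (simp add: C1_def)
  qed
  define B where "B = (\<lambda>j. \<Union>i\<le>I. A j i)"
  have Bm: "B j \<in> sets wiener" for j unfolding B_def A_def by measurable
  have PB: "wiener.prob (B j) \<le> 2 * C1 * d / e ^ 4 * b ^ j" for j
  proof -
   have "wiener.prob (B j) \<le> (\<Sum>i\<le>I. wiener.prob (A j i))"
    unfolding B_def by (rule wiener.finite_measure_subadditive_finite) (use wiener_dev_sets in \<open>auto simp: A_def\<close>)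
   also have "... \<le> (\<Sum>i\<le>I. C1 * d^2 / e ^ 4 * b ^ j)" by (intro sum_mono A)
   also have "... = real (Suc I) * (C1 * d^2 / e ^ 4 * b ^ j)" by simp
   \<comment> \<open>At most \<open>2 / d\<close> windows, each failing with probability of order
     \<open>d^2\<close>: one power of \<open>d\<close> survives.\<close>
   also have "... \<le> 2 / d * (C1 * d^2 / e ^ 4 * b ^ j)"
    using C1 e b by (intro mult_right_mono I) auto
   also have "... = 2 * C1 * d / e ^ 4 * b ^ j" using d by (simp add: power2_eq_square)
   finally show ?thesis .
  qed
  have S: "(\<lambda>j. 2 * C1 * d / e ^ 4 * b ^ j) sums (2 * C1 * d / e ^ 4 * (1 / (1 - b)))"
   using b by (intro sums_mult geometric_sums) auto
  have sum: "summable (\<lambda>j. wiener.prob (B j))"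
   by (rule summable_comparison_test'[OF sums_summable[OF S], of 0]) (use PB in auto)
  have "wiener.prob (\<Union>j. B j) \<le> (\<Sum>j. wiener.prob (B j))"
   by (rule wiener.finite_measure_subadditive_countably[OF _ sum]) (use Bm in blast)
  also have "... \<le> 2 * C1 * d / e ^ 4 * (1 / (1 - b))"
   using suminf_le[OF PB sum sums_summable[OF S]] sums_unique[OF S] by simp
  finally have P: "wiener.prob (\<Union>j. B j) \<le> 2 * C1 / (1 - b) * d / e ^ 4" by (simp add: mult.commute)
  have good: "\<bar>w v - w t\<bar> \<le> e * N powr (1/2 - q) * t powr q"
   if w: "w \<in> path_set - (\<Union>j. B j)" and t: "t \<in> {0<..N}" and v: "0 \<le> v" and vt: "\<bar>v - t\<bar> \<le> d * t" for w t v
  proof -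
   obtain j where j: "N / 2 ^ Suc j < t" "t \<le> N / 2 ^ j" using dyadic_block[of t N] t by auto
   define a where "a = min t v"
   define i where "i = nat \<lfloor>a / h j\<rfloor>"
   have "0 \<le> a" using t v by (auto simp: a_def)
   then have "real i = real_of_int \<lfloor>a / h j\<rfloor>" using h[of j] by (simp add: i_def)
   then have "real i \<le> a / h j" "a / h j < real i + 1" by linarith+
   then have ih: "real i * h j \<le> a" "a < real i * h j + h j" using h[of j] by (auto simp: field_simps)
   have dt: "d * t \<le> h j" using mult_left_mono[OF j(2), of d] d by (simp add: h_def)
   have "a / h j \<le> (N / 2 ^ j) / h j" using h[of j] j(2) by (intro divide_right_mono) (auto simp: a_def)
   also have "... = 1 / d" using N by (simp add: h_def)
   finally have "i \<le> I" unfolding i_def I_def by (intro nat_mono floor_mono)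
   then have wA: "w \<in> path_set" "w \<notin> A j i" using w by (auto simp: B_def)
   have "t \<in> {real i * h j..real i * h j + 2 * h j}" "v \<in> {real i * h j..real i * h j + 2 * h j}"
    using ih dt vt by (auto simp: a_def min_def abs_le_iff split: if_splits)
   then have "\<bar>w t - w (real i * h j)\<bar> \<le> x j" "\<bar>w v - w (real i * h j)\<bar> \<le> x j"
    using wiener_dev_bound[OF wA[unfolded A_def]] h[of j] x[of j] by auto
   then have "\<bar>w v - w t\<bar> \<le> 2 * x j" by linarith
   also have "2 * x j \<le> e * N powr (1/2 - q) * t powr q"
    unfolding x_def using j(1) N e q by (simp del: power_Suc) (intro mult_left_mono powr_mono2; simp)
   finally show ?thesis .
  qed
  show "\<exists>A\<in>sets wiener. wiener.prob A \<le> 2 * C1 / (1 - b) * d / e ^ 4 \<and>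
   (\<forall>w\<in>path_set - A. \<forall>t\<in>{0<..N}. \<forall>v\<ge>0. \<bar>v - t\<bar> \<le> d * t --> \<bar>w v - w t\<bar> \<le> e * N powr (1/2 - q) * t powr q)"
  proof (intro bexI[of _ "\<Union>j. B j"] conjI P ballI allI impI good)
   show "(\<Union>j. B j) \<in> sets wiener" using Bm by blast
  qed auto
 qed
qed

section \<open>Skorokhod embedding\<close>

definition emb_mean :: "real measure => (real => real) => real" where
 "emb_mean K g = (LINT x|K. g x)"

text \<open>By \<open>neg_part\<close> this is also the mean of the negative part, that is, half the
  mean absolute deviation of \<open>g\<close>.\<close>

definition emb_half :: "real measure => (real => real) => real" where
 "emb_half K g = (LINT x|K. max 0 (g x - emb_mean K g))"

text \<open>
 Skorokhod's randomised interval: a pair \<open>(x, y)\<close> with \<open>g x < c < g y\<close> is drawn with weight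
 \<open>(g y - g x) / m\<close> relative to two independent samples, where \<open>m\<close> is the mean of the positive part of
 \<open>g - c\<close>; the atom \<open>g x = c\<close> needs no Brownian time at all.
\<close>
definition emb_dens :: "real => real => (real => real) => real => real => ennreal" where
 "emb_dens c m g x y = (if g x = c then 1 else if g x < c \<and> c < g y then ennreal ((g y - g x) / m) else 0)"

definition emb_pair :: "real measure => (real => real) => (real \<times> real) measure" where
 "emb_pair K g = density (K \<Otimes>\<^sub>M K) (\<lambda>(x, y). emb_dens (emb_mean K g) (emb_half K g) g x y)"

text \<open>The path is to leave at \<open>a * (g - c)\<close>. Taking \<open>min\<close> and
  \<open>max\<close> with 0 yields an interval around 0 for every pair, including those to which
  \<open>emb_dens\<close> gives weight 0.\<close>

definition emb_time :: "real => (real => real) => real => real \<times> real => (real => real) => real" where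
 "emb_time c g a z w = exit_time (min 0 (a * (g (fst z) - c))) (max 0 (a * (g (snd z) - c))) w"

text \<open>Returns the sampled point itself and not only its image under \<open>g\<close>. Thus the
  step keeps the law \<open>K\<close> while the path embeds the transformed step; with
  \<open>g\<close> a truncation, nothing of the walk is lost.\<close>

definition emb_val :: "real => (real => real) => real => real \<times> real => (real => real) => real" where
 "emb_val c g a z w = (if w (emb_time c g a z w) \<le> min 0 (a * (g (fst z) - c)) then fst z else snd z)"

definition emb_law :: "real measure => (real => real) => real => (real \<times> real) measure" where
 "emb_law K g a = distr (emb_pair K g \<Otimes>\<^sub>M wiener) plane
   (\<lambda>(z, w). (emb_val (emb_mean K g) g a z w, emb_time (emb_mean K g) g a z w))"

lemma emb_time_measurable:
 assumes g[measurable]: "g \<in> borel_measurable borel"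
  and [measurable]: "c \<in> borel_measurable M" "z \<in> measurable M plane" and w: "w \<in> measurable M path_space"
 shows "(\<lambda>x. emb_time (c x) g a (z x) (w x)) \<in> borel_measurable M"
proof -
 have [measurable]: "(\<lambda>x. g (fst (z x))) \<in> borel_measurable M" "(\<lambda>x. g (snd (z x))) \<in> borel_measurable M"
  by (rule measurable_compose[OF _ g], measurable)+
 show ?thesis unfolding emb_time_def
  by (rule exit_time_measurable[OF w]) measurable
qed

lemma emb_val_measurable:
 assumes g[measurable]: "g \<in> borel_measurable borel"
  and [measurable]: "c \<in> borel_measurable M" "z \<in> measurable M plane" and w: "w \<in> measurable M path_space"
 shows "(\<lambda>x. emb_val (c x) g a (z x) (w x)) \<in> borel_measurable M"
proof -
 have [measurable]: "(\<lambda>x. g (fst (z x))) \<in> borel_measurable M"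
  by (rule measurable_compose[OF _ g], measurable)
 have [measurable]: "(\<lambda>x. w x (emb_time (c x) g a (z x) (w x))) \<in> borel_measurable M"
  by (rule path_eval_measurable[OF w emb_time_measurable[OF assms]])
 show ?thesis unfolding emb_val_def by measurable
qed

text \<open>For \<open>g (fst z) = c\<close> the lower end is 0 and the path exits at once, at the
  correct position 0. Otherwise both ends are the intended values, and \<open>exit_position\<close>
  says that one of them is hit exactly.\<close>

lemma emb_position:
 assumes w: "w \<in> path_set" and a: "0 < a" and T: "0 \<le> emb_time c g a z w"
  and z: "g (fst z) = c \<or> g (fst z) < c \<and> c < g (snd z)"
 shows "w (emb_time c g a z w) = a * (g (emb_val c g a z w) - c)"
proof -
 let ?l = "min 0 (a * (g (fst z) - c))" and ?u = "max 0 (a * (g (snd z) - c))"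
 have l: "?l = a * (g (fst z) - c)"
 proof -
  have "a * (g (fst z) - c) \<le> 0" using z a by (intro mult_nonneg_nonpos) auto
  then show ?thesis by simp
 qed
 have pos: "w (emb_time c g a z w) = ?l \<or> w (emb_time c g a z w) = ?u"
  unfolding emb_time_def by (rule exit_position[OF w]) (use T in \<open>auto simp: emb_time_def\<close>)
 show ?thesis
 proof (cases "w (emb_time c g a z w) \<le> ?l")
  case True
  then have "w (emb_time c g a z w) = ?l" using pos by auto
  then show ?thesis using True l by (simp add: emb_val_def)
 next
  case False
  then have u: "w (emb_time c g a z w) = ?u" using pos by auto
  have "g (fst z) \<noteq> c"
  proof
   assume e: "g (fst z) = c"
   then have "0 \<in> exit_set ?l ?u w" using path_setD(2)[OF w] by (auto simp: exit_set_def)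
   then have "emb_time c g a z w = 0"
    unfolding emb_time_def by (intro exit_time_eqI) (auto simp: exit_set_def)
   then show False using False e path_setD(2)[OF w] by simp
  qed
  then have "?u = a * (g (snd z) - c)" using z a by (auto simp: max_def)
  moreover have "emb_val c g a z w = snd z" using False by (simp only: emb_val_def if_False)
  ultimately show ?thesis using u by simp
 qed
qed

locale skorokhod_step =
 fixes K :: "real measure" and g :: "real => real" and a G :: real
 assumes prob_K: "prob_space K" and sets_K[measurable_cong, simp]: "sets K = sets borel"
  and g[measurable]: "g \<in> borel_measurable borel" and g_bound: "\<And>x. \<bar>g x\<bar> \<le> G" and a: "0 < a"
begin

sublocale K: prob_space K by (rule prob_K)

lemma space_K[simp]: "space K = UNIV"
 using sets_eq_imp_space_eq[OF sets_K] by simp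

sublocale KK: pair_prob_space K K ..

abbreviation "c \<equiv> emb_mean K g"
abbreviation "m \<equiv> emb_half K g"

lemma measurable_K: "borel_measurable K = borel_measurable borel"
 by (rule measurable_cong_sets) auto

lemma g_K[measurable]: "g \<in> borel_measurable K"
 using g by (simp add: measurable_K)

lemma g_integrable: "integrable K g"
 by (rule K.integrable_const_bound[where B=G]) (use g_bound in auto)

lemma m_nonneg: "0 \<le> m"
 unfolding emb_half_def by (rule Bochner_Integration.integral_nonneg) simp

lemma pos_part: "(\<integral>\<^sup>+x. ennreal (max 0 (g x - c)) \<partial>K) = ennreal m"
 unfolding emb_half_def by (rule nn_integral_eq_integral) (use g_integrable in auto)

lemma neg_part: "(\<integral>\<^sup>+x. ennreal (max 0 (c - g x)) \<partial>K) = ennreal m"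
proof -
 have "(LINT x|K. max 0 (c - g x)) = (LINT x|K. max 0 (g x - c) - (g x - c))"
  by (rule Bochner_Integration.integral_cong) auto
 also have "... = m - (c - c)"
  using g_integrable K.prob_space by (simp add: emb_half_def emb_mean_def)
 finally have "(LINT x|K. max 0 (c - g x)) = m" by simp
 then show ?thesis
  by (subst nn_integral_eq_integral) (use g_integrable in auto)
qed

lemma emb_dens_measurable[measurable]: "(\<lambda>(x, y). emb_dens c m g x y) \<in> borel_measurable (K \<Otimes>\<^sub>M K)"
proof -
 have [measurable]: "(\<lambda>z. g (fst z)) \<in> borel_measurable (K \<Otimes>\<^sub>M K)" "(\<lambda>z. g (snd z)) \<in> borel_measurable (K \<Otimes>\<^sub>M K)"
  by (rule measurable_compose[OF _ g], measurable)+
 show ?thesis unfolding emb_dens_def split_beta' by measurable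
qed

lemma sets_emb_pair[measurable_cong, simp]: "sets (emb_pair K g) = sets plane"
 by (simp add: emb_pair_def cong: sets_pair_measure_cong)

text \<open>Gambler's ruin gives the lower point with probability
  \<open>(g y - c) / (g y - g x)\<close>, and the weight in \<open>emb_dens\<close> cancels this
  denominator. What remains is a sum of products of a function of \<open>x\<close> and a function of
  \<open>y\<close>.\<close>

lemma val_integral:
 assumes f[measurable]: "f \<in> borel_measurable borel"
 shows "emb_dens c m g x y * (\<integral>\<^sup>+w. f (emb_val c g a (x, y) w) \<partial>wiener) =
   indicator {x. g x = c} x * f x +
   (indicator {x. g x < c} x * f x) * (indicator {y. c < g y} y * ennreal ((g y - c) / m)) +
   (indicator {x. g x < c} x * ennreal ((c - g x) / m)) * (indicator {y. c < g y} y * f y)"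
proof -
 consider (eq) "g x = c" | (lt) "g x < c" "c < g y" | (no) "g x \<noteq> c" "\<not> (g x < c \<and> c < g y)" by blast
 then show ?thesis
 proof cases
  case eq
  have "emb_val c g a (x, y) w = x" if w: "w \<in> path_set" for w
  proof -
   have "0 \<in> exit_set 0 (max 0 (a * (g y - c))) w" using path_setD(2)[OF w] by (auto simp: exit_set_def)
   then have "emb_time c g a (x, y) w = 0"
    unfolding emb_time_def using eq by (intro exit_time_eqI) (auto simp: exit_set_def)
   then show ?thesis using path_setD(2)[OF w] eq by (simp add: emb_val_def)
  qed
  then have "(\<integral>\<^sup>+w. f (emb_val c g a (x, y) w) \<partial>wiener) = (\<integral>\<^sup>+w. f x \<partial>wiener)"
   by (intro nn_integral_cong) auto
  then show ?thesis using eq wiener.emeasure_space_1 by (simp add: emb_dens_def)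
 next
  case lt
  let ?l = "a * (g x - c)" and ?u = "a * (g y - c)"
  have lu: "?l < 0" "0 < ?u" using lt a by (auto simp: mult_less_0_iff)
  have d: "0 < g y - g x" using lt by simp
  let ?E = "{w\<in>path_set. w (exit_time ?l ?u w) \<le> ?l}" and ?E' = "{w\<in>path_set. \<not> w (exit_time ?l ?u w) \<le> ?l}"
  have Ym: "(\<lambda>w. w (exit_time ?l ?u w)) \<in> borel_measurable wiener" using Y_meas[of ?l ?u] lu by simp
  have mE: "?E \<in> sets wiener" using borel_measurable_le[OF Ym, of "\<lambda>_. ?l"] by simp
  have mE': "?E' \<in> sets wiener"
  proof -
   have "?E' = space wiener - ?E" by auto
   then show ?thesis using mE by (simp only: sets.compl_sets)
  qed
  have p: "?u / (?u - ?l) = (g y - c) / (g y - g x)" "- ?l / (?u - ?l) = (c - g x) / (g y - g x)"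
  proof -
   have e: "?u - ?l = a * (g y - g x)" "- ?l = a * (c - g x)" by (simp_all add: algebra_simps)
   show "?u / (?u - ?l) = (g y - c) / (g y - g x)" "- ?l / (?u - ?l) = (c - g x) / (g y - g x)"
    unfolding e using a by auto
  qed
  have "(\<integral>\<^sup>+w. f (emb_val c g a (x, y) w) \<partial>wiener) = (\<integral>\<^sup>+w. f x * indicator ?E w + f y * indicator ?E' w \<partial>wiener)"
   using lu by (intro nn_integral_cong) (auto simp: emb_val_def emb_time_def min_absorb2 max_absorb2 less_imp_le)
  also have "... = f x * emeasure wiener ?E + f y * emeasure wiener ?E'"
   using mE mE' by (subst nn_integral_add) (auto simp: nn_integral_cmult_indicator)
  also have "... = f x * ennreal ((g y - c) / (g y - g x)) + f y * ennreal ((c - g x) / (g y - g x))"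
   unfolding exit_probability[OF lu] p ..
  finally have I: "(\<integral>\<^sup>+w. f (emb_val c g a (x, y) w) \<partial>wiener) = f x * ennreal ((g y - c) / (g y - g x)) + f y * ennreal ((c - g x) / (g y - g x))" .
  have q: "ennreal ((g y - g x) / m) * ennreal (r / (g y - g x)) = ennreal (r / m)" if "0 \<le> r" for r
   using d m_nonneg that by (subst ennreal_mult[symmetric]) auto
  have "emb_dens c m g x y * (\<integral>\<^sup>+w. f (emb_val c g a (x, y) w) \<partial>wiener)
   = f x * (ennreal ((g y - g x) / m) * ennreal ((g y - c) / (g y - g x))) + f y * (ennreal ((g y - g x) / m) * ennreal ((c - g x) / (g y - g x)))"
   unfolding I using lt by (simp add: emb_dens_def distrib_left mult.left_commute)
  also have "... = f x * ennreal ((g y - c) / m) + f y * ennreal ((c - g x) / m)"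
   using lt by (simp add: q)
  finally show ?thesis using lt by (simp add: mult.commute)
 qed (auto simp: emb_dens_def indicator_def)
qed

lemma product_sum_integral:
 fixes A B B' C C' :: "real => ennreal"
 assumes [measurable]: "A \<in> borel_measurable K" "B \<in> borel_measurable K" "B' \<in> borel_measurable K"
  "C \<in> borel_measurable K" "C' \<in> borel_measurable K"
 shows "(\<integral>\<^sup>+z. A (fst z) + B (fst z) * B' (snd z) + C (fst z) * C' (snd z) \<partial>(K \<Otimes>\<^sub>M K))
  = (\<integral>\<^sup>+x. A x \<partial>K) + (\<integral>\<^sup>+x. B x \<partial>K) * (\<integral>\<^sup>+y. B' y \<partial>K) + (\<integral>\<^sup>+x. C x \<partial>K) * (\<integral>\<^sup>+y. C' y \<partial>K)"
proof -
 have "(\<integral>\<^sup>+z. A (fst z) + B (fst z) * B' (snd z) + C (fst z) * C' (snd z) \<partial>(K \<Otimes>\<^sub>M K))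
  = (\<integral>\<^sup>+x. (\<integral>\<^sup>+y. A x + B x * B' y + C x * C' y \<partial>K) \<partial>K)"
  by (subst K.nn_integral_fst[symmetric]) auto
 also have "... = (\<integral>\<^sup>+x. A x + B x * (\<integral>\<^sup>+y. B' y \<partial>K) + C x * (\<integral>\<^sup>+y. C' y \<partial>K) \<partial>K)"
  using K.emeasure_space_1 by (intro nn_integral_cong) (simp add: nn_integral_add nn_integral_cmult)
 also have "... = (\<integral>\<^sup>+x. A x \<partial>K) + (\<integral>\<^sup>+x. B x \<partial>K) * (\<integral>\<^sup>+y. B' y \<partial>K) + (\<integral>\<^sup>+x. C x \<partial>K) * (\<integral>\<^sup>+y. C' y \<partial>K)"
  by (simp add: nn_integral_add nn_integral_multc)
 finally show ?thesis .
qed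

text \<open>After the factorisation, integrating out the partner of the chosen point gives 1 by the
  normalisation \<open>m\<close>, and the three regions \<open>g = c\<close>, \<open>g < c\<close>,
  \<open>g > c\<close> reassemble \<open>K\<close>.\<close>

lemma emb_pair_val_integral:
 assumes F[measurable]: "F \<in> borel_measurable borel"
 shows "(\<integral>\<^sup>+z. (\<integral>\<^sup>+w. F (emb_val c g a z w) \<partial>wiener) \<partial>emb_pair K g) = (\<integral>\<^sup>+x. F x \<partial>K)"
proof -
 have [measurable]: "(\<lambda>z. g (fst z)) \<in> borel_measurable plane" "(\<lambda>z. g (snd z)) \<in> borel_measurable plane"
  by (rule measurable_compose[OF _ g], measurable)+
 have "(\<lambda>p. emb_val c g a (fst p) (snd p)) \<in> borel_measurable (plane \<Otimes>\<^sub>M path_space)"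
  by (rule emb_val_measurable[OF g]) auto
 from measurable_compose[OF this F]
 have vm: "(\<lambda>p. F (emb_val c g a (fst p) (snd p))) \<in> borel_measurable (plane \<Otimes>\<^sub>M wiener)"
  by (simp cong: measurable_cong_sets sets_pair_measure_cong)
 have im[measurable]: "(\<lambda>z. \<integral>\<^sup>+w. F (emb_val c g a z w) \<partial>wiener) \<in> borel_measurable plane"
  using wiener.borel_measurable_nn_integral_fst[OF vm] by simp
 have mK: "borel_measurable (K \<Otimes>\<^sub>M K) = (borel_measurable plane :: (real \<times> real => ennreal) set)"
  by (intro measurable_cong_sets sets_pair_measure_cong) auto
 let ?A = "\<lambda>x. indicator {x. g x = c} x * F x"
 let ?B = "\<lambda>x. indicator {x. g x < c} x * F x" and ?B' = "\<lambda>y. indicator {y. c < g y} y * ennreal ((g y - c) / m)"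
 let ?C = "\<lambda>x. indicator {x. g x < c} x * ennreal ((c - g x) / m)" and ?C' = "\<lambda>y. indicator {y. c < g y} y * F y"
 have S: "{x. g x = c} \<in> sets borel" "{x. g x < c} \<in> sets borel" "{x. c < g x} \<in> sets borel"
  using borel_measurable_eq[OF g, of "\<lambda>_. c"] borel_measurable_less[OF g, of "\<lambda>_. c"] borel_measurable_less[OF _ g, of "\<lambda>_. c"]
  by auto
 have [measurable]: "indicator {x. g x = c} \<in> borel_measurable borel" "indicator {x. g x < c} \<in> borel_measurable borel"
  "indicator {x. c < g x} \<in> borel_measurable borel"
  using S by (auto intro!: borel_measurable_indicator)
 have mA: "?A \<in> borel_measurable K" unfolding measurable_K by measurable
 have mB: "?B \<in> borel_measurable K" unfolding measurable_K by measurable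
 have mB': "?B' \<in> borel_measurable K" unfolding measurable_K by measurable
 have mC: "?C \<in> borel_measurable K" unfolding measurable_K by measurable
 have mC': "?C' \<in> borel_measurable K" unfolding measurable_K by measurable
 have "(\<integral>\<^sup>+z. (\<integral>\<^sup>+w. F (emb_val c g a z w) \<partial>wiener) \<partial>emb_pair K g)
  = (\<integral>\<^sup>+z. emb_dens c m g (fst z) (snd z) * (\<integral>\<^sup>+w. F (emb_val c g a z w) \<partial>wiener) \<partial>(K \<Otimes>\<^sub>M K))"
  unfolding emb_pair_def by (subst nn_integral_density) (auto simp: mK split_beta')
 also have "... = (\<integral>\<^sup>+z. ?A (fst z) + ?B (fst z) * ?B' (snd z) + ?C (fst z) * ?C' (snd z) \<partial>(K \<Otimes>\<^sub>M K))"
  using val_integral[OF F] by (intro nn_integral_cong) (auto simp: split_beta')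
 also have "... = (\<integral>\<^sup>+x. ?A x \<partial>K) + (\<integral>\<^sup>+x. ?B x \<partial>K) * (\<integral>\<^sup>+y. ?B' y \<partial>K) + (\<integral>\<^sup>+x. ?C x \<partial>K) * (\<integral>\<^sup>+y. ?C' y \<partial>K)"
  by (rule product_sum_integral[OF mA mB mB' mC mC'])
 also have "... = (\<integral>\<^sup>+x. ?A x \<partial>K) + (\<integral>\<^sup>+x. ?B x \<partial>K) + (\<integral>\<^sup>+x. ?C' x \<partial>K)"
 proof (cases "m = 0")
  \<comment> \<open>If \<open>m = 0\<close> then \<open>g = c\<close> almost surely, and the two
    terms with a partner vanish before any division by \<open>m\<close> matters.\<close>
  case True
  have z: "AE x in K. f x \<le> 0" if "(\<integral>\<^sup>+x. ennreal (max 0 (f x)) \<partial>K) = 0" "f \<in> borel_measurable K" for f :: "real => real"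
   using that nn_integral_0_iff_AE[of "\<lambda>x. ennreal (max 0 (f x))" K] by (auto simp: ennreal_eq_0_iff)
  have "AE x in K. g x - c \<le> 0" using pos_part True by (intro z) auto
  moreover have "AE x in K. c - g x \<le> 0" using neg_part True by (intro z) auto
  ultimately have "AE x in K. ?B x = 0" "AE x in K. ?C' x = 0"
   by (eventually_elim, simp)+
  then have "(\<integral>\<^sup>+x. ?B x \<partial>K) = (\<integral>\<^sup>+x. 0 \<partial>K)" "(\<integral>\<^sup>+x. ?C' x \<partial>K) = (\<integral>\<^sup>+x. 0 \<partial>K)"
   by (intro nn_integral_cong_AE, simp)+
  then show ?thesis by simp
 next
  case False
  then have mp: "0 < m" using m_nonneg by simp
  have "(\<integral>\<^sup>+y. ?B' y \<partial>K) = (\<integral>\<^sup>+y. ennreal (1 / m) * ennreal (max 0 (g y - c)) \<partial>K)"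
   using mp by (intro nn_integral_cong) (auto simp: indicator_def ennreal_mult[symmetric] max_def)
  also have "... = ennreal (1 / m) * ennreal m" by (subst nn_integral_cmult, measurable) (simp only: pos_part)
  also have "... = 1" using mp by (subst ennreal_mult[symmetric]) auto
  finally have B': "(\<integral>\<^sup>+y. ?B' y \<partial>K) = 1" .
  have "(\<integral>\<^sup>+y. ?C y \<partial>K) = (\<integral>\<^sup>+y. ennreal (1 / m) * ennreal (max 0 (c - g y)) \<partial>K)"
   using mp by (intro nn_integral_cong) (auto simp: indicator_def ennreal_mult[symmetric] max_def)
  also have "... = ennreal (1 / m) * ennreal m" by (subst nn_integral_cmult, measurable) (simp only: neg_part)
  also have "... = 1" using mp by (subst ennreal_mult[symmetric]) auto
  finally show ?thesis using B' by simp
 qed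
 also have "... = (\<integral>\<^sup>+x. ?A x + ?B x \<partial>K) + (\<integral>\<^sup>+x. ?C' x \<partial>K)"
  by (subst nn_integral_add[OF mA mB]) simp
 also have "... = (\<integral>\<^sup>+x. ?A x + ?B x + ?C' x \<partial>K)"
  by (rule nn_integral_add[symmetric, OF borel_measurable_add[OF mA mB] mC'])
 also have "... = (\<integral>\<^sup>+x. F x \<partial>K)" by (intro nn_integral_cong) (auto simp: indicator_def)
 finally show ?thesis .
qed

text \<open>The case of the constant function 1 in \<open>emb_pair_val_integral\<close>.\<close>

lemma prob_space_emb_pair: "prob_space (emb_pair K g)"
proof (rule prob_spaceI)
 have "emeasure (emb_pair K g) (space (emb_pair K g)) = (\<integral>\<^sup>+z. (\<integral>\<^sup>+w. 1 \<partial>wiener) \<partial>emb_pair K g)"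
  using wiener.emeasure_space_1 by simp
 also have "... = 1" using emb_pair_val_integral[of "\<lambda>_. 1"] K.emeasure_space_1 by simp
 finally show "emeasure (emb_pair K g) (space (emb_pair K g)) = 1" .
qed

sublocale EP: prob_space "emb_pair K g" by (rule prob_space_emb_pair)

sublocale EW: pair_prob_space "emb_pair K g" wiener ..

lemma emb_map_measurable:
 "(\<lambda>(z, w). (emb_val c g a z w, emb_time c g a z w)) \<in> measurable (plane \<Otimes>\<^sub>M path_space) plane"
 unfolding split_beta' by (intro measurable_Pair emb_val_measurable[OF g] emb_time_measurable[OF g]) auto

lemma pair_sets_eq[measurable_cong]: "sets (emb_pair K g \<Otimes>\<^sub>M wiener) = sets (plane \<Otimes>\<^sub>M path_space)"
 by (intro sets_pair_measure_cong) auto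

lemma emb_law_integral:
 assumes [measurable]: "F \<in> borel_measurable plane"
 shows "(\<integral>\<^sup>+y. F y \<partial>emb_law K g a) = (\<integral>\<^sup>+z. (\<integral>\<^sup>+w. F (emb_val c g a z w, emb_time c g a z w) \<partial>wiener) \<partial>emb_pair K g)"
proof -
 have m: "(\<lambda>(z, w). (emb_val c g a z w, emb_time c g a z w)) \<in> measurable (emb_pair K g \<Otimes>\<^sub>M wiener) plane"
  using emb_map_measurable by (simp add: measurable_cong_sets[OF pair_sets_eq refl])
 have "(\<integral>\<^sup>+y. F y \<partial>emb_law K g a) = (\<integral>\<^sup>+p. F (emb_val c g a (fst p) (snd p), emb_time c g a (fst p) (snd p)) \<partial>(emb_pair K g \<Otimes>\<^sub>M wiener))"
  unfolding emb_law_def by (subst nn_integral_distr[OF m]) (auto simp: split_beta')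
 also have "... = (\<integral>\<^sup>+z. (\<integral>\<^sup>+w. F (emb_val c g a z w, emb_time c g a z w) \<partial>wiener) \<partial>emb_pair K g)"
  using measurable_compose[OF m assms] by (subst wiener.nn_integral_fst[symmetric]) (auto simp: split_beta')
 finally show ?thesis .
qed

lemma sets_emb_law[measurable_cong, simp]: "sets (emb_law K g a) = sets plane"
 by (simp add: emb_law_def)

lemma prob_space_emb_law: "prob_space (emb_law K g a)"
 unfolding emb_law_def
 by (rule EW.prob_space_distr) (use emb_map_measurable in \<open>simp add: measurable_cong_sets[OF pair_sets_eq refl]\<close>)

lemma emb_law_fst:
 assumes [measurable]: "f \<in> borel_measurable borel"
 shows "(\<integral>\<^sup>+y. f (fst y) \<partial>emb_law K g a) = (\<integral>\<^sup>+x. f x \<partial>K)"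
 by (subst emb_law_integral) (auto simp: emb_pair_val_integral)

lemma AE_emb_pair: "AE z in emb_pair K g. g (fst z) = c \<or> g (fst z) < c \<and> c < g (snd z)"
 unfolding emb_pair_def
 by (subst AE_density) (auto simp: emb_dens_def split: if_splits intro!: AE_I2)

lemma AE_emb_position:
 "AE z in emb_pair K g. AE w in wiener. 0 \<le> emb_time c g a z w \<and> w (emb_time c g a z w) = a * (g (emb_val c g a z w) - c)"
 using AE_emb_pair
proof eventually_elim
 case (elim z)
 have "AE w in wiener. w \<in> path_set" using AE_space[of wiener] by simp
 moreover have "AE w in wiener. 0 \<le> emb_time c g a z w"
  unfolding emb_time_def by (rule AE_exit) simp
 ultimately show ?case
  by eventually_elim (use emb_position[OF _ a _ elim] in auto)
qed

lemma AE_emb_time: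
 "AE z in emb_pair K g.
   (\<integral>\<^sup>+w. ennreal (emb_time c g a z w) \<partial>wiener) = (\<integral>\<^sup>+w. ennreal (a^2 * (g (emb_val c g a z w) - c)^2) \<partial>wiener) \<and>
   (\<integral>\<^sup>+w. ennreal ((emb_time c g a z w)^2) \<partial>wiener) \<le> (\<integral>\<^sup>+w. ennreal (4 * a ^ 4 * (g (emb_val c g a z w) - c) ^ 4) \<partial>wiener)"
 using AE_emb_position
proof eventually_elim
 case (elim z)
 have lu: "min 0 (a * (g (fst z) - c)) \<le> 0" "0 \<le> max 0 (a * (g (snd z) - c))" by auto
 note em = exit_moments[OF lu, folded emb_time_def]
 have "(\<integral>\<^sup>+w. ennreal (emb_time c g a z w) \<partial>wiener) = ennreal (LINT w|wiener. emb_time c g a z w)"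
  by (rule nn_integral_eq_integral) (use elim exit_moments(2)[OF lu] in \<open>auto simp: emb_time_def\<close>)
 also have "... = ennreal (LINT w|wiener. (w (emb_time c g a z w))^2)" by (simp only: em(3))
 also have "... = (\<integral>\<^sup>+w. ennreal ((w (emb_time c g a z w))^2) \<partial>wiener)"
  by (rule nn_integral_eq_integral[symmetric]) (auto intro: em(6))
 also have "... = (\<integral>\<^sup>+w. ennreal (a^2 * (g (emb_val c g a z w) - c)^2) \<partial>wiener)"
  by (rule nn_integral_cong_AE) (use elim in \<open>eventually_elim, simp add: power_mult_distrib\<close>)
 finally have 1: "(\<integral>\<^sup>+w. ennreal (emb_time c g a z w) \<partial>wiener) = (\<integral>\<^sup>+w. ennreal (a^2 * (g (emb_val c g a z w) - c)^2) \<partial>wiener)" .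
 have "(\<integral>\<^sup>+w. ennreal ((emb_time c g a z w)^2) \<partial>wiener) = ennreal (LINT w|wiener. (emb_time c g a z w)^2)"
  by (intro nn_integral_eq_integral em(4)) auto
 also have "... \<le> ennreal (LINT w|wiener. 4 * (w (emb_time c g a z w)) ^ 4)" using em(5) by (intro ennreal_leI) simp
 also have "... = (\<integral>\<^sup>+w. ennreal (4 * (w (emb_time c g a z w)) ^ 4) \<partial>wiener)"
  by (rule nn_integral_eq_integral[symmetric]) (auto intro: em(6))
 also have "... = (\<integral>\<^sup>+w. ennreal (4 * a ^ 4 * (g (emb_val c g a z w) - c) ^ 4) \<partial>wiener)"
  by (rule nn_integral_cong_AE) (use elim in \<open>eventually_elim, simp add: power_mult_distrib mult.assoc\<close>)
 finally show ?case using 1 by simp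
qed

text \<open>Wald's identity for each drawn interval, followed by averaging over the intervals; the
  exit position is \<open>a * (g - c)\<close> at a point of law \<open>K\<close>.\<close>

lemma emb_law_time_mean:
 "(\<integral>\<^sup>+y. ennreal (snd y) \<partial>emb_law K g a) = (\<integral>\<^sup>+x. ennreal (a^2 * (g x - c)^2) \<partial>K)"
proof -
 have "(\<integral>\<^sup>+y. ennreal (snd y) \<partial>emb_law K g a) = (\<integral>\<^sup>+z. (\<integral>\<^sup>+w. ennreal (emb_time c g a z w) \<partial>wiener) \<partial>emb_pair K g)"
  by (subst emb_law_integral) auto
 also have "... = (\<integral>\<^sup>+z. (\<integral>\<^sup>+w. ennreal (a^2 * (g (emb_val c g a z w) - c)^2) \<partial>wiener) \<partial>emb_pair K g)"
  by (rule nn_integral_cong_AE) (use AE_emb_time in \<open>eventually_elim, simp\<close>)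
 also have "... = (\<integral>\<^sup>+x. ennreal (a^2 * (g x - c)^2) \<partial>K)" by (rule emb_pair_val_integral) auto
 finally show ?thesis .
qed

lemma emb_law_time_square:
 "(\<integral>\<^sup>+y. ennreal ((snd y)^2) \<partial>emb_law K g a) \<le> (\<integral>\<^sup>+x. ennreal (4 * a ^ 4 * (g x - c) ^ 4) \<partial>K)"
proof -
 have "(\<integral>\<^sup>+y. ennreal ((snd y)^2) \<partial>emb_law K g a) = (\<integral>\<^sup>+z. (\<integral>\<^sup>+w. ennreal ((emb_time c g a z w)^2) \<partial>wiener) \<partial>emb_pair K g)"
  by (subst emb_law_integral) auto
 also have "... \<le> (\<integral>\<^sup>+z. (\<integral>\<^sup>+w. ennreal (4 * a ^ 4 * (g (emb_val c g a z w) - c) ^ 4) \<partial>wiener) \<partial>emb_pair K g)"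
  by (rule nn_integral_mono_AE) (use AE_emb_time in \<open>eventually_elim, simp\<close>)
 also have "... = (\<integral>\<^sup>+x. ennreal (4 * a ^ 4 * (g x - c) ^ 4) \<partial>K)" by (rule emb_pair_val_integral) auto
 finally show ?thesis .
qed

text \<open>\<open>wiener_regeneration\<close> for each drawn pair: value and time are functions of
  the pair and of the exit, so the restarted path is an independent Wiener path, and this persists
  after averaging over the pairs.\<close>

lemma emb_regeneration:
 assumes F: "F \<in> borel_measurable (plane \<Otimes>\<^sub>M path_space)"
 shows "(\<integral>\<^sup>+z. (\<integral>\<^sup>+w. F ((emb_val c g a z w, emb_time c g a z w), path_shift (emb_time c g a z w) w) \<partial>wiener) \<partial>emb_pair K g)
  = (\<integral>\<^sup>+y. (\<integral>\<^sup>+w. F (y, w) \<partial>wiener) \<partial>emb_law K g a)"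
proof -
 have Fw: "F \<in> borel_measurable (plane \<Otimes>\<^sub>M wiener)"
  using F by (simp cong: measurable_cong_sets sets_pair_measure_cong)
 have Fm: "(\<lambda>y. \<integral>\<^sup>+w. F (y, w) \<partial>wiener) \<in> borel_measurable plane"
  by (rule wiener.borel_measurable_nn_integral_fst[OF Fw])
 have "(\<integral>\<^sup>+w. F ((emb_val c g a z w, emb_time c g a z w), path_shift (emb_time c g a z w) w) \<partial>wiener)
  = (\<integral>\<^sup>+w. (\<integral>\<^sup>+w'. F ((emb_val c g a z w, emb_time c g a z w), w') \<partial>wiener) \<partial>wiener)" for z
 proof -
  let ?l = "min 0 (a * (g (fst z) - c))" and ?u = "max 0 (a * (g (snd z) - c))"
  let ?T = "exit_time ?l ?u"
  have lu: "?l \<le> 0" "0 \<le> ?u" by auto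
  have lu': "?l \<le> ?u" using lu by linarith
  define H where "H = (\<lambda>p :: (real \<times> real) \<times> (real => real). F ((if snd (fst p) \<le> ?l then fst z else snd z, fst (fst p)), snd p))"
  have Hm: "H \<in> borel_measurable (plane \<Otimes>\<^sub>M path_space)"
   unfolding H_def by (rule measurable_compose[OF _ F]) measurable
  have Hw: "H \<in> borel_measurable (plane \<Otimes>\<^sub>M wiener)"
   using Hm by (simp cong: measurable_cong_sets sets_pair_measure_cong)
  let ?D = "distr wiener plane (\<lambda>w. (?T w, w (?T w)))"
  have TY: "(\<lambda>w. (?T w, w (?T w))) \<in> measurable wiener plane" by (rule TY_meas[OF lu])
  have gm: "(\<lambda>w. ((?T w, w (?T w)), path_shift (?T w) w)) \<in> measurable wiener (plane \<Otimes>\<^sub>M path_space)"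
  proof (rule measurable_Pair[OF TY])
   show "(\<lambda>w. path_shift (?T w) w) \<in> measurable wiener path_space"
    using exit_shift_meas[OF lu' sets.empty_sets] by (simp add: measurable_cong_sets[OF sets_wiener refl])
  qed
  have "(\<integral>\<^sup>+w. F ((emb_val c g a z w, emb_time c g a z w), path_shift (emb_time c g a z w) w) \<partial>wiener)
   = (\<integral>\<^sup>+w. H ((?T w, w (?T w)), path_shift (?T w) w) \<partial>wiener)"
   by (simp add: H_def emb_val_def emb_time_def)
  also have "... = (\<integral>\<^sup>+p. H p \<partial>distr wiener (plane \<Otimes>\<^sub>M path_space) (\<lambda>w. ((?T w, w (?T w)), path_shift (?T w) w)))"
   by (rule nn_integral_distr[symmetric, OF gm]) (use Hm in simp)
  also have "... = (\<integral>\<^sup>+p. H p \<partial>(?D \<Otimes>\<^sub>M wiener))" unfolding wiener_regeneration[OF lu'] ..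
  also have "... = (\<integral>\<^sup>+q. (\<integral>\<^sup>+w'. H (q, w') \<partial>wiener) \<partial>?D)"
   by (rule wiener.nn_integral_fst[symmetric]) (use Hw in \<open>simp cong: measurable_cong_sets sets_pair_measure_cong\<close>)
  also have "... = (\<integral>\<^sup>+w. (\<integral>\<^sup>+w'. H ((?T w, w (?T w)), w') \<partial>wiener) \<partial>wiener)"
   by (rule nn_integral_distr[OF TY]) (use wiener.borel_measurable_nn_integral_fst[OF Hw] in simp)
  finally show ?thesis by (simp add: H_def emb_val_def emb_time_def)
 qed
 then show ?thesis by (simp add: emb_law_integral[OF Fm])
qed

end

section \<open>Embedding a dependent sequence in one path\<close>

lemma emb_mean_measurable:
 assumes L: "L \<in> measurable M (subprob_algebra borel)" and g: "g \<in> borel_measurable borel"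
 shows "(\<lambda>x. emb_mean (L x) g) \<in> borel_measurable M"
 unfolding emb_mean_def
 by (rule measurable_compose[OF L]) (rule integral_measurable_subprob_algebra[OF g])

lemma emb_half_measurable:
 assumes L: "L \<in> measurable M (subprob_algebra borel)" and g[measurable]: "g \<in> borel_measurable borel"
  and prob: "\<And>x. x \<in> space M ==> prob_space (L x)" and b: "\<And>x. \<bar>g x\<bar> \<le> G"
 shows "(\<lambda>x. emb_half (L x) g) \<in> borel_measurable M"
proof -
 note [measurable] = emb_mean_measurable[OF L g]
 have "(\<lambda>z. g (snd z)) \<in> borel_measurable (M \<Otimes>\<^sub>M borel)" by (rule measurable_compose[OF _ g]) simp
  then have [measurable]: "(\<lambda>x. \<integral>\<^sup>+y. ennreal (max 0 (g y - emb_mean (L x) g)) \<partial>L x) \<in> borel_measurable M"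
   by (intro nn_integral_measurable_subprob_algebra2[OF _ L]) (simp add: split_beta')
 have "(\<lambda>x. enn2real (\<integral>\<^sup>+y. ennreal (max 0 (g y - emb_mean (L x) g)) \<partial>L x)) \<in> borel_measurable M"
  by measurable
 moreover have "emb_half (L x) g = enn2real (\<integral>\<^sup>+y. ennreal (max 0 (g y - emb_mean (L x) g)) \<partial>L x)" if x: "x \<in> space M" for x
 proof -
  interpret skorokhod_step "L x" g 1 G
   by (rule skorokhod_step.intro[OF prob[OF x] sets_kernel[OF L x] g b zero_less_one])
  show ?thesis using pos_part m_nonneg by simp
 qed
 ultimately show ?thesis by (simp cong: measurable_cong)
qed

text \<open>The interval is drawn from a law that depends on the past, so \<open>emb_pair\<close>
  has to be a kernel in its parameter before a chain can be built.\<close>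

lemma emb_pair_measurable:
 assumes L: "L \<in> measurable M (subprob_algebra borel)" and g[measurable]: "g \<in> borel_measurable borel"
  and prob: "\<And>x. x \<in> space M ==> prob_space (L x)" and b: "\<And>x. \<bar>g x\<bar> \<le> G"
 shows "(\<lambda>x. emb_pair (L x) g) \<in> measurable M (subprob_algebra plane)"
proof (rule measurable_subprob_algebra)
 fix x assume x: "x \<in> space M"
 interpret skorokhod_step "L x" g 1 G
  by (rule skorokhod_step.intro[OF prob[OF x] sets_kernel[OF L x] g b zero_less_one])
 show "subprob_space (emb_pair (L x) g)" using prob_space_emb_pair by (rule prob_space_imp_subprob_space)
 show "sets (emb_pair (L x) g) = sets plane" by simp
next
 fix A :: "(real \<times> real) set" assume A[measurable]: "A \<in> sets plane"
 note [measurable] = emb_mean_measurable[OF L g] emb_half_measurable[OF L g prob b]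
 have [measurable]: "(\<lambda>p. g (fst (snd p))) \<in> borel_measurable (M \<Otimes>\<^sub>M plane)"
  "(\<lambda>p. g (snd (snd p))) \<in> borel_measurable (M \<Otimes>\<^sub>M plane)"
  by (rule measurable_compose[OF _ g], measurable)+
 have LL: "(\<lambda>x. L x \<Otimes>\<^sub>M L x) \<in> measurable M (subprob_algebra plane)"
  by (rule measurable_pair_measure[OF L L])
 have "(\<lambda>x. \<integral>\<^sup>+z. emb_dens (emb_mean (L x) g) (emb_half (L x) g) g (fst z) (snd z) * indicator A z \<partial>(L x \<Otimes>\<^sub>M L x)) \<in> borel_measurable M"
 proof (rule nn_integral_measurable_subprob_algebra2[OF _ LL])
  show "(\<lambda>(x, z). emb_dens (emb_mean (L x) g) (emb_half (L x) g) g (fst z) (snd z) * indicator A z) \<in> borel_measurable (M \<Otimes>\<^sub>M plane)"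
   unfolding emb_dens_def split_beta' by measurable
 qed
 moreover have "emeasure (emb_pair (L x) g) A = (\<integral>\<^sup>+z. emb_dens (emb_mean (L x) g) (emb_half (L x) g) g (fst z) (snd z) * indicator A z \<partial>(L x \<Otimes>\<^sub>M L x))" if x: "x \<in> space M" for x
 proof -
  interpret skorokhod_step "L x" g 1 G
   by (rule skorokhod_step.intro[OF prob[OF x] sets_kernel[OF L x] g b zero_less_one])
  have "A \<in> sets (L x \<Otimes>\<^sub>M L x)" using A by (simp cong: sets_pair_measure_cong)
  then show ?thesis unfolding emb_pair_def
   by (subst emeasure_density) (auto simp: split_beta')
 qed
 ultimately show "(\<lambda>x. emeasure (emb_pair (L x) g) A) \<in> borel_measurable M" by (simp cong: measurable_cong)
qed

section \<open>Integrals along an Ionescu-Tulcea chain\<close>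

context Ionescu_Tulcea
begin

lemma distr_lim_C: "distr PF.lim (PiM {0..<n} M) (\<lambda>s. restrict s {0..<n}) = C 0 n (\<lambda>_. undefined)"
proof -
 have x: "(\<lambda>_. undefined) \<in> space (PiM {0..<0::nat} M)" by (simp add: space_PiM)
 have "up_to {0..<n} = n"
  by (intro antisym up_to_iff[THEN iffD2]) (auto simp: up_to_iff[symmetric], use up_to_less[of "{0..<n}" "n - 1"] in force)
 then have "CI {0..<n} = distr (C 0 n (\<lambda>_. undefined)) (PiM {0..<n} M) (\<lambda>f. restrict f {0..<n})"
  by (simp add: CI_def)
 also have "... = distr (C 0 n (\<lambda>_. undefined)) (C 0 n (\<lambda>_. undefined)) (\<lambda>f. f)"
  using sets_C[OF x, of n] space_C[OF x, of n]
  by (intro distr_cong) (auto simp: space_PiM restrict_PiE_iff PiE_restrict)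
 finally show ?thesis by (simp add: distr_lim)
qed

lemma prob_space_lim: "prob_space PF.lim"
proof (rule prob_space_distrD)
 show "(\<lambda>x. restrict x {0..<0}) \<in> measurable PF.lim (PiM {0..<0} M)"
  by (auto simp: measurable_cong_sets[OF PF.sets_lim refl] intro!: measurable_restrict_subset)
 show "prob_space (distr PF.lim (PiM {0..<0} M) (\<lambda>x. restrict x {0..<0}))"
  unfolding distr_lim_C by (rule prob_space_C) (simp add: space_PiM)
qed

text \<open>One-step disintegration of the limit measure; all facts about conditional laws of the
  chain are derived from it.\<close>

lemma nn_integral_lim_step:
 assumes f[measurable]: "f \<in> borel_measurable (PiM {0..<Suc n} M)"
 shows "(\<integral>\<^sup>+z. f (restrict z {0..<Suc n}) \<partial>PF.lim)
  = (\<integral>\<^sup>+z. (\<integral>\<^sup>+x. f ((restrict z {0..<n})(n := x)) \<partial>P n (restrict z {0..<n})) \<partial>PF.lim)"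
proof -
 have x: "(\<lambda>_. undefined) \<in> space (PiM {0..<0::nat} M)" by (simp add: space_PiM)
 have r: "(\<lambda>z. restrict z {0..<k}) \<in> measurable PF.lim (PiM {0..<k} M)" for k
  by (auto simp: measurable_cong_sets[OF PF.sets_lim refl] intro!: measurable_restrict_subset)
 have "(\<integral>\<^sup>+z. f (restrict z {0..<Suc n}) \<partial>PF.lim) = (\<integral>\<^sup>+s. f s \<partial>C 0 (Suc n) (\<lambda>_. undefined))"
  unfolding distr_lim_C[symmetric] by (rule nn_integral_distr[symmetric, OF r]) (use f in simp)
 also have "... = (\<integral>\<^sup>+s. (\<integral>\<^sup>+s'. f s' \<partial>eP n s) \<partial>C 0 n (\<lambda>_. undefined))"
 proof -
  have e: "eP (0 + n) \<in> measurable (C 0 n (\<lambda>_. undefined)) (subprob_algebra (PiM {0..<Suc n} M))"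
   using measurable_eP[of n] sets_C[OF x, of n] by (simp add: measurable_cong_sets[of "C 0 n (\<lambda>_. undefined)" "PiM {0..<n} M"])
  show ?thesis unfolding C.simps
   by (subst nn_integral_bind[OF f e]) simp
 qed
 also have "... = (\<integral>\<^sup>+s. (\<integral>\<^sup>+x. f (fun_upd s n x) \<partial>P n s) \<partial>C 0 n (\<lambda>_. undefined))"
  using space_C[OF x, of n] by (intro nn_integral_cong nn_integral_eP f) auto
 also have "... = (\<integral>\<^sup>+z. (\<integral>\<^sup>+x. f ((restrict z {0..<n})(n := x)) \<partial>P n (restrict z {0..<n})) \<partial>PF.lim)"
  unfolding distr_lim_C[symmetric]
 proof (rule nn_integral_distr[OF r])
  have "(\<lambda>(s, x). f (s(n := x))) \<in> borel_measurable (PiM {0..<n} M \<Otimes>\<^sub>M M n)"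
  proof -
   have "(\<lambda>(s, x). s(n := x)) \<in> measurable (PiM {0..<n} M \<Otimes>\<^sub>M M n) (PiM {0..<Suc n} M)"
    unfolding split_beta' by (rule measurable_fun_upd[where J="{0..<n}"]) auto
   from measurable_compose[OF this f] show ?thesis by (simp add: split_beta')
  qed
  from nn_integral_measurable_subprob_algebra2[OF this P]
  show "(\<lambda>s. \<integral>\<^sup>+x. f (s(n := x)) \<partial>P n s) \<in> borel_measurable (distr PF.lim (PiM {0..<n} M) (\<lambda>z. restrict z {0..<n}))"
   by simp
 qed
 finally show ?thesis .
qed

end

abbreviation hist_space :: "(nat => real \<times> real) measure" where
 "hist_space \<equiv> PiM UNIV (\<lambda>_. plane)"

text \<open>The step taken, the Brownian time it consumed, and the path that is left after that
  time.\<close>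

type_synonym state = "real \<times> real \<times> (real => real)"

abbreviation state_space :: "state measure" where
 "state_space \<equiv> borel \<Otimes>\<^sub>M (borel \<Otimes>\<^sub>M path_space)"

text \<open>\<open>K i h\<close> is the law of step \<open>i\<close> given the earlier steps, passed
  as a sequence padded with zeros. \<open>g i\<close> is the bounded function to be embedded and
  \<open>a i\<close> its scale.\<close>

locale skorokhod_chain =
 fixes K :: "nat => (nat => real) => real measure" and g :: "nat => real => real" and a G :: "nat => real"
 assumes K: "\<And>i. K i \<in> measurable (PiM UNIV (\<lambda>_. borel)) (subprob_algebra borel)"
  and prob_K: "\<And>i h. prob_space (K i h)"
  and g: "\<And>i. g i \<in> borel_measurable borel" and g_bound: "\<And>i x. \<bar>g i x\<bar> \<le> G i" and a: "\<And>i. 0 < a i"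
begin

lemma step: "skorokhod_step (K i h) (g i) (a i) (G i)"
proof (rule skorokhod_step.intro[OF prob_K _ g g_bound a])
 show "sets (K i h) = sets borel" by (rule sets_kernel[OF K]) (simp add: space_PiM)
qed

definition cm :: "nat => (nat => real) => real" where "cm i h = emb_mean (K i h) (g i)"

lemma cm_measurable: "cm i \<in> borel_measurable (PiM UNIV (\<lambda>_. borel))"
 unfolding cm_def[abs_def] by (rule emb_mean_measurable[OF K g])

definition upd :: "nat => (nat => real) => (real => real) => real \<times> real => state" where
 "upd i h w z = (emb_val (cm i h) (g i) (a i) z w, emb_time (cm i h) (g i) (a i) z w,
   path_shift (emb_time (cm i h) (g i) (a i) z w) w)"

lemma upd_measurable:
 assumes h: "h \<in> measurable M (PiM UNIV (\<lambda>_. borel))" and w: "w \<in> measurable M path_space"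
  and z: "z \<in> measurable M plane"
 shows "(\<lambda>x. upd i (h x) (w x) (z x)) \<in> measurable M state_space"
proof -
 have c: "(\<lambda>x. cm i (h x)) \<in> borel_measurable M" by (rule measurable_compose[OF h cm_measurable])
 note t = emb_time_measurable[OF g c z w]
 show ?thesis unfolding upd_def
  by (intro measurable_Pair emb_val_measurable[OF g c z w] t path_shift_measurable2[OF w t])
qed

text \<open>State 0 holds only the initial path, so step \<open>j\<close> is found in state
  \<open>Suc j\<close>.\<close>

definition hx :: "nat => (nat => state) => nat => real" where
 "hx i s = (\<lambda>j. if j < i then fst (s (Suc j)) else 0)"

definition wp :: "nat => (nat => state) => real => real" where
 "wp i s = snd (snd (s i))"

text \<open>The path is drawn once, in state 0. From then on only the pair determining the interval
  is random, and the path moves deterministically by shifts; this is what places all steps in one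
  Brownian path.\<close>

definition kern :: "nat => (nat => state) => state measure" where
 "kern n s = (case n of 0 => distr wiener state_space (\<lambda>w. (0, 0, w))
   | Suc i => distr (emb_pair (K i (hx i s)) (g i)) state_space (upd i (hx i s) (wp i s)))"

lemma component_measurable: "i \<in> J ==> (\<lambda>s. s i) \<in> measurable (PiM J (\<lambda>_. state_space)) state_space"
 by (rule measurable_component_singleton)

lemma hist_component: "(\<lambda>h. h j) \<in> measurable hist_space plane"
 by (rule measurable_component_singleton) simp

lemma hx_measurable:
 assumes "{Suc j | j. j < i} \<subseteq> J"
 shows "hx i \<in> measurable (PiM J (\<lambda>_. state_space)) (PiM UNIV (\<lambda>_. borel))"
proof (rule measurable_PiM_single')
 fix j
 show "(\<lambda>s. hx i s j) \<in> borel_measurable (PiM J (\<lambda>_. state_space))"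
 proof (cases "j < i")
  case True
  then have "Suc j \<in> J" using assms by auto
  then show ?thesis using True by (auto simp: hx_def intro!: measurable_compose[OF component_measurable measurable_fst])
 qed (simp add: hx_def)
qed (auto simp: hx_def)

lemma wp_measurable:
 assumes "i \<in> J" shows "wp i \<in> measurable (PiM J (\<lambda>_. state_space)) path_space"
 unfolding wp_def[abs_def] using measurable_component_singleton[OF assms, of "\<lambda>_. state_space"]
 by (intro measurable_compose[OF _ measurable_snd] measurable_compose[OF _ measurable_snd[of borel]])

lemma kern_measurable: "kern n \<in> measurable (PiM {0..<n} (\<lambda>_. state_space)) (subprob_algebra state_space)"
proof (cases n)
 case 0
 have "(\<lambda>w. (0, 0, w)) \<in> measurable wiener state_space" by simp
 then have "prob_space (distr wiener state_space (\<lambda>w. (0, 0, w)))" by (rule wiener.prob_space_distr)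
 then have "distr wiener state_space (\<lambda>w. (0, 0, w)) \<in> space (subprob_algebra state_space)"
  by (auto simp: space_subprob_algebra prob_space_imp_subprob_space)
 then show ?thesis by (simp add: 0 kern_def[abs_def])
next
 case (Suc i)
 have h: "hx i \<in> measurable (PiM {0..<n} (\<lambda>_. state_space)) (PiM UNIV (\<lambda>_. borel))"
  by (rule hx_measurable) (auto simp: Suc)
 have w: "wp i \<in> measurable (PiM {0..<n} (\<lambda>_. state_space)) path_space"
  by (rule wp_measurable) (simp add: Suc)
 have "(\<lambda>s. distr (emb_pair (K i (hx i s)) (g i)) state_space (upd i (hx i s) (wp i s)))
   \<in> measurable (PiM {0..<n} (\<lambda>_. state_space)) (subprob_algebra state_space)"
 proof (rule measurable_distr2)
  show "(\<lambda>(s, z). upd i (hx i s) (wp i s) z) \<in> measurable (PiM {0..<n} (\<lambda>_. state_space) \<Otimes>\<^sub>M plane) state_space"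
   unfolding split_beta'
   by (rule upd_measurable)
    (auto intro: measurable_compose[OF measurable_fst h] measurable_compose[OF measurable_fst w])
  show "(\<lambda>s. emb_pair (K i (hx i s)) (g i)) \<in> measurable (PiM {0..<n} (\<lambda>_. state_space)) (subprob_algebra plane)"
   by (rule emb_pair_measurable[OF measurable_compose[OF h K] g prob_K g_bound])
 qed
 then show ?thesis by (simp add: Suc kern_def[abs_def])
qed

lemma kern_prob: "s \<in> space (PiM {0..<n} (\<lambda>_. state_space)) ==> prob_space (kern n s)"
proof (cases n)
 case 0
 show ?thesis by (simp add: 0 kern_def wiener.prob_space_distr)
next
 case (Suc i)
 assume s: "s \<in> space (PiM {0..<n} (\<lambda>_. state_space))"
 interpret st: skorokhod_step "K i (hx i s)" "g i" "a i" "G i" by (rule step)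
 have w: "wp i s \<in> path_set" using measurable_space[OF wp_measurable[of i "{0..<n}"] s] Suc by simp
 have "upd i (hx i s) (wp i s) \<in> measurable plane state_space"
  using w by (intro upd_measurable measurable_const) (auto simp: space_PiM)
 then show ?thesis unfolding Suc kern_def
  by (auto intro!: st.EP.prob_space_distr simp: measurable_cong_sets[OF st.sets_emb_pair refl])
qed

sublocale IT: Ionescu_Tulcea kern "\<lambda>_. state_space"
 by (rule Ionescu_Tulcea.intro[OF kern_measurable kern_prob])

abbreviation "Om \<equiv> IT.PF.lim"

sublocale chain: prob_space Om
 by (rule IT.prob_space_lim)

lemma sets_Om[measurable_cong]: "sets Om = sets (PiM UNIV (\<lambda>_. state_space))"
 by simp

lemma measurable_Om: "measurable Om N = measurable (PiM UNIV (\<lambda>_. state_space)) N"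
 by (rule measurable_cong_sets) auto

definition xi :: "nat => (nat => state) => real" where "xi i s = fst (s (Suc i))"
definition dt :: "nat => (nat => state) => real" where "dt i s = fst (snd (s (Suc i)))"
definition hist :: "nat => (nat => state) => nat => real \<times> real" where
 "hist i s = (\<lambda>j. if j < i then (xi j s, dt j s) else (0, 0))"

lemma xi_measurable': "Suc i \<in> J ==> xi i \<in> borel_measurable (PiM J (\<lambda>_. state_space))"
 unfolding xi_def[abs_def] by (rule measurable_compose[OF component_measurable measurable_fst])

lemma dt_measurable': "Suc i \<in> J ==> dt i \<in> borel_measurable (PiM J (\<lambda>_. state_space))"
 unfolding dt_def[abs_def]
 by (rule measurable_compose[OF measurable_compose[OF component_measurable measurable_snd] measurable_fst])

lemma hist_measurable': "{Suc j | j. j < i} \<subseteq> J ==> hist i \<in> measurable (PiM J (\<lambda>_. state_space)) hist_space"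
proof (rule measurable_PiM_single')
 fix j assume "{Suc j | j. j < i} \<subseteq> J"
 then show "(\<lambda>s. hist i s j) \<in> measurable (PiM J (\<lambda>_. state_space)) plane"
  unfolding hist_def by (cases "j < i") (auto intro!: measurable_Pair xi_measurable' dt_measurable')
qed (auto simp: space_pair_measure)

lemma xi_measurable[measurable]: "xi i \<in> borel_measurable Om"
 unfolding measurable_Om by (rule xi_measurable') simp

lemma dt_measurable[measurable]: "dt i \<in> borel_measurable Om"
 unfolding measurable_Om by (rule dt_measurable') simp

lemma hist_measurable[measurable]: "hist i \<in> measurable Om hist_space"
 unfolding measurable_Om by (rule hist_measurable') simp

lemma wp_measurable_Om[measurable]: "wp i \<in> measurable Om path_space"
 unfolding measurable_Om by (rule wp_measurable) simp

lemma hx_hist: "hx i s = (\<lambda>j. fst (hist i s j))"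
 by (auto simp: hx_def hist_def xi_def)

definition fsts :: "(nat => real \<times> real) => nat => real" where "fsts h = (\<lambda>j. fst (h j))"

lemma fsts_measurable[measurable]: "fsts \<in> measurable hist_space (PiM UNIV (\<lambda>_. borel))"
proof (rule measurable_PiM_single')
 fix j show "(\<lambda>h. fsts h j) \<in> borel_measurable hist_space"
  unfolding fsts_def by (rule measurable_compose[OF hist_component[of j] measurable_fst])
qed auto

text \<open>Only the pair is integrated out here. The remaining path is still the concrete
  \<open>wp i y\<close>; averaging over it has to wait until it is known to be independent of the
  history.\<close>

lemma transition_raw:
 assumes F: "F \<in> borel_measurable (hist_space \<Otimes>\<^sub>M (path_space \<Otimes>\<^sub>M state_space))"
 shows "(\<integral>\<^sup>+y. F (hist i y, wp i y, y (Suc i)) \<partial>Om) =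
  (\<integral>\<^sup>+y. (\<integral>\<^sup>+z. F (hist i y, wp i y, upd i (fsts (hist i y)) (wp i y) z) \<partial>emb_pair (K i (fsts (hist i y))) (g i)) \<partial>Om)"
proof -
 define f where "f = (\<lambda>s. F (hist i s, wp i s, s (Suc i)))"
 have fm: "f \<in> borel_measurable (PiM {0..<Suc (Suc i)} (\<lambda>_. state_space))"
  unfolding f_def
  by (rule measurable_compose[OF _ F])
   (auto intro!: measurable_Pair hist_measurable' wp_measurable component_measurable)
 have h1: "hist i (restrict y {0..<Suc (Suc i)}) = hist i y" "wp i (restrict y {0..<Suc (Suc i)}) = wp i y" for y
  by (auto simp: hist_def wp_def xi_def dt_def fun_eq_iff)
 have h2: "hist i ((restrict y {0..<Suc i})(Suc i := x)) = hist i y" "wp i ((restrict y {0..<Suc i})(Suc i := x)) = wp i y" for y x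
  by (auto simp: hist_def wp_def xi_def dt_def fun_eq_iff)
 have h3: "hx i (restrict y {0..<Suc i}) = fsts (hist i y)" "wp i (restrict y {0..<Suc i}) = wp i y" for y
  by (auto simp: hx_def hist_def wp_def xi_def dt_def fsts_def fun_eq_iff)
 have "(\<integral>\<^sup>+y. F (hist i y, wp i y, y (Suc i)) \<partial>Om) = (\<integral>\<^sup>+y. f (restrict y {0..<Suc (Suc i)}) \<partial>Om)"
  unfolding f_def h1 by simp
 also have "... = (\<integral>\<^sup>+y. (\<integral>\<^sup>+x. f ((restrict y {0..<Suc i})(Suc i := x)) \<partial>kern (Suc i) (restrict y {0..<Suc i})) \<partial>Om)"
  by (rule IT.nn_integral_lim_step[OF fm])
 also have "... = (\<integral>\<^sup>+y. (\<integral>\<^sup>+z. F (hist i y, wp i y, upd i (fsts (hist i y)) (wp i y) z) \<partial>emb_pair (K i (fsts (hist i y))) (g i)) \<partial>Om)"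
 proof (rule nn_integral_cong)
  fix y assume y: "y \<in> space Om"
  interpret st: skorokhod_step "K i (fsts (hist i y))" "g i" "a i" "G i" by (rule step)
  have w: "wp i y \<in> path_set" using measurable_space[OF wp_measurable_Om y] by simp
  have h: "hist i y \<in> space hist_space" using measurable_space[OF hist_measurable y] .
  have um: "upd i (fsts (hist i y)) (wp i y) \<in> measurable (emb_pair (K i (fsts (hist i y))) (g i)) state_space"
   using w by (simp add: measurable_cong_sets[OF st.sets_emb_pair refl]) (intro upd_measurable; simp add: space_PiM)
  have Fm: "(\<lambda>x. F (hist i y, wp i y, x)) \<in> borel_measurable state_space"
   using w h by (intro measurable_compose[OF _ F] measurable_Pair) auto
  show "(\<integral>\<^sup>+x. f ((restrict y {0..<Suc i})(Suc i := x)) \<partial>kern (Suc i) (restrict y {0..<Suc i}))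
   = (\<integral>\<^sup>+z. F (hist i y, wp i y, upd i (fsts (hist i y)) (wp i y) z) \<partial>emb_pair (K i (fsts (hist i y))) (g i))"
   unfolding f_def h2 kern_def using nn_integral_distr[OF um, of "\<lambda>x. F (hist i y, wp i y, x)"] Fm by (simp add: h3 fun_upd_same)
 qed
 finally show ?thesis .
qed

definition law :: "nat => (nat => real \<times> real) => (real \<times> real) measure" where
 "law i h = emb_law (K i (fsts h)) (g i) (a i)"

lemma hist_Suc: "hist (Suc i) s = (hist i s)(i := (xi i s, dt i s))"
 by (auto simp: hist_def fun_eq_iff)

lemmas K_hist = measurable_compose[OF fsts_measurable K]
lemmas emb_pair_hist = emb_pair_measurable[OF K_hist g prob_K g_bound]

lemma law_measurable: "law i \<in> measurable hist_space (subprob_algebra plane)"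
proof -
 have c: "(\<lambda>h. emb_mean (K i (fsts h)) (g i)) \<in> borel_measurable hist_space"
  by (rule emb_mean_measurable[OF K_hist g])
 have W: "(\<lambda>h. wiener) \<in> measurable hist_space (subprob_algebra path_space)"
  by (rule measurable_const) (simp add: space_subprob_algebra prob_space_imp_subprob_space prob_space_wiener)
 have PW: "(\<lambda>h. emb_pair (K i (fsts h)) (g i) \<Otimes>\<^sub>M wiener) \<in> measurable hist_space (subprob_algebra (plane \<Otimes>\<^sub>M path_space))"
  by (rule measurable_pair_measure[OF emb_pair_hist W])
 show ?thesis unfolding law_def[abs_def] emb_law_def
 proof (rule measurable_distr2[OF _ PW])
  have c': "(\<lambda>x. emb_mean (K i (fsts (fst x))) (g i)) \<in> borel_measurable (hist_space \<Otimes>\<^sub>M (plane \<Otimes>\<^sub>M path_space))"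
   by (rule measurable_compose[OF measurable_fst c])
  have z: "(\<lambda>x. fst (snd x)) \<in> measurable (hist_space \<Otimes>\<^sub>M (plane \<Otimes>\<^sub>M path_space)) plane"
   by (rule measurable_compose[OF measurable_snd measurable_fst])
  have w: "(\<lambda>x. snd (snd x)) \<in> measurable (hist_space \<Otimes>\<^sub>M (plane \<Otimes>\<^sub>M path_space)) path_space"
   by (rule measurable_compose[OF measurable_snd measurable_snd])
  show "(\<lambda>(h, z, w). (emb_val (emb_mean (K i (fsts h)) (g i)) (g i) (a i) z w, emb_time (emb_mean (K i (fsts h)) (g i)) (g i) (a i) z w))
   \<in> measurable (hist_space \<Otimes>\<^sub>M (plane \<Otimes>\<^sub>M path_space)) plane"
   unfolding split_beta'
   by (rule measurable_Pair[OF emb_val_measurable[OF g c' z w] emb_time_measurable[OF g c' z w]])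
 qed
qed

text \<open>Freshness of the path is a hypothesis at index \<open>i\<close>, because its inductive
  proof in \<open>fresh_path\<close> uses this transition at the previous index. With it, the path
  can be integrated first and the pair afterwards.\<close>

lemma transition_full:
 assumes F: "F \<in> borel_measurable (hist_space \<Otimes>\<^sub>M (path_space \<Otimes>\<^sub>M state_space))"
  and fresh: "\<And>H. H \<in> borel_measurable (hist_space \<Otimes>\<^sub>M path_space) ==>
   (\<integral>\<^sup>+s. H (hist i s, wp i s) \<partial>Om) = (\<integral>\<^sup>+s. (\<integral>\<^sup>+w. H (hist i s, w) \<partial>wiener) \<partial>Om)"
 shows "(\<integral>\<^sup>+s. F (hist i s, wp i s, s (Suc i)) \<partial>Om) =
  (\<integral>\<^sup>+s. (\<integral>\<^sup>+z. (\<integral>\<^sup>+w. F (hist i s, w, upd i (fsts (hist i s)) w z) \<partial>wiener) \<partial>emb_pair (K i (fsts (hist i s))) (g i)) \<partial>Om)"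
proof -
 define G' where "G' = (\<lambda>h w z. F (h, w, upd i (fsts h) w z))"
 let ?S = "(hist_space \<Otimes>\<^sub>M path_space) \<Otimes>\<^sub>M plane"
 have G': "(\<lambda>((h, w), z). G' h w z) \<in> borel_measurable ?S"
 proof -
  have h: "(\<lambda>x. fst (fst x)) \<in> measurable ?S hist_space" by (rule measurable_compose[OF measurable_fst measurable_fst])
  have w: "(\<lambda>x. snd (fst x)) \<in> measurable ?S path_space" by (rule measurable_compose[OF measurable_fst measurable_snd])
  show ?thesis unfolding G'_def split_beta'
   by (rule measurable_compose[OF _ F])
    (intro measurable_Pair h w upd_measurable[OF measurable_compose[OF h fsts_measurable] w measurable_snd])
 qed
 define H where "H = (\<lambda>(h, w). \<integral>\<^sup>+z. G' h w z \<partial>emb_pair (K i (fsts h)) (g i))"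
 have H: "H \<in> borel_measurable (hist_space \<Otimes>\<^sub>M path_space)"
  unfolding H_def split_beta'
  by (rule nn_integral_measurable_subprob_algebra2[OF _ measurable_compose[OF measurable_fst emb_pair_hist]])
   (use G' in \<open>simp add: split_beta'\<close>)
 have "(\<integral>\<^sup>+s. F (hist i s, wp i s, s (Suc i)) \<partial>Om) = (\<integral>\<^sup>+s. H (hist i s, wp i s) \<partial>Om)"
  by (subst transition_raw[OF F]) (simp add: H_def G'_def)
 also have "... = (\<integral>\<^sup>+s. (\<integral>\<^sup>+w. H (hist i s, w) \<partial>wiener) \<partial>Om)" by (rule fresh[OF H])
 also have "... = (\<integral>\<^sup>+s. (\<integral>\<^sup>+z. (\<integral>\<^sup>+w. F (hist i s, w, upd i (fsts (hist i s)) w z) \<partial>wiener) \<partial>emb_pair (K i (fsts (hist i s))) (g i)) \<partial>Om)"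
 proof (rule nn_integral_cong)
  fix s assume s: "s \<in> space Om"
  let ?h = "hist i s"
  interpret st: skorokhod_step "K i (fsts ?h)" "g i" "a i" "G i" by (rule step)
  have h: "?h \<in> space hist_space" using measurable_space[OF hist_measurable s] .
  have "(\<lambda>x. G' ?h (snd x) (fst x)) \<in> borel_measurable (plane \<Otimes>\<^sub>M path_space)"
  proof -
   have "(\<lambda>x. ((?h, snd x), fst x)) \<in> measurable (plane \<Otimes>\<^sub>M path_space) ?S"
    using h by (intro measurable_Pair) auto
   from measurable_compose[OF this G'] show ?thesis by (simp add: split_beta')
  qed
  then have Gm: "(\<lambda>x. G' ?h (snd x) (fst x)) \<in> borel_measurable (emb_pair (K i (fsts ?h)) (g i) \<Otimes>\<^sub>M wiener)"
   by (simp add: measurable_cong_sets[OF st.pair_sets_eq refl])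
  show "(\<integral>\<^sup>+w. H (?h, w) \<partial>wiener) = (\<integral>\<^sup>+z. (\<integral>\<^sup>+w. F (?h, w, upd i (fsts ?h) w z) \<partial>wiener) \<partial>emb_pair (K i (fsts ?h)) (g i))"
   unfolding H_def prod.case using Gm by (subst st.EW.Fubini') (auto simp: split_beta' G'_def)
 qed
 finally show ?thesis .
qed

text \<open>By \<open>emb_regeneration\<close> the path left after the step is again Wiener and
  independent of the pair of step and time.\<close>

lemma transition_step:
 assumes F: "F \<in> borel_measurable (hist_space \<Otimes>\<^sub>M (plane \<Otimes>\<^sub>M path_space))"
  and fresh: "\<And>H. H \<in> borel_measurable (hist_space \<Otimes>\<^sub>M path_space) ==>
   (\<integral>\<^sup>+v. H (hist i v, wp i v) \<partial>Om) = (\<integral>\<^sup>+v. (\<integral>\<^sup>+w. H (hist i v, w) \<partial>wiener) \<partial>Om)"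
 shows "(\<integral>\<^sup>+v. F (hist i v, (xi i v, dt i v), wp (Suc i) v) \<partial>Om) =
  (\<integral>\<^sup>+v. (\<integral>\<^sup>+y. (\<integral>\<^sup>+w. F (hist i v, y, w) \<partial>wiener) \<partial>law i (hist i v)) \<partial>Om)"
proof -
 define F' where "F' = (\<lambda>(h, w :: real => real, s :: state). F (h, (fst s, fst (snd s)), snd (snd s)))"
 have F': "F' \<in> borel_measurable (hist_space \<Otimes>\<^sub>M (path_space \<Otimes>\<^sub>M state_space))"
  unfolding F'_def split_beta' by (rule measurable_compose[OF _ F]) measurable
 have "(\<integral>\<^sup>+z. (\<integral>\<^sup>+w. F' (hist i v, w, upd i (fsts (hist i v)) w z) \<partial>wiener) \<partial>emb_pair (K i (fsts (hist i v))) (g i))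
  = (\<integral>\<^sup>+y. (\<integral>\<^sup>+w. F (hist i v, y, w) \<partial>wiener) \<partial>law i (hist i v))" if v: "v \<in> space Om" for v
 proof -
  interpret st: skorokhod_step "K i (fsts (hist i v))" "g i" "a i" "G i" by (rule step)
  have FF: "(\<lambda>x. F (hist i v, fst x, snd x)) \<in> borel_measurable (plane \<Otimes>\<^sub>M path_space)"
   using measurable_space[OF hist_measurable v] by (intro measurable_compose[OF _ F] measurable_Pair) auto
  show ?thesis using st.emb_regeneration[OF FF] by (simp add: F'_def upd_def law_def cm_def)
 qed
 note eq = nn_integral_cong[OF this]
 have "(\<integral>\<^sup>+v. F (hist i v, (xi i v, dt i v), wp (Suc i) v) \<partial>Om) = (\<integral>\<^sup>+v. F' (hist i v, wp i v, v (Suc i)) \<partial>Om)"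
  by (simp add: F'_def xi_def dt_def wp_def)
 then show ?thesis by (simp only: transition_full[OF F' fresh] eq)
qed

lemma wp_0: "distr Om path_space (wp 0) = wiener"
proof (rule measure_eqI)
 fix A assume "A \<in> sets (distr Om path_space (wp 0))"
 then have A: "A \<in> sets path_space" by simp
 have wm: "(\<lambda>w. (0, 0, w)) \<in> measurable wiener state_space" by simp
 have fm: "(\<lambda>s. indicator A (wp 0 s)) \<in> borel_measurable (PiM {0..<Suc 0} (\<lambda>_. state_space))"
  by (rule measurable_compose[OF wp_measurable]) (use A in auto)
 have "emeasure (distr Om path_space (wp 0)) A = (\<integral>\<^sup>+z. indicator A (wp 0 (restrict z {0..<Suc 0})) \<partial>Om)"
  using A by (subst nn_integral_indicator[symmetric], simp, subst nn_integral_distr[OF wp_measurable_Om])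
   (auto simp: wp_def)
 also have "... = (\<integral>\<^sup>+z. (\<integral>\<^sup>+x. indicator A (snd (snd x)) \<partial>distr wiener state_space (\<lambda>w. (0, 0, w))) \<partial>Om)"
  by (subst IT.nn_integral_lim_step[OF fm]) (simp add: wp_def kern_def)
 also have "... = (\<integral>\<^sup>+z. emeasure wiener A \<partial>Om)"
 proof (rule nn_integral_cong)
  fix z
  have "(\<lambda>x :: state. indicator A (snd (snd x)) :: ennreal) \<in> borel_measurable state_space"
   by (rule measurable_compose[OF _ borel_measurable_indicator[OF A]]) simp
  then have "(\<integral>\<^sup>+x. indicator A (snd (snd x)) \<partial>distr wiener state_space (\<lambda>w. (0, 0, w))) = (\<integral>\<^sup>+w. indicator A w \<partial>wiener)"
   by (subst nn_integral_distr[OF wm]) auto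
  then show "(\<integral>\<^sup>+x. indicator A (snd (snd x)) \<partial>distr wiener state_space (\<lambda>w. (0, 0, w))) = emeasure wiener A"
   using A by simp
 qed
 also have "... = emeasure wiener A" by (simp add: chain.emeasure_space_1 del: IT.PF.space_lim)
 finally show "emeasure (distr Om path_space (wp 0)) A = emeasure wiener A" .
qed simp

text \<open>The remaining path is Wiener and independent of the history. In the induction step
  \<open>transition_step\<close> is used twice, for \<open>H\<close> and for its average over the
  path; the two right-hand sides agree.\<close>

lemma fresh_path:
 assumes "H \<in> borel_measurable (hist_space \<Otimes>\<^sub>M path_space)"
 shows "(\<integral>\<^sup>+s. H (hist i s, wp i s) \<partial>Om) = (\<integral>\<^sup>+s. (\<integral>\<^sup>+w. H (hist i s, w) \<partial>wiener) \<partial>Om)"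
 using assms
proof (induction i arbitrary: H)
 case 0
 have h: "hist 0 s = (\<lambda>_. (0, 0))" for s by (simp add: hist_def)
 have Hm: "(\<lambda>w. H (\<lambda>_. (0, 0), w)) \<in> borel_measurable path_space"
  by (rule measurable_compose[OF _ 0]) (auto intro!: measurable_Pair simp: space_PiM space_pair_measure)
 have "(\<integral>\<^sup>+s. H (hist 0 s, wp 0 s) \<partial>Om) = (\<integral>\<^sup>+w. H (\<lambda>_. (0, 0), w) \<partial>distr Om path_space (wp 0))"
  unfolding h by (rule nn_integral_distr[symmetric, OF wp_measurable_Om]) (use Hm in simp)
 then show ?case by (simp add: h wp_0 chain.emeasure_space_1 del: IT.PF.space_lim)
next
 case (Suc i)
 define u where "u = (\<lambda>x :: (nat => real \<times> real) \<times> (real \<times> real) \<times> (real => real). ((fst x)(i := fst (snd x)), snd (snd x)))"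
 have um: "u \<in> measurable (hist_space \<Otimes>\<^sub>M (plane \<Otimes>\<^sub>M path_space)) (hist_space \<Otimes>\<^sub>M path_space)"
  unfolding u_def by (intro measurable_Pair measurable_fun_upd[where J=UNIV]) auto
 note m1 = measurable_compose[OF um Suc.prems]
 have Hw: "H \<in> borel_measurable (hist_space \<Otimes>\<^sub>M wiener)"
  using Suc.prems by (simp cong: measurable_cong_sets sets_pair_measure_cong)
 have "(\<lambda>h. \<integral>\<^sup>+w. H (h, w) \<partial>wiener) \<in> borel_measurable hist_space"
  by (rule wiener.borel_measurable_nn_integral_fst[OF Hw])
 note m2 = measurable_compose[OF measurable_compose[OF um measurable_fst] this]
 have "(\<integral>\<^sup>+s. H (hist (Suc i) s, wp (Suc i) s) \<partial>Om)
  = (\<integral>\<^sup>+s. (\<integral>\<^sup>+y. (\<integral>\<^sup>+w. H ((hist i s)(i := y), w) \<partial>wiener) \<partial>law i (hist i s)) \<partial>Om)"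
  using transition_step[OF m1 Suc.IH] by (simp add: u_def hist_Suc)
 also have "... = (\<integral>\<^sup>+s. (\<integral>\<^sup>+w. H (hist (Suc i) s, w) \<partial>wiener) \<partial>Om)"
  using transition_step[OF m2 Suc.IH] wiener.emeasure_space_1 by (simp add: u_def hist_Suc)
 finally show ?case .
qed

lemmas transition = transition_step[OF _ fresh_path]

lemma transition_law:
 assumes F: "F \<in> borel_measurable (hist_space \<Otimes>\<^sub>M plane)"
 shows "(\<integral>\<^sup>+s. F (hist i s, xi i s, dt i s) \<partial>Om) = (\<integral>\<^sup>+s. (\<integral>\<^sup>+y. F (hist i s, y) \<partial>law i (hist i s)) \<partial>Om)"
proof -
 have "(\<lambda>x. F (fst x, fst (snd x))) \<in> borel_measurable (hist_space \<Otimes>\<^sub>M (plane \<Otimes>\<^sub>M path_space))"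
  by (rule measurable_compose[OF _ F]) measurable
 from transition[OF this] show ?thesis using wiener.emeasure_space_1 by simp
qed

end

context skorokhod_chain
begin

text \<open>The indicator of failure integrates to 0 under \<open>transition_full\<close>. Equality
  of paths is tested at rational times, which makes it a measurable event; continuity then gives all
  times.\<close>

lemma AE_embedded_step:
 "AE y in Om. 0 \<le> dt i y \<and> wp i y (dt i y) = a i * (g i (xi i y) - cm i (hx i y)) \<and> wp (Suc i) y = path_shift (dt i y) (wp i y)"
proof -
 let ?S = "hist_space \<Otimes>\<^sub>M (path_space \<Otimes>\<^sub>M state_space)"
 define good where "good = (\<lambda>(h, w, s). 0 \<le> fst (snd s) \<and> w (fst (snd s)) = a i * (g i (fst s) - cm i (fsts h)) \<and>
  (\<forall>r\<in>\<rat>. snd (snd s) r = path_shift (fst (snd s)) w r))"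
 have gm: "Measurable.pred ?S good"
 proof -
  note path_coordinate_measurable[measurable del]
  have h: "fst \<in> measurable ?S hist_space" by (rule measurable_fst)
  have w: "(\<lambda>x. fst (snd x)) \<in> measurable ?S path_space" by (rule measurable_compose[OF measurable_snd measurable_fst])
  have s: "(\<lambda>x. snd (snd x)) \<in> measurable ?S state_space" by (rule measurable_compose[OF measurable_snd measurable_snd])
  have x: "(\<lambda>x. fst (snd (snd x))) \<in> borel_measurable ?S" by (rule measurable_compose[OF s measurable_fst])
  have t[measurable]: "(\<lambda>x. fst (snd (snd (snd x)))) \<in> borel_measurable ?S"
   by (rule measurable_compose[OF measurable_compose[OF s measurable_snd] measurable_fst])
  have w': "(\<lambda>x. snd (snd (snd (snd x)))) \<in> measurable ?S path_space"
   by (rule measurable_compose[OF measurable_compose[OF s measurable_snd] measurable_snd])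
  have [measurable]: "(\<lambda>x. cm i (fsts (fst x))) \<in> borel_measurable ?S"
   by (rule measurable_compose[OF measurable_compose[OF h fsts_measurable] cm_measurable])
  have [measurable]: "(\<lambda>x. g i (fst (snd (snd x)))) \<in> borel_measurable ?S"
   by (rule measurable_compose[OF x g])
  have [measurable]: "(\<lambda>x. fst (snd x) (fst (snd (snd (snd x))))) \<in> borel_measurable ?S"
   by (rule path_eval_measurable[OF w t])
  have [measurable]: "(\<lambda>x. snd (snd (snd (snd x))) r) \<in> borel_measurable ?S" for r
   by (rule measurable_compose[OF w' path_coordinate_measurable])
  have [measurable]: "(\<lambda>x. path_shift (fst (snd (snd (snd x)))) (fst (snd x)) r) \<in> borel_measurable ?S" for r
   by (rule measurable_compose[OF path_shift_measurable2[OF w t] path_coordinate_measurable])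
  have [simp]: "countable (\<rat> :: real set)" by (rule countable_rat)
  show ?thesis unfolding good_def split_beta' by measurable
 qed
 define F where "F = (\<lambda>x. if good x then 0 else 1 :: ennreal)"
 have F: "F \<in> borel_measurable ?S"
  unfolding F_def using gm by measurable
 have "(\<integral>\<^sup>+z. (\<integral>\<^sup>+w. F (hist i y, w, upd i (fsts (hist i y)) w z) \<partial>wiener) \<partial>emb_pair (K i (fsts (hist i y))) (g i)) = 0" for y
 proof -
  interpret st: skorokhod_step "K i (fsts (hist i y))" "g i" "a i" "G i" by (rule step)
  have "(\<integral>\<^sup>+z. (\<integral>\<^sup>+w. F (hist i y, w, upd i (fsts (hist i y)) w z) \<partial>wiener) \<partial>emb_pair (K i (fsts (hist i y))) (g i))
   = (\<integral>\<^sup>+z. 0 \<partial>emb_pair (K i (fsts (hist i y))) (g i))"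
  proof (rule nn_integral_cong_AE)
   show "AE z in emb_pair (K i (fsts (hist i y))) (g i). (\<integral>\<^sup>+w. F (hist i y, w, upd i (fsts (hist i y)) w z) \<partial>wiener) = 0"
    using st.AE_emb_position
   proof eventually_elim
    case (elim z)
    have "(\<integral>\<^sup>+w. F (hist i y, w, upd i (fsts (hist i y)) w z) \<partial>wiener) = (\<integral>\<^sup>+w. 0 \<partial>wiener)"
     by (rule nn_integral_cong_AE) (use elim in \<open>eventually_elim, simp add: F_def good_def upd_def cm_def\<close>)
    then show ?case by simp
   qed
  qed
  then show ?thesis by simp
 qed
 then have "(\<integral>\<^sup>+y. F (hist i y, wp i y, y (Suc i)) \<partial>Om) = 0"
  using transition_full[OF F fresh_path, of i] by simp
 moreover have "(\<lambda>y. F (hist i y, wp i y, y (Suc i))) \<in> borel_measurable Om"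
  by (intro measurable_compose[OF _ F] measurable_Pair hist_measurable wp_measurable_Om)
   (simp add: measurable_Om component_measurable)
 ultimately have "AE y in Om. F (hist i y, wp i y, y (Suc i)) = 0"
  by (subst (asm) nn_integral_0_iff_AE) simp_all
 moreover have "AE y in Om. y \<in> space Om" by (rule AE_space)
 ultimately show ?thesis
 proof eventually_elim
  case (elim y)
  then have "good (hist i y, wp i y, y (Suc i))" by (simp add: F_def split: if_splits)
  then have *: "0 \<le> dt i y" "wp i y (dt i y) = a i * (g i (xi i y) - cm i (hx i y))"
   "\<And>r. r \<in> \<rat> ==> wp (Suc i) y r = path_shift (dt i y) (wp i y) r"
   by (auto simp: good_def dt_def xi_def wp_def hx_hist fsts_def)
  have p: "wp i y \<in> path_set" "wp (Suc i) y \<in> path_set"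
   using measurable_space[OF wp_measurable_Om elim(2)] by auto
  have "wp (Suc i) y r = path_shift (dt i y) (wp i y) r" for r
  proof -
   have "closed {r. wp (Suc i) y r = path_shift (dt i y) (wp i y) r}"
    using p(2) path_shift_in[OF p(1)] by (intro closed_Collect_eq) (auto simp: path_set_def)
   moreover have "\<rat> \<subseteq> {r. wp (Suc i) y r = path_shift (dt i y) (wp i y) r}" using * by auto
   ultimately have "closure \<rat> \<subseteq> {r. wp (Suc i) y r = path_shift (dt i y) (wp i y) r}"
    by (rule closure_minimal[rotated])
   then show ?thesis by (auto simp: Rats_closure_real)
  qed
  then show ?case using * by auto
 qed
qed

text \<open>Successive shifts add up, so the path left after \<open>n\<close> steps is the original
  path restarted at the sum of the first \<open>n\<close> times, and the exit positions telescope
  along the original path.\<close>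

lemma AE_embedding:
 "AE x in Om. (\<forall>i. 0 \<le> dt i x) \<and>
   (\<forall>n. wp 0 x (\<Sum>i<n. dt i x) = (\<Sum>i<n. a i * (g i (xi i x) - cm i (hx i x))))"
proof -
 have "AE x in Om. \<forall>i. 0 \<le> dt i x \<and> wp i x (dt i x) = a i * (g i (xi i x) - cm i (hx i x)) \<and> wp (Suc i) x = path_shift (dt i x) (wp i x)"
  unfolding AE_all_countable using AE_embedded_step by blast
 moreover have "AE x in Om. x \<in> space Om" by (rule AE_space)
 ultimately show ?thesis
 proof eventually_elim
  case (elim x)
  then have d: "0 \<le> dt i x" and v: "wp i x (dt i x) = a i * (g i (xi i x) - cm i (hx i x))"
   and s: "wp (Suc i) x = path_shift (dt i x) (wp i x)" for i by auto
  have p: "wp i x \<in> path_set" for i using measurable_space[OF wp_measurable_Om elim(2)] by auto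
  have shift: "wp n x r = path_shift (\<Sum>i<n. dt i x) (wp 0 x) r" for n r
  proof (induction n arbitrary: r)
   case 0
   show ?case using path_setD(2)[OF p[of 0]] by (auto simp: path_shift_def)
  next
   case (Suc n)
   have "wp (Suc n) x r = wp n x (dt n x + max 0 r) - wp n x (dt n x)" by (simp only: s path_shift_eq)
   also have "... = wp 0 x ((\<Sum>i<n. dt i x) + (dt n x + max 0 r)) - wp 0 x ((\<Sum>i<n. dt i x) + dt n x)"
   proof -
    have "max 0 (dt n x + max 0 r) = dt n x + max 0 r" "max 0 (dt n x) = dt n x" using d[of n] by auto
    then show ?thesis by (simp only: Suc.IH path_shift_eq)
   qed
   finally show ?case by (simp only: path_shift_eq sum.lessThan_Suc add.assoc)
  qed
  have "wp 0 x (\<Sum>i<n. dt i x) = (\<Sum>i<n. a i * (g i (xi i x) - cm i (hx i x)))" for n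
  proof (induction n)
   case 0
   show ?case using path_setD(2)[OF p[of 0]] by simp
  next
   case (Suc n)
   have "wp n x (dt n x) = wp 0 x ((\<Sum>i<n. dt i x) + dt n x) - wp 0 x (\<Sum>i<n. dt i x)"
    using d[of n] by (simp only: shift[of n "dt n x"] path_shift_eq)
   then show ?case using Suc.IH v[of n] by simp
  qed
  then show ?case using d by auto
 qed
qed

end

section \<open>Martingales and averaged recursions\<close>

text \<open>Toeplitz' lemma: late terms are small, and the finitely many early ones are swallowed by
  \<open>b\<close>.\<close>

lemma weighted_cesaro:
 fixes w y b :: "nat => real"
 assumes w: "\<And>i. 0 \<le> w i" and b: "\<And>n. 0 < b n" "filterlim b at_top sequentially"
  and bound: "\<And>n. (\<Sum>i<n. w i) \<le> K * b n" and y: "y \<longlonglongrightarrow> 0"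
 shows "(\<lambda>n. (\<Sum>i<n. w i * y i) / b n) \<longlonglongrightarrow> 0"
proof (rule LIMSEQ_I)
 fix r :: real assume r: "0 < r"
 have K: "0 \<le> K" using bound[of 0] b(1)[of 0] by (simp add: zero_le_mult_iff)
 define e where "e = r / (2 * (K + 1))"
 have e: "0 < e" "K * e < r / 2" using r K by (auto simp: e_def field_simps)
 obtain N where N: "\<And>i. N \<le> i ==> \<bar>y i\<bar> < e" using LIMSEQ_D[OF y e(1)] by auto
 define A where "A = (\<Sum>i<N. w i * \<bar>y i\<bar>)"
 have "eventually (\<lambda>n. 2 * A / r < b n) sequentially"
  using b(2) by (rule filterlim_at_top_dense[THEN iffD1, rule_format])
 then obtain n0 where n0: "\<And>n. n0 \<le> n ==> 2 * A / r < b n" by (auto simp: eventually_sequentially)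
 show "\<exists>no. \<forall>n\<ge>no. norm ((\<Sum>i<n. w i * y i) / b n - 0) < r"
 proof (intro exI allI impI)
  fix n assume n: "n0 \<le> n"
  have "\<bar>\<Sum>i<n. w i * y i\<bar> \<le> (\<Sum>i<n. w i * \<bar>y i\<bar>)"
   by (rule order_trans[OF sum_abs]) (simp add: abs_mult w)
  also have "... \<le> (\<Sum>i<n. (if i < N then w i * \<bar>y i\<bar> else 0) + e * w i)"
  proof (rule sum_mono)
   fix i
   show "w i * \<bar>y i\<bar> \<le> (if i < N then w i * \<bar>y i\<bar> else 0) + e * w i"
    using N[of i] w[of i] e(1) mult_left_mono[of "\<bar>y i\<bar>" e "w i"] by (auto simp: mult.commute)
  qed
  also have "... = (\<Sum>i<n. if i < N then w i * \<bar>y i\<bar> else 0) + e * (\<Sum>i<n. w i)"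
   by (simp add: sum.distrib sum_distrib_left)
  also have "(\<Sum>i<n. if i < N then w i * \<bar>y i\<bar> else 0) = (\<Sum>i\<in>{..<n} \<inter> {..<N}. w i * \<bar>y i\<bar>)"
   by (simp add: sum.inter_restrict)
  also have "... \<le> A" unfolding A_def by (rule sum_mono2) (auto simp: w)
  also have "e * (\<Sum>i<n. w i) \<le> e * (K * b n)" using bound[of n] e by (intro mult_left_mono) auto
  finally have "\<bar>\<Sum>i<n. w i * y i\<bar> \<le> A + K * e * b n" by (simp add: mult_ac)
  moreover have "A < r / 2 * b n" using n0[OF n] r by (simp add: field_simps)
  moreover have "K * e * b n \<le> r / 2 * b n" using e(2) b(1)[of n] by (intro mult_right_mono) auto
  ultimately have "\<bar>\<Sum>i<n. w i * y i\<bar> < r * b n" by simp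
  then show "norm ((\<Sum>i<n. w i * y i) / b n - 0) < r" using b(1)[of n] by (simp add: field_simps)
 qed
qed

text \<open>Abel summation against the tails \<open>R\<close> of the convergent series. The tails
  tend to 0, so what remains is a weighted mean of a null sequence.\<close>

lemma kronecker_lemma:
 fixes a b :: "nat => real"
 assumes b: "\<And>n. 0 < b n" "incseq b" "filterlim b at_top sequentially"
  and sum: "summable (\<lambda>i. a i / b i)"
 shows "(\<lambda>n. (\<Sum>i<n. a i) / b n) \<longlonglongrightarrow> 0"
proof -
 define R where "R = (\<lambda>n. \<Sum>i. a (i + n) / b (i + n))"
 have R0: "R \<longlonglongrightarrow> 0" unfolding R_def using suminf_exist_split2[OF sum] .
 have RS: "a n = b n * (R n - R (Suc n))" for n
 proof -
  have "R n = a n / b n + R (Suc n)"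
   unfolding R_def using suminf_split_head[OF summable_ignore_initial_segment[OF sum, of n]] by simp
  then show ?thesis using b(1)[of n] by simp
 qed
 have abel: "(\<Sum>i<n. a i) = b 0 * R 0 + (\<Sum>i<n. (b (Suc i) - b i) * R (Suc i)) - b n * R n" for n
  by (induction n) (simp_all add: RS algebra_simps)
 have W: "(\<lambda>n. (\<Sum>i<n. (b (Suc i) - b i) * R (Suc i)) / b n) \<longlonglongrightarrow> 0"
 proof (rule weighted_cesaro[where K=1, OF _ b(1,3) _ LIMSEQ_Suc[OF R0]])
  show "0 \<le> b (Suc i) - b i" for i using b(2) by (simp add: incseq_SucD)
  show "(\<Sum>i<n. b (Suc i) - b i) \<le> 1 * b n" for n
   using b(1)[of 0] by (simp add: sum_lessThan_telescope)
 qed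
 have "(\<lambda>n. b 0 * R 0 / b n + (\<Sum>i<n. (b (Suc i) - b i) * R (Suc i)) / b n - R n) \<longlonglongrightarrow> 0 + 0 - 0"
  by (intro tendsto_intros W R0 tendsto_divide_0[OF tendsto_const filterlim_at_top_imp_at_infinity[OF b(3)]])
 moreover have "b 0 * R 0 / b n + (\<Sum>i<n. (b (Suc i) - b i) * R (Suc i)) / b n - R n = (\<Sum>i<n. a i) / b n" for n
  using b(1)[of n] by (simp add: abel add_divide_distrib diff_divide_distrib)
 ultimately show ?thesis by simp
qed

lemma integrable_mult_sq:
 fixes f g :: "'a => real"
 assumes [measurable]: "f \<in> borel_measurable M" "g \<in> borel_measurable M"
  and "integrable M (\<lambda>s. (f s)^2)" "integrable M (\<lambda>s. (g s)^2)"
 shows "integrable M (\<lambda>s. f s * g s)"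
proof (rule Bochner_Integration.integrable_bound[where f="\<lambda>s. (f s)^2 + (g s)^2"])
 have "\<bar>x * y\<bar> \<le> x^2 + y^2" for x y :: real
 proof -
  have "2 * (\<bar>x\<bar> * \<bar>y\<bar>) \<le> x^2 + y^2" using sum_squares_bound[of "\<bar>x\<bar>" "\<bar>y\<bar>"] by (simp add: mult.assoc)
  moreover have "0 \<le> \<bar>x\<bar> * \<bar>y\<bar>" by simp
  ultimately show ?thesis unfolding abs_mult by linarith
 qed
 then show "AE s in M. norm (f s * g s) \<le> norm ((f s)^2 + (g s)^2)" by simp
qed (use assms in auto)

lemma integrable_add_sq:
 fixes f g :: "'a => real"
 assumes "f \<in> borel_measurable M" "g \<in> borel_measurable M"
  and "integrable M (\<lambda>x. (f x)^2)" "integrable M (\<lambda>x. (g x)^2)"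
 shows "integrable M (\<lambda>x. (f x + g x)^2)"
 using integrable_mult_sq[OF assms] assms(3,4) by (auto simp: power2_sum mult.assoc)

section \<open>Square integrable martingale differences\<close>

locale l2_martingale_differences = prob_space M for M :: "'a measure" +
 fixes F :: "nat => 'a measure" and D :: "nat => 'a => real"
 assumes sub: "\<And>i. subalgebra M (F i)"
  and filtration: "\<And>i j. i \<le> j ==> sets (F i) \<subseteq> sets (F j)"
  and adapted: "\<And>i. D i \<in> borel_measurable (F (Suc i))"
  and sq_integrable: "\<And>i. integrable M (\<lambda>x. (D i x)^2)"
  and mean_zero: "\<And>i A. A \<in> sets (F i) ==> (LINT x|M. indicator A x * D i x) = 0"
begin

lemma F_mono: "i \<le> j ==> f \<in> borel_measurable (F i) ==> f \<in> borel_measurable (F j)"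
 using filtration[of i j] sub[of i] sub[of j] by (auto simp: subalgebra_def measurable_def subset_iff)

lemma F_meas: "f \<in> borel_measurable (F i) ==> f \<in> borel_measurable M"
 using sub[of i] by (rule measurable_from_subalg)

lemma D_meas[measurable]: "D i \<in> borel_measurable M"
 by (rule F_meas[OF adapted])

text \<open>\<open>mean_zero\<close> says that the conditional expectation of \<open>D i\<close>
  vanishes; square integrability of both factors makes the product integrable, so that the
  measurable factor can be pulled out.\<close>

lemma orthogonal:
 assumes Z: "Z \<in> borel_measurable (F i)" "integrable M (\<lambda>x. (Z x)^2)"
 shows "(LINT x|M. Z x * D i x) = 0"
proof -
 interpret s: finite_measure_subalgebra M "F i" by unfold_locales (rule sub)
 have ae: "AE x in M. real_cond_exp M (F i) (D i) x = 0"
  by (rule s.real_cond_exp_charact)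
   (use mean_zero square_integrable_imp_integrable[OF D_meas sq_integrable] in \<open>auto simp: set_lebesgue_integral_def\<close>)
 have int: "integrable M (\<lambda>x. Z x * D i x)"
  by (intro integrable_mult_sq F_meas[OF Z(1)] D_meas Z(2) sq_integrable)
 have "(LINT x|M. Z x * real_cond_exp M (F i) (D i) x) = (LINT x|M. 0)"
  using s.real_cond_exp_intg(1)[OF int Z(1) D_meas] by (intro integral_cong_AE) (use ae in auto)
 then show ?thesis using s.real_cond_exp_intg(2)[OF int Z(1) D_meas] by simp
qed

definition S :: "nat => nat => 'a => real" where "S m n x = (\<Sum>i=m..<n. D i x)"

lemma S_adapted: "S m n \<in> borel_measurable (F n)"
 unfolding S_def by (intro borel_measurable_sum F_mono[OF _ adapted]) auto

lemma S_meas[measurable]: "S m n \<in> borel_measurable M" by (rule F_meas[OF S_adapted])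

lemma S_sq: "integrable M (\<lambda>x. (S m n x)^2)"
proof (induction n)
 case 0 then show ?case by (simp add: S_def)
next
 case (Suc n)
 have "S m (Suc n) x = (if m \<le> n then S m n x + D n x else 0)" for x by (simp add: S_def)
 then show ?case using integrable_add_sq[OF S_meas D_meas Suc sq_integrable] by (cases "m \<le> n") auto
qed

lemma orth_S:
 assumes Z: "Z \<in> borel_measurable (F k)" "integrable M (\<lambda>x. (Z x)^2)"
 shows "(LINT x|M. Z x * S k n x) = 0"
proof -
 have "(LINT x|M. Z x * S k n x) = (LINT x|M. (\<Sum>i=k..<n. Z x * D i x))"
  by (simp add: S_def sum_distrib_left)
 also have "... = (\<Sum>i=k..<n. \<integral>x. Z x * D i x \<partial>M)"
  by (rule Bochner_Integration.integral_sum)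
   (intro integrable_mult_sq F_meas[OF Z(1)] D_meas Z(2) sq_integrable)
 also have "... = 0" by (rule sum.neutral) (use orthogonal[OF F_mono[OF _ Z(1)] Z(2)] in auto)
 finally show ?thesis .
qed

lemma S_variance: "m \<le> n ==> (LINT x|M. (S m n x)^2) = (\<Sum>i=m..<n. \<integral>x. (D i x)^2 \<partial>M)"
proof (induction n rule: dec_induct)
 case base show ?case by (simp add: S_def)
next
 case (step n)
 have "S m (Suc n) x = S m n x + D n x" for x using step by (simp add: S_def)
 then have "(LINT x|M. (S m (Suc n) x)^2) = (LINT x|M. (S m n x)^2 + (D n x)^2 + 2 * (S m n x * D n x))"
  by (simp add: power2_sum mult.assoc)
 also have "... = (LINT x|M. (S m n x)^2) + (LINT x|M. (D n x)^2)"
  using orthogonal[OF S_adapted S_sq] integrable_mult_sq[OF S_meas D_meas S_sq sq_integrable]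
  by (simp add: S_sq sq_integrable)
 finally show ?case using step by simp
qed

text \<open>Kolmogorov's inequality: the event is split according to the first index
  \<open>k\<close> at which the threshold is reached, and \<open>B k\<close> is known at time
  \<open>k\<close>.\<close>

lemma maximal_inequality:
 assumes "0 < c" and mn: "m \<le> n"
 shows "prob {x\<in>space M. \<exists>k\<in>{m..n}. c \<le> \<bar>S m k x\<bar>} \<le> (\<Sum>i=m..<n. \<integral>x. (D i x)^2 \<partial>M) / c^2"
proof -
 define B where "B = (\<lambda>k. {x\<in>space M. c \<le> \<bar>S m k x\<bar> \<and> (\<forall>j\<in>{m..<k}. \<bar>S m j x\<bar> < c)})"
 have BF: "(\<lambda>x. indicator (B k) x * S m k x) \<in> borel_measurable (F k)" for k
 proof -
  have sp: "space (F k) = space M" using sub[of k] by (simp add: subalgebra_def)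
  have [measurable]: "S m j \<in> borel_measurable (F k)" if "j \<le> k" for j
   by (rule F_mono[OF that S_adapted])
  have [measurable]: "S m k \<in> borel_measurable (F k)" by (rule S_adapted)
  have "{x\<in>space (F k). \<forall>j\<in>{m..<k}. \<bar>S m j x\<bar> < c} \<in> sets (F k)"
  proof (rule sets.sets_Collect_finite_All)
   fix j assume "j \<in> {m..<k}"
   then have "S m j \<in> borel_measurable (F k)" by (intro F_mono[OF _ S_adapted]) auto
   then show "{x\<in>space (F k). \<bar>S m j x\<bar> < c} \<in> sets (F k)" by measurable
  qed simp
  moreover have "{x\<in>space (F k). c \<le> \<bar>S m k x\<bar>} \<in> sets (F k)" by measurable
  moreover have "B k = {x\<in>space (F k). c \<le> \<bar>S m k x\<bar>} \<inter> {x\<in>space (F k). \<forall>j\<in>{m..<k}. \<bar>S m j x\<bar> < c}"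
   by (auto simp: B_def sp)
  ultimately have "B k \<in> sets (F k)" by simp
  then show ?thesis by measurable
 qed
 have Bm[measurable]: "B k \<in> sets M" for k unfolding B_def by measurable
 have disj: "disjoint_family_on B {m..n}"
  unfolding disjoint_family_on_def B_def
 proof (intro ballI impI)
  fix i j assume "i \<in> {m..n}" "j \<in> {m..n}" "i \<noteq> j"
  then consider "i < j" "i \<in> {m..<j}" | "j < i" "j \<in> {m..<i}" by fastforce
  then show "{x\<in>space M. c \<le> \<bar>S m i x\<bar> \<and> (\<forall>j\<in>{m..<i}. \<bar>S m j x\<bar> < c)} \<inter>
   {x\<in>space M. c \<le> \<bar>S m j x\<bar> \<and> (\<forall>j\<in>{m..<j}. \<bar>S m j x\<bar> < c)} = {}"
   by cases force+
 qed
 have intI: "integrable M (\<lambda>x. indicator (B k) x * (S m l x)^2)" for k l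
  using integrable_mult_indicator[OF Bm S_sq[of m l]] by simp
 have sqI: "integrable M (\<lambda>x. (indicator (B k) x * S m k x)^2)" for k
 proof -
  have "(indicator (B k) x * S m k x)^2 = indicator (B k) x * (S m k x)^2" for x by (simp add: indicator_def)
  then show ?thesis using intI by simp
 qed
 have pk: "c^2 * prob (B k) \<le> (LINT x|M. indicator (B k) x * (S m n x)^2)" if k: "k \<in> {m..n}" for k
 proof -
  let ?Z = "\<lambda>x. indicator (B k) x * S m k x"
  have "c^2 * prob (B k) = (LINT x|M. indicator (B k) x * c^2)" by simp
  also have "... \<le> (LINT x|M. indicator (B k) x * (S m k x)^2)"
  proof (rule integral_mono)
   fix x
   show "indicator (B k) x * c^2 \<le> indicator (B k) x * (S m k x)^2"
    using abs_le_square_iff[of c "S m k x"] \<open>0 < c\<close> by (auto simp: B_def indicator_def)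
   show "integrable M (\<lambda>x. indicator (B k) x * c^2)"
    using integrable_mult_indicator[OF Bm, of "\<lambda>_. c^2"] by simp
  qed (rule intI)
  \<comment> \<open>A cross term of expectation 0 is added, because the later increments are
    orthogonal to what is known at time \<open>k\<close>; with it the square of \<open>S m n\<close>
    is nearly complete.\<close>
  also have "... = (LINT x|M. indicator (B k) x * (S m k x)^2 + 2 * (?Z x * S k n x))"
   using orth_S[OF BF sqI, of k n] integrable_mult_sq[OF F_meas[OF BF] S_meas sqI S_sq, of k k n] intI by simp
  also have "... \<le> (LINT x|M. indicator (B k) x * (S m n x)^2)"
  proof (rule integral_mono)
   show "integrable M (\<lambda>x. indicator (B k) x * (S m k x)^2 + 2 * (?Z x * S k n x))"
    using integrable_mult_sq[OF F_meas[OF BF] S_meas sqI S_sq, of k k n] intI by simp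
   fix x
   have "S m n x = S m k x + S k n x"
    using k by (simp add: S_def sum.atLeastLessThan_concat)
   then have "(S m n x)^2 = (S m k x)^2 + 2 * (S m k x * S k n x) + (S k n x)^2"
    by (simp add: power2_sum)
   then show "indicator (B k) x * (S m k x)^2 + 2 * (?Z x * S k n x) \<le> indicator (B k) x * (S m n x)^2"
    by (simp add: indicator_def)
  qed (rule intI)
  finally show ?thesis .
 qed
 have U: "{x\<in>space M. \<exists>k\<in>{m..n}. c \<le> \<bar>S m k x\<bar>} = (\<Union>k\<in>{m..n}. B k)"
 proof (intro set_eqI iffI)
  fix x assume x: "x \<in> {x\<in>space M. \<exists>k\<in>{m..n}. c \<le> \<bar>S m k x\<bar>}"
  define k0 where "k0 = (LEAST k. k \<in> {m..n} \<and> c \<le> \<bar>S m k x\<bar>)"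
  have k0: "k0 \<in> {m..n} \<and> c \<le> \<bar>S m k0 x\<bar>"
   unfolding k0_def by (rule LeastI_ex) (use x in auto)
  have "\<bar>S m j x\<bar> < c" if "j \<in> {m..<k0}" for j
  proof -
   have "j < k0" using that by simp
   from not_less_Least[OF this[unfolded k0_def]] show ?thesis using that k0 by auto
  qed
  then have "x \<in> B k0" using k0 x by (auto simp: B_def)
  then show "x \<in> (\<Union>k\<in>{m..n}. B k)" using k0 by blast
 qed (auto simp: B_def)
 have "c^2 * prob (\<Union>k\<in>{m..n}. B k) = (\<Sum>k\<in>{m..n}. c^2 * prob (B k))"
  by (subst finite_measure_finite_Union[OF _ _ disj]) (auto simp: sum_distrib_left)
 also have "... \<le> (\<Sum>k\<in>{m..n}. \<integral>x. indicator (B k) x * (S m n x)^2 \<partial>M)" by (intro sum_mono pk)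
 also have "... = (LINT x|M. (\<Sum>k\<in>{m..n}. indicator (B k) x * (S m n x)^2))"
  by (rule Bochner_Integration.integral_sum[symmetric]) (rule intI)
 also have "... \<le> (LINT x|M. (S m n x)^2)"
 proof (rule integral_mono)
  fix x
  have "(\<Sum>k\<in>{m..n}. indicator (B k) x * (S m n x)^2) = indicator (\<Union>k\<in>{m..n}. B k) x * (S m n x)^2"
   by (subst indicator_UN_disjoint[OF _ disj]) (auto simp: sum_distrib_right)
  also have "... \<le> (S m n x)^2" by (simp add: indicator_def)
  finally show "(\<Sum>k\<in>{m..n}. indicator (B k) x * (S m n x)^2) \<le> (S m n x)^2" .
  show "integrable M (\<lambda>x. \<Sum>k\<in>{m..n}. indicator (B k) x * (S m n x)^2)"
   by (rule Bochner_Integration.integrable_sum) (rule intI)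
 qed (rule S_sq)
 finally show ?thesis unfolding U S_variance[OF mn] using \<open>0 < c\<close> by (simp add: field_simps)
qed

text \<open>The maximal inequality, carried to an infinite horizon by monotonicity, makes the
  oscillation beyond \<open>m\<close> small in probability; hence the partial sums are almost surely
  Cauchy.\<close>

theorem convergence:
 assumes sum: "summable (\<lambda>i. \<integral>x. (D i x)^2 \<partial>M)"
 shows "AE x in M. summable (\<lambda>i. D i x)"
proof -
 define r where "r = (\<lambda>m. \<Sum>i. \<integral>x. (D (i + m) x)^2 \<partial>M)"
 have r0: "r \<longlonglongrightarrow> 0" unfolding r_def using suminf_exist_split2[OF sum] .
 have tail: "prob {x\<in>space M. \<exists>k\<ge>m. c \<le> \<bar>S m k x\<bar>} \<le> r m / c^2" if c: "0 < c" for m c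
 proof -
  let ?A = "\<lambda>n. {x\<in>space M. \<exists>k\<in>{m..m + n}. c \<le> \<bar>S m k x\<bar>}"
  have "incseq ?A" by (rule incseq_SucI) auto
  then have "(\<lambda>n. prob (?A n)) \<longlonglongrightarrow> prob (\<Union>n. ?A n)"
   by (intro finite_Lim_measure_incseq) auto
  moreover have "(\<Union>n. ?A n) = {x\<in>space M. \<exists>k\<ge>m. c \<le> \<bar>S m k x\<bar>}"
   by (auto simp: Bex_def) (metis le_add_diff_inverse order_refl)
  moreover have "prob (?A n) \<le> r m / c^2" for n
  proof -
   have "prob (?A n) \<le> (\<Sum>i=m..<m + n. \<integral>x. (D i x)^2 \<partial>M) / c^2"
    by (rule maximal_inequality[OF c]) simp
   also have "(\<Sum>i=m..<m + n. \<integral>x. (D i x)^2 \<partial>M) = (\<Sum>i<n. \<integral>x. (D (i + m) x)^2 \<partial>M)"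
    using sum.shift_bounds_nat_ivl[of "\<lambda>i. \<integral>x. (D i x)^2 \<partial>M" 0 m n]
    by (simp add: atLeast0LessThan add.commute[of m n])
   also have "... \<le> r m"
    unfolding r_def using summable_ignore_initial_segment[OF sum, of m] by (intro sum_le_suminf) auto
   finally show ?thesis using c by (simp add: divide_right_mono)
  qed
  ultimately show ?thesis by (intro LIMSEQ_le_const2[of "\<lambda>n. prob (?A n)"]) auto
 qed
 have "AE x in M. \<exists>m. \<forall>k\<ge>m. \<bar>S m k x\<bar> < 1 / real (Suc j)" for j
 proof -
  let ?c = "1 / real (Suc j)"
  let ?N = "{x\<in>space M. \<forall>m. \<exists>k\<ge>m. ?c \<le> \<bar>S m k x\<bar>}"
  have "prob ?N \<le> r m / ?c^2" for m
  proof -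
   have "prob ?N \<le> prob {x\<in>space M. \<exists>k\<ge>m. ?c \<le> \<bar>S m k x\<bar>}" by (intro finite_measure_mono) auto
   also have "... \<le> r m / ?c^2" by (rule tail) simp
   finally show ?thesis .
  qed
  moreover have "(\<lambda>m. r m / ?c^2) \<longlonglongrightarrow> 0 / ?c^2" by (intro tendsto_intros r0) simp
  ultimately have "prob ?N \<le> 0 / ?c^2" by (intro LIMSEQ_le_const[of "\<lambda>m. r m / ?c^2"]) auto
  then have "emeasure M ?N = 0" by (simp add: emeasure_eq_measure measure_le_0_iff)
  moreover have "?N \<in> sets M" by measurable
  ultimately show ?thesis by (intro AE_I[of _ _ ?N]) (auto simp: not_less)
 qed
 then have "AE x in M. \<forall>j. \<exists>m. \<forall>k\<ge>m. \<bar>S m k x\<bar> < 1 / real (Suc j)" by (simp add: AE_all_countable)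
 then show ?thesis
 proof eventually_elim
  case (elim x)
  show ?case
   unfolding summable_Cauchy
  proof (intro allI impI)
   fix e :: real assume "0 < e"
   then obtain j where j: "1 / real (Suc j) < e / 2" using nat_approx_posE[of "e / 2"] by auto
   obtain m where m: "\<And>k. k \<ge> m ==> \<bar>S m k x\<bar> < 1 / real (Suc j)" using elim by blast
   show "\<exists>N. \<forall>m\<ge>N. \<forall>n. norm (sum (\<lambda>i. D i x) {m..<n}) < e"
   proof (intro exI[of _ m] allI impI)
    fix k n assume k: "m \<le> k"
    show "norm (sum (\<lambda>i. D i x) {k..<n}) < e"
    proof (cases "k \<le> n")
     case True
     have "S m n x = S m k x + S k n x" using k True by (simp add: S_def sum.atLeastLessThan_concat)
     then have "\<bar>S k n x\<bar> \<le> \<bar>S m n x\<bar> + \<bar>S m k x\<bar>" by linarith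
     also have "... < e" using m[of n] m[of k] k True j by linarith
     finally show ?thesis by (simp add: S_def)
    next
     case False then show ?thesis using \<open>0 < e\<close> by simp
    qed
   qed
  qed
 qed
qed

end

text \<open>The differences \<open>D i / b i\<close> again satisfy the hypotheses, so their series
  converges, and Kronecker's lemma turns convergence of the series into the averaged
  statement.\<close>

theorem (in l2_martingale_differences) law_of_large_numbers:
 fixes b :: "nat => real"
 assumes b: "\<And>n. 0 < b n" "incseq b" "filterlim b at_top sequentially"
  and sum: "summable (\<lambda>i. (LINT x|M. (D i x)^2) / (b i)^2)"
 shows "AE x in M. (\<lambda>n. (\<Sum>i<n. D i x) / b n) \<longlonglongrightarrow> 0"
proof -
 interpret Db: l2_martingale_differences M F "\<lambda>i x. D i x / b i"
 proof
  show "integrable M (\<lambda>x. (D i x / b i)^2)" for i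
   using sq_integrable[of i] by (simp add: power_divide)
  show "(\<lambda>x. D i x / b i) \<in> borel_measurable (F (Suc i))" for i
   using adapted[of i] by measurable
  show "(LINT x|M. indicator A x * (D i x / b i)) = 0" if "A \<in> sets (F i)" for i A
   using mean_zero[OF that] by simp
 qed (use sub filtration in auto)
 have "summable (\<lambda>i. \<integral>x. (D i x / b i)^2 \<partial>M)"
  using sum by (simp add: power_divide)
 from Db.convergence[OF this] show ?thesis
  by eventually_elim (rule kronecker_lemma[OF b])
qed

text \<open>Multiplied by \<open>exp (c * harm n)\<close>, the recursion becomes a weighted average of the errors \<open>e\<close>.\<close>
lemma contraction_recursion:
 fixes v e :: "nat => real"
 assumes c: "0 < c" and v0: "\<And>n. 0 \<le> v n" and e: "e \<longlonglongrightarrow> 0"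
  and rec: "\<And>n. n \<ge> n0 ==> v (Suc n) \<le> v n * (1 - c / real (Suc n)) + e n / real (Suc n)"
 shows "v \<longlonglongrightarrow> 0"
proof -
 define b where "b = (\<lambda>n. exp (c * harm n :: real))"
 define w where "w = (\<lambda>n. b (Suc n) / real (Suc n))"
 have b: "0 < b n" for n by (simp add: b_def)
 have bS: "b (Suc n) = b n * exp (c / real (Suc n))" for n
  by (simp add: b_def harm_Suc exp_add[symmetric] inverse_eq_divide algebra_simps)
 have binf: "filterlim b at_top sequentially" unfolding b_def
  by (intro filterlim_compose[OF exp_at_top] filterlim_tendsto_pos_mult_at_top[OF tendsto_const c harm_at_top])
 have wb: "c * w n \<le> (1 + c) * (b (Suc n) - b n)" for n
 proof -
  define y where "y = c / real (Suc n)"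
  have y: "0 < y" "y \<le> c" using c by (auto simp: y_def field_simps)
  have "(1 + y) * b n \<le> b (Suc n)" unfolding bS y_def[symmetric] using exp_ge_add_one_self[of y] b[of n] by simp
  then have "y * b (Suc n) \<le> (1 + y) * (b (Suc n) - b n)" by (simp add: algebra_simps)
  also have "... \<le> (1 + c) * (b (Suc n) - b n)"
   using y b[of n] unfolding bS y_def[symmetric] by (intro mult_right_mono) auto
  finally show ?thesis by (simp add: w_def y_def)
 qed
 have W: "(\<Sum>i<n. w i) \<le> (1 + c) / c * b n" for n
 proof -
  have "c * (\<Sum>i<n. w i) \<le> (\<Sum>i<n. (1 + c) * (b (Suc i) - b i))"
   unfolding sum_distrib_left by (rule sum_mono[OF wb])
  also have "... \<le> (1 + c) * b n"
   using c b[of 0] by (simp add: sum_distrib_left[symmetric] sum_lessThan_telescope)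
  finally show ?thesis using c by (simp add: field_simps)
 qed
 obtain N where N: "n0 \<le> N" "c \<le> real N"
  using real_arch_simple[of c] by (metis max.cobounded1 max.cobounded2 of_nat_mono order_trans)
 have step: "b (Suc n) * v (Suc n) \<le> b n * v n + w n * \<bar>e n\<bar>" if n: "N \<le> n" for n
 proof -
  have "1 - c / real (Suc n) \<le> exp (- (c / real (Suc n)))" using exp_ge_add_one_self[of "- (c / real (Suc n))"] by simp
  then have "b (Suc n) * (1 - c / real (Suc n)) \<le> b (Suc n) * exp (- (c / real (Suc n)))"
   using b[of "Suc n"] by (intro mult_left_mono) auto
  also have "b (Suc n) * exp (- (c / real (Suc n))) = b n" by (simp add: bS exp_minus)
  finally have "b (Suc n) * (1 - c / real (Suc n)) \<le> b n" .
  then have "b (Suc n) * (1 - c / real (Suc n)) * v n \<le> b n * v n" using v0 by (rule mult_right_mono)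
  moreover have "b (Suc n) * v (Suc n) \<le> b (Suc n) * (v n * (1 - c / real (Suc n)) + e n / real (Suc n))"
   using rec[of n] N n b[of "Suc n"] by (intro mult_left_mono) auto
  moreover have "w n * e n \<le> w n * \<bar>e n\<bar>" using b[of "Suc n"] by (intro mult_left_mono) (auto simp: w_def)
  ultimately show ?thesis by (simp add: w_def algebra_simps)
 qed
 have bound: "b n * v n \<le> b N * v N + (\<Sum>i<n. w i * \<bar>e i\<bar>)" if "N \<le> n" for n
  using that
 proof (induction n rule: dec_induct)
  case base
  then show ?case using b by (auto intro!: sum_nonneg simp: w_def less_imp_le)
 qed (use step in fastforce)
 have "(\<lambda>n. b N * v N / b n + (\<Sum>i<n. w i * \<bar>e i\<bar>) / b n) \<longlonglongrightarrow> 0 + 0"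
  by (intro tendsto_add tendsto_divide_0[OF tendsto_const filterlim_at_top_imp_at_infinity[OF binf]]
    weighted_cesaro[OF _ b binf W] tendsto_rabs_zero e) (use b in \<open>auto simp: w_def less_imp_le\<close>)
 then have lim: "(\<lambda>n. b N * v N / b n + (\<Sum>i<n. w i * \<bar>e i\<bar>) / b n) \<longlonglongrightarrow> 0" by simp
 show ?thesis
 proof (rule tendsto_sandwich[OF _ _ tendsto_const lim])
  show "eventually (\<lambda>n. v n \<le> b N * v N / b n + (\<Sum>i<n. w i * \<bar>e i\<bar>) / b n) sequentially"
   using eventually_ge_at_top[of N]
  proof eventually_elim
   case (elim n)
   then show ?case using bound[of n] b[of n] by (simp add: add_divide_distrib[symmetric] pos_le_divide_eq mult.commute)
  qed
 qed (use v0 in simp)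
qed

text \<open>The deviation \<open>y n\<close> of \<open>B n / n\<close> from \<open>L\<close>
  satisfies \<open>(n + 1) * y (n + 1) = (n + p) * y n + o(1)\<close>, a contraction by
  \<open>1 - (1 - p) / (n + 1)\<close>. Negative \<open>p\<close> is allowed: the mean of the walk
  uses \<open>- p\<close>, the mean square uses \<open>p\<close>.\<close>

lemma averaged_recursion:
 fixes A R :: "nat => real"
 assumes p: "p < 1" and A: "\<And>n. A n = p * (\<Sum>i=1..<n. A i / real i) + R n"
  and R: "(\<lambda>n. R n / real n) \<longlonglongrightarrow> r"
 shows "(\<lambda>n. A n / real n) \<longlonglongrightarrow> r / (1 - p)"
proof -
 define L where "L = r / (1 - p)"
 define B where "B = (\<lambda>n. \<Sum>i=1..<n. A i / real i)"
 define y where "y = (\<lambda>n. B n / real n - L)"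
 define e where "e = (\<lambda>n. \<bar>R n / real n - r\<bar>)"
 have L: "r - L + p * L = 0" using p by (simp add: L_def field_simps)
 have e0: "e \<longlonglongrightarrow> 0" unfolding e_def using R by (simp add: LIM_zero tendsto_rabs_zero)
 \<comment> \<open>Ensures \<open>n + p >= 0\<close> also for negative \<open>p\<close>, so that the
   factor can be moved through the absolute value.\<close>
 obtain n0 :: nat where n0: "1 - p \<le> real n0" using real_arch_simple by blast
 have rec: "\<bar>y (Suc n)\<bar> \<le> \<bar>y n\<bar> * (1 - (1 - p) / real (Suc n)) + e n / real (Suc n)" if n: "n \<ge> max 1 n0" for n
 proof -
  have n1: "0 < real n" using n by simp
  have B: "B (Suc n) = B n + A n / real n" using n by (simp add: B_def)
  have An: "A n / real n = p * (B n / real n) + R n / real n"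
   by (subst A) (simp add: B_def add_divide_distrib)
  \<comment> \<open>The last bracket is 0 by the choice of \<open>L\<close>; keeping it makes this
    an identity of ring expressions.\<close>
  have "B (Suc n) - L * real (Suc n) = (real n + p) * (B n / real n - L) + (R n / real n - r) + (r - L + p * L)"
  proof -
   define z where "z = B n / real n"
   have Bz: "B n = z * real n" using n1 by (simp add: z_def)
   show ?thesis unfolding B An unfolding z_def[symmetric] unfolding Bz by (simp add: algebra_simps)
  qed
  then have "B (Suc n) - L * real (Suc n) = (real n + p) * y n + (R n / real n - r)" unfolding L by (simp add: y_def)
  moreover have "y (Suc n) * real (Suc n) = B (Suc n) - L * real (Suc n)" by (simp add: y_def field_simps)
  ultimately have "\<bar>y (Suc n)\<bar> * real (Suc n) = \<bar>(real n + p) * y n + (R n / real n - r)\<bar>"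
   by (metis abs_mult abs_of_nat)
  also have "... \<le> (real n + p) * \<bar>y n\<bar> + e n"
  proof -
   have "0 \<le> real n + p" using n n0 by simp
   then show ?thesis using abs_triangle_ineq[of "(real n + p) * y n" "R n / real n - r"] by (simp add: e_def abs_mult)
  qed
  finally have "\<bar>y (Suc n)\<bar> \<le> ((real n + p) * \<bar>y n\<bar> + e n) / real (Suc n)" by (simp add: pos_le_divide_eq)
  also have "... = \<bar>y n\<bar> * (1 - (1 - p) / real (Suc n)) + e n / real (Suc n)"
  proof -
   have "((s - (1 - p)) * z + f) / s = z * (1 - (1 - p) / s) + f / s" if "s \<noteq> 0" for s z f :: real
    using that by (simp add: field_simps)
   from this[of "real (Suc n)"] show ?thesis by simp
  qed
  finally show ?thesis .
 qed
 have "(\<lambda>n. \<bar>y n\<bar>) \<longlonglongrightarrow> 0"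
  by (rule contraction_recursion[of "1 - p" "\<lambda>n. \<bar>y n\<bar>" e "max 1 n0", OF _ _ e0 rec]) (use p in auto)
 then have "y \<longlonglongrightarrow> 0" by (rule tendsto_rabs_zero_cancel)
 then have Bn: "(\<lambda>n. B n / real n) \<longlonglongrightarrow> L" unfolding y_def by (rule LIM_zero_cancel)
 have "(\<lambda>n. p * (B n / real n) + R n / real n) \<longlonglongrightarrow> p * L + r" by (intro tendsto_intros Bn R)
 moreover have "p * (B n / real n) + R n / real n = A n / real n" for n
  by (subst A) (simp add: B_def add_divide_distrib)
 moreover have "p * L + r = L" using L by simp
 ultimately show ?thesis by (simp add: L_def)
qed

section \<open>A law of large numbers along the embedded chain\<close>

context skorokhod_chain
begin

text \<open>Generated by steps and times only. The remaining path is left out, since it would reveal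
  the future.\<close>

definition past :: "nat => (nat => state) measure" where
 "past i = vimage_algebra (space Om) (hist i) hist_space"

lemma space_past[simp]: "space (past i) = space Om"
 by (simp add: past_def del: IT.PF.space_lim)

lemma sets_past: "sets (past i) = {hist i -` B \<inter> space Om | B. B \<in> sets hist_space}"
 unfolding past_def by (rule sets_vimage_algebra2) (use measurable_space[OF hist_measurable] in auto)

lemma subalgebra_past: "subalgebra Om (past i)"
 unfolding subalgebra_def
proof
 show "sets (past i) \<subseteq> sets Om" unfolding sets_past using measurable_sets[OF hist_measurable] by blast
qed simp

lemma past_hist: "hist i \<in> measurable (past i) hist_space"
 unfolding past_def by (rule measurable_vimage_algebra1) (use measurable_space[OF hist_measurable] in auto)

lemma past_mono:
 assumes "i \<le> j" shows "sets (past i) \<subseteq> sets (past j)"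
proof -
 have "hist i \<in> measurable (past j) hist_space"
 proof (rule measurable_PiM_single')
  fix k
  show "(\<lambda>x. hist i x k) \<in> measurable (past j) plane"
  proof (cases "k < i")
   case True
   then have "(\<lambda>x. hist i x k) = (\<lambda>x. hist j x k)" using assms by (auto simp: hist_def)
   then show ?thesis using measurable_compose[OF past_hist hist_component] by simp
  qed (simp add: hist_def)
 qed (auto simp: space_pair_measure)
 from measurable_sets[OF this] show ?thesis unfolding sets_past by auto
qed

lemma past_pair: "(\<lambda>x. (xi i x, dt i x)) \<in> measurable (past (Suc i)) plane"
proof -
 have "(\<lambda>x. (xi i x, dt i x)) = (\<lambda>x. hist (Suc i) x i)" by (simp add: hist_def)
 then show ?thesis using measurable_compose[OF past_hist hist_component] by simp
qed

lemma law_integral_measurable: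
 fixes f :: "real \<times> real => real"
 assumes "f \<in> borel_measurable plane"
 shows "(\<lambda>h. \<integral>y. f y \<partial>law i h) \<in> borel_measurable hist_space"
 using law_measurable by (rule integral_measurable_subprob_algebra[OF assms, THEN measurable_compose[rotated]])

lemma measurable_law: "measurable (law i h) N = measurable plane N"
 unfolding law_def by (rule measurable_cong_sets) (simp_all add: skorokhod_step.sets_emb_law[OF step])

lemma prob_space_law: "prob_space (law i h)"
 unfolding law_def by (rule skorokhod_step.prob_space_emb_law[OF step])

text \<open>\<open>transition_law\<close> speaks of nonnegative functions; positive and negative
  parts are transported separately and shown to be finite almost surely before they are
  subtracted.\<close>

lemma transition_integral:
 fixes F :: "(nat => real \<times> real) \<times> real \<times> real => real"
 assumes F: "F \<in> borel_measurable (hist_space \<Otimes>\<^sub>M plane)"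
  and int: "integrable Om (\<lambda>s. F (hist i s, xi i s, dt i s))"
 shows "AE s in Om. integrable (law i (hist i s)) (\<lambda>y. F (hist i s, y))"
  and "integrable Om (\<lambda>s. \<integral>y. F (hist i s, y) \<partial>law i (hist i s))"
  and "(LINT s|Om. F (hist i s, xi i s, dt i s)) = (LINT s|Om. (LINT y|law i (hist i s). F (hist i s, y)))"
proof -
 let ?N = "\<lambda>F s. \<integral>\<^sup>+y. ennreal (F (hist i s, y)) \<partial>law i (hist i s)"
 have N: "?N F \<in> borel_measurable Om" "(\<integral>\<^sup>+s. ?N F s \<partial>Om) = (\<integral>\<^sup>+s. ennreal (F (hist i s, xi i s, dt i s)) \<partial>Om)"
  if [measurable]: "F \<in> borel_measurable (hist_space \<Otimes>\<^sub>M plane)" for F :: "_ => real"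
 proof -
  have "(\<lambda>h. \<integral>\<^sup>+y. ennreal (F (h, y)) \<partial>law i h) \<in> borel_measurable hist_space"
   by (rule nn_integral_measurable_subprob_algebra2[OF _ law_measurable]) simp
  then show "?N F \<in> borel_measurable Om" by (rule measurable_compose[OF hist_measurable])
  show "(\<integral>\<^sup>+s. ?N F s \<partial>Om) = (\<integral>\<^sup>+s. ennreal (F (hist i s, xi i s, dt i s)) \<partial>Om)"
   using transition_law[of "\<lambda>x. ennreal (F x)" i] by simp
 qed
 have fin: "(\<integral>\<^sup>+s. ?N F' s \<partial>Om) < \<infinity>" "AE s in Om. ?N F' s < \<infinity>"
  "integrable Om (\<lambda>s. enn2real (?N F' s))" "(LINT s|Om. enn2real (?N F' s)) = enn2real (\<integral>\<^sup>+s. ?N F' s \<partial>Om)"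
  if F': "F' \<in> borel_measurable (hist_space \<Otimes>\<^sub>M plane)" "\<And>x. F' x \<le> \<bar>F x\<bar>" for F' :: "_ => real"
 proof -
  have "(\<integral>\<^sup>+s. ?N F' s \<partial>Om) \<le> (\<integral>\<^sup>+s. norm (F (hist i s, xi i s, dt i s)) \<partial>Om)"
   unfolding N(2)[OF F'(1)] using F'(2) by (intro nn_integral_mono ennreal_leI) simp
  also have "... < \<infinity>" using int by (simp add: integrable_iff_bounded)
  finally show fin: "(\<integral>\<^sup>+s. ?N F' s \<partial>Om) < \<infinity>" .
  then show ae: "AE s in Om. ?N F' s < \<infinity>"
   using nn_integral_PInf_AE[OF N(1)[OF F'(1)]] by (auto simp: less_top[symmetric])
  have e: "(\<integral>\<^sup>+s. ennreal (enn2real (?N F' s)) \<partial>Om) = (\<integral>\<^sup>+s. ?N F' s \<partial>Om)"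
   by (rule nn_integral_cong_AE) (use ae in \<open>eventually_elim, simp\<close>)
  have m: "(\<lambda>s. enn2real (?N F' s)) \<in> borel_measurable Om" using N(1)[OF F'(1)] by measurable
  show "integrable Om (\<lambda>s. enn2real (?N F' s))" using m e fin by (simp add: integrable_iff_bounded)
  show "(LINT s|Om. enn2real (?N F' s)) = enn2real (\<integral>\<^sup>+s. ?N F' s \<partial>Om)"
   using m by (subst integral_eq_nn_integral) (auto simp: e)
 qed
 have Fm: "(\<lambda>x. - F x) \<in> borel_measurable (hist_space \<Otimes>\<^sub>M plane)"
  "(\<lambda>x. \<bar>F x\<bar>) \<in> borel_measurable (hist_space \<Otimes>\<^sub>M plane)" using F by auto
 show i: "AE s in Om. integrable (law i (hist i s)) (\<lambda>y. F (hist i s, y))"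
  using fin(2)[OF Fm(2) order_refl] AE_space
 proof eventually_elim
  case (elim s)
  have "(\<lambda>y. F (hist i s, y)) \<in> borel_measurable plane"
   by (rule measurable_compose[OF measurable_Pair1' F]) (use measurable_space[OF hist_measurable elim(2)] in simp)
  then show ?case using elim by (simp add: integrable_iff_bounded measurable_law)
 qed
 have *: "AE s in Om. (LINT y|law i (hist i s). F (hist i s, y)) = enn2real (?N F s) - enn2real (?N (\<lambda>x. - F x) s)"
  using i by eventually_elim (rule real_lebesgue_integral_def)
 have m: "(\<lambda>s. \<integral>y. F (hist i s, y) \<partial>law i (hist i s)) \<in> borel_measurable Om"
 proof (rule measurable_compose[OF hist_measurable], subst measurable_cong)
  show "(\<lambda>h. integral\<^sup>L (distr (law i h) (hist_space \<Otimes>\<^sub>M plane) (Pair h)) F) \<in> borel_measurable hist_space"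
   by (rule measurable_compose[OF measurable_distr2[OF _ law_measurable] integral_measurable_subprob_algebra[OF F]]) simp
  show "(LINT y|law i h. F (h, y)) = integral\<^sup>L (distr (law i h) (hist_space \<Otimes>\<^sub>M plane) (Pair h)) F"
   if "h \<in> space hist_space" for h
   by (rule integral_distr[symmetric, OF _ F]) (simp add: measurable_law measurable_Pair1'[OF that])
 qed
 have d: "has_bochner_integral Om (\<lambda>s. enn2real (?N F s) - enn2real (?N (\<lambda>x. - F x) s)) (LINT s|Om. F (hist i s, xi i s, dt i s))"
  unfolding has_bochner_integral_iff real_lebesgue_integral_def[OF int]
  using fin(3,4)[OF F abs_ge_self] fin(3,4)[OF Fm(1) abs_ge_minus_self] N(2)[OF F] N(2)[OF Fm(1)] by simp
 then have "has_bochner_integral Om (\<lambda>s. \<integral>y. F (hist i s, y) \<partial>law i (hist i s)) (LINT s|Om. F (hist i s, xi i s, dt i s))"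
  using * m by (subst has_bochner_integral_cong_AE) auto
 then show "integrable Om (\<lambda>s. \<integral>y. F (hist i s, y) \<partial>law i (hist i s))"
  "(LINT s|Om. F (hist i s, xi i s, dt i s)) = (LINT s|Om. (LINT y|law i (hist i s). F (hist i s, y)))"
  by (simp_all add: has_bochner_integral_iff)
qed

text \<open>Subtracting the integral against the conditional law produces martingale differences for
  \<open>past\<close>. Their second moments are at most \<open>4 * v i\<close>, so the summability
  assumption on \<open>v\<close> carries over.\<close>

theorem martingale_law_of_large_numbers:
 fixes f :: "nat => real \<times> real => real" and b v :: "nat => real"
 assumes f: "\<And>i. f i \<in> borel_measurable plane"
  and v: "\<And>i. (\<integral>\<^sup>+s. ennreal ((f i (xi i s, dt i s))^2) \<partial>Om) \<le> ennreal (v i)" "\<And>i. 0 \<le> v i"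
  and b: "\<And>n. 0 < b n" "incseq b" "filterlim b at_top sequentially"
  and sum: "summable (\<lambda>i. v i / (b i)^2)"
 shows "AE s in Om. (\<lambda>n. (\<Sum>i<n. f i (xi i s, dt i s) - (LINT y|law i (hist i s). f i y)) / b n) \<longlonglongrightarrow> 0"
proof -
 let ?Y = "\<lambda>i s. f i (xi i s, dt i s)" and ?m = "\<lambda>i s. \<integral>y. f i y \<partial>law i (hist i s)"
 have Ym[measurable]: "?Y i \<in> borel_measurable Om" for i
  by (rule measurable_compose[OF _ f]) simp
 have mm[measurable]: "?m i \<in> borel_measurable Om" for i
  by (rule measurable_compose[OF hist_measurable law_integral_measurable[OF f]])
 have Y2: "integrable Om (\<lambda>s. (?Y i s)^2)" for i
  using v(1)[of i] le_less_trans[OF _ ennreal_less_top] by (auto simp: integrable_iff_bounded)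
 have Y2v: "(LINT s|Om. (?Y i s)^2) \<le> v i" for i
  using v(1)[of i] nn_integral_eq_integral[OF Y2[of i]] v(2)[of i] by simp
 have Y1: "integrable Om (?Y i)" for i
  using chain.square_integrable_imp_integrable[OF Ym Y2] .
 have f2: "(\<lambda>y. (f i y)^2) \<in> borel_measurable plane" for i using f[of i] by measurable
 have fs[measurable]: "(\<lambda>x. f i (snd x)) \<in> borel_measurable (hist_space \<Otimes>\<^sub>M plane)" for i
  by (rule measurable_compose[OF measurable_snd f])
 note c1 = transition_integral[OF fs, simplified, OF Y1]
  and c2 = transition_integral[of "\<lambda>x. (f i (snd x))^2" i for i, simplified, OF Y2]
 \<comment> \<open>Nonnegativity of the variance under the conditional law.\<close>
 have jensen: "AE s in Om. (?m i s)^2 \<le> (LINT y|law i (hist i s). (f i y)^2)" for i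
  using c1(1)[of i] c2(1)[of i]
 proof eventually_elim
  case (elim s)
  interpret l: prob_space "law i (hist i s)" by (rule prob_space_law)
  show ?case using l.variance_positive[of "f i"] l.variance_eq[OF elim] by simp
 qed
 have m2: "integrable Om (\<lambda>s. (?m i s)^2)" for i
  by (rule Bochner_Integration.integrable_bound[OF c2(2)[of i]]) (use jensen[of i] in auto)
 have m2v: "(LINT s|Om. (?m i s)^2) \<le> v i" for i
  using integral_mono_AE[OF m2[of i] c2(2)[of i] jensen[of i]] c2(3)[of i] Y2v[of i] by simp
 have sq: "(x - y)^2 \<le> 2 * x^2 + 2 * y^2" for x y :: real
  using zero_le_power2[of "x + y"] by (simp add: power2_eq_square algebra_simps)
 have D2: "integrable Om (\<lambda>s. (?Y i s - ?m i s)^2)" for i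
  by (rule Bochner_Integration.integrable_bound[where f="\<lambda>s. 2 * (?Y i s)^2 + 2 * (?m i s)^2"])
   (use Y2[of i] m2[of i] sq in auto)
 interpret D: l2_martingale_differences Om past "\<lambda>i s. ?Y i s - ?m i s"
 proof
  show "subalgebra Om (past i)" for i by (rule subalgebra_past)
  show "i \<le> j ==> sets (past i) \<subseteq> sets (past j)" for i j by (rule past_mono)
  show "(\<lambda>s. ?Y i s - ?m i s) \<in> borel_measurable (past (Suc i))" for i
  proof (rule borel_measurable_diff)
   show "?Y i \<in> borel_measurable (past (Suc i))" by (rule measurable_compose[OF past_pair f])
   have "?m i \<in> borel_measurable (past i)"
    by (rule measurable_compose[OF past_hist law_integral_measurable[OF f]])
   then show "?m i \<in> borel_measurable (past (Suc i))"
    using past_mono[of i "Suc i"] by (auto simp: measurable_def)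
  qed
  show "integrable Om (\<lambda>s. (?Y i s - ?m i s)^2)" for i by (rule D2)
  fix i A assume "A \<in> sets (past i)"
  then obtain B where [measurable]: "B \<in> sets hist_space" and A: "A = hist i -` B \<inter> space Om" by (auto simp: sets_past)
  let ?F = "\<lambda>x. indicator B (fst x) * (f i (snd x) - (LINT y|law i (fst x). f i y))"
  have F: "?F \<in> borel_measurable (hist_space \<Otimes>\<^sub>M plane)"
   using measurable_compose[OF measurable_fst law_integral_measurable[OF f]] by measurable
  have "integrable Om (\<lambda>s. ?F (hist i s, xi i s, dt i s))"
   by (rule Bochner_Integration.integrable_bound[OF Bochner_Integration.integrable_diff[OF Y1[of i] c1(2)[of i]]])
    (use measurable_compose[OF _ F, of "\<lambda>s. (hist i s, xi i s, dt i s)" Om] in \<open>auto simp: indicator_def\<close>)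
  note tr = transition_integral[OF F this]
  have "(LINT s|Om. (LINT y|law i (hist i s). ?F (hist i s, y))) = (LINT s|Om. 0)"
  proof (rule integral_cong_AE)
   show "AE s in Om. (LINT y|law i (hist i s). ?F (hist i s, y)) = 0"
    using c1(1)[of i]
   proof eventually_elim
    case (elim s)
    interpret l: prob_space "law i (hist i s)" by (rule prob_space_law)
    show ?case using elim l.prob_space by simp
   qed
  qed (use tr(2) in auto)
  moreover have "(LINT s|Om. indicator A s * (?Y i s - ?m i s)) = (LINT s|Om. ?F (hist i s, xi i s, dt i s))"
   by (rule Bochner_Integration.integral_cong) (auto simp: A indicator_def)
  ultimately show "(LINT s|Om. indicator A s * (?Y i s - ?m i s)) = 0" using tr(3) by simp
 qed
 have "summable (\<lambda>i. (LINT s|Om. (?Y i s - ?m i s)^2) / (b i)^2)"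
 proof (rule summable_comparison_test'[OF summable_mult[OF sum, of 4]])
  fix i
  have "(LINT s|Om. (?Y i s - ?m i s)^2) \<le> (LINT s|Om. 2 * (?Y i s)^2 + 2 * (?m i s)^2)"
   by (rule integral_mono[OF D2]) (use Y2[of i] m2[of i] sq in auto)
  also have "... \<le> 4 * v i" using Y2[of i] m2[of i] Y2v[of i] m2v[of i] by simp
  finally show "norm ((LINT s|Om. (?Y i s - ?m i s)^2) / (b i)^2) \<le> 4 * (v i / (b i)^2)"
   using divide_right_mono[of _ "4 * v i" "(b i)^2"] by simp
 qed
 from D.law_of_large_numbers[OF b this] show ?thesis .
qed

end

section \<open>The reinforced walk\<close>

declare path_coordinate_measurable[measurable del]

abbreviation seq_space :: "(nat => real) measure" where
 "seq_space \<equiv> PiM UNIV (\<lambda>_. borel)"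

definition initial_part :: "(nat => 'a => real) => nat => 'a => nat => real" where
 "initial_part Y n x = (\<lambda>j. if j < n then Y j x else 0)"

lemma initial_part_measurable:
 assumes "\<And>j. j < n ==> Y j \<in> borel_measurable M"
 shows "initial_part Y n \<in> measurable M seq_space"
proof (rule measurable_PiM_single')
 fix j show "(\<lambda>x. initial_part Y n x j) \<in> borel_measurable M"
  using assms by (cases "j < n") (auto simp: initial_part_def)
qed auto

lemma initial_part_Suc: "initial_part Y (Suc n) x = (initial_part Y n x)(n := Y n x)"
 by (auto simp: initial_part_def fun_eq_iff)

text \<open>Conditional laws are expressed by testing functions of the past and the next value,
  without conditional expectations. The given walk and the embedded one are both shown to have this
  property, which settles equality in law.\<close>

definition kernel_process :: "(nat => (nat => real) => real measure) => 'a measure => (nat => 'a => real) => bool" where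
 "kernel_process K M Y \<longleftrightarrow> (\<forall>n. Y n \<in> borel_measurable M) \<and>
  (\<forall>n F. F \<in> borel_measurable (seq_space \<Otimes>\<^sub>M borel) -->
   (\<integral>\<^sup>+s. F (initial_part Y n s, Y n s) \<partial>M) = (\<integral>\<^sup>+s. (\<integral>\<^sup>+x. F (initial_part Y n s, x) \<partial>K n (initial_part Y n s)) \<partial>M))"

text \<open>Induction on the length for functions of an initial part; every cylinder set looks at
  finitely many coordinates and so is decided by an initial part.\<close>

lemma kernel_process_unique:
 assumes K: "\<And>n. K n \<in> measurable seq_space (subprob_algebra borel)"
  and M: "prob_space M" "kernel_process K M Y" and N: "prob_space N" "kernel_process K N Z"
 shows "distr M seq_space (\<lambda>s n. Y n s) = distr N seq_space (\<lambda>s n. Z n s)"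
proof -
 interpret M: prob_space M by fact
 interpret N: prob_space N by fact
 have Y[measurable]: "Y n \<in> borel_measurable M" and Z[measurable]: "Z n \<in> borel_measurable N" for n
  using M N by (auto simp: kernel_process_def)
 have step: "(\<integral>\<^sup>+s. F (initial_part Y' (Suc n) s) \<partial>M') =
  (\<integral>\<^sup>+s. (\<integral>\<^sup>+x. F ((initial_part Y' n s)(n := x)) \<partial>K n (initial_part Y' n s)) \<partial>M')"
  if "kernel_process K M' Y'" "F \<in> borel_measurable seq_space" for M' :: "'c measure" and Y' F n
 proof -
  have "(\<lambda>(h, x). h(n := x)) \<in> measurable (seq_space \<Otimes>\<^sub>M borel) seq_space"
   unfolding split_beta' by (rule measurable_fun_upd[where J=UNIV]) auto
  from that(1)[unfolded kernel_process_def, THEN conjunct2, rule_format, OF measurable_compose[OF this that(2)]]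
  show ?thesis by (simp add: initial_part_Suc)
 qed
 have eq: "(\<integral>\<^sup>+s. F (initial_part Y n s) \<partial>M) = (\<integral>\<^sup>+s. F (initial_part Z n s) \<partial>N)"
  if "F \<in> borel_measurable seq_space" for F n
  using that
 proof (induction n arbitrary: F)
  case 0
  then show ?case by (simp add: initial_part_def M.emeasure_space_1 N.emeasure_space_1)
 next
  case (Suc n)
  have "(\<lambda>(h, x). h(n := x)) \<in> measurable (seq_space \<Otimes>\<^sub>M borel) seq_space"
   unfolding split_beta' by (rule measurable_fun_upd[where J=UNIV]) auto
  from measurable_compose[OF this Suc.prems]
  have "(\<lambda>(h, x). F (h(n := x))) \<in> borel_measurable (seq_space \<Otimes>\<^sub>M borel)" by (simp only: split_beta')
  then have "(\<lambda>h. \<integral>\<^sup>+x. F (h(n := x)) \<partial>K n h) \<in> borel_measurable seq_space"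
   by (rule nn_integral_measurable_subprob_algebra2[OF _ K])
  from Suc.IH[OF this] show ?case using step[OF M(2) Suc.prems] step[OF N(2) Suc.prems] by simp
 qed
 have mY: "(\<lambda>s n. Y n s) \<in> measurable M seq_space" and mZ: "(\<lambda>s n. Z n s) \<in> measurable N seq_space"
  by (rule measurable_PiM_single'; simp)+
 show ?thesis
 proof (rule measure_eqI_PiM_infinite)
  show "finite_measure (distr M seq_space (\<lambda>s n. Y n s))"
   using M.prob_space_distr[OF mY] by (simp add: prob_space_def)
  fix A :: "nat => real set" and J :: "nat set" assume J: "finite J" "J \<subseteq> UNIV" and A: "\<And>j. j \<in> J ==> A j \<in> sets borel"
  let ?E = "prod_emb UNIV (\<lambda>_. borel :: real measure) J (Pi\<^sub>E J A)"
  have E: "?E \<in> sets seq_space" using J A by (intro sets_PiM_I) auto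
  have in_E: "h \<in> ?E \<longleftrightarrow> (\<forall>j\<in>J. h j \<in> A j)" for h :: "nat => real"
   by (auto simp: prod_emb_def space_PiM PiE_iff)
  obtain n where n: "J \<subseteq> {..<n}" using finite_nat_bounded[OF J(1)] by blast
  have ind: "indicator ?E (initial_part Y' n s) = (indicator ?E (\<lambda>n. Y' n s) :: ennreal)" for Y' :: "nat => 'c => real" and s
  proof -
   have "initial_part Y' n s j = Y' j s" if "j \<in> J" for j using n that by (auto simp: initial_part_def)
   then show ?thesis by (simp add: indicator_def in_E)
  qed
  have em: "emeasure (distr M' seq_space (\<lambda>s n. Y' n s)) ?E = (\<integral>\<^sup>+s. indicator ?E (initial_part Y' n s) \<partial>M')"
   if "(\<lambda>s n. Y' n s) \<in> measurable M' seq_space" for M' :: "'c measure" and Y'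
   using E that by (subst nn_integral_indicator[symmetric], simp, subst nn_integral_distr) (auto simp: ind)
  show "emeasure (distr M seq_space (\<lambda>s n. Y n s)) ?E = emeasure (distr N seq_space (\<lambda>s n. Z n s)) ?E"
   using em[OF mY] em[OF mZ] eq[of "indicator ?E" n] E by simp
 qed simp_all
qed

abbreviation choice_law :: "real => nat => (bool \<times> nat) measure" where
 "choice_law p i \<equiv> measure_pmf (bernoulli_pmf p) \<Otimes>\<^sub>M measure_pmf (pmf_of_set {1..<Suc i})"

text \<open>Steps are counted from 0 here but from 1 in the model: \<open>K i\<close> produces the
  step with number \<open>i + 1\<close>, and the memory \<open>u\<close> in \<open>{1..i}\<close>
  points to entry \<open>u - 1\<close>. The guard covers the first step, which has no past.\<close>

definition nsr_kernel :: "real => real measure => nat => (nat => real) => real measure" where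
 "nsr_kernel p \<nu> i h = distr (\<nu> \<Otimes>\<^sub>M choice_law p i) borel
   (\<lambda>(x, e, u). if 0 < i \<and> e then - h (u - 1) else x)"

locale nsr_law = prob_space \<nu> for \<nu> :: "real measure" and p :: real +
 assumes sets_\<nu>[measurable_cong, simp]: "sets \<nu> = sets borel" and p: "0 < p" "p < 1"
begin

lemma input_sets[measurable_cong]: "sets (\<nu> \<Otimes>\<^sub>M choice_law p i) =
  sets (borel \<Otimes>\<^sub>M (count_space UNIV \<Otimes>\<^sub>M count_space UNIV))"
 by (intro sets_pair_measure_cong) auto

lemma select_measurable:
 assumes h: "h \<in> measurable M seq_space" and [measurable]: "x \<in> borel_measurable M"
  "e \<in> measurable M (count_space UNIV)" "u \<in> measurable M (count_space (UNIV :: nat set))"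
 shows "(\<lambda>s. if 0 < i \<and> e s then - h s (u s - 1) else x s :: real) \<in> borel_measurable M"
proof -
 have [measurable]: "(\<lambda>s. h s k) \<in> borel_measurable M" for k :: nat
  by (rule measurable_compose[OF h measurable_component_singleton]) simp
 have [measurable]: "(\<lambda>s. h s (u s - 1)) \<in> borel_measurable M"
  by (rule measurable_compose_countable) measurable
 show ?thesis by measurable
qed

sublocale U: prob_space "choice_law p i" for i
 by (rule prob_space_pair) (rule measure_pmf.prob_space_axioms)+

lemma prob_space_input: "prob_space (\<nu> \<Otimes>\<^sub>M choice_law p i)"
 by (rule prob_space_pair[OF prob_space_axioms U.prob_space_axioms])

lemma nsr_kernel_measurable: "nsr_kernel p \<nu> i \<in> measurable seq_space (subprob_algebra borel)"
 unfolding nsr_kernel_def[abs_def]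
proof (rule measurable_distr2)
 let ?I = "borel \<Otimes>\<^sub>M (count_space UNIV \<Otimes>\<^sub>M count_space UNIV) :: (real \<times> bool \<times> nat) measure"
 show "(\<lambda>(h, x, e, u). if 0 < i \<and> e then - h (u - 1) else x) \<in> borel_measurable (seq_space \<Otimes>\<^sub>M ?I)"
  unfolding split_beta' by (rule select_measurable) measurable
 show "(\<lambda>h. \<nu> \<Otimes>\<^sub>M choice_law p i) \<in> measurable seq_space (subprob_algebra ?I)"
  by (rule measurable_const) (simp only: space_subprob_algebra mem_Collect_eq prob_space_imp_subprob_space[OF prob_space_input] input_sets simp_thms)
qed

lemma select_measurable':
 "(\<lambda>(x, e, u). if 0 < i \<and> e then - h (u - 1) else x :: real) \<in>
  borel_measurable (\<nu> \<Otimes>\<^sub>M choice_law p i)"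
 unfolding split_beta' by (rule select_measurable) (measurable, auto simp: space_PiM)

lemma nsr_kernel_prob: "prob_space (nsr_kernel p \<nu> i h)"
 unfolding nsr_kernel_def by (rule prob_space.prob_space_distr[OF prob_space_input select_measurable'])

lemma sets_nsr_kernel[simp]: "sets (nsr_kernel p \<nu> i h) = sets borel"
 by (simp add: nsr_kernel_def)

lemma nn_integral_nsr_kernel':
 assumes f[measurable]: "f \<in> borel_measurable borel"
 shows "(\<integral>\<^sup>+x. f x \<partial>nsr_kernel p \<nu> i h) = (\<integral>\<^sup>+x. (\<integral>\<^sup>+e. (\<integral>\<^sup>+u. f (if 0 < i \<and> e then - h (u - 1) else x)
  \<partial>measure_pmf (pmf_of_set {1..<Suc i})) \<partial>measure_pmf (bernoulli_pmf p)) \<partial>\<nu>)"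
proof -
 have m: "(\<lambda>(x, e, u). f (if 0 < i \<and> e then - h (u - 1) else x)) \<in>
  borel_measurable (\<nu> \<Otimes>\<^sub>M choice_law p i)"
  using measurable_compose[OF select_measurable' f] by (simp add: split_beta')
 have "(\<integral>\<^sup>+x. f x \<partial>nsr_kernel p \<nu> i h) = (\<integral>\<^sup>+q. (\<lambda>(x, e, u). f (if 0 < i \<and> e then - h (u - 1) else x)) q
   \<partial>(\<nu> \<Otimes>\<^sub>M choice_law p i))"
  unfolding nsr_kernel_def by (subst nn_integral_distr[OF select_measurable']) (auto intro!: nn_integral_cong)
 also have "... = (\<integral>\<^sup>+x. (\<integral>\<^sup>+q. (\<lambda>(e, u). f (if 0 < i \<and> e then - h (u - 1) else x)) q
   \<partial>choice_law p i) \<partial>\<nu>)"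
  by (subst U.nn_integral_fst[OF m, symmetric]) simp
 also have "... = (\<integral>\<^sup>+x. (\<integral>\<^sup>+e. (\<integral>\<^sup>+u. f (if 0 < i \<and> e then - h (u - 1) else x)
  \<partial>measure_pmf (pmf_of_set {1..<Suc i})) \<partial>measure_pmf (bernoulli_pmf p)) \<partial>\<nu>)"
 proof (rule nn_integral_cong)
  fix x assume "x \<in> space \<nu>"
  from measurable_Pair2[OF m this]
  have s: "(\<lambda>(e, u). f (if 0 < i \<and> e then - h (u - 1) else x)) \<in> borel_measurable (choice_law p i)" by simp
  show "(\<integral>\<^sup>+q. (\<lambda>(e, u). f (if 0 < i \<and> e then - h (u - 1) else x)) q
    \<partial>choice_law p i)
   = (\<integral>\<^sup>+e. (\<integral>\<^sup>+u. f (if 0 < i \<and> e then - h (u - 1) else x)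
    \<partial>measure_pmf (pmf_of_set {1..<Suc i})) \<partial>measure_pmf (bernoulli_pmf p))"
   by (subst measure_pmf.nn_integral_fst[OF s, symmetric]) simp
 qed
 finally show ?thesis .
qed

lemma nn_integral_nsr_kernel:
 assumes f[measurable]: "f \<in> borel_measurable borel" and i: "0 < i"
 shows "(\<integral>\<^sup>+x. f x \<partial>nsr_kernel p \<nu> i h) =
  ennreal (1 - p) * (\<integral>\<^sup>+x. f x \<partial>\<nu>) + ennreal (p / real i) * (\<Sum>j<i. f (- h j))"
proof -
 have \<phi>': "f \<in> borel_measurable \<nu>" by measurable
 have "(\<integral>\<^sup>+u. f (- h (u - 1)) \<partial>measure_pmf (pmf_of_set {1..<Suc i})) = (\<Sum>j<i. f (- h j)) / ennreal (real i)"
 proof -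
  have "(\<Sum>u\<in>{1..<Suc i}. f (- h (u - 1))) = (\<Sum>j<i. f (- h j))"
   by (rule sum.reindex_bij_witness[of _ Suc "\<lambda>u. u - 1"]) auto
  then show ?thesis using i by (subst nn_integral_pmf_of_set) (auto simp: ennreal_of_nat_eq_real_of_nat)
 qed
 then have "(\<integral>\<^sup>+x. f x \<partial>nsr_kernel p \<nu> i h) = (\<integral>\<^sup>+x. ennreal p * ((\<Sum>j<i. f (- h j)) / ennreal (real i)) + ennreal (1 - p) * f x \<partial>\<nu>)"
  using i p by (subst nn_integral_nsr_kernel'[OF f]) (simp add: nn_integral_bernoulli_pmf measure_pmf.emeasure_space_1 mult.commute)
 also have "... = ennreal p * ((\<Sum>j<i. f (- h j)) / ennreal (real i)) + ennreal (1 - p) * (\<integral>\<^sup>+x. f x \<partial>\<nu>)"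
  using \<phi>' by (simp add: nn_integral_add nn_integral_cmult emeasure_space_1)
 also have "ennreal p * ((\<Sum>j<i. f (- h j)) / ennreal (real i)) = ennreal (p / real i) * (\<Sum>j<i. f (- h j))"
  using i p by (simp add: divide_ennreal[symmetric] ennreal_times_divide ennreal_divide_times mult.commute)
 finally show ?thesis by (simp add: add.commute)
qed

lemma nsr_kernel_0:
 assumes f[measurable]: "f \<in> borel_measurable borel"
 shows "(\<integral>\<^sup>+x. f x \<partial>nsr_kernel p \<nu> 0 h) = (\<integral>\<^sup>+x. f x \<partial>\<nu>)"
 by (subst nn_integral_nsr_kernel'[OF f]) (simp add: measure_pmf.emeasure_space_1)

end

section \<open>The given input follows the reinforcement kernel\<close>

context nsr_input
begin

abbreviation "inputs \<equiv> Innovation ` {1..} \<union> Indicator ` {2..} \<union> Memory ` {2..}"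

definition input_events :: "nsr_index => 'a set set" where
 "input_events k = (case k of
      Innovation n => sets (vimage_algebra (space M) (X n) borel)
     | Indicator n => sets (vimage_algebra (space M) (\<epsilon> n) (count_space UNIV))
     | Memory n => sets (vimage_algebra (space M) (U n) (count_space UNIV)))"

lemma indep_inputs: "indep_sets input_events inputs"
 unfolding input_events_def[abs_def] by (rule independent)

definition gen :: "nsr_index set => 'a measure" where
 "gen I = sigma (space M) (\<Union>k\<in>I. input_events k)"

lemma input_events_space: "input_events k \<subseteq> Pow (space M)"
proof (cases k)
 case (Innovation n)
 show ?thesis using sets.space_closed[of "vimage_algebra (space M) (X n) borel"] by (simp add: Innovation input_events_def)
next
 case (Indicator n)
 show ?thesis using sets.space_closed[of "vimage_algebra (space M) (\<epsilon> n) (count_space UNIV)"] by (simp add: Indicator input_events_def)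
next
 case (Memory n)
 show ?thesis using sets.space_closed[of "vimage_algebra (space M) (U n) (count_space UNIV)"] by (simp add: Memory input_events_def)
qed

lemma space_gen[simp]: "space (gen I) = space M"
 by (simp add: gen_def space_measure_of_conv)

lemma sets_gen: "sets (gen I) = sigma_sets (space M) (\<Union>k\<in>I. input_events k)"
 unfolding gen_def by (rule sets_measure_of) (use input_events_space in blast)

lemma X_gen: "Innovation n \<in> I ==> X n \<in> borel_measurable (gen I)"
 by (rule measurableI) (auto simp: sets_gen input_events_def intro!: sigma_sets.Basic bexI[of _ "Innovation n"] in_vimage_algebra)

lemma \<epsilon>_gen: "Indicator n \<in> I ==> \<epsilon> n \<in> measurable (gen I) (count_space UNIV)"
 by (rule measurableI) (auto simp: sets_gen input_events_def intro!: sigma_sets.Basic bexI[of _ "Indicator n"] in_vimage_algebra)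

lemma U_gen: "Memory n \<in> I ==> U n \<in> measurable (gen I) (count_space UNIV)"
 by (rule measurableI) (auto simp: sets_gen input_events_def intro!: sigma_sets.Basic bexI[of _ "Memory n"] in_vimage_algebra)

lemma subalgebra_gen: "I \<subseteq> inputs ==> subalgebra M (gen I)"
 unfolding subalgebra_def
proof
 assume I: "I \<subseteq> inputs"
 have "\<forall>k\<in>inputs. input_events k \<subseteq> events" using indep_inputs unfolding indep_sets_def by (rule conjunct1)
 then have "input_events k \<subseteq> events" if "k \<in> I" for k using subsetD[OF I that] by (rule bspec)
 then have "(\<Union>k\<in>I. input_events k) \<subseteq> events" by (rule UN_least)
 then show "sets (gen I) \<subseteq> events" unfolding sets_gen by (rule sets.sigma_sets_subset)
qed simp

lemma gen_measurable: "f \<in> measurable (gen I) S ==> I \<subseteq> inputs ==> f \<in> measurable M S"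
 by (rule measurable_from_subalg[OF subalgebra_gen])

text \<open>Inputs of three types are grouped through their sigma-algebras: disjoint index sets
  generate independent sigma-algebras, and any two variables read from them have a product
  law.\<close>

lemma indep_blocks:
 assumes I: "I \<subseteq> inputs" "J \<subseteq> inputs" "I \<inter> J = {}"
  and f: "f \<in> measurable (gen I) S" and h: "h \<in> measurable (gen J) T"
 shows "distr M (S \<Otimes>\<^sub>M T) (\<lambda>x. (f x, h x)) = distr M S f \<Otimes>\<^sub>M distr M T h"
proof -
 let ?B = "case_bool I J"
 have "indep_sets (\<lambda>b. sigma_sets (space M) (\<Union>k\<in>?B b. input_events k)) UNIV"
 proof (rule indep_sets_collect_sigma)
  show "indep_sets input_events (\<Union>b. ?B b)"
   by (rule indep_sets_mono_index[OF _ indep_inputs]) (use I in \<open>auto split: bool.splits\<close>)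
  show "disjoint_family_on ?B UNIV" using I(3) by (auto simp: disjoint_family_on_def split: bool.splits)
  show "Int_stable (input_events k)" for k
   unfolding Int_stable_def input_events_def by (auto split: nsr_index.splits)
 qed
 then have "indep_sets (\<lambda>b. sets (gen (?B b))) UNIV" by (simp add: sets_gen)
 then have ind: "indep_set (sets (gen I)) (sets (gen J))"
  unfolding indep_set_def by (rule indep_sets_mono_sets) (auto split: bool.splits)
 note fM = gen_measurable[OF f I(1)] and hM = gen_measurable[OF h I(2)]
 interpret F: prob_space "distr M S f" by (rule prob_space_distr[OF fM])
 interpret H: prob_space "distr M T h" by (rule prob_space_distr[OF hM])
 show ?thesis
 proof (rule pair_measure_eqI[symmetric])
  fix A B assume "A \<in> sets (distr M S f)" "B \<in> sets (distr M T h)"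
  then have AB: "A \<in> sets S" "B \<in> sets T" by auto
  have "(f -` A \<inter> space M) \<inter> (h -` B \<inter> space M) = (\<lambda>x. (f x, h x)) -` (A \<times> B) \<inter> space M" by auto
  moreover have "prob ((f -` A \<inter> space M) \<inter> (h -` B \<inter> space M)) = prob (f -` A \<inter> space M) * prob (h -` B \<inter> space M)"
   by (rule indep_setD[OF ind]) (use measurable_sets[OF f AB(1)] measurable_sets[OF h AB(2)] in auto)
  ultimately show "emeasure (distr M S f) A * emeasure (distr M T h) B = emeasure (distr M (S \<Otimes>\<^sub>M T) (\<lambda>x. (f x, h x))) (A \<times> B)"
   using AB fM hM by (simp add: emeasure_distr emeasure_eq_measure ennreal_mult[symmetric])
 qed (auto intro: F.sigma_finite_measure_axioms H.sigma_finite_measure_axioms)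
qed

definition seen :: "nat => nsr_index set" where
 "seen n = Innovation ` {1..n} \<union> Indicator ` {2..n} \<union> Memory ` {2..n}"

definition nsr_seq :: "nat => 'a => real" where
 "nsr_seq i x = nsr_step (\<lambda>i. X i x) (\<lambda>i. \<epsilon> i x) (\<lambda>i. U i x) (Suc i)"

lemma nsr_seq_eq:
 "nsr_seq i x = (if 0 < i \<and> \<epsilon> (Suc i) x \<and> U (Suc i) x \<in> {1..<Suc i} then - initial_part nsr_seq i x (U (Suc i) x - 1) else X (Suc i) x)"
 by (subst nsr_seq_def, subst nsr_step.simps) (auto simp: initial_part_def nsr_seq_def)

lemma nsr_seq_gen: "i < n ==> nsr_seq i \<in> borel_measurable (gen (seen n))"
proof (induction i rule: less_induct)
 case (less i)
 have h: "initial_part nsr_seq i \<in> measurable (gen (seen n)) seq_space"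
  by (rule initial_part_measurable) (use less in auto)
 have Xm: "X (Suc i) \<in> borel_measurable (gen (seen n))"
  using less.prems by (intro X_gen) (auto simp: seen_def)
 have eq: "nsr_seq i = (\<lambda>x. if 0 < i \<and> \<epsilon> (Suc i) x \<and> U (Suc i) x \<in> {1..<Suc i} then - initial_part nsr_seq i x (U (Suc i) x - 1) else X (Suc i) x)"
  by (rule ext) (rule nsr_seq_eq)
 show ?case
 proof (cases "0 < i")
  case True
  have em: "\<epsilon> (Suc i) \<in> measurable (gen (seen n)) (count_space UNIV)" and um: "U (Suc i) \<in> measurable (gen (seen n)) (count_space UNIV)"
   using less.prems True by (auto intro!: \<epsilon>_gen U_gen simp: seen_def)
  have k: "(\<lambda>x. initial_part nsr_seq i x k) \<in> borel_measurable (gen (seen n))" for k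
   by (rule measurable_compose[OF h measurable_component_singleton]) simp
  have "(\<lambda>x. U (Suc i) x - 1) \<in> measurable (gen (seen n)) (count_space UNIV)" by (rule measurable_compose[OF um]) simp
  from measurable_compose_countable[OF k this]
  have i: "(\<lambda>x. initial_part nsr_seq i x (U (Suc i) x - 1)) \<in> borel_measurable (gen (seen n))" .
  have "(\<epsilon> (Suc i) -` {True} \<inter> space (gen (seen n))) \<inter> (U (Suc i) -` {1..<Suc i} \<inter> space (gen (seen n))) \<in> sets (gen (seen n))"
   by (intro sets.Int measurable_sets[OF em] measurable_sets[OF um]) auto
  moreover have "(\<epsilon> (Suc i) -` {True} \<inter> space (gen (seen n))) \<inter> (U (Suc i) -` {1..<Suc i} \<inter> space (gen (seen n)))
   = {x \<in> space (gen (seen n)). 0 < i \<and> \<epsilon> (Suc i) x \<and> U (Suc i) x \<in> {1..<Suc i}}" using True by auto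
  ultimately have "{x \<in> space (gen (seen n)). 0 < i \<and> \<epsilon> (Suc i) x \<and> U (Suc i) x \<in> {1..<Suc i}} \<in> sets (gen (seen n))"
   by (rule back_subst[where P="\<lambda>A. A \<in> sets (gen (seen n))"])
  from measurable_If[OF borel_measurable_uminus[OF i] Xm this]
  show ?thesis by (rule ssubst[OF eq])
 next
  case False
  then show ?thesis using Xm by (subst eq) simp
 qed
qed

lemma initial_part_gen: "i \<le> n ==> initial_part nsr_seq i \<in> measurable (gen (seen n)) seq_space"
 by (rule initial_part_measurable[OF nsr_seq_gen]) simp

lemma seen_inputs: "seen n \<subseteq> inputs"
 by (auto simp: seen_def)

lemma nsr_seq_measurable[measurable]: "nsr_seq i \<in> borel_measurable M"
 by (rule gen_measurable[OF nsr_seq_gen[OF lessI] seen_inputs])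

abbreviation "\<nu> \<equiv> distr M borel (X 1)"

text \<open>The first \<open>i\<close> steps are functions of the inputs in \<open>seen i\<close>,
  which are disjoint from the three inputs of the next step. So the next step selects, by fresh
  independent inputs, between a new value and an entry of the history.\<close>

lemma nsr_kernel_process:
 assumes p: "0 < p" "p < 1"
 shows "kernel_process (nsr_kernel p \<nu>) M nsr_seq"
proof -
 interpret \<nu>: prob_space \<nu> by (rule prob_space_distr) (simp add: X_measurable)
 interpret L: nsr_law \<nu> p by unfold_locales (simp_all add: p)
 show ?thesis unfolding kernel_process_def
 proof (intro conjI allI impI)
  fix i and F :: "(nat => real) \<times> real => ennreal" assume F: "F \<in> borel_measurable (seq_space \<Otimes>\<^sub>M borel)"
  let ?h = "initial_part nsr_seq i"
  have Fs: "(\<lambda>x. F (h, x)) \<in> borel_measurable borel" for h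
   by (rule measurable_compose[OF _ F]) (simp add: space_PiM)
  have hm: "?h \<in> measurable M seq_space" by (rule gen_measurable[OF initial_part_gen[OF order_refl] seen_inputs])
  show "(\<integral>\<^sup>+s. F (?h s, nsr_seq i s) \<partial>M) = (\<integral>\<^sup>+s. (\<integral>\<^sup>+x. F (?h s, x) \<partial>nsr_kernel p \<nu> i (?h s)) \<partial>M)"
  proof (cases "i = 0")
   case True
   have "(\<integral>\<^sup>+s. F ((\<lambda>_. 0), X 1 s) \<partial>M) = (\<integral>\<^sup>+x. F ((\<lambda>_. 0), x) \<partial>\<nu>)"
    by (rule nn_integral_distr[symmetric]) (use Fs X_measurable in auto)
   moreover have "nsr_seq 0 = X 1" by (rule ext) (simp add: nsr_seq_eq[of 0])
   ultimately show ?thesis using L.nsr_kernel_0[OF Fs] emeasure_space_1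
    by (simp add: True initial_part_def)
  next
   case False
   let ?n = "Suc i" let ?B = "measure_pmf (bernoulli_pmf p)" and ?U = "measure_pmf (pmf_of_set {1..<Suc i})"
   let ?C = "count_space UNIV \<Otimes>\<^sub>M count_space UNIV :: (bool \<times> nat) measure"
   have n: "2 \<le> ?n" "1 \<le> ?n" using False by auto
   have Xm: "X ?n \<in> borel_measurable (gen {Innovation ?n})" by (rule X_gen) simp
   have em: "\<epsilon> ?n \<in> measurable (gen {Indicator ?n}) (count_space UNIV)" by (rule \<epsilon>_gen) simp
   have um: "U ?n \<in> measurable (gen {Memory ?n}) (count_space UNIV)" by (rule U_gen) simp
   have eum: "(\<lambda>s. (\<epsilon> ?n s, U ?n s)) \<in> measurable (gen {Indicator ?n, Memory ?n}) ?C"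
    by (intro measurable_Pair \<epsilon>_gen U_gen) auto
   have Xeum: "(\<lambda>s. (X ?n s, \<epsilon> ?n s, U ?n s)) \<in> measurable (gen {Innovation ?n, Indicator ?n, Memory ?n}) (borel \<Otimes>\<^sub>M ?C)"
    by (intro measurable_Pair X_gen \<epsilon>_gen U_gen) auto
   \<comment> \<open>The joint law of history, innovation, indicator and memory is assembled by
     splitting off one block at a time, three times.\<close>
   have d1: "distr M ?C (\<lambda>s. (\<epsilon> ?n s, U ?n s)) = ?B \<Otimes>\<^sub>M ?U"
    unfolding \<epsilon>_bernoulli[OF n(1), symmetric] U_uniform[OF n(1), symmetric]
    by (rule indep_blocks[OF _ _ _ em um]) (use n in auto)
   have d2: "distr M (borel \<Otimes>\<^sub>M ?C) (\<lambda>s. (X ?n s, \<epsilon> ?n s, U ?n s)) = \<nu> \<Otimes>\<^sub>M (?B \<Otimes>\<^sub>M ?U)"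
    unfolding d1[symmetric] X_identical[OF n(2), symmetric]
    by (rule indep_blocks[OF _ _ _ Xm eum]) (use n in auto)
   have d3: "distr M (seq_space \<Otimes>\<^sub>M (borel \<Otimes>\<^sub>M ?C)) (\<lambda>s. (?h s, X ?n s, \<epsilon> ?n s, U ?n s)) = distr M seq_space ?h \<Otimes>\<^sub>M (\<nu> \<Otimes>\<^sub>M (?B \<Otimes>\<^sub>M ?U))"
    unfolding d2[symmetric]
    by (rule indep_blocks[OF _ _ _ initial_part_gen[OF order_refl] Xeum]) (use n seen_inputs in \<open>auto simp: seen_def\<close>)
   have ijoint: "(\<lambda>s. (?h s, X ?n s, \<epsilon> ?n s, U ?n s)) \<in> measurable M (seq_space \<Otimes>\<^sub>M (borel \<Otimes>\<^sub>M ?C))"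
    by (intro measurable_Pair hm X_measurable \<epsilon>_measurable U_measurable n)
   \<comment> \<open>The termination guard in \<open>nsr_step\<close> holds almost surely, and the
     kernel does without it.\<close>
   have Uin: "AE s in M. U ?n s \<in> {1..<?n}"
   proof -
    have "AE u in distr M (count_space UNIV) (U ?n). u \<in> {1..<?n}"
     unfolding U_uniform[OF n(1)] using False by (simp add: AE_measure_pmf_iff set_pmf_of_set)
    then show ?thesis by (subst (asm) AE_distr_iff) (use U_measurable n in auto)
   qed
   define \<Phi> where "\<Phi> = (\<lambda>(h :: nat => real, x, e, u). F (h, if 0 < i \<and> e then - h (u - 1) else x))"
   have \<Phi>: "\<Phi> \<in> borel_measurable (seq_space \<Otimes>\<^sub>M (borel \<Otimes>\<^sub>M ?C))"
    unfolding \<Phi>_def split_beta'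
   proof (rule measurable_compose[OF _ F], rule measurable_Pair[OF measurable_fst])
    let ?S = "seq_space \<Otimes>\<^sub>M (borel \<Otimes>\<^sub>M ?C)"
    have 1: "(\<lambda>x. fst (snd x)) \<in> borel_measurable ?S" by (rule measurable_compose[OF measurable_snd measurable_fst])
    have 2: "(\<lambda>x. fst (snd (snd x))) \<in> measurable ?S (count_space UNIV)"
     by (rule measurable_compose[OF measurable_compose[OF measurable_snd measurable_snd] measurable_fst])
    have 3: "(\<lambda>x. snd (snd (snd x))) \<in> measurable ?S (count_space UNIV)"
     by (rule measurable_compose[OF measurable_compose[OF measurable_snd measurable_snd] measurable_snd])
    show "(\<lambda>x. if 0 < i \<and> fst (snd (snd x)) then - fst x (snd (snd (snd x)) - 1) else fst (snd x)) \<in> borel_measurable ?S"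
     by (rule L.select_measurable[OF measurable_fst 1 2 3])
   qed
   have \<Phi>': "\<Phi> \<in> borel_measurable (distr M seq_space ?h \<Otimes>\<^sub>M (\<nu> \<Otimes>\<^sub>M (?B \<Otimes>\<^sub>M ?U)))"
    using \<Phi> unfolding d3[symmetric] by simp
   interpret I: prob_space "\<nu> \<Otimes>\<^sub>M (?B \<Otimes>\<^sub>M ?U)" by (rule L.prob_space_input)
   have "(\<integral>\<^sup>+s. F (?h s, nsr_seq i s) \<partial>M) = (\<integral>\<^sup>+s. \<Phi> (?h s, X ?n s, \<epsilon> ?n s, U ?n s) \<partial>M)"
    by (rule nn_integral_cong_AE) (use Uin in \<open>eventually_elim, simp add: \<Phi>_def nsr_seq_eq[of i]\<close>)
   also have "... = (\<integral>\<^sup>+q. \<Phi> q \<partial>(distr M seq_space ?h \<Otimes>\<^sub>M (\<nu> \<Otimes>\<^sub>M (?B \<Otimes>\<^sub>M ?U))))"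
    unfolding d3[symmetric] by (rule nn_integral_distr[symmetric, OF ijoint]) (use \<Phi> in simp)
   also have "... = (\<integral>\<^sup>+h. (\<integral>\<^sup>+y. \<Phi> (h, y) \<partial>(\<nu> \<Otimes>\<^sub>M (?B \<Otimes>\<^sub>M ?U))) \<partial>distr M seq_space ?h)"
    by (rule I.nn_integral_fst[symmetric, OF \<Phi>'])
   also have "... = (\<integral>\<^sup>+s. (\<integral>\<^sup>+y. \<Phi> (?h s, y) \<partial>(\<nu> \<Otimes>\<^sub>M (?B \<Otimes>\<^sub>M ?U))) \<partial>M)"
    by (rule nn_integral_distr[OF hm]) (use I.borel_measurable_nn_integral_fst[OF \<Phi>'] in simp)
   also have "... = (\<integral>\<^sup>+s. (\<integral>\<^sup>+x. F (?h s, x) \<partial>nsr_kernel p \<nu> i (?h s)) \<partial>M)"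
    unfolding nsr_kernel_def
    by (intro nn_integral_cong, subst nn_integral_distr[OF L.select_measurable'])
     (use Fs in \<open>auto simp: \<Phi>_def intro!: nn_integral_cong\<close>)
   finally show ?thesis .
  qed
 qed simp
qed

lemma nsr_walk_eq: "nsr_walk (\<lambda>i. X i x) (\<lambda>i. \<epsilon> i x) (\<lambda>i. U i x) n = (\<Sum>i<n. nsr_seq i x)"
 unfolding nsr_walk_def nsr_seq_def
 by (rule sum.reindex_bij_witness[of _ Suc "\<lambda>u. u - 1"]) auto

end

section \<open>Strong approximation\<close>

text \<open>Holds because the first marginal of \<open>emb_law\<close> is \<open>K\<close> itself,
  without truncation.\<close>

lemma (in skorokhod_chain) chain_kernel_process: "kernel_process K Om xi"
 unfolding kernel_process_def
proof (intro conjI allI impI)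
 fix n and F :: "(nat => real) \<times> real => ennreal" assume F: "F \<in> borel_measurable (seq_space \<Otimes>\<^sub>M borel)"
 have ip: "initial_part xi n s = fsts (hist n s)" for s
  by (auto simp: initial_part_def fsts_def hist_def)
 have F': "(\<lambda>x. F (fsts (fst x), fst (snd x))) \<in> borel_measurable (hist_space \<Otimes>\<^sub>M plane)"
  by (rule measurable_compose[OF _ F])
   (intro measurable_Pair measurable_compose[OF measurable_fst fsts_measurable] measurable_compose[OF measurable_snd measurable_fst])
 have Fs: "(\<lambda>x. F (h, x)) \<in> borel_measurable borel" for h
  by (rule measurable_compose[OF _ F]) (simp add: space_PiM)
 have "(\<integral>\<^sup>+y. F (fsts h, fst y) \<partial>law n h) = (\<integral>\<^sup>+x. F (fsts h, x) \<partial>K n (fsts h))" for h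
  unfolding law_def by (rule skorokhod_step.emb_law_fst[OF step Fs])
 then show "(\<integral>\<^sup>+s. F (initial_part xi n s, xi n s) \<partial>Om) = (\<integral>\<^sup>+s. (\<integral>\<^sup>+x. F (initial_part xi n s, x) \<partial>K n (initial_part xi n s)) \<partial>Om)"
  using transition_law[OF F', of n] by (simp add: ip)
qed simp

lemma (in nsr_law) integral_nsr_kernel:
 fixes F :: "real => real"
 assumes F[measurable]: "F \<in> borel_measurable borel" and int: "integrable \<nu> F" and i: "0 < i"
 shows "(LINT x|nsr_kernel p \<nu> i h. F x) = (1 - p) * (LINT x|\<nu>. F x) + p / real i * (\<Sum>j<i. F (- h j))"
proof -
 have mK: "f \<in> borel_measurable (nsr_kernel p \<nu> i h) \<longleftrightarrow> f \<in> borel_measurable borel" for f :: "real => real"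
  by (simp add: measurable_cong_sets[OF sets_nsr_kernel refl])
 have pos: "integrable (nsr_kernel p \<nu> i h) f \<and> (LINT x|nsr_kernel p \<nu> i h. f x) = (1 - p) * (LINT x|\<nu>. f x) + p / real i * (\<Sum>j<i. f (- h j))"
  if f[measurable]: "f \<in> borel_measurable borel" and fi: "integrable \<nu> f" and f0: "\<And>x. 0 \<le> f x" for f :: "real => real"
 proof -
  have I: "0 \<le> (LINT x|\<nu>. f x)" using f0 by simp
  have "(\<integral>\<^sup>+x. ennreal (f x) \<partial>nsr_kernel p \<nu> i h) = ennreal (1 - p) * (\<integral>\<^sup>+x. ennreal (f x) \<partial>\<nu>) + ennreal (p / real i) * (\<Sum>j<i. ennreal (f (- h j)))"
   by (rule nn_integral_nsr_kernel) (use i in auto)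
  also have "... = ennreal ((1 - p) * (LINT x|\<nu>. f x) + p / real i * (\<Sum>j<i. f (- h j)))"
   using p I f0 fi by (simp add: nn_integral_eq_integral sum_ennreal ennreal_mult[symmetric] ennreal_plus[symmetric] sum_nonneg del: ennreal_plus)
  finally have *: "(\<integral>\<^sup>+x. ennreal (f x) \<partial>nsr_kernel p \<nu> i h) = ennreal ((1 - p) * (LINT x|\<nu>. f x) + p / real i * (\<Sum>j<i. f (- h j)))" .
  have "integrable (nsr_kernel p \<nu> i h) f"
   using f f0 * by (simp add: integrable_iff_bounded mK)
  moreover have "0 \<le> (1 - p) * (LINT x|\<nu>. f x) + p / real i * (\<Sum>j<i. f (- h j))"
   using p I f0 by (intro add_nonneg_nonneg mult_nonneg_nonneg sum_nonneg) auto
  ultimately show ?thesis using nn_integral_eq_integral[of "nsr_kernel p \<nu> i h" f] f0 * by simp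
 qed
 have u: "integrable \<nu> (\<lambda>x. max 0 (F x))" "integrable \<nu> (\<lambda>x. max 0 (- F x))"
  using int by (auto intro!: integrable_max)
 note P = pos[OF _ u(1)] pos[OF _ u(2)]
 have e: "F x = max 0 (F x) - max 0 (- F x)" for x by simp
 have "(LINT x|nsr_kernel p \<nu> i h. F x) = (LINT x|nsr_kernel p \<nu> i h. max 0 (F x)) - (LINT x|nsr_kernel p \<nu> i h. max 0 (- F x))"
  by (subst e, rule Bochner_Integration.integral_diff) (use P in auto)
 also have "... = (1 - p) * ((LINT x|\<nu>. max 0 (F x)) - (LINT x|\<nu>. max 0 (- F x))) + p / real i * ((\<Sum>j<i. max 0 (F (- h j))) - (\<Sum>j<i. max 0 (- F (- h j))))"
  using P by (simp add: right_diff_distrib)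
 also have "(LINT x|\<nu>. max 0 (F x)) - (LINT x|\<nu>. max 0 (- F x)) = (LINT x|\<nu>. F x)"
  by (subst Bochner_Integration.integral_diff[symmetric, OF u]) (simp only: e[symmetric])
 also have "(\<Sum>j<i. max 0 (F (- h j))) - (\<Sum>j<i. max 0 (- F (- h j))) = (\<Sum>j<i. F (- h j))"
  by (subst sum_subtractf[symmetric]) (simp only: e[symmetric])
 finally show ?thesis .
qed

section \<open>Truncation at the square root of the index\<close>

definition trunc :: "nat => real => real" where
 "trunc i x = (if \<bar>x\<bar> \<le> sqrt (real (Suc i)) then x else 0)"

lemma trunc_measurable[measurable]: "trunc i \<in> borel_measurable borel"
 unfolding trunc_def[abs_def] by measurable

lemma trunc_bound: "\<bar>trunc i x\<bar> \<le> sqrt (real (Suc i))" "\<bar>trunc i x\<bar> \<le> \<bar>x\<bar>"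
 by (auto simp: trunc_def)

lemma trunc_minus: "trunc i (- x) = - trunc i x"
 by (simp add: trunc_def)

lemma abs_le_sqrt_iff: "\<bar>x\<bar> \<le> sqrt (real (Suc i)) \<longleftrightarrow> x\<^sup>2 \<le> real (Suc i)"
 by (metis abs_le_square_iff real_sqrt_abs real_sqrt_le_iff)

text \<open>A pointwise count whose integral bounds the sum of the exceedance probabilities by the
  second moment. The induction carries the minimum with \<open>n\<close>.\<close>

lemma sum_exceed: "(\<Sum>i<n. if x^2 \<le> real (Suc i) then 0 else 1 :: real) \<le> x^2"
proof -
 have "(\<Sum>i<n. if x^2 \<le> real (Suc i) then 0 else 1 :: real) \<le> min (real n) (x^2)"
 proof (induction n)
  case (Suc n)
  have "min (real n) (x^2) \<le> min (real (Suc n)) (x^2)" "min (real n) (x^2) \<le> real n" by auto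
  then show ?case using Suc.IH by (cases "x^2 \<le> real (Suc n)") (simp_all add: min_def del: min.bounded_iff)
 qed simp
 then show ?thesis by simp
qed

text \<open>The analogue for the means lost by truncation, where an exceedance at index
  \<open>i\<close> costs \<open>1 / sqrt (i + 1)\<close>; each such term is at most twice the
  increment of the square root.\<close>

lemma sum_exceed_sqrt: "(\<Sum>i<n. if x^2 \<le> real (Suc i) then 0 else 1 / sqrt (real (Suc i))) \<le> 2 * \<bar>x\<bar>"
proof -
 have "(\<Sum>i<n. if x^2 \<le> real (Suc i) then 0 else 1 / sqrt (real (Suc i))) \<le> 2 * min (sqrt (real n)) \<bar>x\<bar>"
 proof (induction n)
  case (Suc n)
  show ?case
  proof (cases "x^2 \<le> real (Suc n)")
   case True
   have "min (sqrt (real n)) \<bar>x\<bar> \<le> min (sqrt (real (Suc n))) \<bar>x\<bar>" by (intro min.mono) auto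
   then show ?thesis using Suc.IH True by (simp del: of_nat_Suc)
  next
   case False
   let ?r = "sqrt (real (Suc n))" and ?q = "sqrt (real n)"
   have "?r * ?r = real n + 1" "?q * ?q = real n" by auto
   then have "(?r - ?q) * (?r + ?q) = 1" by (simp add: algebra_simps)
   moreover have q: "0 \<le> ?q" "?q \<le> ?r" "0 < ?r" by auto
   ultimately have "1 \<le> (?r - ?q) * (2 * ?r)"
    using mult_left_mono[of "?r + ?q" "2 * ?r" "?r - ?q"] by simp
   then have "1 / ?r \<le> 2 * ?r - 2 * ?q" using q by (simp add: field_simps)
   moreover have "?r < \<bar>x\<bar>" using False abs_le_sqrt_iff[of x n] by auto
   moreover have "min ?q \<bar>x\<bar> \<le> ?q" by simp
   ultimately show ?thesis using Suc.IH False by (simp del: of_nat_Suc add: min_def)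
  qed
 qed simp
 then show ?thesis by simp
qed

text \<open>Only indices with \<open>x^2 \<le> i + 1\<close> contribute, and there the sum of the
  inverse squares is at most \<open>2 / x^2\<close>. The telescoping bound
  \<open>1 / k^2 \<le> 2 / k - 2 / (k + 1)\<close> drives the induction.\<close>

lemma sum_trunc_fourth: "(\<Sum>i<n. (trunc i x) ^ 4 / (real (Suc i))^2) \<le> 2 * x^2"
proof -
 let ?S = "\<lambda>n. \<Sum>i<n. if x^2 \<le> real (Suc i) then x^2 / (real (Suc i))^2 else 0"
 have "?S n \<le> max 0 (2 - 2 * x^2 / real (Suc n))" for n
 proof (induction n)
  case (Suc n)
  have inc: "max 0 (2 - 2 * x^2 / real (Suc n)) \<le> max 0 (2 - 2 * x^2 / real (Suc (Suc n)))"
   by (intro max.mono) (auto intro!: divide_left_mono)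
  show ?case
  proof (cases "x^2 \<le> real (Suc n)")
   case True
   define k where "k = real (Suc n)"
   have k: "1 \<le> k" by (simp add: k_def)
   have "1 / k^2 = 2 / (k * (2 * k))" using k by (simp add: power2_eq_square)
   also have "... \<le> 2 / (k * (k + 1))" using k by (intro divide_left_mono mult_left_mono mult_pos_pos) auto
   also have "... = 2 / k - 2 / (k + 1)" using k by (simp add: divide_simps)
   finally have "1 / k^2 \<le> 2 / k - 2 / (k + 1)" .
   then have "x^2 * (1 / k^2) \<le> x^2 * (2 / k - 2 / (k + 1))" by (rule mult_left_mono) simp
   then have 1: "x^2 / k^2 \<le> 2 * x^2 / k - 2 * x^2 / (k + 1)" by (simp add: right_diff_distrib mult.commute)
   have 2: "2 * x^2 / k \<le> 2" using True k by (simp add: k_def field_simps)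
   have "?S (Suc n) = ?S n + x^2 / k^2" using True by (simp add: k_def)
   also have "... \<le> max 0 (2 - 2 * x^2 / k) + x^2 / k^2" using Suc.IH by (simp add: k_def)
   also have "... = 2 - 2 * x^2 / k + x^2 / k^2" using 2 by simp
   also have "... \<le> 2 - 2 * x^2 / (k + 1)" using 1 by simp
   finally show ?thesis by (simp add: k_def add.commute)
  qed (use Suc.IH inc in simp)
 qed simp
 also have "max 0 (2 - 2 * x^2 / real (Suc n)) \<le> 2" by simp
 finally have "x^2 * ?S n \<le> x^2 * 2" by (intro mult_left_mono) auto
 moreover have "(\<Sum>i<n. (trunc i x) ^ 4 / (real (Suc i))^2) = x^2 * ?S n"
  unfolding sum_distrib_left
  by (rule sum.cong) (auto simp: trunc_def abs_le_sqrt_iff power2_eq_square power4_eq_xxxx simp del: of_nat_Suc)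
 ultimately show ?thesis by simp
qed

context skorokhod_step
begin

lemma emb_law_fst_integral:
 fixes f :: "real => real"
 assumes [measurable]: "f \<in> borel_measurable borel"
 shows "(LINT y|emb_law K g a. f (fst y)) = (LINT x|K. f x)"
proof -
 have fm: "fst \<in> measurable (emb_law K g a) borel" by (simp add: measurable_cong_sets[OF sets_emb_law refl])
 have "distr (emb_law K g a) borel fst = K"
 proof (rule measure_eqI)
  fix A assume "A \<in> sets (distr (emb_law K g a) borel fst)"
  then have A[measurable]: "A \<in> sets borel" by simp
  show "emeasure (distr (emb_law K g a) borel fst) A = emeasure K A"
   using emb_law_fst[of "indicator A"]
   by (subst nn_integral_indicator[symmetric], simp, subst nn_integral_distr[OF fm]) auto
 qed simp
 then show ?thesis using integral_distr[OF fm, of f] by simp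
qed

lemma integrable_power: "integrable K (\<lambda>x. (g x - r) ^ n)"
proof (rule K.integrable_const_bound[where B="(G + \<bar>r\<bar>) ^ n"])
 have "\<bar>g x - r\<bar> ^ n \<le> (G + \<bar>r\<bar>) ^ n" for x
  using g_bound[of x] by (intro power_mono) auto
 then show "AE x in K. norm ((g x - r) ^ n) \<le> (G + \<bar>r\<bar>) ^ n" by (simp add: power_abs)
qed simp

text \<open>The positive part removes the default time -1 and makes the integral agree with the
  nonnegative one of \<open>emb_law_time_mean\<close>; the variance is then expanded into
  moments.\<close>

lemma emb_law_time_integral:
 "(LINT y|emb_law K g a. max 0 (snd y)) = a^2 * ((LINT x|K. (g x)^2) - c^2)"
proof -
 note i2 = integrable_power[of 0 2] integrable_power[of c 2]
 have "(LINT y|emb_law K g a. max 0 (snd y)) = enn2real (\<integral>\<^sup>+y. ennreal (snd y) \<partial>emb_law K g a)"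
  by (subst integral_eq_nn_integral) (simp_all add: measurable_cong_sets[OF sets_emb_law refl])
 also have "... = (LINT x|K. a^2 * (g x - c)^2)"
  unfolding emb_law_time_mean using i2 by (subst nn_integral_eq_integral) auto
 also have "... = a^2 * (LINT x|K. (g x)^2 - 2 * c * g x + c^2)"
 proof -
  have "(g x - c)^2 = (g x)^2 - 2 * c * g x + c^2" for x by (simp add: power2_diff)
  then show ?thesis by simp
 qed
 also have "(LINT x|K. (g x)^2 - 2 * c * g x + c^2) = (LINT x|K. (g x)^2) - c^2"
 proof -
  have "(LINT x|K. g x) = c" by (simp add: emb_mean_def)
  then have "(LINT x|K. (g x)^2 - 2 * c * g x + c^2) = (LINT x|K. (g x)^2) - 2 * c * c + c^2"
   using i2(1) g_integrable K.prob_space by simp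
  then show ?thesis by (simp add: power2_eq_square)
 qed
 finally show ?thesis .
qed

end

locale nsr_embedding = nsr_law +
 assumes square_integrable: "integrable \<nu> (\<lambda>x. x^2)"
  and variance_pos: "0 < sqrt ((LINT x|\<nu>. x^2) - ((1 - p) * (LINT x|\<nu>. x) / (1 + p))^2)"
begin

definition "m1 = (LINT x|\<nu>. x)"
definition "m2 = (LINT x|\<nu>. x^2)"
definition "mu = (1 - p) * m1 / (1 + p)"
definition "sg = sqrt (m2 - mu^2)"
text \<open>With conditional variance tending to \<open>sg^2\<close>, the mean exit time of step
  \<open>i\<close> is close to \<open>(2 * p + 1) * (i + 1) powr (2 * p)\<close>. This choice makes
  the clock asymptotic to \<open>n powr (2 * p + 1)\<close> with constant 1.\<close>

definition "lam = sqrt (2 * p + 1) / sg"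
definition scale :: "nat => real" where "scale i = lam * real (Suc i) powr p"

lemma sg_pos: "0 < sg"
 using variance_pos by (simp add: sg_def m2_def mu_def m1_def)

lemma sg_square: "sg^2 = m2 - mu^2"
 using sg_pos by (simp add: sg_def)

lemma lam_pos: "0 < lam"
 using sg_pos p by (simp add: lam_def)

sublocale C: skorokhod_chain "nsr_kernel p \<nu>" trunc scale "\<lambda>i. sqrt (real (Suc i))"
 by (rule skorokhod_chain.intro[OF nsr_kernel_measurable nsr_kernel_prob trunc_measurable trunc_bound(1)])
  (simp add: scale_def lam_pos)

abbreviation "Om \<equiv> C.Om"
abbreviation "xi \<equiv> C.xi"

lemma measurable_\<nu>: "borel_measurable \<nu> = borel_measurable borel"
 by (rule measurable_cong_sets) auto

lemma integrable_id: "integrable \<nu> (\<lambda>x. x)"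
 by (rule square_integrable_imp_integrable[OF _ square_integrable]) (simp add: measurable_\<nu>)

lemma integrable_trunc: "integrable \<nu> (trunc i)"
 by (rule integrable_const_bound[where B="sqrt (real (Suc i))"]) (use trunc_bound in \<open>auto simp: measurable_\<nu>\<close>)

lemma integrable_trunc_square: "integrable \<nu> (\<lambda>x. (trunc i x)^2)"
 by (rule Bochner_Integration.integrable_bound[OF square_integrable])
  (use trunc_bound(2) in \<open>auto simp: measurable_\<nu> abs_le_square_iff\<close>)

lemma integrable_trunc_fourth: "integrable \<nu> (\<lambda>x. (trunc i x) ^ 4)"
proof (rule integrable_const_bound[where B="(sqrt (real (Suc i))) ^ 4"])
 have "\<bar>trunc i x\<bar> ^ 4 \<le> (sqrt (real (Suc i))) ^ 4" for x by (rule power_mono[OF trunc_bound(1)]) simp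
 then show "AE x in \<nu>. norm ((trunc i x) ^ 4) \<le> (sqrt (real (Suc i))) ^ 4" by (simp add: power_abs)
qed (simp add: measurable_\<nu>)

text \<open>A sign flip does not change an even function, so the reinforced step is a mixture of a
  fresh value and a copy, both with the same mean of \<open>f\<close>. The steps themselves need not
  be identically distributed.\<close>

lemma xi_even_law:
 assumes f: "f \<in> borel_measurable borel" and even: "\<And>x. f (- x) = f x"
 shows "(\<integral>\<^sup>+s. f (xi i s) \<partial>Om) = (\<integral>\<^sup>+x. f x \<partial>\<nu>)"
proof (induction i rule: less_induct)
 case (less i)
 have F: "(\<lambda>q. f (snd q)) \<in> borel_measurable (seq_space \<Otimes>\<^sub>M borel)"
  by (rule measurable_compose[OF measurable_snd f])
 have tr: "(\<integral>\<^sup>+s. f (xi i s) \<partial>Om) = (\<integral>\<^sup>+s. (\<integral>\<^sup>+x. f x \<partial>nsr_kernel p \<nu> i (initial_part xi i s)) \<partial>Om)"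
  using C.chain_kernel_process F unfolding kernel_process_def by force
 show ?case
 proof (cases "i = 0")
  case True
  then show ?thesis unfolding tr using nsr_kernel_0[OF f] C.chain.emeasure_space_1 by simp
 next
  case False
  have [measurable]: "(\<lambda>s. f (xi j s)) \<in> borel_measurable Om" for j
   by (rule measurable_compose[OF C.xi_measurable f])
  have "(\<integral>\<^sup>+s. f (xi i s) \<partial>Om) = (\<integral>\<^sup>+s. ennreal (1 - p) * (\<integral>\<^sup>+x. f x \<partial>\<nu>) + ennreal (p / real i) * (\<Sum>j<i. f (xi j s)) \<partial>Om)"
   unfolding tr using False by (simp add: nn_integral_nsr_kernel[OF f] even initial_part_def)
  also have "... = ennreal (1 - p) * (\<integral>\<^sup>+x. f x \<partial>\<nu>) + ennreal (p / real i) * (\<Sum>j<i. \<integral>\<^sup>+s. f (xi j s) \<partial>Om)"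
   by (simp add: nn_integral_add nn_integral_cmult nn_integral_sum C.chain.emeasure_space_1 del: C.IT.PF.space_lim)
  also have "... = ennreal (1 - p) * (\<integral>\<^sup>+x. f x \<partial>\<nu>) + ennreal (p / real i) * (ennreal (real i) * (\<integral>\<^sup>+x. f x \<partial>\<nu>))"
   using less.IH by (simp add: ennreal_of_nat_eq_real_of_nat)
  also have "... = (ennreal (1 - p) + ennreal p) * (\<integral>\<^sup>+x. f x \<partial>\<nu>)"
   using False p by (simp add: mult.assoc[symmetric] ennreal_mult[symmetric] distrib_right)
  also have "ennreal (1 - p) + ennreal p = 1" using p by (simp add: ennreal_plus[symmetric] del: ennreal_plus)
  finally show ?thesis by simp
 qed
qed

text \<open>Borel-Cantelli; the probabilities are those of the innovation law because the event is
  even in the step.\<close>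

lemma AE_eventually_trunc: "AE s in Om. eventually (\<lambda>i. \<bar>xi i s\<bar> \<le> sqrt (real (Suc i))) sequentially"
proof -
 let ?A = "\<lambda>i. {s \<in> space Om. \<not> (xi i s)^2 \<le> real (Suc i)}"
 let ?f = "\<lambda>i x. (if x^2 \<le> real (Suc i) then 0 else 1 :: real)"
 have fi: "integrable \<nu> (?f i)" for i
  by (rule integrable_const_bound[where B=1]) (auto simp: measurable_\<nu>)
 have A: "?A i \<in> sets Om" for i by measurable
 have m: "measure Om (?A i) = (LINT x|\<nu>. ?f i x)" for i
 proof -
  have "emeasure Om (?A i) = (\<integral>\<^sup>+s. indicator (?A i) s \<partial>Om)" using A[of i] by (simp del: C.IT.PF.space_lim)
  also have "... = (\<integral>\<^sup>+s. ennreal (?f i (xi i s)) \<partial>Om)" by (intro nn_integral_cong) (auto simp: indicator_def)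
  also have "... = (\<integral>\<^sup>+x. ennreal (?f i x) \<partial>\<nu>)"
   by (rule xi_even_law) auto
  also have "... = ennreal (LINT x|\<nu>. ?f i x)" by (rule nn_integral_eq_integral[OF fi]) auto
  finally show ?thesis by (simp add: measure_def)
 qed
 have "summable (\<lambda>i. measure Om (?A i))"
 proof (rule summableI_nonneg_bounded[where x=m2])
  fix n
  have "(\<Sum>i<n. measure Om (?A i)) = (LINT x|\<nu>. (\<Sum>i<n. ?f i x))"
   unfolding m using fi by (subst Bochner_Integration.integral_sum) auto
  also have "... \<le> m2" unfolding m2_def
   by (rule integral_mono[OF _ square_integrable sum_exceed]) (use fi in auto)
  finally show "(\<Sum>i<n. measure Om (?A i)) \<le> m2" .
 qed simp
 from borel_cantelli_AE1[OF A _ this] have "AE s in Om. eventually (\<lambda>i. s \<in> space Om - ?A i) sequentially"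
  by (simp add: C.chain.emeasure_eq_measure less_top)
 then show ?thesis
 proof eventually_elim
  case (elim s)
  then show ?case by (rule eventually_mono) (auto simp: abs_le_sqrt_iff simp del: of_nat_Suc)
 qed
qed

lemma summable_trunc_fourth: "summable (\<lambda>i. (LINT x|\<nu>. (trunc i x) ^ 4) / (real (Suc i))^2)"
proof (rule summableI_nonneg_bounded[where x="2 * m2"])
 fix n
 have "(\<Sum>i<n. (LINT x|\<nu>. (trunc i x) ^ 4) / (real (Suc i))^2) = (LINT x|\<nu>. (\<Sum>i<n. (trunc i x) ^ 4 / (real (Suc i))^2))"
  using integrable_trunc_fourth by (subst Bochner_Integration.integral_sum) auto
 also have "... \<le> (LINT x|\<nu>. 2 * x^2)"
  by (rule integral_mono[OF _ _ sum_trunc_fourth]) (use integrable_trunc_fourth square_integrable in auto)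
 finally show "(\<Sum>i<n. (LINT x|\<nu>. (trunc i x) ^ 4) / (real (Suc i))^2) \<le> 2 * m2" by (simp add: m2_def)
qed (auto intro!: divide_nonneg_nonneg)

text \<open>The mean lost at index \<open>i\<close> is at most the integral of
  \<open>\<bar>x\<bar>\<close> over the exceedance set. Summing first under the integral costs a
  factor \<open>2 * \<bar>x\<bar>\<close>, and a second moment results.\<close>

lemma summable_trunc_rest: "summable (\<lambda>i. \<bar>m1 - (LINT x|\<nu>. trunc i x)\<bar> / sqrt (real (Suc i)))"
proof (rule summableI_nonneg_bounded[where x="2 * m2"])
 fix n
 let ?f = "\<lambda>i x. \<bar>x - trunc i x\<bar> / sqrt (real (Suc i))"
 have fi: "integrable \<nu> (?f i)" for i using integrable_id integrable_trunc[of i] by auto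
 have "(\<Sum>i<n. \<bar>m1 - (LINT x|\<nu>. trunc i x)\<bar> / sqrt (real (Suc i))) \<le> (\<Sum>i<n. \<integral>x. ?f i x \<partial>\<nu>)"
 proof (rule sum_mono)
  fix i
  have "m1 - (LINT x|\<nu>. trunc i x) = (LINT x|\<nu>. x - trunc i x)"
   using integrable_id integrable_trunc[of i] by (simp add: m1_def)
  then have "\<bar>m1 - (LINT x|\<nu>. trunc i x)\<bar> \<le> (LINT x|\<nu>. \<bar>x - trunc i x\<bar>)"
   using integral_abs_bound[of \<nu> "\<lambda>x. x - trunc i x"] by simp
  then show "\<bar>m1 - (LINT x|\<nu>. trunc i x)\<bar> / sqrt (real (Suc i)) \<le> (LINT x|\<nu>. ?f i x)"
   by (simp add: divide_right_mono del: of_nat_Suc)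
 qed
 also have "... = (LINT x|\<nu>. (\<Sum>i<n. ?f i x))"
  using fi by (subst Bochner_Integration.integral_sum) auto
 also have "... \<le> (LINT x|\<nu>. 2 * x^2)"
 proof (rule integral_mono)
  fix x :: real
  have "(\<Sum>i<n. ?f i x) = \<bar>x\<bar> * (\<Sum>i<n. if x^2 \<le> real (Suc i) then 0 else 1 / sqrt (real (Suc i)))"
   unfolding sum_distrib_left by (rule sum.cong) (auto simp: trunc_def abs_le_sqrt_iff simp del: of_nat_Suc)
  also have "... \<le> \<bar>x\<bar> * (2 * \<bar>x\<bar>)" by (intro mult_left_mono sum_exceed_sqrt) auto
  finally show "(\<Sum>i<n. ?f i x) \<le> 2 * x^2" by (simp add: power2_eq_square)
 qed (use fi square_integrable in auto)
 finally show "(\<Sum>i<n. \<bar>m1 - (LINT x|\<nu>. trunc i x)\<bar> / sqrt (real (Suc i))) \<le> 2 * m2" by (simp add: m2_def)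
qed auto

end

section \<open>Asymptotics along one sample path\<close>

lemma power_sum_bounds:
 fixes r :: real assumes r: "1 \<le> r"
 shows "real n powr r \<le> (\<Sum>i<n. r * real (Suc i) powr (r - 1))" "(\<Sum>i<n. r * real (Suc i) powr (r - 1)) \<le> real (Suc n) powr r"
proof -
 have step: "\<exists>z. x < z \<and> z < x + 1 \<and> (x + 1) powr r - x powr r = r * z powr (r - 1)" if x: "0 < x" for x :: real
 proof -
  have "\<exists>z. x < z \<and> z < x + 1 \<and> (x + 1) powr r - x powr r = (x + 1 - x) * (r * z powr (r - 1))"
   by (rule MVT2) (use x in \<open>auto intro!: derivative_eq_intros\<close>)
  then show ?thesis by simp
 qed
 show "real n powr r \<le> (\<Sum>i<n. r * real (Suc i) powr (r - 1))"
 proof (induction n)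
  case (Suc n)
  have "real (Suc n) powr r - real n powr r \<le> r * real (Suc n) powr (r - 1)"
  proof (cases "n = 0")
   case False
   then obtain z where z: "real n < z" "z < real n + 1" "(real n + 1) powr r - real n powr r = r * z powr (r - 1)"
    using step[of "real n"] by auto
   have "z powr (r - 1) \<le> (real n + 1) powr (r - 1)" using z r by (intro powr_mono2) auto
   then have "r * z powr (r - 1) \<le> r * (real n + 1) powr (r - 1)" using r by (intro mult_left_mono) auto
   then show ?thesis using z by (simp add: add.commute)
  qed (use r in simp)
  then show ?case using Suc.IH by simp
 qed simp
 have "(\<Sum>i<n. r * real (Suc i) powr (r - 1)) + 1 \<le> real (Suc n) powr r"
 proof (induction n)
  case (Suc n)
  obtain z where z: "real (Suc n) < z" "z < real (Suc n) + 1" "(real (Suc n) + 1) powr r - real (Suc n) powr r = r * z powr (r - 1)"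
   using step[of "real (Suc n)"] by auto
  have "real (Suc n) powr (r - 1) \<le> z powr (r - 1)" using z(1,2) r by (intro powr_mono2) auto
  then have "r * real (Suc n) powr (r - 1) \<le> r * z powr (r - 1)" using r by (intro mult_left_mono) auto
  then have "r * real (Suc n) powr (r - 1) \<le> real (Suc (Suc n)) powr r - real (Suc n) powr r" using z(3) by (simp add: add.commute)
  then show ?case using Suc.IH by simp
 qed simp
 then show "(\<Sum>i<n. r * real (Suc i) powr (r - 1)) \<le> real (Suc n) powr r" by simp
qed

text \<open>This is why \<open>i powr p\<close> is the right multiplier: its growth offsets the pull
  \<open>1 - p / i\<close> of the negative reinforcement to first order, and the mismatch is two
  orders smaller.\<close>

lemma reinforcement_factor:
 fixes p :: real assumes p: "0 < p" "p < 1"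
 shows "(\<lambda>i. real (Suc i) powr p * (1 - p / real i) - real i powr p) \<in> O(\<lambda>i. real i powr (p - 2))"
 using p by real_asymp

text \<open>Collects what holds almost surely, so that the remaining limits are deterministic.
  \<open>x\<close> are the steps, \<open>c\<close> and \<open>q\<close> the conditional first and
  second moments of the truncated steps, \<open>d\<close> the exit times, and \<open>\<tau>\<close>,
  \<open>\<theta>\<close> the truncated moments of the innovation.\<close>

locale nsr_path =
 fixes p m1 m2 mu sg lam :: real and \<tau> \<theta> x c q d :: "nat => real"
 assumes p: "0 < p" "p < 1"
  and mu: "(1 + p) * mu = (1 - p) * m1" and sg: "0 < sg" "sg^2 = m2 - mu^2" and lam: "lam = sqrt (2 * p + 1) / sg"
  and x_small: "eventually (\<lambda>i. \<bar>x i\<bar> \<le> sqrt (real (Suc i))) sequentially"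
  and \<tau>_summable: "summable (\<lambda>i. \<bar>m1 - \<tau> i\<bar> / sqrt (real (Suc i)))"
  and \<tau>_tendsto: "\<tau> \<longlonglongrightarrow> m1" and \<theta>_tendsto: "\<theta> \<longlonglongrightarrow> m2"
  and c: "\<And>i. 0 < i ==> c i = (1 - p) * \<tau> i - p / real i * (\<Sum>j<i. trunc i (x j))"
  and q: "\<And>i. 0 < i ==> q i = (1 - p) * \<theta> i + p / real i * (\<Sum>j<i. (trunc i (x j))^2)"
  and lln_mean: "(\<lambda>n. (\<Sum>i<n. trunc i (x i) - c i) / real (Suc n)) \<longlonglongrightarrow> 0"
  and lln_square: "(\<lambda>n. (\<Sum>i<n. (trunc i (x i))^2 - q i) / real (Suc n)) \<longlonglongrightarrow> 0"
  and lln_time: "(\<lambda>n. (\<Sum>i<n. d i - (lam * real (Suc i) powr p)^2 * (q i - (c i)^2)) / real (Suc n) powr (2 * p + 1)) \<longlonglongrightarrow> 0"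
begin

definition S :: "nat => real" where "S n = (\<Sum>i<n. x i)"
definition e :: "nat => real" where "e i = (1 - p) * m1 - p / real i * S i"

lemma lam_pos: "0 < lam"
 using sg p by (simp add: lam)

text \<open>Only finitely many steps of the path exceed their level. The levels \<open>k j\<close>
  are free above \<open>j\<close>, because sums occur both with each step at its own level and with
  all past steps at the level of the present one.\<close>

lemma truncation_correction:
 fixes f :: "real => real"
 assumes "f 0 = 0"
 shows "\<exists>B\<ge>0. \<forall>n k. (\<forall>j<n. j \<le> k j) --> \<bar>\<Sum>j<n. f (x j) - f (trunc (k j) (x j))\<bar> \<le> B"
proof -
 obtain J where J: "\<And>j. J \<le> j ==> \<bar>x j\<bar> \<le> sqrt (real (Suc j))"
  using x_small by (auto simp: eventually_sequentially)
 define B where "B = (\<Sum>j<J. \<bar>f (x j)\<bar>)"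
 have "\<bar>\<Sum>j<n. f (x j) - f (trunc (k j) (x j))\<bar> \<le> B" if k: "\<forall>j<n. j \<le> k j" for n k
 proof -
  have "\<bar>\<Sum>j<n. f (x j) - f (trunc (k j) (x j))\<bar> \<le> (\<Sum>j<n. \<bar>f (x j) - f (trunc (k j) (x j))\<bar>)" by (rule sum_abs)
  also have "... \<le> (\<Sum>j<n. if j < J then \<bar>f (x j)\<bar> else 0)"
  proof (rule sum_mono)
   fix j assume j: "j \<in> {..<n}"
   show "\<bar>f (x j) - f (trunc (k j) (x j))\<bar> \<le> (if j < J then \<bar>f (x j)\<bar> else 0)"
   proof (cases "j < J")
    case False
    then have "\<bar>x j\<bar> \<le> sqrt (real (Suc j))" by (intro J) simp
    also have "... \<le> sqrt (real (Suc (k j)))" using k j by simp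
    finally show ?thesis by (simp add: trunc_def)
   qed (auto simp: trunc_def assms)
  qed
  also have "... = (\<Sum>j\<in>{..<n} \<inter> {..<J}. \<bar>f (x j)\<bar>)" by (simp add: sum.inter_restrict)
  also have "... \<le> B" unfolding B_def by (rule sum_mono2) auto
  finally show ?thesis .
 qed
 moreover have "0 \<le> B" unfolding B_def by (rule sum_nonneg) simp
 ultimately show ?thesis by blast
qed

lemma bounded_over_n:
 fixes f :: "nat => real" assumes "\<And>n. \<bar>f n\<bar> \<le> B" shows "(\<lambda>n. f n / real n) \<longlonglongrightarrow> 0"
proof (rule tendsto_0_le[where K=1 and f="\<lambda>n. B / real n"])
 show "(\<lambda>n. B / real n) \<longlonglongrightarrow> 0" by real_asymp
 show "eventually (\<lambda>n. norm (f n / real n) \<le> norm (B / real n) * 1) sequentially"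
  using assms by (intro always_eventually allI) (auto intro!: divide_right_mono order_trans[OF assms])
qed

lemma over_Suc:
 fixes f :: "nat => real"
 assumes "(\<lambda>n. f n / real (Suc n) powr r) \<longlonglongrightarrow> l" shows "(\<lambda>n. f n / real n powr r) \<longlonglongrightarrow> l"
proof -
 have "(\<lambda>n. real (Suc n) powr r / real n powr r) \<longlonglongrightarrow> 1" by real_asymp
 from tendsto_mult[OF assms this] show ?thesis by simp
qed

lemma average_tendsto_0:
 fixes f :: "nat => real"
 assumes "f \<longlonglongrightarrow> 0" shows "(\<lambda>n. (\<Sum>i<n. f i) / real n) \<longlonglongrightarrow> 0"
proof -
 have "(\<lambda>n. (\<Sum>i<n. 1 * f i) / real (Suc n)) \<longlonglongrightarrow> 0"
  by (rule weighted_cesaro[where K=1]) (use assms in \<open>auto, real_asymp\<close>)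
 then show ?thesis using over_Suc[of "\<lambda>n. \<Sum>i<n. f i" 1 0] by simp
qed

text \<open>\<open>e\<close> is the conditional mean of the untruncated step and \<open>c\<close>
  that of the truncated one; they differ by the mean lost in the innovation and by the bounded
  correction of the past, spread over \<open>i\<close> entries.\<close>

lemma drift_difference:
 obtains B where "0 \<le> B" "\<And>i. 0 < i ==> \<bar>e i - c i\<bar> \<le> \<bar>m1 - \<tau> i\<bar> + B / real i"
proof -
 obtain B where B: "0 \<le> B" "\<And>n k. (\<forall>j<n. j \<le> k j) ==> \<bar>\<Sum>j<n. x j - trunc (k j) (x j)\<bar> \<le> B"
  using truncation_correction[of "\<lambda>x. x"] by auto
 have "\<bar>e i - c i\<bar> \<le> \<bar>m1 - \<tau> i\<bar> + B / real i" if i: "0 < i" for i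
 proof -
  have "e i - c i = (1 - p) * (m1 - \<tau> i) - p / real i * (\<Sum>j<i. x j - trunc i (x j))"
   by (simp add: e_def c[OF i] S_def sum_subtractf algebra_simps)
  also have "\<bar>...\<bar> \<le> (1 - p) * \<bar>m1 - \<tau> i\<bar> + p / real i * \<bar>\<Sum>j<i. x j - trunc i (x j)\<bar>"
   using p by (intro order_trans[OF abs_triangle_ineq4]) (simp add: abs_mult)
  also have "... \<le> 1 * \<bar>m1 - \<tau> i\<bar> + 1 / real i * B"
   using p B(2)[of i "\<lambda>_. i"] by (intro add_mono mult_mono divide_right_mono) auto
  finally show ?thesis by simp
 qed
 with B(1) show thesis by (rule that)
qed

text \<open>The running sum of \<open>f (x i)\<close> is driven by its own averages with coefficient
  \<open>r\<close>. For the identity \<open>r = - p\<close>, because remembered steps change sign;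
  for the square \<open>r = p\<close>.\<close>

lemma averaged_limit:
 fixes f :: "real => real" and k v :: "nat => real"
 assumes f: "f 0 = 0" and r: "r < 1" and v: "v \<longlonglongrightarrow> m"
  and k: "\<And>i. 0 < i ==> k i = (1 - p) * v i + r / real i * (\<Sum>j<i. f (trunc i (x j)))"
  and lln: "(\<lambda>n. (\<Sum>i<n. f (trunc i (x i)) - k i) / real (Suc n)) \<longlonglongrightarrow> 0"
 shows "(\<lambda>n. (\<Sum>i<n. f (x i)) / real n) \<longlonglongrightarrow> (1 - p) * m / (1 - r)" and "k \<longlonglongrightarrow> (1 - p) * m / (1 - r)"
proof -
 let ?F = "\<lambda>n. \<Sum>i<n. f (x i)"
 \<comment> \<open>The error made when the truncated quantities in \<open>k\<close> are replaced by
   the limit \<open>m\<close> and by the untruncated average; it tends to 0.\<close>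
 define y where "y = (\<lambda>i. k i - ((1 - p) * m + r * (?F i / real i)))"
 define R where "R = (\<lambda>n. (\<Sum>i<n. f (x i) - f (trunc i (x i))) + (\<Sum>i<n. f (trunc i (x i)) - k i) + (\<Sum>i<n. y i) + real n * ((1 - p) * m))"
 obtain B where B: "\<And>n k. (\<forall>j<n. j \<le> k j) ==> \<bar>\<Sum>j<n. f (x j) - f (trunc (k j) (x j))\<bar> \<le> B"
  using truncation_correction[of f] f by auto
 have y: "y \<longlonglongrightarrow> 0"
 proof (rule Lim_transform_eventually)
  have "(\<lambda>i. (\<Sum>j<i. f (x j) - f (trunc i (x j))) / real i) \<longlonglongrightarrow> 0"
   by (rule bounded_over_n[OF B]) auto
  then have "(\<lambda>i. (1 - p) * (v i - m) - r * ((\<Sum>j<i. f (x j) - f (trunc i (x j))) / real i)) \<longlonglongrightarrow> (1 - p) * (m - m) - r * 0"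
   by (intro tendsto_intros v)
  then show "(\<lambda>i. (1 - p) * (v i - m) - r * ((\<Sum>j<i. f (x j) - f (trunc i (x j))) / real i)) \<longlonglongrightarrow> 0" by simp
  show "eventually (\<lambda>i. (1 - p) * (v i - m) - r * ((\<Sum>j<i. f (x j) - f (trunc i (x j))) / real i) = y i) sequentially"
   by (rule eventually_sequentiallyI[of 1]) (simp add: y_def k sum_subtractf diff_divide_distrib algebra_simps)
 qed
 have "(\<lambda>n. ?F n / real n) \<longlonglongrightarrow> (0 + 0 + 0 + (1 - p) * m) / (1 - r)"
 proof (rule averaged_recursion[OF r])
  fix n
  have "(\<Sum>i<n. ?F i / real i) = (\<Sum>i=1..<n. ?F i / real i)" by (rule sum.mono_neutral_right) auto
  then have "(\<Sum>i<n. r * (?F i / real i)) = r * (\<Sum>i=1..<n. ?F i / real i)" by (simp only: sum_distrib_left[symmetric])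
  then have "(\<Sum>i<n. y i) = (\<Sum>i<n. k i) - real n * ((1 - p) * m) - r * (\<Sum>i=1..<n. ?F i / real i)"
   by (simp add: y_def sum_subtractf sum.distrib)
  then show "?F n = r * (\<Sum>i=1..<n. ?F i / real i) + R n" unfolding R_def by (simp add: sum_subtractf)
 next
  have t1: "(\<lambda>n. (\<Sum>i<n. f (x i) - f (trunc i (x i))) / real n) \<longlonglongrightarrow> 0"
   using B[of _ "\<lambda>j. j"] by (intro bounded_over_n) simp
  have t2: "(\<lambda>n. (\<Sum>i<n. f (trunc i (x i)) - k i) / real n) \<longlonglongrightarrow> 0" using over_Suc[of _ 1] lln by simp
  have t4: "(\<lambda>n. real n * ((1 - p) * m) / real n) \<longlonglongrightarrow> (1 - p) * m" by real_asymp
  show "(\<lambda>n. R n / real n) \<longlonglongrightarrow> 0 + 0 + 0 + (1 - p) * m"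
   unfolding R_def add_divide_distrib by (intro tendsto_add t1 t2 t4 average_tendsto_0[OF y])
 qed
 then show F: "(\<lambda>n. ?F n / real n) \<longlonglongrightarrow> (1 - p) * m / (1 - r)" by simp
 have "(\<lambda>i. y i + ((1 - p) * m + r * (?F i / real i))) \<longlonglongrightarrow> 0 + ((1 - p) * m + r * ((1 - p) * m / (1 - r)))"
  by (intro tendsto_intros y F)
 moreover have "(1 - p) * m + r * ((1 - p) * m / (1 - r)) = (1 - p) * m / (1 - r)" using r by (simp add: field_simps)
 ultimately show "k \<longlonglongrightarrow> (1 - p) * m / (1 - r)" by (simp add: y_def)
qed

text \<open>With \<open>r = - p\<close> the limit is \<open>(1 - p) * m1 / (1 + p) = mu\<close>;
  with \<open>r = p\<close> the factors \<open>1 - p\<close> cancel and leave \<open>m2\<close>. The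
  conditional moments have the same limits.\<close>

lemma mean: "(\<lambda>n. S n / real n) \<longlonglongrightarrow> mu" and conditional_variance: "(\<lambda>i. q i - (c i)^2) \<longlonglongrightarrow> sg^2"
proof -
 have mu': "(1 - p) * m1 / (1 - (- p)) = mu" using mu p by (simp add: field_simps)
 have m2: "(1 - p) * m2 / (1 - p) = m2" using p by simp
 have "- p < 1" "p < 1" using p by auto
 note M = averaged_limit[of "\<lambda>x. x", OF _ this(1) \<tau>_tendsto _ lln_mean, unfolded mu']
  and M2 = averaged_limit[of "\<lambda>x. x^2", OF _ this(2) \<theta>_tendsto q lln_square, unfolded m2]
 show "(\<lambda>n. S n / real n) \<longlonglongrightarrow> mu" using M(1) by (simp add: c S_def[abs_def])
 have "(\<lambda>i. q i - (c i)^2) \<longlonglongrightarrow> m2 - mu^2" using M(2) M2(2) by (intro tendsto_intros) (simp_all add: c)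
 then show "(\<lambda>i. q i - (c i)^2) \<longlonglongrightarrow> sg^2" by (simp add: sg)
qed

text \<open>The conditional mean of an exit time is \<open>w i * (1 + y i)\<close> with
  \<open>y\<close> a null sequence, the sums of \<open>w\<close> are squeezed by
  \<open>power_sum_bounds\<close>, and \<open>lln_time\<close> says that the exit times follow their
  conditional means.\<close>

lemma time: "(\<lambda>n. (\<Sum>i<n. d i) / real n powr (2 * p + 1)) \<longlonglongrightarrow> 1"
proof -
 let ?s = "2 * p + 1"
 define w where "w = (\<lambda>i. ?s * real (Suc i) powr (?s - 1))"
 define y where "y = (\<lambda>i. (q i - (c i)^2) / sg^2 - 1)"
 have y: "y \<longlonglongrightarrow> 0"
 proof -
  have "(\<lambda>i. (q i - (c i)^2) / sg^2 - 1) \<longlonglongrightarrow> sg^2 / sg^2 - 1"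
   by (intro tendsto_intros conditional_variance) (use sg in auto)
  then show ?thesis using sg(1) by (simp add: y_def)
 qed
 have s1: "1 \<le> ?s" using p by simp
 note W = power_sum_bounds[OF s1, folded w_def]
 have 1: "(\<lambda>n. (\<Sum>i<n. w i * y i) / real (Suc n) powr ?s) \<longlonglongrightarrow> 0"
 proof (rule weighted_cesaro[where K=1, OF _ _ _ _ y])
  show "0 \<le> w i" for i using p by (simp add: w_def)
  show "filterlim (\<lambda>n. real (Suc n) powr ?s) at_top sequentially" using p by real_asymp
  show "(\<Sum>i<n. w i) \<le> 1 * real (Suc n) powr ?s" for n using W(2)[of n] by simp
 qed simp
 have 2: "(\<lambda>n. (\<Sum>i<n. w i) / real (Suc n) powr ?s) \<longlonglongrightarrow> 1"
 proof (rule tendsto_sandwich)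
  show "(\<lambda>n. real n powr ?s / real (Suc n) powr ?s) \<longlonglongrightarrow> 1" using p by real_asymp
  show "eventually (\<lambda>n. real n powr ?s / real (Suc n) powr ?s \<le> (\<Sum>i<n. w i) / real (Suc n) powr ?s) sequentially"
   using W(1) by (intro always_eventually allI divide_right_mono) auto
  show "eventually (\<lambda>n. (\<Sum>i<n. w i) / real (Suc n) powr ?s \<le> 1) sequentially"
   using W(2) by (intro always_eventually allI) (simp del: of_nat_Suc)
 qed simp
 have sq: "(lam * real (Suc i) powr p)^2 * (q i - (c i)^2) = w i + w i * y i" for i
 proof -
  have "(real (Suc i) powr p)^2 = real (Suc i) powr (?s - 1)"
   by (simp add: power2_eq_square powr_add[symmetric] del: of_nat_Suc)
  moreover have "lam^2 = ?s / sg^2" using p by (simp add: lam power_divide)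
  moreover have "w i + w i * y i = w i * ((q i - (c i)^2) / sg^2)" by (simp add: y_def right_diff_distrib)
  ultimately show ?thesis by (simp add: w_def power_mult_distrib del: of_nat_Suc)
 qed
 have "(\<lambda>n. (\<Sum>i<n. d i - (lam * real (Suc i) powr p)^2 * (q i - (c i)^2)) / real (Suc n) powr ?s
   + ((\<Sum>i<n. w i) / real (Suc n) powr ?s + (\<Sum>i<n. w i * y i) / real (Suc n) powr ?s)) \<longlonglongrightarrow> 0 + (1 + 0)"
  by (intro tendsto_add lln_time 1 2)
 then have "(\<lambda>n. (\<Sum>i<n. d i) / real (Suc n) powr ?s) \<longlonglongrightarrow> 1"
  by (simp add: sq sum_subtractf sum.distrib add_divide_distrib[symmetric] del: of_nat_Suc)
 then show ?thesis by (rule over_Suc)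
qed

text \<open>The scaled centred walk and the embedded martingale have increments that differ by
  \<open>r i\<close>. Divided by \<open>(i + 1) powr (p + 1 / 2)\<close> these are summable, so
  Kronecker's lemma applies.\<close>

lemma remainder:
 "(\<lambda>n. (lam * (real n powr p * (S n - mu * real n)) - (\<Sum>i<n. lam * real (Suc i) powr p * (trunc i (x i) - c i))) / real n powr (p + 1 / 2)) \<longlonglongrightarrow> 0"
proof -
 define D where "D = (\<lambda>n. S n - mu * real n)"
 define d where "d = (\<lambda>i. real (Suc i) powr p * (1 - p / real i) - real i powr p)"
 define r where "r = (\<lambda>i. lam * (real (Suc i) powr p * D (Suc i)) - lam * (real i powr p * D i) - lam * real (Suc i) powr p * (trunc i (x i) - c i))"
 let ?b = "\<lambda>n. real (Suc n) powr (p + 1 / 2)"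
 \<comment> \<open>From the recursion
   \<open>D (Suc i) = D i * (1 - p / real i) + (x i - e i)\<close>. The three terms are the
   truncated part of the step, the error in the conditional mean, and the mismatch of the
   weights.\<close>
 have rho: "r i = lam * real (Suc i) powr p * (x i - trunc i (x i)) - lam * real (Suc i) powr p * (e i - c i) + lam * (d i * D i)" if i: "0 < i" for i
 proof -
  have "p / real i * S i = p / real i * D i + p * mu" using i by (simp add: D_def right_diff_distrib)
  then have "e i = mu - p / real i * D i" using mu by (simp add: e_def algebra_simps)
  moreover have "D (Suc i) = D i + x i - mu" by (simp add: D_def S_def algebra_simps)
  ultimately have "D (Suc i) = D i * (1 - p / real i) + (x i - e i)"
   by (simp add: algebra_simps)
  show ?thesis unfolding r_def d_def \<open>D (Suc i) = D i * (1 - p / real i) + _\<close> by (simp add: algebra_simps del: of_nat_Suc)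
 qed
 have b_split: "?b i = real (Suc i) powr p * sqrt (real (Suc i))" for i
  by (simp only: powr_add powr_half_sqrt of_nat_0_le_iff)
 have s1: "summable (\<lambda>i. \<bar>x i - trunc i (x i)\<bar> / sqrt (real (Suc i)))"
 proof -
  have "eventually (\<lambda>i. norm (\<bar>x i - trunc i (x i)\<bar> / sqrt (real (Suc i))) \<le> 0) sequentially"
   using x_small by eventually_elim (simp add: trunc_def)
  then show ?thesis by (rule summable_comparison_test_ev) simp
 qed
 obtain B where B: "0 \<le> B" "\<And>i. 0 < i ==> \<bar>e i - c i\<bar> \<le> \<bar>m1 - \<tau> i\<bar> + B / real i" by (rule drift_difference) blast
 have p32: "summable (\<lambda>i. real i powr (- (3 / 2)))" by (simp add: summable_real_powr_iff)
 have s2: "summable (\<lambda>i. \<bar>e i - c i\<bar> / sqrt (real (Suc i)))"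
 proof (rule summable_comparison_test_ev)
  show "summable (\<lambda>i. \<bar>m1 - \<tau> i\<bar> / sqrt (real (Suc i)) + B * real i powr (- (3 / 2)))"
   by (intro summable_add \<tau>_summable summable_mult p32)
  show "eventually (\<lambda>i. norm (\<bar>e i - c i\<bar> / sqrt (real (Suc i))) \<le> \<bar>m1 - \<tau> i\<bar> / sqrt (real (Suc i)) + B * real i powr (- (3 / 2))) sequentially"
  proof (rule eventually_sequentiallyI[of 1])
   fix i :: nat assume i: "1 \<le> i"
   have "\<bar>e i - c i\<bar> / sqrt (real (Suc i)) \<le> (\<bar>m1 - \<tau> i\<bar> + B / real i) / sqrt (real (Suc i))"
    using i by (intro divide_right_mono B(2)) auto
   also have "... = \<bar>m1 - \<tau> i\<bar> / sqrt (real (Suc i)) + B / real i / sqrt (real (Suc i))" by (rule add_divide_distrib)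
   also have "B / real i / sqrt (real (Suc i)) \<le> B / real i / sqrt (real i)"
    using i B(1) by (intro divide_left_mono mult_pos_pos) auto
   also have "B / real i / sqrt (real i) = B * real i powr (- (3 / 2))"
   proof -
    have "real i powr (3 / 2) = real i powr (1 + 1 / 2)" by simp
    also have "... = real i * sqrt (real i)" using i by (simp only: powr_add powr_half_sqrt of_nat_0_le_iff) simp
    finally show ?thesis by (simp add: powr_minus divide_simps)
   qed
   finally show "norm (\<bar>e i - c i\<bar> / sqrt (real (Suc i))) \<le> \<bar>m1 - \<tau> i\<bar> / sqrt (real (Suc i)) + B * real i powr (- (3 / 2))"
    by simp
  qed
 qed
 \<comment> \<open>\<open>mean\<close> makes \<open>D\<close> at most linear in \<open>i\<close>;
   with \<open>reinforcement_factor\<close> the terms are of order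
   \<open>i powr (- (3 / 2))\<close>.\<close>
 have s3: "summable (\<lambda>i. \<bar>d i * D i\<bar> / ?b i)"
 proof -
  have Dn: "(\<lambda>i. D i / real i) \<longlonglongrightarrow> mu - mu"
  proof (rule Lim_transform_eventually)
   show "(\<lambda>i. S i / real i - mu) \<longlonglongrightarrow> mu - mu" by (intro tendsto_intros mean)
   show "eventually (\<lambda>i. S i / real i - mu = D i / real i) sequentially"
    by (rule eventually_sequentiallyI[of 1]) (simp add: D_def field_simps)
  qed
  then have "D \<in> O(\<lambda>i. real i)"
   by (intro bigoI_tendsto[where c="mu - mu"]) (auto intro: eventually_sequentiallyI[of 1])
  then have "(\<lambda>i. d i * D i) \<in> O(\<lambda>i. real i powr (p - 2) * real i)"
   unfolding d_def by (intro landau_o.big.mult reinforcement_factor p)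
  then have "(\<lambda>i. \<bar>d i * D i\<bar> / ?b i) \<in> O(\<lambda>i. real i powr (p - 2) * real i / ?b i)"
   by (intro landau_o.big.divide_right) (auto intro!: always_eventually)
  also have "(\<lambda>i. real i powr (p - 2) * real i / ?b i) \<in> O(\<lambda>i. real i powr (- (3 / 2)))" using p by real_asymp
  finally show ?thesis
   by (rule summable_comparison_test_bigo[rotated]) (use p32 in simp)
 qed
 have "summable (\<lambda>i. r i / ?b i)"
 proof (rule summable_comparison_test_ev)
  show "summable (\<lambda>i. lam * (\<bar>x i - trunc i (x i)\<bar> / sqrt (real (Suc i))) + lam * (\<bar>e i - c i\<bar> / sqrt (real (Suc i))) + lam * (\<bar>d i * D i\<bar> / ?b i))"
   by (intro summable_add summable_mult s1 s2 s3)
  show "eventually (\<lambda>i. norm (r i / ?b i) \<le> lam * (\<bar>x i - trunc i (x i)\<bar> / sqrt (real (Suc i))) + lam * (\<bar>e i - c i\<bar> / sqrt (real (Suc i))) + lam * (\<bar>d i * D i\<bar> / ?b i)) sequentially"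
  proof (rule eventually_sequentiallyI[of 1])
   fix i :: nat assume "1 \<le> i"
   then have i: "0 < i" by simp
   let ?k = "real (Suc i) powr p"
   have k: "0 < ?k" by simp
   have "\<bar>r i\<bar> \<le> lam * ?k * \<bar>x i - trunc i (x i)\<bar> + lam * ?k * \<bar>e i - c i\<bar> + lam * \<bar>d i * D i\<bar>"
   proof -
    have "\<bar>u - v + w\<bar> \<le> \<bar>u\<bar> + \<bar>v\<bar> + \<bar>w\<bar>" for u v w :: real by linarith
    from order_trans[OF this] show ?thesis unfolding rho[OF i] using lam_pos k by (simp add: abs_mult del: of_nat_Suc)
   qed
   then have "\<bar>r i\<bar> / ?b i \<le> (lam * ?k * \<bar>x i - trunc i (x i)\<bar> + lam * ?k * \<bar>e i - c i\<bar> + lam * \<bar>d i * D i\<bar>) / ?b i"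
    by (rule divide_right_mono) simp
   also have "... = lam * (\<bar>x i - trunc i (x i)\<bar> / sqrt (real (Suc i))) + lam * (\<bar>e i - c i\<bar> / sqrt (real (Suc i))) + lam * (\<bar>d i * D i\<bar> / ?b i)"
    using k unfolding add_divide_distrib b_split by (simp del: of_nat_Suc)
   finally show "norm (r i / ?b i) \<le> lam * (\<bar>x i - trunc i (x i)\<bar> / sqrt (real (Suc i))) + lam * (\<bar>e i - c i\<bar> / sqrt (real (Suc i))) + lam * (\<bar>d i * D i\<bar> / ?b i)"
    by simp
  qed
 qed
 then have "(\<lambda>n. (\<Sum>i<n. r i) / ?b n) \<longlonglongrightarrow> 0"
 proof (rule kronecker_lemma[rotated 3])
  show "incseq ?b" using p by (intro incseq_SucI powr_mono2) auto
  show "filterlim ?b at_top sequentially" using p by real_asymp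
 qed simp
 moreover have "(\<Sum>i<n. r i) = lam * (real n powr p * D n) - (\<Sum>i<n. lam * real (Suc i) powr p * (trunc i (x i) - c i))" for n
  by (induction n) (simp_all add: r_def)
 ultimately have "(\<lambda>n. (lam * (real n powr p * D n) - (\<Sum>i<n. lam * real (Suc i) powr p * (trunc i (x i) - c i))) / ?b n) \<longlonglongrightarrow> 0"
  by simp
 then show ?thesis unfolding D_def by (rule over_Suc)
qed

end

text \<open>The centred fourth moment is replaced by the uncentred one, at the cost
  \<open>64 = 4 * 8 * 2\<close> (the 2 because \<open>c ^ 4\<close> is at most the fourth moment).
  The bound is then linear in an even function of the step, so \<open>xi_even_law\<close> applies
  after averaging over the past.\<close>

lemma (in skorokhod_step) emb_law_time_square':
 "(\<integral>\<^sup>+y. ennreal ((snd y)^2) \<partial>emb_law K g a) \<le> (\<integral>\<^sup>+x. ennreal (64 * a ^ 4 * (g x) ^ 4) \<partial>K)"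
proof -
 note bd = integrable_power
 have i: "integrable K (\<lambda>x. (g x) ^ n)" for n using bd[of 0 n] by simp
 have e4: "((g x)^2)^2 = (g x) ^ 4" for x by simp
 have j: "(LINT x|K. f x)^2 \<le> (LINT x|K. (f x)^2)" if "integrable K f" "integrable K (\<lambda>x. (f x)^2)" for f :: "real => real"
  using K.variance_positive[of f] K.variance_eq[OF that] by simp
 have "c ^ 4 = (c^2)^2" by simp
 also have "... \<le> (LINT x|K. (g x)^2)^2"
  using j[of g] i[of 2] g_integrable by (intro power_mono) (auto simp: emb_mean_def)
 also have "... \<le> (LINT x|K. (g x) ^ 4)"
  using j[of "\<lambda>x. (g x)^2"] i[of 2] i[of 4] by (simp only: e4)
 finally have c4: "c ^ 4 \<le> (LINT x|K. (g x) ^ 4)" .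
 have four: "(x - y) ^ 4 \<le> 8 * (x ^ 4 + y ^ 4)" for x y :: real
 proof -
  have sq: "(u + v)^2 \<le> 2 * (u^2 + v^2)" for u v :: real
   using zero_le_power2[of "u - v"] by (simp add: power2_eq_square algebra_simps)
  have "(x - y)^2 \<le> 2 * (x^2 + y^2)" using sq[of x "- y"] by simp
  then have "((x - y)^2)^2 \<le> (2 * (x^2 + y^2))^2" by (rule power_mono) simp
  also have "... = 4 * (x^2 + y^2)^2" by (simp only: power_mult_distrib) simp
  also have "... \<le> 4 * (2 * ((x^2)^2 + (y^2)^2))" using sq[of "x^2" "y^2"] by simp
  finally show ?thesis by simp
 qed
 have "(LINT x|K. (g x - c) ^ 4) \<le> (LINT x|K. 8 * ((g x) ^ 4 + c ^ 4))"
  using bd[of c 4] i[of 4] by (intro integral_mono four) auto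
 also have "... = 8 * (LINT x|K. (g x) ^ 4) + 8 * c ^ 4" using i[of 4] K.prob_space by simp
 also have "... \<le> 16 * (LINT x|K. (g x) ^ 4)" using c4 by simp
 finally have 16: "(LINT x|K. (g x - c) ^ 4) \<le> 16 * (LINT x|K. (g x) ^ 4)" .
 have "(\<integral>\<^sup>+y. ennreal ((snd y)^2) \<partial>emb_law K g a) \<le> (\<integral>\<^sup>+x. ennreal (4 * a ^ 4 * (g x - c) ^ 4) \<partial>K)"
  by (rule emb_law_time_square)
 also have "... = ennreal (LINT x|K. 4 * a ^ 4 * (g x - c) ^ 4)"
  using bd[of c 4] a by (intro nn_integral_eq_integral) auto
 also have "... = ennreal (4 * a ^ 4 * (LINT x|K. (g x - c) ^ 4))" by simp
 also have "... \<le> ennreal (4 * a ^ 4 * (16 * (LINT x|K. (g x) ^ 4)))"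
  using 16 a by (intro ennreal_leI mult_left_mono) auto
 also have "... = ennreal (LINT x|K. 64 * a ^ 4 * (g x) ^ 4)" by simp
 also have "... = (\<integral>\<^sup>+x. ennreal (64 * a ^ 4 * (g x) ^ 4) \<partial>K)"
  using i[of 4] a by (intro nn_integral_eq_integral[symmetric]) auto
 finally show ?thesis .
qed

section \<open>Almost sure properties of the embedded walk\<close>

context nsr_embedding
begin

definition \<tau> :: "nat => real" where "\<tau> i = (LINT x|\<nu>. trunc i x)"
definition \<theta> :: "nat => real" where "\<theta> i = (LINT x|\<nu>. (trunc i x)^2)"
definition ci where "ci i x = C.cm i (C.hx i x)"
definition qi where "qi i s = (LINT x|nsr_kernel p \<nu> i (C.hx i s). (trunc i x)^2)"

lemma trunc_tendsto: "(\<lambda>i. trunc i x) \<longlonglongrightarrow> x"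
proof (rule tendsto_eventually)
 have "filterlim (\<lambda>i. sqrt (real (Suc i))) at_top sequentially" by real_asymp
 then have "eventually (\<lambda>i. \<bar>x\<bar> \<le> sqrt (real (Suc i))) sequentially" by (simp only: filterlim_at_top)
 then show "eventually (\<lambda>i. trunc i x = x) sequentially" by eventually_elim (simp add: trunc_def)
qed

lemma \<tau>_tendsto: "\<tau> \<longlonglongrightarrow> m1"
 unfolding \<tau>_def m1_def
proof (rule integral_dominated_convergence[where w="\<lambda>x. \<bar>x\<bar>"])
 show "AE x in \<nu>. (\<lambda>i. trunc i x) \<longlonglongrightarrow> x" using trunc_tendsto by simp
 show "AE x in \<nu>. norm (trunc i x) \<le> \<bar>x\<bar>" for i using trunc_bound(2) by simp
 show "(\<lambda>x. x) \<in> borel_measurable \<nu>" "trunc i \<in> borel_measurable \<nu>" for i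
  by (simp_all only: measurable_\<nu> trunc_measurable measurable_ident id_def[symmetric])
 show "integrable \<nu> (\<lambda>x. \<bar>x\<bar>)" by (rule integrable_abs[OF integrable_id])
qed

lemma \<theta>_tendsto: "\<theta> \<longlonglongrightarrow> m2"
 unfolding \<theta>_def m2_def
proof (rule integral_dominated_convergence[where w="\<lambda>x. x^2"])
 show "AE x in \<nu>. (\<lambda>i. (trunc i x)^2) \<longlonglongrightarrow> x^2" using trunc_tendsto by (intro AE_I2 tendsto_power)
 show "AE x in \<nu>. norm ((trunc i x)^2) \<le> x^2" for i using trunc_bound(2) by (simp add: abs_le_square_iff)
 show "(\<lambda>x. x^2) \<in> borel_measurable \<nu>" "(\<lambda>x. (trunc i x)^2) \<in> borel_measurable \<nu>" for i
  by (rule borel_measurable_integrable[OF square_integrable], rule borel_measurable_integrable[OF integrable_trunc_square])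
 show "integrable \<nu> (\<lambda>x. x^2)" by (rule square_integrable)
qed

lemma ci_eq: "0 < i ==> ci i x = (1 - p) * \<tau> i - p / real i * (\<Sum>j<i. trunc i (xi j x))"
 unfolding ci_def C.cm_def emb_mean_def
 by (subst integral_nsr_kernel[OF trunc_measurable integrable_trunc])
  (simp_all add: \<tau>_def trunc_minus sum_negf C.hx_def C.xi_def)

lemma qi_eq: "0 < i ==> qi i x = (1 - p) * \<theta> i + p / real i * (\<Sum>j<i. (trunc i (xi j x))^2)"
 unfolding qi_def
 by (subst integral_nsr_kernel[OF _ integrable_trunc_square])
  (simp_all add: \<theta>_def trunc_minus C.hx_def C.xi_def)

lemma law_fst:
 fixes f :: "real => real"
 assumes "f \<in> borel_measurable borel"
 shows "(LINT y|C.law i (C.hist i s). f (fst y)) = (LINT x|nsr_kernel p \<nu> i (C.hx i s). f x)"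
 unfolding C.law_def C.hx_hist C.fsts_def by (rule skorokhod_step.emb_law_fst_integral[OF C.step assms])

lemma law_time: "(LINT y|C.law i (C.hist i x). max 0 (snd y)) = (scale i)^2 * (qi i x - (ci i x)^2)"
 unfolding C.law_def qi_def ci_def C.cm_def C.hx_hist C.fsts_def
 by (rule skorokhod_step.emb_law_time_integral[OF C.step])

lemma b_Suc: "0 < real (Suc n)" "incseq (\<lambda>n. real (Suc n))" "filterlim (\<lambda>n. real (Suc n)) at_top sequentially"
 by (auto simp: incseq_def) real_asymp

text \<open>The second moments of the truncated steps are bounded by \<open>m2\<close> for all
  \<open>i\<close>, which is summable against \<open>(i + 1)^2\<close>.\<close>

lemma AE_lln_mean: "AE s in Om. (\<lambda>n. (\<Sum>i<n. trunc i (xi i s) - ci i s) / real (Suc n)) \<longlonglongrightarrow> 0"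
proof -
 have "AE s in Om. (\<lambda>n. (\<Sum>i<n. trunc i (fst (xi i s, C.dt i s)) - (LINT y|C.law i (C.hist i s). trunc i (fst y))) / real (Suc n)) \<longlonglongrightarrow> 0"
 proof (rule C.martingale_law_of_large_numbers[where v="\<lambda>_. m2", OF _ _ _ b_Suc])
  show "(\<lambda>y. trunc i (fst y)) \<in> borel_measurable plane" for i by measurable
  show "0 \<le> m2" by (simp add: m2_def)
  fix i
  have "(\<integral>\<^sup>+s. ennreal ((trunc i (xi i s))^2) \<partial>Om) = (\<integral>\<^sup>+x. ennreal ((trunc i x)^2) \<partial>\<nu>)"
   by (rule xi_even_law) (auto simp: trunc_minus)
  also have "... \<le> (\<integral>\<^sup>+x. ennreal (x^2) \<partial>\<nu>)"
   by (intro nn_integral_mono ennreal_leI) (use trunc_bound(2) in \<open>simp add: abs_le_square_iff\<close>)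
  also have "... = ennreal m2" unfolding m2_def by (rule nn_integral_eq_integral[OF square_integrable]) simp
  finally show "(\<integral>\<^sup>+s. ennreal ((trunc i (fst (xi i s, C.dt i s)))^2) \<partial>Om) \<le> ennreal m2" by simp
 next
  have "summable (\<lambda>i. m2 * (1 / (real (Suc i))^2))"
   by (intro summable_mult) (use inverse_power_summable[of 2, where 'a=real, THEN summable_Suc_iff[THEN iffD2]] in \<open>simp add: divide_inverse\<close>)
  then show "summable (\<lambda>i. m2 / (real (Suc i))^2)" by simp
 qed
 moreover have "(LINT y|C.law i (C.hist i s). trunc i (fst y)) = ci i s" for i s
  by (simp add: law_fst ci_def C.cm_def emb_mean_def)
 ultimately show ?thesis by simp
qed

lemma nn_integral_trunc_fourth: "(\<integral>\<^sup>+s. ennreal ((trunc i (xi i s)) ^ 4) \<partial>Om) = ennreal (LINT x|\<nu>. (trunc i x) ^ 4)"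
proof -
 have "(\<integral>\<^sup>+s. ennreal ((trunc i (xi i s)) ^ 4) \<partial>Om) = (\<integral>\<^sup>+x. ennreal ((trunc i x) ^ 4) \<partial>\<nu>)"
  by (rule xi_even_law) (auto simp: trunc_minus)
 then show ?thesis using nn_integral_eq_integral[OF integrable_trunc_fourth[of i]] by simp
qed

lemma AE_lln_square: "AE s in Om. (\<lambda>n. (\<Sum>i<n. (trunc i (xi i s))^2 - qi i s) / real (Suc n)) \<longlonglongrightarrow> 0"
proof -
 have "AE s in Om. (\<lambda>n. (\<Sum>i<n. (trunc i (fst (xi i s, C.dt i s)))^2 - (LINT y|C.law i (C.hist i s). (trunc i (fst y))^2)) / real (Suc n)) \<longlonglongrightarrow> 0"
 proof (rule C.martingale_law_of_large_numbers[OF _ _ _ b_Suc summable_trunc_fourth])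
  show "(\<lambda>y. (trunc i (fst y))^2) \<in> borel_measurable plane" for i by measurable
  fix i
  show "0 \<le> (LINT x|\<nu>. (trunc i x) ^ 4)" by simp
  show "(\<integral>\<^sup>+s. ennreal (((trunc i (fst (xi i s, C.dt i s)))^2)^2) \<partial>Om) \<le> ennreal (LINT x|\<nu>. (trunc i x) ^ 4)"
   using nn_integral_trunc_fourth[of i] by simp
 qed
 then show ?thesis by (simp add: law_fst[of "\<lambda>x. (trunc _ x)^2"] qi_def)
qed

text \<open>The second moment of an exit time is bounded by a fourth moment of the truncated step,
  through the conditional law given the past.\<close>

lemma AE_lln_time:
 "AE s in Om. (\<lambda>n. (\<Sum>i<n. max 0 (C.dt i s) - (scale i)^2 * (qi i s - (ci i s)^2)) / real (Suc n) powr (2 * p + 1)) \<longlonglongrightarrow> 0"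
proof -
 let ?v = "\<lambda>i. 64 * (scale i) ^ 4 * (LINT x|\<nu>. (trunc i x) ^ 4)"
 have "AE s in Om. (\<lambda>n. (\<Sum>i<n. max 0 (snd (xi i s, C.dt i s)) - (LINT y|C.law i (C.hist i s). max 0 (snd y))) / real (Suc n) powr (2 * p + 1)) \<longlonglongrightarrow> 0"
 proof (rule C.martingale_law_of_large_numbers[where v="?v"])
  show "(\<lambda>y :: real \<times> real. max 0 (snd y)) \<in> borel_measurable plane" by measurable
  fix i
  show "0 \<le> ?v i" by simp
  have F1: "(\<lambda>x. ennreal ((snd (snd x))^2)) \<in> borel_measurable (hist_space \<Otimes>\<^sub>M plane)"
   by measurable
  have F2: "(\<lambda>x. ennreal (64 * scale i ^ 4 * (trunc i (fst (snd x))) ^ 4)) \<in> borel_measurable (hist_space \<Otimes>\<^sub>M plane)"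
   by measurable
  have F3: "(\<lambda>x. ennreal (64 * scale i ^ 4 * (trunc i x) ^ 4)) \<in> borel_measurable borel" by measurable
  have "(\<integral>\<^sup>+s. ennreal ((max 0 (snd (xi i s, C.dt i s)))^2) \<partial>Om) \<le> (\<integral>\<^sup>+s. ennreal ((C.dt i s)^2) \<partial>Om)"
   by (intro nn_integral_mono ennreal_leI) (auto simp: max_def)
  also have "... = (\<integral>\<^sup>+s. (\<integral>\<^sup>+y. ennreal ((snd y)^2) \<partial>C.law i (C.hist i s)) \<partial>Om)"
   using C.transition_law[OF F1, of i] by simp
  also have "... \<le> (\<integral>\<^sup>+s. (\<integral>\<^sup>+y. ennreal (64 * scale i ^ 4 * (trunc i (fst y)) ^ 4) \<partial>C.law i (C.hist i s)) \<partial>Om)"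
  proof (rule nn_integral_mono)
   fix s
   show "(\<integral>\<^sup>+y. ennreal ((snd y)^2) \<partial>C.law i (C.hist i s)) \<le> (\<integral>\<^sup>+y. ennreal (64 * scale i ^ 4 * (trunc i (fst y)) ^ 4) \<partial>C.law i (C.hist i s))"
    unfolding C.law_def using skorokhod_step.emb_law_time_square'[OF C.step] skorokhod_step.emb_law_fst[OF C.step F3]
    by simp
  qed
  also have "... = (\<integral>\<^sup>+s. ennreal (64 * scale i ^ 4) * ennreal ((trunc i (xi i s)) ^ 4) \<partial>Om)"
   using C.transition_law[OF F2, of i] by (simp add: ennreal_mult)
  also have "... = ennreal (64 * scale i ^ 4) * (\<integral>\<^sup>+s. ennreal ((trunc i (xi i s)) ^ 4) \<partial>Om)"
   by (rule nn_integral_cmult) measurable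
  also have "... = ennreal (?v i)" by (simp add: nn_integral_trunc_fourth ennreal_mult)
  finally show "(\<integral>\<^sup>+s. ennreal ((max 0 (snd (xi i s, C.dt i s)))^2) \<partial>Om) \<le> ennreal (?v i)" .
 next
  show "incseq (\<lambda>n. real (Suc n) powr (2 * p + 1))" using p by (intro incseq_SucI powr_mono2) auto
  show "filterlim (\<lambda>n. real (Suc n) powr (2 * p + 1)) at_top sequentially" using p by real_asymp
  \<comment> \<open>The scale contributes \<open>(i + 1) powr (4 * p)\<close> against
    \<open>(i + 1) powr (4 * p + 2)\<close>, which leaves the series of
    \<open>summable_trunc_fourth\<close>.\<close>
  have "?v i / (real (Suc i) powr (2 * p + 1))^2 = 64 * lam ^ 4 * ((LINT x|\<nu>. (trunc i x) ^ 4) / (real (Suc i))^2)" for i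
  proof -
   define k where "k = real (Suc i)"
   have k: "0 < k" by (simp add: k_def)
   have "k powr (2 * p + 1) = (k powr p)^2 * k"
    using k by (simp add: powr_add power2_eq_square powr_add[symmetric])
   moreover have "scale i = lam * k powr p" by (simp add: scale_def k_def)
   ultimately show ?thesis using k unfolding k_def[symmetric]
    by (simp add: power_mult_distrib)
  qed
  then show "summable (\<lambda>i. ?v i / (real (Suc i) powr (2 * p + 1))^2)"
   using summable_mult[OF summable_trunc_fourth, of "64 * lam ^ 4"] by simp
 qed simp
 then show ?thesis by (simp add: law_time)
qed

text \<open>The almost sure event on which all later arguments take place: the limit properties of
  \<open>nsr_path\<close>, and the truncated martingale read off one continuous path at the
  accumulated times.\<close>

definition good :: "(nat => state) => bool" where
 "good x \<longleftrightarrow> nsr_path p m1 m2 mu sg lam \<tau> \<theta> (\<lambda>i. xi i x) (\<lambda>i. ci i x) (\<lambda>i. qi i x) (\<lambda>i. C.dt i x) \<and>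
  (\<forall>i. 0 \<le> C.dt i x) \<and> C.wp 0 x \<in> path_set \<and>
  (\<forall>n. C.wp 0 x (\<Sum>i<n. C.dt i x) = (\<Sum>i<n. lam * real (Suc i) powr p * (trunc i (xi i x) - ci i x)))"

lemma AE_good: "AE x in Om. good x"
proof -
 have "AE x in Om. C.wp 0 x \<in> path_set"
  using measurable_space[OF C.wp_measurable_Om] by (intro AE_I2) auto
 then show ?thesis
  using AE_eventually_trunc AE_lln_mean AE_lln_square AE_lln_time C.AE_embedding
 proof eventually_elim
  case (elim x)
  have mx: "max 0 (C.dt i x) = C.dt i x" for i using elim by auto
  have "nsr_path p m1 m2 mu sg lam \<tau> \<theta> (\<lambda>i. xi i x) (\<lambda>i. ci i x) (\<lambda>i. qi i x) (\<lambda>i. C.dt i x)"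
  proof (rule nsr_path.intro)
   show "0 < p" "p < 1" by (fact p)+
   show "(1 + p) * mu = (1 - p) * m1" using p by (simp add: mu_def)
   show "0 < sg" "sg^2 = m2 - mu^2" by (fact sg_pos sg_square)+
   show "lam = sqrt (2 * p + 1) / sg" by (rule lam_def)
   show "summable (\<lambda>i. \<bar>m1 - \<tau> i\<bar> / sqrt (real (Suc i)))" using summable_trunc_rest by (simp add: \<tau>_def)
   show "(\<lambda>n. (\<Sum>i<n. C.dt i x - (lam * real (Suc i) powr p)^2 * (qi i x - (ci i x)^2)) / real (Suc n) powr (2 * p + 1)) \<longlonglongrightarrow> 0"
    using elim by (simp add: mx scale_def)
  qed (use elim \<tau>_tendsto \<theta>_tendsto ci_eq qi_eq in auto)
  then show ?case using elim by (auto simp: good_def ci_def scale_def)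
 qed
qed

end

section \<open>The two approximations on a good path\<close>

definition coupling_error :: "real => real => real => (nat => real) => (real => real) => nat => real => real" where
 "coupling_error p lam mu S w n t = \<bar>lam * ((S (nat \<lfloor>real n * t\<rfloor>) - mu * real (nat \<lfloor>real n * t\<rfloor>)) / sqrt (real n))
  - (if t = 0 then 0 else t powr (- p) * w ((real n * t) powr (2 * p + 1))) / sqrt (real n powr (2 * p + 1))\<bar>"

text \<open>The exponent is chosen for Brownian time \<open>u powr (2 * p + 1)\<close>: the weight
  becomes \<open>u powr p\<close> and cancels the factor \<open>u powr (- p)\<close>, while
  \<open>N = n powr (2 * p + 1)\<close> contributes exactly \<open>sqrt n\<close>.\<close>

definition oscillation_event :: "real => (real => real) => real => real => real => bool" where
 "oscillation_event p w d e N \<longleftrightarrow> (\<forall>t\<in>{0<..N}. \<forall>v\<ge>0. \<bar>v - t\<bar> \<le> d * t -->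
   \<bar>w v - w t\<bar> \<le> e * N powr (1 / 2 - p / (2 * p + 1)) * t powr (p / (2 * p + 1)))"

locale nsr_coupling =
 fixes p lam mu :: real and S T :: "nat => real" and w :: "real => real"
 assumes p: "0 < p" "p < 1" and w: "w \<in> path_set" and T: "\<And>n. 0 \<le> T n" and S0: "S 0 = 0"
  and time: "(\<lambda>n. T n / real n powr (2 * p + 1)) \<longlonglongrightarrow> 1"
  and mean: "(\<lambda>n. S n / real n) \<longlonglongrightarrow> mu"
  and remainder: "(\<lambda>n. (lam * (real n powr p * (S n - mu * real n)) - w (T n)) / real n powr (p + 1 / 2)) \<longlonglongrightarrow> 0"
begin

definition Rem :: "nat => real" where "Rem n = lam * (real n powr p * (S n - mu * real n)) - w (T n)"

lemma sqrt_power: "sqrt (real n powr (2 * p + 1)) = real n powr (p + 1 / 2)"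
proof -
 have "sqrt (real n powr (2 * p + 1)) = (real n powr (2 * p + 1)) powr (1 / 2)"
  by (simp add: powr_half_sqrt)
 then show ?thesis by (simp add: powr_powr field_simps)
qed

lemma time_close: "0 < d ==> eventually (\<lambda>n. \<bar>T n - real n powr (2 * p + 1)\<bar> \<le> d * real n powr (2 * p + 1)) sequentially"
proof -
 assume d: "0 < d"
 have "eventually (\<lambda>n. dist (T n / real n powr (2 * p + 1)) 1 < d) sequentially"
  using tendstoD[OF time d] .
 moreover have "eventually (\<lambda>n. 0 < real n) sequentially" by real_asymp
 ultimately show ?thesis
 proof eventually_elim
  case (elim n)
  let ?b = "real n powr (2 * p + 1)"
  have b: "0 < ?b" using elim by simp
  have "\<bar>T n - ?b\<bar> = \<bar>T n / ?b - 1\<bar> * ?b" using b by (simp add: abs_mult_pos[symmetric] field_simps)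
  also have "... \<le> d * ?b" using elim(1) b by (intro mult_right_mono) (auto simp: dist_real_def)
  finally show ?case .
 qed
qed

text \<open>The remainder is of smaller order than \<open>n powr (p + 1 / 2)\<close>, and the
  relative error of the clock tends to 0, so the modulus at infinity controls the exchange of
  \<open>T n\<close> for \<open>n powr (2 * p + 1)\<close>.\<close>

theorem strong_approximation:
 assumes modulus: "\<And>n::nat. \<exists>d>0. \<exists>t0. \<forall>t\<ge>t0. \<forall>s. \<bar>s - t\<bar> \<le> d * t --> \<bar>w s - w t\<bar> \<le> 1 / real (Suc n) * sqrt (t * ln (ln t))"
 shows "(\<lambda>n. 1 / sqrt (real n powr (2 * p + 1) * ln (ln (real n))) *
  \<bar>lam * ((S n - mu * real n) / real n powr (- p)) - w (real n powr (2 * p + 1))\<bar>) \<longlonglongrightarrow> 0"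
proof (rule LIMSEQ_I)
 fix r :: real assume r: "0 < r"
 let ?t = "\<lambda>n. real n powr (2 * p + 1)" and ?L = "\<lambda>n. ln (ln (real n))"
 obtain k where k: "1 / real (Suc k) < r / 4" using nat_approx_posE[of "r / 4"] r by auto
 obtain d t0 where d: "0 < d" and mod: "\<And>t s. t0 \<le> t ==> \<bar>s - t\<bar> \<le> d * t ==> \<bar>w s - w t\<bar> \<le> 1 / real (Suc k) * sqrt (t * ln (ln t))"
  using modulus[of k] by auto
 have "eventually (\<lambda>n. norm (Rem n / real n powr (p + 1 / 2) - 0) < r / 2) sequentially"
  using LIMSEQ_D[OF remainder[folded Rem_def], of "r / 2"] r by (auto simp: eventually_sequentially)
 moreover note time_close[OF d]
 moreover have "eventually (\<lambda>n. t0 \<le> ?t n) sequentially"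
 proof -
  have "filterlim ?t at_top sequentially" using p by real_asymp
  then show ?thesis by (simp add: filterlim_at_top)
 qed
 \<comment> \<open>The two iterated logarithms differ by a bounded amount. The factor 4 becomes 2
   under the root and is paid for by the tolerance \<open>r / 4\<close>.\<close>
 moreover have "eventually (\<lambda>n. ln (ln (?t n)) \<le> 4 * ?L n) sequentially" using p by real_asymp
 moreover have "eventually (\<lambda>n. 1 \<le> ?L n) sequentially" by real_asymp
 moreover have "eventually (\<lambda>n. 0 < real n) sequentially" by real_asymp
 ultimately have "eventually (\<lambda>n. norm (1 / sqrt (?t n * ?L n) * \<bar>lam * ((S n - mu * real n) / real n powr (- p)) - w (?t n)\<bar> - 0) < r) sequentially"
 proof eventually_elim
  case (elim n)
  have tp: "0 < ?t n" using elim by simp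
  have "lam * ((S n - mu * real n) / real n powr (- p)) = w (T n) + Rem n"
   by (simp add: Rem_def powr_minus divide_inverse mult.commute)
  then have "\<bar>lam * ((S n - mu * real n) / real n powr (- p)) - w (?t n)\<bar> \<le> \<bar>Rem n\<bar> + \<bar>w (T n) - w (?t n)\<bar>" by linarith
  also have "\<bar>w (T n) - w (?t n)\<bar> \<le> 1 / real (Suc k) * sqrt (?t n * ln (ln (?t n)))" by (rule mod[OF elim(3,2)])
  also have "... \<le> 1 / real (Suc k) * sqrt (?t n * (4 * ?L n))" using elim tp by (intro mult_left_mono) auto
  also have "... \<le> r / 4 * sqrt (?t n * (4 * ?L n))" using k elim tp by (intro mult_right_mono) auto
  also have "r / 4 * sqrt (?t n * (4 * ?L n)) = r / 2 * sqrt (?t n * ?L n)"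
   by (simp add: real_sqrt_mult)
  also have "\<bar>Rem n\<bar> < r / 2 * real n powr (p + 1 / 2)"
   using elim(1,6) by (simp add: field_simps)
  also have "r / 2 * real n powr (p + 1 / 2) \<le> r / 2 * sqrt (?t n * ?L n)"
  proof -
   have "real n powr (p + 1 / 2) = sqrt (?t n * 1)" by (simp add: sqrt_power)
   also have "... \<le> sqrt (?t n * ?L n)" using elim tp by (intro real_sqrt_le_mono mult_left_mono) auto
   finally show ?thesis using r by simp
  qed
  finally have "\<bar>lam * ((S n - mu * real n) / real n powr (- p)) - w (?t n)\<bar> < r * sqrt (?t n * ?L n)" by simp
  moreover have "0 < sqrt (?t n * ?L n)" using tp elim by simp
  ultimately show ?case by (simp add: divide_simps)
 qed
 then show "\<exists>no. \<forall>n\<ge>no. norm (1 / sqrt (?t n * ?L n) * \<bar>lam * ((S n - mu * real n) / real n powr (- p)) - w (?t n)\<bar> - 0) < r"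
  by (simp add: eventually_sequentially)
qed

text \<open>Turns a statement at the final index into one uniform over all indices up to
  \<open>n\<close>: the early values are bounded and are absorbed by the growth of
  \<open>sqrt n\<close>.\<close>

lemma running_max_small:
 fixes E :: "nat => real"
 assumes E: "(\<lambda>k. E k / sqrt (real k)) \<longlonglongrightarrow> 0" and e: "0 < e"
 shows "eventually (\<lambda>n. \<forall>k\<in>{1..n}. E k \<le> e * sqrt (real n)) sequentially"
proof -
 obtain K where K: "\<And>k. K \<le> k ==> \<bar>E k / sqrt (real k)\<bar> < e" using LIMSEQ_D[OF E e] by auto
 define M where "M = (\<Sum>k<K. \<bar>E k\<bar>)"
 have M: "E k \<le> M" if "k < K" for k
  using member_le_sum[of k "{..<K}" "\<lambda>k. \<bar>E k\<bar>"] that by (auto simp: M_def)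
 have "filterlim (\<lambda>n. e * sqrt (real n)) at_top sequentially" using e by real_asymp
 then have "eventually (\<lambda>n. M \<le> e * sqrt (real n)) sequentially" by (simp add: filterlim_at_top)
 then show ?thesis
 proof eventually_elim
  case (elim n)
  show ?case
  proof
   fix k assume k: "k \<in> {1..n}"
   show "E k \<le> e * sqrt (real n)"
   proof (cases "k < K")
    case False
    then have "\<bar>E k / sqrt (real k)\<bar> < e" by (intro K) simp
    then have "E k \<le> e * sqrt (real k)" using k by (simp add: divide_simps abs_less_iff)
    also have "... \<le> e * sqrt (real n)" using k e by (intro mult_left_mono) auto
    finally show ?thesis .
   qed (use M elim in force)
  qed
 qed
qed

text \<open>Everything in the error on \<open>[k, k + 1)\<close> that can be bounded without
  reference to the position inside: the remainder at \<open>k\<close>, and the change of the weight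
  \<open>u powr (- p)\<close> across the interval.\<close>

definition grid_error :: "nat => real" where
 "grid_error k = real k powr (- p) * \<bar>Rem k\<bar> + (real k powr (- p) - real (Suc k) powr (- p)) * \<bar>w (T k)\<bar>"

text \<open>The weight changes by order \<open>k powr (- p - 1)\<close>, and \<open>w (T k)\<close>
  is up to \<open>Rem k\<close> a multiple of \<open>k powr p * (S k - mu * k)\<close>, which is
  \<open>o(k powr (p + 1))\<close> by \<open>mean\<close>. So the product is bounded, which is more
  than enough after division by \<open>sqrt k\<close>.\<close>

lemma grid_error_small: "(\<lambda>k. grid_error k / sqrt (real k)) \<longlonglongrightarrow> 0"
proof -
 let ?R = "\<lambda>k. \<bar>Rem k / real k powr (p + 1 / 2)\<bar>" and ?D = "\<lambda>k. S k - mu * real k"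
 let ?c = "\<lambda>k. (real k powr (- p) - real (Suc k) powr (- p)) * real k powr p * sqrt (real k)"
 have 1: "?R \<longlonglongrightarrow> 0" using remainder[folded Rem_def] by (rule tendsto_rabs_zero)
 have 2: "(\<lambda>k. \<bar>?D k / real k\<bar>) \<longlonglongrightarrow> 0"
 proof (rule tendsto_rabs_zero, rule Lim_transform_eventually)
  show "(\<lambda>k. S k / real k - mu) \<longlonglongrightarrow> 0" using tendsto_diff[OF mean tendsto_const[of mu]] by simp
  show "eventually (\<lambda>k. S k / real k - mu = ?D k / real k) sequentially"
   by (rule eventually_sequentiallyI[of 1]) (simp add: field_simps)
 qed
 have 3: "?c \<longlonglongrightarrow> 0" using p by real_asymp
 have "(\<lambda>k. 2 * ?R k + ?c k * (\<bar>lam\<bar> * \<bar>?D k / real k\<bar>)) \<longlonglongrightarrow> 2 * 0 + 0 * (\<bar>lam\<bar> * 0)"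
  by (intro tendsto_intros 1 2 3)
 then have lim: "(\<lambda>k. 2 * ?R k + ?c k * (\<bar>lam\<bar> * \<bar>?D k / real k\<bar>)) \<longlonglongrightarrow> 0" by simp
 have bound: "0 \<le> grid_error k / sqrt (real k) \<and> grid_error k / sqrt (real k) \<le> 2 * ?R k + ?c k * (\<bar>lam\<bar> * \<bar>?D k / real k\<bar>)" if "1 \<le> k" for k
 proof -
  have k: "0 < real k" using that by simp
  let ?a = "real k powr (- p)" and ?b = "real (Suc k) powr (- p)"
  have ab: "?b \<le> ?a" "0 < ?b" "0 < ?a" using p k by (auto intro!: powr_mono2')
  have w1: "\<bar>w (T k)\<bar> \<le> real k powr p * (\<bar>lam\<bar> * \<bar>?D k\<bar>) + \<bar>Rem k\<bar>"
  proof -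
   have "w (T k) = lam * (real k powr p * ?D k) - Rem k" by (simp add: Rem_def)
   then have "\<bar>w (T k)\<bar> \<le> \<bar>lam * (real k powr p * ?D k)\<bar> + \<bar>Rem k\<bar>" by linarith
   then show ?thesis by (simp add: abs_mult mult_ac)
  qed
  have "grid_error k \<le> ?a * \<bar>Rem k\<bar> + (?a - ?b) * (real k powr p * (\<bar>lam\<bar> * \<bar>?D k\<bar>) + \<bar>Rem k\<bar>)"
   unfolding grid_error_def using ab w1 by (intro add_left_mono mult_left_mono) auto
  also have "... \<le> 2 * (?a * \<bar>Rem k\<bar>) + (?a - ?b) * (real k powr p * (\<bar>lam\<bar> * \<bar>?D k\<bar>))"
  proof -
   have "(?a - ?b) * \<bar>Rem k\<bar> \<le> ?a * \<bar>Rem k\<bar>" using ab by (intro mult_right_mono) auto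
   then show ?thesis by (simp add: distrib_left)
  qed
  finally have "grid_error k / sqrt (real k) \<le> (2 * (?a * \<bar>Rem k\<bar>) + (?a - ?b) * (real k powr p * (\<bar>lam\<bar> * \<bar>?D k\<bar>))) / sqrt (real k)"
   by (rule divide_right_mono) simp
  also have "... = 2 * ?R k + ?c k * (\<bar>lam\<bar> * \<bar>?D k / real k\<bar>)"
  proof -
   have 1: "real k powr (p + 1 / 2) = real k powr p * sqrt (real k)"
    by (simp only: powr_add powr_half_sqrt of_nat_0_le_iff)
   have 2: "?a = 1 / real k powr p" by (simp add: powr_minus_divide)
   have "?a * \<bar>Rem k\<bar> / sqrt (real k) = ?R k" unfolding 1 unfolding 2 by (simp add: abs_mult)
   moreover have "(?a - ?b) * (real k powr p * (\<bar>lam\<bar> * \<bar>?D k\<bar>)) / sqrt (real k) = ?c k * (\<bar>lam\<bar> * \<bar>?D k / real k\<bar>)"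
   proof -
    have s: "real k = sqrt (real k) * sqrt (real k)" by simp
    have "\<bar>?D k / real k\<bar> = \<bar>?D k\<bar> / real k" by simp
    also have "... = \<bar>?D k\<bar> / sqrt (real k) / sqrt (real k)" by (subst s) (simp only: divide_divide_eq_left)
    finally have e: "\<bar>?D k / real k\<bar> = \<bar>?D k\<bar> / sqrt (real k) / sqrt (real k)" .
    have gen: "x * (y * (l * z)) / r = x * y * r * (l * (z / r / r))" if "0 < r" for x y l z r :: real
     using that by (simp add: field_simps)
    show ?thesis unfolding e by (rule gen) (use k in simp)
   qed
   ultimately show ?thesis by (simp add: add_divide_distrib)
  qed
  finally have "grid_error k / sqrt (real k) \<le> 2 * ?R k + ?c k * (\<bar>lam\<bar> * \<bar>?D k / real k\<bar>)" .
  moreover have "0 \<le> grid_error k" unfolding grid_error_def using ab by (intro add_nonneg_nonneg mult_nonneg_nonneg) auto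
  ultimately show ?thesis by simp
 qed
 show ?thesis
  by (rule tendsto_sandwich[OF _ _ tendsto_const lim]) (use bound in \<open>auto intro!: eventually_sequentiallyI[of 1]\<close>)
qed

text \<open>The clock at the integer \<open>k\<close> also serves all real \<open>u\<close> in
  \<open>[k, k + 1]\<close>, because neighbouring powers have ratio tending to 1.\<close>

lemma interpolated_time_close:
 assumes d: "0 < d"
 shows "\<exists>k0\<ge>1. \<forall>k\<ge>k0. \<forall>u. real k \<le> u \<and> u \<le> real k + 1 --> \<bar>T k - u powr (2 * p + 1)\<bar> \<le> d * u powr (2 * p + 1)"
proof -
 let ?s = "2 * p + 1"
 have "(\<lambda>k. (real k + 1) powr ?s / real k powr ?s) \<longlonglongrightarrow> 1" using p by real_asymp
 then have "eventually (\<lambda>k. dist ((real k + 1) powr ?s / real k powr ?s) 1 < d / 2) sequentially"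
  by (rule tendstoD) (use d in simp)
 moreover have "eventually (\<lambda>n. \<bar>T n - real n powr ?s\<bar> \<le> d / 2 * real n powr ?s) sequentially"
  by (rule time_close) (use d in simp)
 moreover have "eventually (\<lambda>n. 1 \<le> n) sequentially" by (rule eventually_ge_at_top)
 ultimately have "eventually (\<lambda>k. \<forall>u. real k \<le> u \<and> u \<le> real k + 1 --> \<bar>T k - u powr ?s\<bar> \<le> d * u powr ?s) sequentially"
 proof eventually_elim
  case (elim k)
  show ?case
  proof (intro allI impI)
   fix u assume u: "real k \<le> u \<and> u \<le> real k + 1"
   have b: "0 < real k powr ?s" using elim by simp
   have m: "real k powr ?s \<le> u powr ?s" "u powr ?s \<le> (real k + 1) powr ?s"
    using u p by (auto intro!: powr_mono2)
   have "(real k + 1) powr ?s / real k powr ?s - 1 < d / 2" using elim(1) unfolding dist_real_def by linarith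
   then have "(real k + 1) powr ?s - real k powr ?s < d / 2 * real k powr ?s" using b by (simp add: field_simps)
   then have "\<bar>T k - u powr ?s\<bar> \<le> d / 2 * real k powr ?s + d / 2 * real k powr ?s"
    using elim(2) m by linarith
   also have "... \<le> d * u powr ?s" using m d by simp
   finally show "\<bar>T k - u powr ?s\<bar> \<le> d * u powr ?s" .
  qed
 qed
 then obtain k0 where "\<And>k. k0 \<le> k ==> \<forall>u. real k \<le> u \<and> u \<le> real k + 1 --> \<bar>T k - u powr ?s\<bar> \<le> d * u powr ?s"
  by (auto simp: eventually_sequentially)
 then show ?thesis by (intro exI[of _ "max 1 k0"]) auto
qed

text \<open>The two oscillation events enter as hypotheses, since their probabilities are estimated
  separately for each \<open>n\<close>. One \<open>e\<close> pays for \<open>grid_error\<close> and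
  one for the change of clock; small \<open>k\<close> and the time before the first step are treated
  apart.\<close>

theorem uniform_approximation:
 assumes d: "0 < d" and e: "0 < e"
 shows "eventually (\<lambda>n. oscillation_event p w d e (real n powr (2 * p + 1)) --> oscillation_event p w 1 (e * sqrt (real n)) 1 -->
  (\<forall>t\<in>{0..1}. coupling_error p lam mu S w n t \<le> 2 * e)) sequentially"
proof -
 let ?s = "2 * p + 1" and ?q = "p / (2 * p + 1)"
 have s: "0 < ?s" "?s * ?q = p" "?s * (1 / 2 - ?q) = 1 / 2" using p by (auto simp: field_simps)
 obtain k0 where k0: "1 \<le> k0" "\<And>k u. k0 \<le> k ==> real k \<le> u ==> u \<le> real k + 1 ==> \<bar>T k - u powr ?s\<bar> \<le> d * u powr ?s"
  using interpolated_time_close[OF d] by blast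
 \<comment> \<open>Bounds every Brownian time that can occur for \<open>k < k0\<close>, both
   \<open>T k\<close> and \<open>u powr (2 * p + 1)\<close>. There the path is merely bounded, and
   \<open>sqrt n\<close> absorbs the bound.\<close>
 define R where "R = real k0 powr ?s + (\<Sum>k<k0. T k)"
 have "compact (w ` {0..R})"
  using w by (intro compact_continuous_image) (auto simp: path_set_def intro: continuous_on_subset)
 from compact_imp_bounded[OF this] have "\<exists>B. \<forall>t\<in>{0..R}. \<bar>w t\<bar> \<le> B" by (simp add: bounded_iff)
 then obtain B where B: "\<And>t. t \<in> {0..R} ==> \<bar>w t\<bar> \<le> B" by blast
 have "filterlim (\<lambda>n. e * sqrt (real n)) at_top sequentially" using e by real_asymp
 then have "eventually (\<lambda>n. 2 * B \<le> e * sqrt (real n)) sequentially" by (simp add: filterlim_at_top)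
 moreover note running_max_small[OF grid_error_small e]
 moreover have "eventually (\<lambda>n. 1 \<le> n) sequentially" by (rule eventually_ge_at_top)
 ultimately show ?thesis
 proof eventually_elim
  case (elim n)
  show ?case
  proof (intro impI ballI)
   fix t :: real assume osc: "oscillation_event p w d e (real n powr ?s)" and start: "oscillation_event p w 1 (e * sqrt (real n)) 1"
    and t: "t \<in> {0..1}"
   have n: "0 < real n" "0 < sqrt (real n)" using elim by auto
   show "coupling_error p lam mu S w n t \<le> 2 * e"
   proof (cases "t = 0")
    case True
    then show ?thesis using S0 e by (simp add: coupling_error_def)
   next
    case False
    define u where "u = real n * t"
    define k where "k = nat \<lfloor>u\<rfloor>"
    have u: "0 < u" "u \<le> real n" using t False n by (auto simp: u_def mult_le_cancel_left1)
    have ku: "real k \<le> u" "u < real k + 1"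
     unfolding k_def using u by (simp_all add: of_nat_floor)
    have kn: "k \<le> n" using ku u by linarith
    have tp: "t powr (- p) = u powr (- p) * real n powr p"
    proof -
     have "t = u / real n" using n by (simp add: u_def)
     then have "t powr (- p) = u powr (- p) / real n powr (- p)" using u n by (simp add: powr_divide)
     then show ?thesis by (simp add: powr_minus divide_inverse)
    qed
    have sq: "sqrt (real n powr ?s) = real n powr p * sqrt (real n)"
     unfolding sqrt_power by (simp only: powr_add powr_half_sqrt of_nat_0_le_iff)
    have err: "coupling_error p lam mu S w n t = \<bar>lam * (S k - mu * real k) - u powr (- p) * w (u powr ?s)\<bar> / sqrt (real n)"
    proof -
     have "t powr (- p) * w ((real n * t) powr ?s) / sqrt (real n powr ?s) = u powr (- p) * w (u powr ?s) / sqrt (real n)"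
      unfolding sq tp u_def[symmetric] using n by simp
     then have "coupling_error p lam mu S w n t = \<bar>lam * (S k - mu * real k) / sqrt (real n) - u powr (- p) * w (u powr ?s) / sqrt (real n)\<bar>"
      unfolding coupling_error_def using False by (simp add: u_def[symmetric] k_def[symmetric])
     also have "... = \<bar>lam * (S k - mu * real k) - u powr (- p) * w (u powr ?s)\<bar> / sqrt (real n)"
      unfolding diff_divide_distrib[symmetric] by simp
     finally show ?thesis .
    qed
    have cancel: "u powr (- p) * (c * (u powr ?s) powr ?q) = c" for c
     using u s by (simp add: powr_powr powr_minus)
    have "\<bar>lam * (S k - mu * real k) - u powr (- p) * w (u powr ?s)\<bar> \<le> e * sqrt (real n) + e * sqrt (real n)"
    proof (cases "k = 0")
     case True
     \<comment> \<open>Before the first step the walk is 0. The second event, with relative window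
       1, admits the comparison time \<open>v = 0\<close>, where the path vanishes.\<close>
     have "u powr ?s \<in> {0<..1}" using u ku True s powr_le1[of ?s u] by auto
     moreover have "\<bar>0 - u powr ?s\<bar> \<le> 1 * u powr ?s" by simp
     ultimately have "\<bar>w 0 - w (u powr ?s)\<bar> \<le> e * sqrt (real n) * 1 powr (1 / 2 - ?q) * (u powr ?s) powr ?q"
      using start unfolding oscillation_event_def by blast
     then have "\<bar>w (u powr ?s)\<bar> \<le> e * sqrt (real n) * (u powr ?s) powr ?q" using path_setD(2)[OF w, of 0] by simp
     then have "u powr (- p) * \<bar>w (u powr ?s)\<bar> \<le> u powr (- p) * (e * sqrt (real n) * (u powr ?s) powr ?q)"
      by (rule mult_left_mono) simp
     then have "u powr (- p) * \<bar>w (u powr ?s)\<bar> \<le> e * sqrt (real n)" unfolding cancel .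
     moreover have "0 \<le> e * sqrt (real n)" using e by simp
     ultimately have "u powr (- p) * \<bar>w (u powr ?s)\<bar> \<le> e * sqrt (real n) + e * sqrt (real n)" by linarith
     then show ?thesis using True S0 by (simp add: abs_mult)
    next
     case False
     then have k: "1 \<le> k" "0 < real k" by auto
     have mono: "u powr (- p) \<le> real k powr (- p)" "real (Suc k) powr (- p) \<le> u powr (- p)" "u powr (- p) \<le> 1"
     proof -
      show "u powr (- p) \<le> real k powr (- p)" using ku k p by (intro powr_mono2') auto
      show "real (Suc k) powr (- p) \<le> u powr (- p)" using ku u p by (intro powr_mono2') auto
      have "u powr (- p) \<le> 1 powr (- p)" using ku k p by (intro powr_mono2') auto
      then show "u powr (- p) \<le> 1" by simp
     qed
     have rep: "lam * (S k - mu * real k) = real k powr (- p) * (w (T k) + Rem k)"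
     proof -
      have "real k powr (- p) * (lam * (real k powr p * (S k - mu * real k))) = lam * (S k - mu * real k)"
       using k by (simp add: powr_minus)
      then show ?thesis by (simp add: Rem_def)
     qed
     have time_part: "u powr (- p) * \<bar>w (T k) - w (u powr ?s)\<bar> \<le> e * sqrt (real n)"
     proof (cases "k0 \<le> k")
      case True
      have "\<bar>T k - u powr ?s\<bar> \<le> d * u powr ?s" using ku by (intro k0(2)[OF True]) auto
      moreover have "u powr ?s \<in> {0<..real n powr ?s}" using u s by (auto intro!: powr_mono2)
      ultimately have "\<bar>w (T k) - w (u powr ?s)\<bar> \<le> e * (real n powr ?s) powr (1 / 2 - ?q) * (u powr ?s) powr ?q"
       using osc T[of k] unfolding oscillation_event_def by blast
      also have "(real n powr ?s) powr (1 / 2 - ?q) = sqrt (real n)"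
       unfolding powr_powr s(3) by (simp add: powr_half_sqrt)
      finally have "u powr (- p) * \<bar>w (T k) - w (u powr ?s)\<bar> \<le> u powr (- p) * (e * sqrt (real n) * (u powr ?s) powr ?q)"
       by (rule mult_left_mono) simp
      then show ?thesis unfolding cancel .
     next
      case False
      have "T k \<le> (\<Sum>k<k0. T k)" using False T by (intro member_le_sum) auto
      then have "T k \<in> {0..R}" using T[of k] by (simp add: R_def add_increasing)
      moreover have "u powr ?s \<le> real k0 powr ?s" using ku u False s by (intro powr_mono2) auto
      then have "u powr ?s \<in> {0..R}" using sum_nonneg[of "{..<k0}" T] T by (simp add: R_def)
      ultimately have "\<bar>w (T k)\<bar> \<le> B" "\<bar>w (u powr ?s)\<bar> \<le> B" by (auto intro: B)
      then have "\<bar>w (T k) - w (u powr ?s)\<bar> \<le> 2 * B" by linarith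
      then have "u powr (- p) * \<bar>w (T k) - w (u powr ?s)\<bar> \<le> 1 * (2 * B)"
       using mono(3) by (intro mult_mono) auto
      then show ?thesis using elim by simp
     qed
     have "\<bar>lam * (S k - mu * real k) - u powr (- p) * w (u powr ?s)\<bar>
      = \<bar>real k powr (- p) * Rem k + (real k powr (- p) - u powr (- p)) * w (T k) + u powr (- p) * (w (T k) - w (u powr ?s))\<bar>"
      unfolding rep by (simp add: algebra_simps)
     also have "... \<le> \<bar>real k powr (- p) * Rem k\<bar> + \<bar>(real k powr (- p) - u powr (- p)) * w (T k)\<bar> + \<bar>u powr (- p) * (w (T k) - w (u powr ?s))\<bar>"
      by linarith
     also have "... = real k powr (- p) * \<bar>Rem k\<bar> + (real k powr (- p) - u powr (- p)) * \<bar>w (T k)\<bar> + u powr (- p) * \<bar>w (T k) - w (u powr ?s)\<bar>"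
      using mono by (simp add: abs_mult)
     also have "... \<le> grid_error k + e * sqrt (real n)"
      unfolding grid_error_def using mono time_part by (intro add_mono mult_right_mono) auto
     also have "grid_error k \<le> e * sqrt (real n)" using elim k kn by auto
     finally show ?thesis by simp
    qed
    then show ?thesis unfolding err using n by (simp add: divide_simps)
   qed
  qed
 qed
qed

end

section \<open>Passage to the richer probability space\<close>

lemma (in prob_space) indep_vars_add_constants:
 assumes I: "indep_vars M' X I" "I \<subseteq> K"
  and const: "\<And>i. i \<in> K - I ==> \<exists>c\<in>space (M' i). \<forall>s\<in>space M. X i s = c"
 shows "indep_vars M' X K"
 unfolding indep_vars_def2
proof (intro conjI ballI indep_setsI)
 have IX: "\<And>i. i \<in> I ==> X i \<in> measurable M (M' i)"
  and ind: "indep_sets (\<lambda>i. {X i -` A \<inter> space M |A. A \<in> sets (M' i)}) I"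
  using I(1) by (auto simp: indep_vars_def2)
 show rv: "random_variable (M' i) (X i)" if i: "i \<in> K" for i
 proof (cases "i \<in> I")
  case False
  then obtain c where c: "c \<in> space (M' i)" "\<forall>s\<in>space M. X i s = c" using const[of i] i by blast
  then show ?thesis by (subst measurable_cong[of M _ "\<lambda>_. c"]) auto
 qed (rule IX)
 show "{X i -` A \<inter> space M |A. A \<in> sets (M' i)} \<subseteq> events" if "i \<in> K" for i
  using measurable_sets[OF rv[OF that]] by auto
 fix A J assume J: "J \<noteq> {}" "J \<subseteq> K" "finite J" and A: "\<forall>j\<in>J. A j \<in> {X j -` B \<inter> space M |B. B \<in> sets (M' j)}"
 \<comment> \<open>An event determined by a constant variable is empty or the whole space, so it
   does not disturb the product formula.\<close>
 have triv: "A j = {} \<or> A j = space M" if j: "j \<in> J - I" for j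
 proof -
  obtain B where B: "A j = X j -` B \<inter> space M" using A j by blast
  obtain c where "\<forall>s\<in>space M. X j s = c" using const[of j] j J(2) by blast
  then show ?thesis unfolding B by (cases "c \<in> B") auto
 qed
 show "prob (\<Inter>j\<in>J. A j) = (\<Prod>j\<in>J. prob (A j))"
 proof (cases "\<exists>j\<in>J - I. A j = {}")
  case True
  then obtain j where j: "j \<in> J" "A j = {}" by blast
  then have "(\<Inter>j\<in>J. A j) = {}" by blast
  moreover have "(\<Prod>j\<in>J. prob (A j)) = 0" using j J(3) by (intro prod_zero bexI[of _ j]) auto
  ultimately show ?thesis by simp
 next
  case False
  then have sp: "A j = space M" if "j \<in> J - I" for j using triv that by blast
  have "(\<Prod>j\<in>J. prob (A j)) = (\<Prod>j\<in>J \<inter> I. prob (A j))"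
   by (rule prod.mono_neutral_right) (use J(3) sp in \<open>auto simp: prob_space\<close>)
  also have "... = prob (\<Inter>j\<in>J. A j)"
  proof (cases "J \<inter> I = {}")
   case True
   then have "A j = space M" if "j \<in> J" for j using sp that by blast
   then have "(\<Inter>j\<in>J. A j) = space M" using J(1) by auto
   then show ?thesis using True by (simp add: prob_space)
  next
   case False
   have "(\<Inter>j\<in>J. A j) = (\<Inter>j\<in>J \<inter> I. A j)"
   proof (rule antisym)
    show "(\<Inter>j\<in>J \<inter> I. A j) \<subseteq> (\<Inter>j\<in>J. A j)"
    proof
     fix x assume x: "x \<in> (\<Inter>j\<in>J \<inter> I. A j)"
     obtain j0 where "j0 \<in> J \<inter> I" using False by blast
     then have "x \<in> space M" using x A by blast
     then show "x \<in> (\<Inter>j\<in>J. A j)" using x sp by blast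
    qed
   qed blast
   moreover have "prob (\<Inter>j\<in>J \<inter> I. A j) = (\<Prod>j\<in>J \<inter> I. prob (A j))"
    by (rule indep_setsD[OF ind]) (use False J A in auto)
   ultimately show ?thesis by simp
  qed
  finally show ?thesis ..
 qed
qed

lemma (in prob_space) indep_vars_reindex:
 assumes f: "inj_on f I" and X: "indep_vars (\<lambda>_. N) X (f ` I)"
 shows "indep_vars (\<lambda>_. N) (\<lambda>i. X (f i)) I"
 unfolding indep_vars_def2
proof (intro conjI ballI indep_setsI)
 have XI: "\<And>i. i \<in> I ==> X (f i) \<in> measurable M N"
  and ind: "indep_sets (\<lambda>i. {X i -` A \<inter> space M |A. A \<in> sets N}) (f ` I)"
  using X by (auto simp: indep_vars_def2)
 show "random_variable N (X (f i))" if "i \<in> I" for i by (rule XI[OF that])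
 show "{X (f i) -` A \<inter> space M |A. A \<in> sets N} \<subseteq> events" if "i \<in> I" for i
  using measurable_sets[OF XI[OF that]] by auto
 fix A J assume J: "J \<noteq> {}" "J \<subseteq> I" "finite J" and A: "\<forall>j\<in>J. A j \<in> {X (f j) -` B \<inter> space M |B. B \<in> sets N}"
 let ?A = "\<lambda>k. A (the_inv_into I f k)"
 have inv: "?A (f j) = A j" if "j \<in> J" for j using the_inv_into_f_f[OF f, of j] that J(2) by auto
 have "prob (\<Inter>k\<in>f ` J. ?A k) = (\<Prod>k\<in>f ` J. prob (?A k))"
  by (rule indep_setsD[OF ind]) (use J A inv in auto)
 moreover have "(\<Prod>k\<in>f ` J. prob (?A k)) = (\<Prod>j\<in>J. prob (A j))"
  by (subst prod.reindex[OF inj_on_subset[OF f J(2)]]) (simp add: inv)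
 moreover have "(\<Inter>k\<in>f ` J. ?A k) = (\<Inter>j\<in>J. A j)" using inv by auto
 ultimately show "prob (\<Inter>j\<in>J. A j) = (\<Prod>j\<in>J. prob (A j))" by simp
qed

text \<open>The target allows repeated times and the time 0, while \<open>gauss_increments\<close>
  speaks of finite sets of positive times. Increments of positive length are reindexed from such a
  set, and those of length 0 are added back as constants.\<close>

lemma std_brownian_motionI:
 assumes "prob_space N" and W: "gauss_increments N W" and cont: "AE z in N. continuous_on {0..} (\<lambda>t. W t z)"
 shows "std_brownian_motion N W"
proof -
 interpret prob_space N by fact
 have Wm[measurable]: "W t \<in> borel_measurable N" for t using W by (auto simp: gauss_increments_def)
 show ?thesis
 proof
  show "AE z in N. W 0 z = 0" using W by (auto simp: gauss_increments_def)
  show "distributed N lborel (\<lambda>z. W t z - W s z) (\<lambda>x. ennreal (normal_density 0 (sqrt (t - s)) x))" if "0 \<le> s" "s < t" for s t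
   using gauss_increments_diff[OF W assms(1) that] by (simp add: distributed_gauss_iff)
  fix k :: nat and \<tau> :: "nat => real" assume \<tau>: "0 \<le> \<tau> 0" "\<And>i. i < k ==> \<tau> i \<le> \<tau> (Suc i)"
  have mono: "i \<le> j ==> j \<le> k ==> \<tau> i \<le> \<tau> j" for i j
  proof (induction j)
   case (Suc j)
   then show ?case using \<tau>(2)[of j] by (cases "i = Suc j") (auto intro: order_trans)
  qed simp
  have pos: "0 \<le> \<tau> i" if "i \<le> k" for i using mono[of 0 i] \<tau>(1) that by auto
  define I where "I = {i. i < k \<and> \<tau> i < \<tau> (Suc i)}"
  define J where "J = \<tau> ` {..k} \<inter> {0<..}"
  have J: "finite J" "J \<subseteq> {0<..}" by (auto simp: J_def)
  have in_J: "\<tau> (Suc i) \<in> J" if "i \<in> I" for i using that pos[of i] by (auto simp: I_def J_def)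
  have prev: "prev_time J (\<tau> (Suc i)) = \<tau> i" if i: "i \<in> I" for i
  proof -
   have "\<tau> j \<le> \<tau> i" if "j \<le> k" "\<tau> j < \<tau> (Suc i)" for j
   proof (cases "j \<le> i")
    case False
    then have "\<tau> (Suc i) \<le> \<tau> j" using that by (intro mono) auto
    then show ?thesis using that by simp
   qed (use i in \<open>auto intro: mono simp: I_def\<close>)
   moreover have "\<tau> i \<in> insert 0 {s \<in> J. s < \<tau> (Suc i)}"
    using i pos[of i] by (auto simp: I_def J_def)
   ultimately show ?thesis unfolding prev_time_def
    using pos[of i] i by (intro Max_eqI) (auto simp: J_def I_def)
  qed
  have inj: "inj_on (\<lambda>i. \<tau> (Suc i)) I"
  proof (rule inj_onI, rule ccontr)
   fix i j assume ij: "i \<in> I" "j \<in> I" "\<tau> (Suc i) = \<tau> (Suc j)" "i \<noteq> j"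
   then show False
    using mono[of "Suc i" j] mono[of "Suc j" i] by (cases "i < j") (auto simp: I_def)
  qed
  have "indep_vars (\<lambda>_. borel) (\<lambda>t z. W t z - W (prev_time J t) z) J"
   by (rule gauss_increments_indep(1)[OF W assms(1) J])
  then have "indep_vars (\<lambda>_. borel) (\<lambda>t z. W t z - W (prev_time J t) z) ((\<lambda>i. \<tau> (Suc i)) ` I)"
   by (rule indep_vars_subset) (use in_J in auto)
  from indep_vars_reindex[OF inj this]
  have "indep_vars (\<lambda>_. borel) (\<lambda>i z. W (\<tau> (Suc i)) z - W (prev_time J (\<tau> (Suc i))) z) I" by (simp add: comp_def)
  then have "indep_vars (\<lambda>_. borel) (\<lambda>i z. W (\<tau> (Suc i)) z - W (\<tau> i) z) I"
   by (rule indep_vars_cong[THEN iffD1, rotated -1]) (auto simp: prev)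
  then show "indep_vars (\<lambda>_. borel) (\<lambda>i z. W (\<tau> (Suc i)) z - W (\<tau> i) z) {..<k}"
  proof (rule indep_vars_add_constants)
   fix i assume "i \<in> {..<k} - I"
   then have "\<tau> (Suc i) = \<tau> i" using \<tau>(2)[of i] by (force simp: I_def)
   then show "\<exists>c\<in>space borel. \<forall>z\<in>space N. W (\<tau> (Suc i)) z - W (\<tau> i) z = c" by simp
  qed (auto simp: I_def)
 qed (use cont in auto)
qed

lemma tendsto_zero_sets:
 fixes f :: "nat => 'a => real"
 assumes [measurable]: "\<And>n. f n \<in> borel_measurable M"
 shows "{x\<in>space M. (\<lambda>n. f n x) \<longlonglongrightarrow> 0} \<in> sets M"
proof -
 have "(\<lambda>n. f n x) \<longlonglongrightarrow> 0 \<longleftrightarrow> (\<forall>k::nat. \<exists>n0. \<forall>n\<ge>n0. \<bar>f n x\<bar> < 1 / real (Suc k))" for x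
 proof
  assume "(\<lambda>n. f n x) \<longlonglongrightarrow> 0"
  then show "\<forall>k::nat. \<exists>n0. \<forall>n\<ge>n0. \<bar>f n x\<bar> < 1 / real (Suc k)"
   using LIMSEQ_D[of "\<lambda>n. f n x" 0 "1 / real (Suc k)" for k] by fastforce
 next
  assume r: "\<forall>k::nat. \<exists>n0. \<forall>n\<ge>n0. \<bar>f n x\<bar> < 1 / real (Suc k)"
  show "(\<lambda>n. f n x) \<longlonglongrightarrow> 0"
  proof (rule LIMSEQ_I)
   fix e :: real assume "0 < e"
   then obtain k where "1 / real (Suc k) < e" using reals_Archimedean[of e] by (auto simp: inverse_eq_divide)
   moreover obtain n0 where "\<forall>n\<ge>n0. \<bar>f n x\<bar> < 1 / real (Suc k)" using r by blast
   ultimately show "\<exists>n0. \<forall>n\<ge>n0. norm (f n x - 0) < e" by force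
  qed
 qed
 then have "{x\<in>space M. (\<lambda>n. f n x) \<longlonglongrightarrow> 0} = {x\<in>space M. \<forall>k::nat. \<exists>n0. \<forall>n\<ge>n0. \<bar>f n x\<bar> < 1 / real (Suc k)}" by simp
 also have "... \<in> sets M" by measurable
 finally show ?thesis .
qed

text \<open>The integer part is right-continuous and the path continuous. Positivity of
  \<open>t\<close> keeps the weight \<open>t powr (- p)\<close> finite and avoids the special value
  at 0.\<close>

lemma coupling_error_right_continuous:
 assumes w: "w \<in> path_set" and p: "0 < p" and t: "0 < t"
 shows "(coupling_error p lam mu S w n \<longlongrightarrow> coupling_error p lam mu S w n t) (at_right t)"
proof -
 let ?g = "\<lambda>r. \<bar>lam * ((S (nat \<lfloor>real n * t\<rfloor>) - mu * real (nat \<lfloor>real n * t\<rfloor>)) / sqrt (real n))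
  - r powr (- p) * w ((real n * r) powr (2 * p + 1)) / sqrt (real n powr (2 * p + 1))\<bar>"
 have id: "((\<lambda>r. r) \<longlongrightarrow> t) (at_right t)" by (rule tendsto_ident_at)
 have e2: "eventually (\<lambda>r. t < r) (at_right t)" by (rule eventually_at_right_less)
 have e1: "eventually (\<lambda>r. \<lfloor>real n * r\<rfloor> = \<lfloor>real n * t\<rfloor>) (at_right t)"
 proof -
  have "((\<lambda>r. real n * r) \<longlongrightarrow> real n * t) (at_right t)" by (intro tendsto_intros)
  then have "eventually (\<lambda>r. real n * r < real_of_int \<lfloor>real n * t\<rfloor> + 1) (at_right t)"
   by (rule order_tendstoD) linarith
  with e2 show ?thesis
  proof eventually_elim
   case (elim r)
   have "real n * t \<le> real n * r" using elim by (intro mult_left_mono) auto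
   then show ?case using elim by (intro floor_unique) linarith+
  qed
 qed
 have "((\<lambda>r. (real n * r) powr (2 * p + 1)) \<longlongrightarrow> (real n * t) powr (2 * p + 1)) (at_right t)"
 proof (rule tendsto_powr')
  have "eventually (\<lambda>r. 0 \<le> real n * r) (at_right t)" using e2 by eventually_elim (use t in simp)
  then show "real n * t \<noteq> 0 \<or> 0 < 2 * p + 1 \<and> eventually (\<lambda>r. 0 \<le> real n * r) (at_right t)" using p by simp
 qed (intro tendsto_intros)+
 note path_tendsto[OF w this]
 then have "(?g \<longlongrightarrow> ?g t) (at_right t)"
  using t p by (cases "n = 0") (auto intro!: tendsto_intros)
 then have "(?g \<longlongrightarrow> coupling_error p lam mu S w n t) (at_right t)"
  using t by (simp add: coupling_error_def)
 then show ?thesis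
 proof (rule Lim_transform_eventually)
  show "eventually (\<lambda>r. ?g r = coupling_error p lam mu S w n r) (at_right t)"
   using e1 e2 by eventually_elim (use t in \<open>simp add: coupling_error_def\<close>)
 qed
qed

text \<open>Makes the supremum measurable: right-continuity moves any interior \<open>t\<close> to a
  nearby rational, and the end points 0 and 1 are rational themselves.\<close>

lemma SUP_coupling_error:
 assumes w: "w \<in> path_set" and p: "0 < p"
 shows "(SUP t\<in>{0..1}. ennreal (coupling_error p lam mu S w n t)) = (SUP t\<in>{0..1} \<inter> \<rat>. ennreal (coupling_error p lam mu S w n t))"
proof (rule antisym)
 let ?e = "\<lambda>t. ennreal (coupling_error p lam mu S w n t)"
 show "(SUP t\<in>{0..1}. ?e t) \<le> (SUP t\<in>{0..1} \<inter> \<rat>. ?e t)"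
 proof (rule SUP_least)
  fix t :: real assume t: "t \<in> {0..1}"
  show "?e t \<le> (SUP t\<in>{0..1} \<inter> \<rat>. ?e t)"
  proof (cases "t = 0 \<or> t = 1")
   case True
   then show ?thesis using t by (intro SUP_upper) auto
  next
   case False
   then have t01: "0 < t" "t < 1" using t by auto
   show ?thesis
   proof (rule ccontr)
    assume "\<not> ?e t \<le> (SUP t\<in>{0..1} \<inter> \<rat>. ?e t)"
    then have lt: "(SUP t\<in>{0..1} \<inter> \<rat>. ?e t) < ?e t" by simp
    have "(?e \<longlongrightarrow> ?e t) (at_right t)"
     by (rule tendsto_ennrealI[OF coupling_error_right_continuous[OF w p t01(1)]])
    then have "eventually (\<lambda>r. (SUP t\<in>{0..1} \<inter> \<rat>. ?e t) < ?e r) (at_right t)"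
     using lt by (rule order_tendstoD)
    then obtain b where b: "t < b" "\<And>r. t < r ==> r < b ==> (SUP t\<in>{0..1} \<inter> \<rat>. ?e t) < ?e r"
     unfolding eventually_at_right_field by blast
    obtain r where r: "r \<in> \<rat>" "t < r" "r < min b 1"
     using Rats_dense_in_real[of t "min b 1"] b(1) t01 by auto
    then have "?e r \<le> (SUP t\<in>{0..1} \<inter> \<rat>. ?e t)" using t01 by (intro SUP_upper) auto
    moreover have "(SUP t\<in>{0..1} \<inter> \<rat>. ?e t) < ?e r" using b(2) r by simp
    ultimately show False by simp
   qed
  qed
 qed
 show "(SUP t\<in>{0..1} \<inter> \<rat>. ?e t) \<le> (SUP t\<in>{0..1}. ?e t)"
  by (rule SUP_subset_mono) auto
qed

lemma (in prob_space) prob_tendsto_zero_AE: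
 assumes A: "\<And>n. A n \<in> events" and AE: "AE x in M. eventually (\<lambda>n. x \<notin> A n) sequentially"
 shows "(\<lambda>n. prob (A n)) \<longlonglongrightarrow> 0"
proof -
 have "(\<lambda>n. \<integral>x. indicator (A n) x \<partial>M) \<longlonglongrightarrow> (LINT x|M. (0 :: real))"
 proof (rule integral_dominated_convergence[where w="\<lambda>_. 1"])
  show "AE x in M. (\<lambda>n. indicator (A n) x :: real) \<longlonglongrightarrow> 0"
   using AE
  proof eventually_elim
   case (elim x)
   then show ?case by (intro tendsto_eventually) (auto elim!: eventually_mono)
  qed
 qed (use A in auto)
 then show ?thesis using A by (simp add: sets.Int_space_eq2)
qed

context nsr_embedding
begin

definition walk :: "nat => (nat => state) => real" where
 "walk n x = (\<Sum>i<n. xi i x)"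

definition joint :: "(nat => state) => path_pair" where
 "joint x = (\<lambda>n. walk n x, C.wp 0 x)"

text \<open>The chain lives on sequences of states; its image under the walk and the initial path is
  a measure on the type fixed for the richer space.\<close>

definition rich :: "path_pair measure" where
 "rich = distr Om (seq_space \<Otimes>\<^sub>M path_space) joint"

lemma walk_measurable[measurable]: "walk n \<in> borel_measurable Om"
 unfolding walk_def[abs_def] by measurable

lemma joint_measurable: "joint \<in> measurable Om (seq_space \<Otimes>\<^sub>M path_space)"
 unfolding joint_def[abs_def] by (intro measurable_Pair C.wp_measurable_Om measurable_PiM_single') auto

lemma sets_rich[measurable_cong]: "sets rich = sets (seq_space \<Otimes>\<^sub>M path_space)"
 by (simp add: rich_def)

lemma measurable_rich: "measurable rich N = measurable (seq_space \<Otimes>\<^sub>M path_space) N"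
 by (rule measurable_cong_sets[OF sets_rich refl])

lemma prob_space_rich: "prob_space rich"
 unfolding rich_def by (rule C.chain.prob_space_distr[OF joint_measurable])

lemma rich_path: "x \<in> space rich ==> snd x \<in> path_set"
 by (auto simp: rich_def space_pair_measure)

lemma rich_walk_measurable: "(\<lambda>x. fst x n) \<in> borel_measurable rich"
 unfolding measurable_rich by (rule measurable_compose[OF measurable_fst measurable_component_singleton]) simp

lemma rich_path_measurable: "(\<lambda>x. snd x t) \<in> borel_measurable rich"
 unfolding measurable_rich by (rule measurable_compose[OF measurable_snd path_coordinate_measurable])

lemma distr_rich_snd: "distr rich path_space snd = wiener"
 unfolding rich_def
 by (subst distr_distr[OF measurable_snd joint_measurable]) (simp add: comp_def joint_def C.wp_0)

lemma distr_rich_fst: "distr rich seq_space (\<lambda>x n. fst x n) = distr Om seq_space (\<lambda>s n. walk n s)"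
proof -
 have "distr rich seq_space fst = distr Om seq_space (\<lambda>s n. walk n s)"
  unfolding rich_def
  by (subst distr_distr[OF measurable_fst joint_measurable]) (simp add: comp_def joint_def)
 then show ?thesis by simp
qed

lemma AE_rich:
 assumes "{x \<in> space rich. P x} \<in> sets rich" "AE s in Om. P (joint s)"
 shows "AE x in rich. P x"
proof -
 have "{x \<in> space (seq_space \<Otimes>\<^sub>M path_space). P x} \<in> sets (seq_space \<Otimes>\<^sub>M path_space)"
  using assms(1) by (simp add: rich_def)
 then show ?thesis unfolding rich_def using assms(2) by (subst AE_distr_iff[OF joint_measurable]) auto
qed

lemma rich_brownian: "std_brownian_motion rich (\<lambda>t x. snd x t)"
proof (rule std_brownian_motionI[OF prob_space_rich])
 show "AE x in rich. continuous_on {0..} (\<lambda>t. snd x t)"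
  using rich_path by (intro AE_I2) (auto simp: path_set_def intro: continuous_on_subset)
 have "snd \<in> measurable rich path_space" unfolding measurable_rich by (rule measurable_snd)
 from gauss_increments_distr(2)[OF this] show "gauss_increments rich (\<lambda>t x. snd x t)"
  using wiener_increments by (simp add: distr_rich_snd)
qed

lemma good_coupling:
 assumes "good x"
 shows "nsr_coupling p lam mu (\<lambda>n. walk n x) (\<lambda>n. \<Sum>i<n. C.dt i x) (C.wp 0 x)"
proof -
 interpret P: nsr_path p m1 m2 mu sg lam \<tau> \<theta> "\<lambda>i. xi i x" "\<lambda>i. ci i x" "\<lambda>i. qi i x" "\<lambda>i. C.dt i x"
  using assms by (simp add: good_def)
 show ?thesis
 proof
  show "(\<lambda>n. (lam * (real n powr p * (walk n x - mu * real n)) - C.wp 0 x (\<Sum>i<n. C.dt i x)) / real n powr (p + 1 / 2)) \<longlonglongrightarrow> 0"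
   using P.remainder assms by (simp add: good_def walk_def P.S_def)
  show "(\<lambda>n. walk n x / real n) \<longlonglongrightarrow> mu" using P.mean by (simp add: walk_def P.S_def)
  show "(\<lambda>n. (\<Sum>i<n. C.dt i x) / real n powr (2 * p + 1)) \<longlonglongrightarrow> 1" by (rule P.time)
  show "0 \<le> (\<Sum>i<n. C.dt i x)" for n using assms by (intro sum_nonneg) (auto simp: good_def)
 qed (use assms p in \<open>auto simp: good_def walk_def\<close>)
qed

lemma rich_strong_approximation:
 "AE x in rich. (\<lambda>n. 1 / sqrt (real n powr (2 * p + 1) * ln (ln (real n))) *
  \<bar>lam * ((fst x n - mu * real n) / real n powr (- p)) - snd x (real n powr (2 * p + 1))\<bar>) \<longlonglongrightarrow> 0"
proof (rule AE_rich)
 note [measurable] = rich_walk_measurable rich_path_measurable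
 show "{x \<in> space rich. (\<lambda>n. 1 / sqrt (real n powr (2 * p + 1) * ln (ln (real n))) *
  \<bar>lam * ((fst x n - mu * real n) / real n powr (- p)) - snd x (real n powr (2 * p + 1))\<bar>) \<longlonglongrightarrow> 0} \<in> sets rich"
  by (rule tendsto_zero_sets) measurable
 \<comment> \<open>The modulus is a property of Wiener measure alone, so it transfers through the
   law of the initial path, although that path is correlated with the walk.\<close>
 have "AE w in distr Om path_space (C.wp 0). \<forall>n::nat. \<exists>d>0. \<exists>t0. \<forall>t\<ge>t0. \<forall>s. \<bar>s - t\<bar> \<le> d * t --> \<bar>w s - w t\<bar> \<le> 1 / real (Suc n) * sqrt (t * ln (ln t))"
  unfolding C.wp_0 by (rule wiener_modulus)
 from AE_distrD[OF C.wp_measurable_Om this] AE_good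
 show "AE z in Om. (\<lambda>n. 1 / sqrt (real n powr (2 * p + 1) * ln (ln (real n))) *
  \<bar>lam * ((fst (joint z) n - mu * real n) / real n powr (- p)) - snd (joint z) (real n powr (2 * p + 1))\<bar>) \<longlonglongrightarrow> 0"
 proof eventually_elim
  case (elim z)
  interpret Q: nsr_coupling p lam mu "\<lambda>n. walk n z" "\<lambda>n. \<Sum>i<n. C.dt i z" "C.wp 0 z" by (rule good_coupling[OF elim(2)])
  show ?case unfolding joint_def fst_conv snd_conv by (rule Q.strong_approximation) (use elim(1) in blast)
 qed
qed

abbreviation sup_error :: "nat => path_pair => ennreal" where
 "sup_error n x \<equiv> SUP t\<in>{0..1}. ennreal (coupling_error p lam mu (fst x) (snd x) n t)"

lemma sup_error_measurable: "sup_error n \<in> borel_measurable rich"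
proof -
 note [measurable] = rich_walk_measurable rich_path_measurable
 have "countable ({0..1} \<inter> \<rat> :: real set)" using countable_rat by (rule countable_Int2)
 then have "(\<lambda>x. SUP t\<in>{0..1} \<inter> \<rat>. ennreal (coupling_error p lam mu (fst x) (snd x) n t)) \<in> borel_measurable rich"
  unfolding coupling_error_def by (rule borel_measurable_SUP) measurable
 then show ?thesis
  by (rule measurable_cong[THEN iffD1, rotated]) (use SUP_coupling_error rich_path p in auto)
qed

text \<open>For each \<open>n\<close> the bad event is covered by a failure of one of the
  oscillation events, estimated under Wiener measure, and by the event that the error is large
  although both hold; the latter almost surely stops occurring.\<close>

lemma rich_uniform_approximation: "tendsto_zero_in_prob rich sup_error"
 unfolding tendsto_zero_in_prob_def
proof (intro conjI allI impI)
 show "sup_error n \<in> borel_measurable rich" for n by (rule sup_error_measurable)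
 fix \<eta>' :: real assume "0 < \<eta>'"
 define e where "e = \<eta>' / 2"
 have e: "0 < e" "\<eta>' = 2 * e" using \<open>0 < \<eta>'\<close> by (auto simp: e_def)
 let ?s = "2 * p + 1" and ?q = "p / (2 * p + 1)"
 let ?bad = "\<lambda>n. {x \<in> space rich. sup_error n x > ennreal \<eta>'}"
 have bad: "?bad n \<in> sets rich" for n using sup_error_measurable[of n] by measurable
 have q: "0 \<le> ?q" "?q < 1 / 2" using p by (auto simp: field_simps)
 obtain C0 where C0: "\<forall>d e N. 0 < d --> d \<le> 1 --> 0 < e --> 0 < N -->
  (\<exists>A\<in>sets wiener. wiener.prob A \<le> C0 * d / e ^ 4 \<and>
   (\<forall>w\<in>path_set - A. \<forall>t\<in>{0<..N}. \<forall>v\<ge>0. \<bar>v - t\<bar> \<le> d * t --> \<bar>w v - w t\<bar> \<le> e * N powr (1/2 - ?q) * t powr ?q))"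
  using wiener_weighted_oscillation[OF q] by (elim exE)
 have osc: "\<exists>A. A \<in> sets wiener \<and> wiener.prob A \<le> C0 * d / e ^ 4 \<and> (\<forall>w\<in>path_set - A. oscillation_event p w d e N)"
  if "0 < d" "d \<le> 1" "0 < e" "0 < N" for d e N
  using C0[rule_format, OF that] unfolding oscillation_event_def by (elim bexE conjE) (intro exI conjI)
 show "(\<lambda>n. measure rich (?bad n)) \<longlonglongrightarrow> 0"
 proof (rule LIMSEQ_I)
  fix r :: real assume r: "0 < r"
  \<comment> \<open>Chosen from the tolerance and the target probability, independently of
    \<open>n\<close>: the oscillation event then fails with probability at most \<open>r / 4\<close>
    for every \<open>n >= 1\<close>.\<close>
  define d where "d = min 1 (r * e ^ 4 / (4 * (\<bar>C0\<bar> + 1)))"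
  have d: "0 < d" "d \<le> 1" using r e by (auto simp: d_def intro!: divide_pos_pos mult_pos_pos)
  have C\<delta>: "C0 * d / e ^ 4 \<le> r / 4"
  proof -
   have "C0 * d \<le> (\<bar>C0\<bar> + 1) * d" using d by (intro mult_right_mono) auto
   also have "... \<le> (\<bar>C0\<bar> + 1) * (r * e ^ 4 / (4 * (\<bar>C0\<bar> + 1)))" by (intro mult_left_mono) (auto simp: d_def)
   also have "... = r / 4 * e ^ 4" by (simp add: field_simps)
   finally show ?thesis using e by (simp add: divide_simps)
  qed
  have "\<forall>n. \<exists>A. 1 \<le> n --> A \<in> sets wiener \<and> wiener.prob A \<le> r / 4 \<and> (\<forall>w\<in>path_set - A. oscillation_event p w d e (real n powr ?s))"
  proof
   fix n
   show "\<exists>A. 1 \<le> n --> A \<in> sets wiener \<and> wiener.prob A \<le> r / 4 \<and> (\<forall>w\<in>path_set - A. oscillation_event p w d e (real n powr ?s))"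
   proof (cases "1 \<le> n")
    case True
    then have "0 < real n powr ?s" by simp
    from osc[OF d e(1) this] obtain A where "A \<in> sets wiener" "wiener.prob A \<le> C0 * d / e ^ 4"
     "\<forall>w\<in>path_set - A. oscillation_event p w d e (real n powr ?s)" by (elim exE conjE)
    then show ?thesis using order_trans[OF _ C\<delta>] by (intro exI[of _ A] impI conjI)
   qed simp
  qed
  from choice[OF this] obtain A where A: "\<And>n. 1 \<le> n ==> A n \<in> sets wiener" "\<And>n. 1 \<le> n ==> wiener.prob (A n) \<le> r / 4"
   "\<And>n w. 1 \<le> n ==> w \<in> path_set - A n ==> oscillation_event p w d e (real n powr ?s)" by (elim exE) auto
  \<comment> \<open>On the unit time interval the tolerance grows like \<open>sqrt n\<close>, so
    even the full window \<open>d = 1\<close> fails only with probability of order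
    \<open>1 / n^2\<close>.\<close>
  have "\<forall>n. \<exists>B. 1 \<le> n --> B \<in> sets wiener \<and> wiener.prob B \<le> C0 * 1 / (e * sqrt (real n)) ^ 4 \<and> (\<forall>w\<in>path_set - B. oscillation_event p w 1 (e * sqrt (real n)) 1)"
  proof
   fix n
   show "\<exists>B. 1 \<le> n --> B \<in> sets wiener \<and> wiener.prob B \<le> C0 * 1 / (e * sqrt (real n)) ^ 4 \<and> (\<forall>w\<in>path_set - B. oscillation_event p w 1 (e * sqrt (real n)) 1)"
   proof (cases "1 \<le> n")
    case True
    then have "0 < e * sqrt (real n)" using e by simp
    from osc[OF zero_less_one order_refl this zero_less_one] show ?thesis by (elim exE) (rule exI, auto)
   qed simp
  qed
  from choice[OF this] obtain B where B: "\<And>n. 1 \<le> n ==> B n \<in> sets wiener" "\<And>n. 1 \<le> n ==> wiener.prob (B n) \<le> C0 * 1 / (e * sqrt (real n)) ^ 4"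
   "\<And>n w. 1 \<le> n ==> w \<in> path_set - B n ==> oscillation_event p w 1 (e * sqrt (real n)) 1" by (elim exE) auto
  define E where "E = (\<lambda>n. if 1 \<le> n then A n \<union> B n else {})"
  have E: "E n \<in> sets path_space" for n using A(1)[of n] B(1)[of n] by (auto simp: E_def)
  \<comment> \<open>The bad points at which both oscillation events hold. On a good path this is
    excluded for large \<open>n\<close>, with a threshold depending on the path, and dominated
    convergence gives probability tending to 0.\<close>
  define R where "R = (\<lambda>n. {z \<in> space Om. joint z \<in> ?bad n} - (C.wp 0 -` E n \<inter> space Om))"
  have bad': "{z \<in> space Om. joint z \<in> ?bad n} \<in> sets Om" for n
  proof -
   have "?bad n \<in> sets (seq_space \<Otimes>\<^sub>M path_space)" using bad[of n] by (simp only: sets_rich)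
   from measurable_sets[OF joint_measurable this] show ?thesis by (simp add: vimage_def Int_def conj_commute)
  qed
  have wpE: "C.wp 0 -` E n \<inter> space Om \<in> sets Om" for n by (rule measurable_sets[OF C.wp_measurable_Om E])
  have R: "R n \<in> sets Om" for n unfolding R_def by (rule sets.Diff[OF bad' wpE])
  have "AE z in Om. eventually (\<lambda>n. z \<notin> R n) sequentially"
   using AE_good
  proof eventually_elim
   case (elim z)
   interpret Q: nsr_coupling p lam mu "\<lambda>n. walk n z" "\<lambda>n. \<Sum>i<n. C.dt i z" "C.wp 0 z" by (rule good_coupling[OF elim])
   show ?case
    using Q.uniform_approximation[OF d(1) e(1)] eventually_ge_at_top[of 1]
   proof eventually_elim
    case (elim n)
    show ?case
    proof
     assume "z \<in> R n"
     then have nb: "sup_error n (joint z) > ennreal \<eta>'" and nE: "C.wp 0 z \<notin> E n" by (auto simp: R_def)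
     have "C.wp 0 z \<in> path_set - A n" "C.wp 0 z \<in> path_set - B n" using nE elim(2) Q.w by (auto simp: E_def)
     from elim(1)[rule_format, OF A(3)[OF elim(2) this(1)] B(3)[OF elim(2) this(2)]]
     have "sup_error n (joint z) \<le> ennreal \<eta>'"
      unfolding joint_def fst_conv snd_conv e(2) by (intro SUP_least ennreal_leI) auto
     then show False using nb by simp
    qed
   qed
  qed
  from C.chain.prob_tendsto_zero_AE[OF R this] have "(\<lambda>n. C.chain.prob (R n)) \<longlonglongrightarrow> 0" .
  then have "eventually (\<lambda>n. C.chain.prob (R n) < r / 4) sequentially"
   by (rule order_tendstoD) (use r in simp)
  moreover have "eventually (\<lambda>n. C0 * 1 / (e * sqrt (real n)) ^ 4 < r / 4) sequentially"
  proof (rule order_tendstoD)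
   show "(\<lambda>n. C0 * 1 / (e * sqrt (real n)) ^ 4) \<longlonglongrightarrow> 0" using e by real_asymp
  qed (use r in simp)
  moreover note eventually_ge_at_top[of 1]
  ultimately have "eventually (\<lambda>n. norm (measure rich (?bad n) - 0) < r) sequentially"
  proof eventually_elim
   case (elim n)
   have "measure rich (?bad n) = C.chain.prob (joint -` ?bad n \<inter> space Om)"
    using bad[of n] unfolding rich_def by (subst measure_distr[OF joint_measurable]) auto
   also have "joint -` ?bad n \<inter> space Om = {z \<in> space Om. joint z \<in> ?bad n}" by auto
   also have "C.chain.prob ... \<le> C.chain.prob (R n \<union> (C.wp 0 -` E n \<inter> space Om))"
    by (rule C.chain.finite_measure_mono[OF _ sets.Un[OF R wpE]]) (unfold R_def, blast)
   also have "... \<le> C.chain.prob (R n) + C.chain.prob (C.wp 0 -` E n \<inter> space Om)"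
    by (rule measure_Un_le[OF R wpE])
   also have "C.chain.prob (C.wp 0 -` E n \<inter> space Om) = wiener.prob (E n)"
    using measure_distr[OF C.wp_measurable_Om E[of n], of 0] by (simp only: C.wp_0)
   also have "wiener.prob (E n) \<le> wiener.prob (A n) + wiener.prob (B n)"
    using elim(3) A(1)[of n] B(1)[of n] by (simp add: E_def measure_Un_le)
   finally have "measure rich (?bad n) < r"
    using elim(1,2) A(2)[OF elim(3)] B(2)[OF elim(3)] r by linarith
   then show ?case by simp
  qed
  then show "\<exists>no. \<forall>n\<ge>no. norm (measure rich (?bad n) - 0) < r" by (simp add: eventually_sequentially)
 qed
qed

end

text \<open>Both step sequences follow the same kernels, hence have the same law, and the walk is
  one measurable function of the steps.\<close>

lemma (in nsr_embedding) rich_same_law: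
 assumes M: "prob_space M" "kernel_process (nsr_kernel p \<nu>) M Y"
 shows "same_law M (\<lambda>n s. \<Sum>i<n. Y i s) rich (\<lambda>n x. fst x n)"
 unfolding same_law_def
proof (intro conjI allI)
 have Y[measurable]: "Y n \<in> borel_measurable M" for n using M(2) by (simp add: kernel_process_def)
 show "(\<lambda>s. \<Sum>i<n. Y i s) \<in> borel_measurable M" for n by measurable
 show "(\<lambda>x. fst x n) \<in> borel_measurable rich" for n by (rule rich_walk_measurable)
 define \<Sigma> where "\<Sigma> = (\<lambda>(h :: nat => real) n. \<Sum>i<n. h i)"
 have Sm: "\<Sigma> \<in> measurable seq_space seq_space"
  unfolding \<Sigma>_def by (intro measurable_PiM_single' borel_measurable_sum measurable_component_singleton) auto
 have mY: "(\<lambda>s n. Y n s) \<in> measurable M seq_space" by (rule measurable_PiM_single') auto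
 have mxi: "(\<lambda>s n. xi n s) \<in> measurable Om seq_space" by (rule measurable_PiM_single') auto
 have "distr M seq_space (\<lambda>s n. \<Sum>i<n. Y i s) = distr (distr M seq_space (\<lambda>s n. Y n s)) seq_space \<Sigma>"
  by (subst distr_distr[OF Sm mY]) (simp add: comp_def \<Sigma>_def)
 also have "distr M seq_space (\<lambda>s n. Y n s) = distr Om seq_space (\<lambda>s n. xi n s)"
  by (rule kernel_process_unique[OF nsr_kernel_measurable M C.chain.prob_space_axioms C.chain_kernel_process])
 also have "distr ... seq_space \<Sigma> = distr Om seq_space (\<lambda>s n. walk n s)"
  by (subst distr_distr[OF Sm mxi]) (simp add: comp_def \<Sigma>_def walk_def)
 finally show "distr M seq_space (\<lambda>s n. \<Sum>i<n. Y i s) = distr rich seq_space (\<lambda>x n. fst x n)"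
  by (simp only: distr_rich_fst)
qed

theorem theorem1p3:
  fixes M :: "'a measure" and p :: real
    and X :: "nat \<Rightarrow> 'a \<Rightarrow> real" and \<epsilon> :: "nat \<Rightarrow> 'a \<Rightarrow> bool" and U :: "nat \<Rightarrow> 'a \<Rightarrow> nat"
    and m\<^sub>1 m\<^sub>2 \<mu> \<sigma> :: real
  assumes "0 < p" and "p < 1"
    and "nsr_input M p X \<epsilon> U"
    and "integrable M (\<lambda>\<omega>. (X 1 \<omega>)\<^sup>2)"
    and "m\<^sub>1 = (\<integral>\<omega>. X 1 \<omega> \<partial>M)"
    and "m\<^sub>2 = (\<integral>\<omega>. (X 1 \<omega>)\<^sup>2 \<partial>M)"
    and "\<mu> = (1 - p) * m\<^sub>1 / (1 + p)"
    and "\<sigma> = sqrt (m\<^sub>2 - ((1 - p) * m\<^sub>1 / (1 + p))\<^sup>2)"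
    and "\<sigma> > 0"
  shows "\<exists>(N :: path_pair measure) S W.
    same_law M (\<lambda>n \<omega>. nsr_walk (\<lambda>i. X i \<omega>) (\<lambda>i. \<epsilon> i \<omega>) (\<lambda>i. U i \<omega>) n) N S \<and>
    std_brownian_motion N W \<and>
    (AE \<omega> in N.
      (\<lambda>n. 1 / sqrt (real n powr (2 * p + 1) * ln (ln (real n))) *
        \<bar>sqrt (2 * p + 1) / \<sigma> * ((S n \<omega> - \<mu> * real n) / real n powr (- p))
          - W (real n powr (2 * p + 1)) \<omega>\<bar>) \<longlonglongrightarrow> 0) \<and>
    tendsto_zero_in_prob N (\<lambda>n \<omega>.
      SUP t\<in>{0..1}. ennreal
        \<bar>sqrt (2 * p + 1) / \<sigma> *
            ((S (nat \<lfloor>real n * t\<rfloor>) \<omega> - \<mu> * real (nat \<lfloor>real n * t\<rfloor>)) / sqrt (real n))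
          - (if t = 0 then 0 else t powr (- p) * W ((real n * t) powr (2 * p + 1)) \<omega>)
              / sqrt (real n powr (2 * p + 1))\<bar>)"
proof -
  interpret nsr_input M p X \<epsilon> U by fact
  have X1: "X 1 \<in> borel_measurable M" by (rule X_measurable) simp
  interpret \<nu>: prob_space \<nu> by (rule prob_space_distr[OF X1])
  have int: "(\<integral>x. f x \<partial>\<nu>) = (\<integral>\<omega>. f (X 1 \<omega>) \<partial>M)" if "f \<in> borel_measurable borel" for f :: "real \<Rightarrow> real"
    by (rule integral_distr[OF X1 that])
  have m: "(\<integral>x. x \<partial>\<nu>) = m\<^sub>1" "(\<integral>x. x\<^sup>2 \<partial>\<nu>) = m\<^sub>2"
    unfolding assms(5,6) by (rule int, simp)+
  \<comment> \<open>From here on only the law of \<open>X 1\<close> matters; its moments under the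
    image measure are the given \<open>m\<^sub>1\<close> and \<open>m\<^sub>2\<close> in the
    code.\<close>
  interpret E: nsr_embedding \<nu> p
  proof
    show "integrable \<nu> (\<lambda>x. x\<^sup>2)" using assms(4) X1 by (subst integrable_distr_eq) auto
    show "0 < sqrt ((\<integral>x. x\<^sup>2 \<partial>\<nu>) - ((1 - p) * (\<integral>x. x \<partial>\<nu>) / (1 + p))\<^sup>2)"
      unfolding m using assms(8,9) by simp
  qed (use assms(1,2) in auto)
  have par: "\<mu> = E.mu" "sqrt (2 * p + 1) / \<sigma> = E.lam"
    unfolding E.lam_def E.sg_def E.mu_def E.m1_def E.m2_def m using assms(7,8) by simp_all
  show ?thesis
  \<comment> \<open>The walk and the Brownian motion are the two coordinate projections of the path
    pair.\<close>
  proof (intro exI conjI)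
    show "same_law M (\<lambda>n \<omega>. nsr_walk (\<lambda>i. X i \<omega>) (\<lambda>i. \<epsilon> i \<omega>) (\<lambda>i. U i \<omega>) n) E.rich (\<lambda>n x. fst x n)"
      unfolding nsr_walk_eq by (rule E.rich_same_law[OF prob_space_axioms nsr_kernel_process[OF assms(1,2)]])
    show "std_brownian_motion E.rich (\<lambda>t x. snd x t)" by (rule E.rich_brownian)
    show "AE \<omega> in E.rich. (\<lambda>n. 1 / sqrt (real n powr (2 * p + 1) * ln (ln (real n))) *
        \<bar>sqrt (2 * p + 1) / \<sigma> * ((fst \<omega> n - \<mu> * real n) / real n powr (- p))
          - snd \<omega> (real n powr (2 * p + 1))\<bar>) \<longlonglongrightarrow> 0"
      unfolding par by (rule E.rich_strong_approximation)
    show "tendsto_zero_in_prob E.rich (\<lambda>n \<omega>. SUP t\<in>{0..1}. ennreal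
        \<bar>sqrt (2 * p + 1) / \<sigma> *
            ((fst \<omega> (nat \<lfloor>real n * t\<rfloor>) - \<mu> * real (nat \<lfloor>real n * t\<rfloor>)) / sqrt (real n))
          - (if t = 0 then 0 else t powr (- p) * snd \<omega> ((real n * t) powr (2 * p + 1)))
              / sqrt (real n powr (2 * p + 1))\<bar>)"
      unfolding par using E.rich_uniform_approximation by (simp only: coupling_error_def)
  qed
qed

end
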